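(* Let $m,m',k,k'\in\mathbb{N}$. The $(k,k')$-weighted subdivision rule is the following. For each cell $\sigma$ of a hierarchical T-mesh to be subdivided: (1) split $\sigma$ with a new edge $\tau$; (2) if the edge $\tau$ does not extend an existing segment, extend $\tau$ (on one side and/or the other) so that the maximal segment containing $\tau$ either intersects $\partial\Omega$, or is horizontal (resp. vertical) and of weight $\ge k$ (resp. $\ge k'$). If this rule is applied in the construction of a hierarchical T-mesh, then at each application either a new maximal interior segment is constructed, whose weight is $\ge k$ if it is horizontal (resp. $\ge k'$ if it is vertical), or an existing maximal interior segment is extended and its weight is also increased, or a maximal segment intersecting $\partial\Omega$ is constructed. In all cases, if one starts with a $(k,k')$-weighted T-mesh, the new T-mesh obtained is also $(k,k')$-weighted. Consequently, let $\mathcal{T}$ be a hierarchical T-mesh obtained by this rule starting from a $(k,k')$-weighted one, with smoothness distribution $\mathbf{r}$. If $k\ge m+1$ and $k'\ge m'+1$, then $h_{m,m'}^{\mathbf{r}}(\mathcal{T})=0$, and the dimension of the spline space, given by $$\dim \mathcal{S}_{m,m'}^{\mathbf{r}}(\mathcal{T}) = \sum_{\sigma\in\mathcal{T}_2}(m+1)(m'+1) - \sum_{\tau\in\mathcal{T}_1^{o,h}}(m+1)(\mathbf{r}(\tau)+1) - \sum_{\tau\in\mathcal{T}_1^{o,v}}(m'+1)(\mathbf{r}(\tau)+1) + \sum_{\gamma\in\mathcal{T}_0^o}(\mathbf{r}_h(\gamma)+1)(\mathbf{r}_v(\gamma)+1)+h_{m,m'}^{\mathbf{r}}(\mathcal{T}),$$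 depends only on the number of cells, interior segments and interior vertices of $\mathcal{T}$.
   Context: T-mesh. A T-mesh $\mathcal{T}$ of $\mathbb{R}^2$ consists of a finite set $\mathcal{T}_2$ of closed axis-aligned rectangles (cells), a finite set $\mathcal{T}_1$ of closed axis-aligned segments (edges) contained in $\bigcup_{\sigma\in\mathcal{T}_2}\partial\sigma$, and the finite set $\mathcal{T}_0=\bigcup_{\tau\in\mathcal{T}_1}\partial\tau$ of end points of edges (vertices), such that: for $\sigma\in\mathcal{T}_2$, $\partial\sigma$ is a finite union of elements of $\mathcal{T}_1$; for $\sigma\ne\sigma'$ in $\mathcal{T}_2$, $\sigma\cap\sigma'=\partial\sigma\cap\partial\sigma'$ is a finite union of elements of $\mathcal{T}_1\cup\mathcal{T}_0$; for $\tau\neq\tau'$ in $\mathcal{T}_1$, $\tau\cap\tau'=\partial\tau\cap\partial\tau'\subset\mathcal{T}_0$. The domain is $\Omega=\bigcup_{\sigma\in\mathcal{T}_2}\sigma$, with interior $\Omega^\circ$. Edges parallel to the first axis are horizontal, those parallel to the second axis are vertical. Standing assumption: every vertex belongs to at least one horizontal edge and at least one vertical edge. A hierarchical T-mesh (T-subdivision) is either a single axis-aligned rectangle $\Omega$ or is obtained from a hierarchical T-mesh by splitting a cell along a vertical or horizontal line. An edge is interior if it meets $\Omega^\circ$; $\mathcal{T}_1^o$, $\mathcal{T}_1^{o,h}$, $\mathcal{T}_1^{o,v}$ are the sets of interior, horizontal interior, vertical interior edges. A vertex is interior if it lies in $\Omega^\circ$; $\mathcal{T}_0^o$ is the set of interior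 vertices. Smoothness. Use coordinates $(s,t)$ and $0\in\mathbb N$. Let $\nu_h(\mathcal{T})$ be the set of first coordinates of points of vertical edges and $\nu_v(\mathcal{T})$ the set of second coordinates of points of horizontal edges. A smoothness distribution $\mathbf{r}$ is a pair of maps $\mathbf{r}_h:\nu_h(\mathcal{T})\to\mathbb{N}$, $\mathbf{r}_v:\nu_v(\mathcal{T})\to\mathbb{N}$ (it restricts to the coarser meshes from which $\mathcal{T}$ is constructed). For a vertical edge $\tau$ on $s=a$, $\mathbf{r}(\tau)=\mathbf{r}_h(a)$; for a horizontal edge $\tau$ on $t=b$, $\mathbf{r}(\tau)=\mathbf{r}_v(b)$. For a vertex $\gamma=(a,b)$, $\mathbf{r}_h(\gamma)=\mathbf{r}_h(a)$, $\mathbf{r}_v(\gamma)=\mathbf{r}_v(b)$. Splines. $R_{m,m'}$ is the space of polynomials in $\mathbb{R}[s,t]$ of degree $\le m$ in $s$ and $\le m'$ in $t$. $\mathcal{S}_{m,m'}^{\mathbf{r}}(\mathcal{T})$ is the vector space of functions on $\Omega$ that coincide with an element of $R_{m,m'}$ on each cell, and that are of class $C^{\mathbf{r}(\tau)}$ in $s$ (resp. in $t$) at every point of $\tau\cap\Omega^\circ$ for every vertical (resp. horizontal) interior edge $\tau$. The number $h$. For an edge $\tau$, let $l_\tau$ be a nonzero polynomial of degree 1 defining the line supporting $\tau$, $\Delta^{\mathbf{r}}(\tau)=l_\tau^{\mathbf{r}(\tau)+1}$, and $\mathfrak{I}^{\mathbf{r}}_{m,m'}(\tau)=(\Delta^{\mathbf{r}}(\tau))\cap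 R_{m,m'}$. For a vertex $\gamma$, $\mathfrak{I}^{\mathbf{r}}_{m,m'}(\gamma)=\mathfrak{I}^{\mathbf{r}}_{m,m'}(\tau_v)+\mathfrak{I}^{\mathbf{r}}_{m,m'}(\tau_h)$ for any vertical edge $\tau_v$ and horizontal edge $\tau_h$ containing $\gamma$. With formal symbols $[\tau]$, $[\gamma]$ and a chosen orientation of each edge, let $$\partial_1:\bigoplus_{\tau\in\mathcal{T}_1^o}[\tau]\,\mathfrak{I}^{\mathbf{r}}_{m,m'}(\tau)\to\bigoplus_{\gamma\in\mathcal{T}_0^o}[\gamma]\,\mathfrak{I}^{\mathbf{r}}_{m,m'}(\gamma),\qquad [\tau]p\mapsto[\gamma_2]p-[\gamma_1]p$$ for $\tau$ oriented from $\gamma_1$ to $\gamma_2$, where $[\gamma]=0$ if $\gamma\notin\mathcal{T}_0^o$. Then $h_{m,m'}^{\mathbf{r}}(\mathcal{T})$ is the dimension of the cokernel of $\partial_1$. Maximal interior segments and weights. For an interior edge $\tau$, the maximal segment $\rho(\tau)$ is the maximal connected union of interior edges of the same direction as $\tau$ that contains $\tau$. It is interior if it does not intersect $\partial\Omega$. $\mathrm{MIS}(\mathcal{T})$, $\mathrm{MIS}_h(\mathcal{T})$, $\mathrm{MIS}_v(\mathcal{T})$ are the sets of all, horizontal, vertical maximal interior segments. In a hierarchical T-mesh, the ordering $\iota:\mathrm{MIS}(\mathcal{T})\to\mathbb{N}$ used is the one in which the maximal interior segments appear during the subdivision process. $\Gamma_\iota(\rho)$ is the set of vertices of $\rho$ which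 do not lie on a maximal interior segment $\rho'$ with $\iota(\rho')>\iota(\rho)$. The weight of $\rho$ is $\omega(\rho)=\sum_{\gamma\in\Gamma_\iota(\rho)}(m-\mathbf{r}_h(\gamma))$ if $\rho\in\mathrm{MIS}_h(\mathcal{T})$ and $\omega(\rho)=\sum_{\gamma\in\Gamma_\iota(\rho)}(m'-\mathbf{r}_v(\gamma))$ if $\rho\in\mathrm{MIS}_v(\mathcal{T})$. $\mathcal{T}$ is $(k,k')$-weighted if $\omega(\rho)\ge k$ for all $\rho\in\mathrm{MIS}_h(\mathcal{T})$ and $\omega(\rho)\ge k'$ for all $\rho\in\mathrm{MIS}_v(\mathcal{T})$.
   Formalization: The smoothness is assumed to satisfy r_h ≤ m on vertical and r_v ≤ m' on horizontal interior edges (otherwise the dimension formula fails), and "its weight is also increased" is proved as "does not decrease", since strict increase is false in general. *)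

theory Defs
  imports
    "HOL-Analysis.Analysis"
    "HOL-Computational_Algebra.Polynomial"
    "HOL-Library.Function_Algebras"
begin

section \<open>T-meshes\<close>

type_synonym point = "real \<times> real"

definition rectangle :: "point set \<Rightarrow> bool" where
  "rectangle \<sigma> \<longleftrightarrow> (\<exists>a b c d. a < b \<and> c < d \<and> \<sigma> = {a..b} \<times> {c..d})"

definition horizontal :: "point set \<Rightarrow> bool" where
  "horizontal \<tau> \<longleftrightarrow> (\<exists>a b c. a < b \<and> \<tau> = {a..b} \<times> {c})"

definition vertical :: "point set \<Rightarrow> bool" where
  "vertical \<tau> \<longleftrightarrow> (\<exists>a c d. c < d \<and> \<tau> = {a} \<times> {c..d})"

record tmesh =
  cells :: "point set set"
  edges :: "point set set"

text \<open>The boundary of an edge (its two end points) is its relative frontier in the plane.\<close>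

definition vertices :: "tmesh \<Rightarrow> point set" where
  "vertices M = (\<Union>\<tau>\<in>edges M. rel_frontier \<tau>)"

definition domain :: "tmesh \<Rightarrow> point set" where
  "domain M = \<Union>(cells M)"

text \<open>The last conjunct is the standing assumption on vertices.  Together with the others it makes
  the edges a function of the cells: they are the pieces into which the sides of the cells are cut
  by the points lying both on a horizontal and on a vertical side.\<close>

definition is_tmesh :: "tmesh \<Rightarrow> bool" where
  "is_tmesh M \<longleftrightarrow>
     finite (cells M) \<and> (\<forall>\<sigma>\<in>cells M. rectangle \<sigma>) \<and>
     finite (edges M) \<and>
     (\<forall>\<tau>\<in>edges M. (horizontal \<tau> \<or> vertical \<tau>) \<and> \<tau> \<subseteq> (\<Union>\<sigma>\<in>cells M. frontier \<sigma>)) \<and>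
     (\<forall>\<sigma>\<in>cells M. \<exists>F\<subseteq>edges M. frontier \<sigma> = \<Union>F) \<and>
     (\<forall>\<sigma>\<in>cells M. \<forall>\<sigma>'\<in>cells M. \<sigma> \<noteq> \<sigma>' \<longrightarrow>
        \<sigma> \<inter> \<sigma>' = frontier \<sigma> \<inter> frontier \<sigma>' \<and>
        (\<exists>F\<subseteq>edges M. \<exists>G\<subseteq>vertices M. \<sigma> \<inter> \<sigma>' = \<Union>F \<union> G)) \<and>
     (\<forall>\<tau>\<in>edges M. \<forall>\<tau>'\<in>edges M. \<tau> \<noteq> \<tau>' \<longrightarrow>
        \<tau> \<inter> \<tau>' = rel_frontier \<tau> \<inter> rel_frontier \<tau>' \<and> \<tau> \<inter> \<tau>' \<subseteq> vertices M) \<and>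
     (\<forall>\<gamma>\<in>vertices M. (\<exists>\<tau>\<in>edges M. horizontal \<tau> \<and> \<gamma> \<in> \<tau>) \<and>
                      (\<exists>\<tau>\<in>edges M. vertical \<tau> \<and> \<gamma> \<in> \<tau>))"

definition interior_edges :: "tmesh \<Rightarrow> point set set" where
  "interior_edges M = {\<tau>\<in>edges M. \<tau> \<inter> interior (domain M) \<noteq> {}}"

definition interior_hedges :: "tmesh \<Rightarrow> point set set" where
  "interior_hedges M = {\<tau>\<in>interior_edges M. horizontal \<tau>}"

definition interior_vedges :: "tmesh \<Rightarrow> point set set" where
  "interior_vedges M = {\<tau>\<in>interior_edges M. vertical \<tau>}"

definition interior_vertices :: "tmesh \<Rightarrow> point set" where
  "interior_vertices M = {\<gamma>\<in>vertices M. \<gamma> \<in> interior (domain M)}"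

section \<open>Hierarchical T-meshes\<close>

text \<open>The T-mesh \<open>M'\<close> arises from \<open>M\<close> by splitting the cell \<open>\<sigma>\<close> with the new edge \<open>\<tau>\<close>.  The edges of
  \<open>M'\<close> need not be listed, see the remark at \<open>is_tmesh\<close>.\<close>

definition splits :: "tmesh \<Rightarrow> point set \<Rightarrow> point set \<Rightarrow> tmesh \<Rightarrow> bool" where
  "splits M \<sigma> \<tau> M' \<longleftrightarrow>
     is_tmesh M' \<and> \<sigma> \<in> cells M \<and>
     (\<exists>a b c d. a < b \<and> c < d \<and> \<sigma> = {a..b} \<times> {c..d} \<and>
        ((\<exists>x. a < x \<and> x < b \<and> \<tau> = {x} \<times> {c..d} \<and>
              cells M' = (cells M - {\<sigma>}) \<union> {{a..x} \<times> {c..d}, {x..b} \<times> {c..d}}) \<or>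
         (\<exists>y. c < y \<and> y < d \<and> \<tau> = {a..b} \<times> {y} \<and>
              cells M' = (cells M - {\<sigma>}) \<union> {{a..b} \<times> {c..y}, {a..b} \<times> {y..d}})))"

text \<open>A hierarchical T-mesh is given by its construction, the list of the successive T-meshes,
  because the ordering of the maximal interior segments depends on it.  The hierarchical T-mesh
  itself is the last element of the list.\<close>

inductive hier_construction :: "tmesh list \<Rightarrow> bool" where
  single: "is_tmesh M \<Longrightarrow> rectangle \<Omega> \<Longrightarrow> cells M = {\<Omega>} \<Longrightarrow> hier_construction [M]"
| split: "hier_construction Ms \<Longrightarrow> splits (last Ms) \<sigma> \<tau> M' \<Longrightarrow> hier_construction (Ms @ [M'])"

section \<open>Smoothness and splines\<close>

text \<open>A smoothness distribution is given by \<open>rh\<close> and \<open>rv\<close>; their values outside the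
  coordinates of the vertical, resp. horizontal, edges are irrelevant.  The lower left end point
  \<open>edge_src\<close> and the upper right end point \<open>edge_tgt\<close> also fix the orientation of the edges.\<close>

definition edge_src :: "point set \<Rightarrow> point" where
  "edge_src \<tau> = (Inf (fst ` \<tau>), Inf (snd ` \<tau>))"

definition edge_tgt :: "point set \<Rightarrow> point" where
  "edge_tgt \<tau> = (Sup (fst ` \<tau>), Sup (snd ` \<tau>))"

definition edge_smoothness :: "(real \<Rightarrow> nat) \<Rightarrow> (real \<Rightarrow> nat) \<Rightarrow> point set \<Rightarrow> nat" where
  "edge_smoothness rh rv \<tau> =
     (if vertical \<tau> then rh (fst (edge_src \<tau>)) else rv (snd (edge_src \<tau>)))"

text \<open>Orders above the degrees force the splines to be polynomial across the edge, and the terms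
  \<open>(m' + 1) (r + 1)\<close>, \<open>m - r\<close> lose their meaning as codimension and dimension; with a single
  vertical split and \<open>r = m + 5\<close> the dimension formula is false.  So this bound is a hypothesis.\<close>

definition smoothness_le :: "nat \<Rightarrow> nat \<Rightarrow> (real \<Rightarrow> nat) \<Rightarrow> (real \<Rightarrow> nat) \<Rightarrow> tmesh \<Rightarrow> bool" where
  "smoothness_le m m' rh rv M \<longleftrightarrow>
     (\<forall>\<tau>\<in>interior_vedges M. edge_smoothness rh rv \<tau> \<le> m) \<and>
     (\<forall>\<tau>\<in>interior_hedges M. edge_smoothness rh rv \<tau> \<le> m')"

text \<open>Polynomials in \<open>s, t\<close> are polynomials in \<open>t\<close> with coefficients in the polynomials in \<open>s\<close>.\<close>

definition bideg_le :: "nat \<Rightarrow> nat \<Rightarrow> real poly poly set" where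
  "bideg_le m m' = {p. degree p \<le> m' \<and> (\<forall>j. degree (coeff p j) \<le> m)}"

definition bieval :: "real poly poly \<Rightarrow> point \<Rightarrow> real" where
  "bieval p z = poly (poly p [:snd z:]) (fst z)"

definition class_C_at :: "nat \<Rightarrow> (real \<Rightarrow> real) \<Rightarrow> real \<Rightarrow> bool" where
  "class_C_at n g x \<longleftrightarrow>
     (\<exists>e>0. (\<forall>i<n. \<forall>y\<in>ball x e. (deriv ^^ i) g differentiable at y) \<and>
            continuous_on (ball x e) ((deriv ^^ n) g))"

text \<open>Functions on the domain are represented by functions that vanish outside the domain.\<close>

definition spline_space ::
    "nat \<Rightarrow> nat \<Rightarrow> (real \<Rightarrow> nat) \<Rightarrow> (real \<Rightarrow> nat) \<Rightarrow> tmesh \<Rightarrow> (point \<Rightarrow> real) set" where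
  "spline_space m m' rh rv M =
     {f. (\<forall>z. z \<notin> domain M \<longrightarrow> f z = 0) \<and>
         (\<forall>\<sigma>\<in>cells M. \<exists>p\<in>bideg_le m m'. \<forall>z\<in>\<sigma>. f z = bieval p z) \<and>
         (\<forall>\<tau>\<in>interior_vedges M. \<forall>z\<in>\<tau> \<inter> interior (domain M).
            class_C_at (edge_smoothness rh rv \<tau>) (\<lambda>s. f (s, snd z)) (fst z)) \<and>
         (\<forall>\<tau>\<in>interior_hedges M. \<forall>z\<in>\<tau> \<inter> interior (domain M).
            class_C_at (edge_smoothness rh rv \<tau>) (\<lambda>t. f (fst z, t)) (snd z))}"

definition fun_scale :: "real \<Rightarrow> (point \<Rightarrow> real) \<Rightarrow> point \<Rightarrow> real" where
  "fun_scale c f = (\<lambda>z. c * f z)"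

interpretation real_fun: vector_space fun_scale
  by unfold_locales (auto simp: fun_scale_def fun_eq_iff algebra_simps)

definition spline_dim :: "nat \<Rightarrow> nat \<Rightarrow> (real \<Rightarrow> nat) \<Rightarrow> (real \<Rightarrow> nat) \<Rightarrow> tmesh \<Rightarrow> nat" where
  "spline_dim m m' rh rv M = real_fun.dim (spline_space m m' rh rv M)"

section \<open>The number h\<close>

definition line_poly :: "point set \<Rightarrow> real poly poly" where
  "line_poly \<tau> = (if vertical \<tau> then [:[:- fst (edge_src \<tau>), 1:]:]
                   else [:[:- snd (edge_src \<tau>):], 1:])"

definition edge_ideal ::
    "nat \<Rightarrow> nat \<Rightarrow> (real \<Rightarrow> nat) \<Rightarrow> (real \<Rightarrow> nat) \<Rightarrow> point set \<Rightarrow> real poly poly set" where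
  "edge_ideal m m' rh rv \<tau> =
     {p \<in> bideg_le m m'. line_poly \<tau> ^ (edge_smoothness rh rv \<tau> + 1) dvd p}"

text \<open>The ideals below do not depend on the choice of the edges through \<open>\<gamma>\<close>.\<close>

definition vertex_ideal ::
    "nat \<Rightarrow> nat \<Rightarrow> (real \<Rightarrow> nat) \<Rightarrow> (real \<Rightarrow> nat) \<Rightarrow> tmesh \<Rightarrow> point \<Rightarrow> real poly poly set" where
  "vertex_ideal m m' rh rv M \<gamma> =
     {p + q | p q \<tau>v \<tau>h. \<tau>v \<in> edges M \<and> vertical \<tau>v \<and> \<gamma> \<in> \<tau>v \<and> p \<in> edge_ideal m m' rh rv \<tau>v \<and>
                         \<tau>h \<in> edges M \<and> horizontal \<tau>h \<and> \<gamma> \<in> \<tau>h \<and> q \<in> edge_ideal m m' rh rv \<tau>h}"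

text \<open>An element of a direct sum is the family of its components, extended by zero.\<close>

definition edge_chains ::
    "nat \<Rightarrow> nat \<Rightarrow> (real \<Rightarrow> nat) \<Rightarrow> (real \<Rightarrow> nat) \<Rightarrow> tmesh \<Rightarrow> (point set \<Rightarrow> real poly poly) set" where
  "edge_chains m m' rh rv M =
     {x. (\<forall>\<tau>\<in>interior_edges M. x \<tau> \<in> edge_ideal m m' rh rv \<tau>) \<and>
         (\<forall>\<tau>. \<tau> \<notin> interior_edges M \<longrightarrow> x \<tau> = 0)}"

definition vertex_chains ::
    "nat \<Rightarrow> nat \<Rightarrow> (real \<Rightarrow> nat) \<Rightarrow> (real \<Rightarrow> nat) \<Rightarrow> tmesh \<Rightarrow> (point \<Rightarrow> real poly poly) set" where
  "vertex_chains m m' rh rv M =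
     {y. (\<forall>\<gamma>\<in>interior_vertices M. y \<gamma> \<in> vertex_ideal m m' rh rv M \<gamma>) \<and>
         (\<forall>\<gamma>. \<gamma> \<notin> interior_vertices M \<longrightarrow> y \<gamma> = 0)}"

definition boundary1 ::
    "tmesh \<Rightarrow> (point set \<Rightarrow> real poly poly) \<Rightarrow> point \<Rightarrow> real poly poly" where
  "boundary1 M x = (\<lambda>\<gamma>. if \<gamma> \<in> interior_vertices M
      then (\<Sum>\<tau> | \<tau> \<in> interior_edges M \<and> edge_tgt \<tau> = \<gamma>. x \<tau>)
         - (\<Sum>\<tau> | \<tau> \<in> interior_edges M \<and> edge_src \<tau> = \<gamma>. x \<tau>)
      else 0)"

definition chain_scale :: "real \<Rightarrow> (point \<Rightarrow> real poly poly) \<Rightarrow> point \<Rightarrow> real poly poly" where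
  "chain_scale c y = (\<lambda>\<gamma>. smult [:c:] (y \<gamma>))"

text \<open>For a finite-dimensional space \<open>V\<close> and a subspace \<open>W\<close> this is the dimension of the quotient
  \<open>V / W\<close>: \<open>quotient_basis\<close> says that the cosets of the elements of \<open>B\<close> are pairwise distinct and
  form a basis of \<open>V / W\<close>.\<close>

definition quotient_basis ::
    "(real \<Rightarrow> 'v::ab_group_add \<Rightarrow> 'v) \<Rightarrow> 'v set \<Rightarrow> 'v set \<Rightarrow> 'v set \<Rightarrow> bool" where
  "quotient_basis scl V W B \<longleftrightarrow> finite B \<and> B \<subseteq> V \<and>
     (\<forall>v\<in>V. \<exists>!c. (\<forall>b. b \<notin> B \<longrightarrow> c b = 0) \<and> v - (\<Sum>b\<in>B. scl (c b) b) \<in> W)"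

definition quotient_dim ::
    "(real \<Rightarrow> 'v::ab_group_add \<Rightarrow> 'v) \<Rightarrow> 'v set \<Rightarrow> 'v set \<Rightarrow> nat" where
  "quotient_dim scl V W = (THE n. \<exists>B. quotient_basis scl V W B \<and> card B = n)"

definition h_number :: "nat \<Rightarrow> nat \<Rightarrow> (real \<Rightarrow> nat) \<Rightarrow> (real \<Rightarrow> nat) \<Rightarrow> tmesh \<Rightarrow> nat" where
  "h_number m m' rh rv M =
     quotient_dim chain_scale (vertex_chains m m' rh rv M)
       (boundary1 M ` edge_chains m m' rh rv M)"

section \<open>Maximal interior segments and weights\<close>

definition max_connected_unions :: "point set set \<Rightarrow> point set set" where
  "max_connected_unions E =
     {\<rho>. \<exists>F\<subseteq>E. F \<noteq> {} \<and> \<rho> = \<Union>F \<and> connected \<rho> \<and>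
          (\<forall>G\<subseteq>E. connected (\<Union>G) \<and> \<rho> \<subseteq> \<Union>G \<longrightarrow> \<Union>G = \<rho>)}"

definition max_segments :: "tmesh \<Rightarrow> point set set" where
  "max_segments M =
     max_connected_unions (interior_hedges M) \<union> max_connected_unions (interior_vedges M)"

definition max_segment :: "tmesh \<Rightarrow> point set \<Rightarrow> point set" where
  "max_segment M \<tau> = (THE \<rho>. \<rho> \<in> max_segments M \<and> \<tau> \<subseteq> \<rho>)"

definition MIS_h :: "tmesh \<Rightarrow> point set set" where
  "MIS_h M = {\<rho> \<in> max_connected_unions (interior_hedges M). \<rho> \<inter> frontier (domain M) = {}}"

definition MIS_v :: "tmesh \<Rightarrow> point set set" where
  "MIS_v M = {\<rho> \<in> max_connected_unions (interior_vedges M). \<rho> \<inter> frontier (domain M) = {}}"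

definition MIS :: "tmesh \<Rightarrow> point set set" where
  "MIS M = MIS_h M \<union> MIS_v M"

text \<open>A maximal interior segment appears together with its first piece; a segment that is extended
  keeps its place in the ordering, and a segment formed by joining several takes the place of the
  oldest one.  Since every splitting contributes to a single maximal segment, \<open>appearance Ms\<close> is
  injective on the maximal interior segments.\<close>

definition appearance :: "tmesh list \<Rightarrow> point set \<Rightarrow> nat" where
  "appearance Ms \<rho> = (LEAST i. i < length Ms \<and> (\<exists>\<rho>0\<in>MIS (Ms ! i). \<rho>0 \<subseteq> \<rho>))"

definition counted_vertices :: "tmesh list \<Rightarrow> point set \<Rightarrow> point set" where
  "counted_vertices Ms \<rho> =
     {\<gamma> \<in> vertices (last Ms). \<gamma> \<in> \<rho> \<and>
        \<not> (\<exists>\<rho>'\<in>MIS (last Ms). \<gamma> \<in> \<rho>' \<and> appearance Ms \<rho>' > appearance Ms \<rho>)}"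

definition seg_weight ::
    "nat \<Rightarrow> nat \<Rightarrow> (real \<Rightarrow> nat) \<Rightarrow> (real \<Rightarrow> nat) \<Rightarrow> tmesh list \<Rightarrow> point set \<Rightarrow> int" where
  "seg_weight m m' rh rv Ms \<rho> =
     (if \<rho> \<in> MIS_h (last Ms)
      then (\<Sum>\<gamma>\<in>counted_vertices Ms \<rho>. int m - int (rh (fst \<gamma>)))
      else (\<Sum>\<gamma>\<in>counted_vertices Ms \<rho>. int m' - int (rv (snd \<gamma>))))"

definition heavy_segment ::
    "nat \<Rightarrow> nat \<Rightarrow> nat \<Rightarrow> nat \<Rightarrow> (real \<Rightarrow> nat) \<Rightarrow> (real \<Rightarrow> nat) \<Rightarrow> tmesh list \<Rightarrow> point set \<Rightarrow> bool" where
  "heavy_segment m m' k k' rh rv Ms \<rho> \<longleftrightarrow>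
     (\<rho> \<in> MIS_h (last Ms) \<and> seg_weight m m' rh rv Ms \<rho> \<ge> int k) \<or>
     (\<rho> \<in> MIS_v (last Ms) \<and> seg_weight m m' rh rv Ms \<rho> \<ge> int k')"

definition weighted ::
    "nat \<Rightarrow> nat \<Rightarrow> nat \<Rightarrow> nat \<Rightarrow> (real \<Rightarrow> nat) \<Rightarrow> (real \<Rightarrow> nat) \<Rightarrow> tmesh list \<Rightarrow> bool" where
  "weighted m m' k k' rh rv Ms \<longleftrightarrow>
     (\<forall>\<rho>\<in>MIS_h (last Ms). seg_weight m m' rh rv Ms \<rho> \<ge> int k) \<and>
     (\<forall>\<rho>\<in>MIS_v (last Ms). seg_weight m m' rh rv Ms \<rho> \<ge> int k')"

section \<open>The weighted subdivision rule\<close>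

definition extends_segment :: "tmesh \<Rightarrow> point set \<Rightarrow> bool" where
  "extends_segment M \<tau> \<longleftrightarrow>
     (horizontal \<tau> \<and> (\<exists>\<rho>\<in>max_connected_unions (interior_hedges M). \<rho> \<inter> \<tau> \<noteq> {})) \<or>
     (vertical \<tau> \<and> (\<exists>\<rho>\<in>max_connected_unions (interior_vedges M). \<rho> \<inter> \<tau> \<noteq> {}))"

text \<open>\<open>extension \<tau> M Ns\<close>: the list \<open>Ns\<close> is obtained from \<open>M\<close> by successive splittings, each of which
  prolongs the maximal segment containing \<open>\<tau>\<close> through one more cell.\<close>

inductive extension :: "point set \<Rightarrow> tmesh \<Rightarrow> tmesh list \<Rightarrow> bool" for \<tau> where
  stop: "extension \<tau> M []"
| step: "splits M \<sigma> \<tau>' M' \<Longrightarrow> \<tau>' \<subseteq> max_segment M' \<tau> \<Longrightarrow> extension \<tau> M' Ns \<Longrightarrow>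
           extension \<tau> M (M' # Ns)"

text \<open>One application of the rule, with new edge \<open>\<tau>\<close>, leading from the construction \<open>Ms\<close> to the
  longer construction \<open>Ms'\<close>.\<close>

definition rule_application ::
    "nat \<Rightarrow> nat \<Rightarrow> nat \<Rightarrow> nat \<Rightarrow> (real \<Rightarrow> nat) \<Rightarrow> (real \<Rightarrow> nat) \<Rightarrow>
     point set \<Rightarrow> tmesh list \<Rightarrow> tmesh list \<Rightarrow> bool" where
  "rule_application m m' k k' rh rv \<tau> Ms Ms' \<longleftrightarrow>
     (\<exists>\<sigma> M1 Ns. splits (last Ms) \<sigma> \<tau> M1 \<and> Ms' = Ms @ M1 # Ns \<and>
        (if extends_segment (last Ms) \<tau> then Ns = []
         else extension \<tau> M1 Ns \<and>
              (max_segment (last Ms') \<tau> \<inter> frontier (domain (last Ms')) \<noteq> {} \<or>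
               heavy_segment m m' k k' rh rv Ms' (max_segment (last Ms') \<tau>))))"

definition obtained_by_rule ::
    "nat \<Rightarrow> nat \<Rightarrow> nat \<Rightarrow> nat \<Rightarrow> (real \<Rightarrow> nat) \<Rightarrow> (real \<Rightarrow> nat) \<Rightarrow> tmesh \<Rightarrow> bool" where
  "obtained_by_rule m m' k k' rh rv M \<longleftrightarrow>
     (\<exists>Ms0 Ms. hier_construction Ms0 \<and> weighted m m' k k' rh rv Ms0 \<and>
        (\<lambda>Ns Ns'. \<exists>\<tau>. rule_application m m' k k' rh rv \<tau> Ns Ns')\<^sup>*\<^sup>* Ms0 Ms \<and> M = last Ms)"

end

theory Submission
  imports Defs
begin

text \<open>When a segment grows, it keeps the place of its oldest piece in the ordering.  So a vertex that
  is counted for some segment remains counted, and no weight decreases.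

  Let \<open>p\<close> lie in the ideal of a line through the vertex \<open>\<gamma>\<close>.  Modulo the image of \<open>\<partial>\<^sub>1\<close>, the element
  \<open>[\<gamma>] p\<close> depends only on the maximal segment \<open>\<rho>\<close> of this line through \<open>\<gamma>\<close>, and it vanishes if \<open>\<rho>\<close>
  reaches the boundary of the domain.  For an interior \<open>\<rho>\<close> one argues by induction on the appearance:
  at a counted vertex the crossing segment has been treated before, so \<open>[\<gamma>] p\<close> vanishes if \<open>p\<close> lies in
  the ideals of both segments.  As the weight of \<open>\<rho>\<close> is at least \<open>m + 1\<close> (or \<open>m' + 1\<close>), these \<open>p\<close>
  span the ideal of \<open>\<rho>\<close>, because the powers of linear forms that divide them span the univariate
  polynomials.  Hence \<open>\<partial>\<^sub>1\<close> is onto.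

  A spline is a family of polynomials on the cells whose jumps across the edges lie in the ideals of
  the edges.  Families with the same jumps differ by a global polynomial, and on a rectangle every
  cycle of \<open>\<partial>\<^sub>1\<close> is a family of jumps.  So the dimension follows from rank-nullity and from the Euler
  characteristic of the rectangle.\<close>

section \<open>Dimensions\<close>

text \<open>\<open>splits\<close> prescribes only the cells of the new mesh, and a split can also
  cut old edges of the other direction at new vertices, so single edges are hard to follow through a
  construction. The unions \<open>hgrid\<close> and \<open>vgrid\<close> of the sides of the cells
  depend on the cells alone and only grow. Vertices and maximal segments are recovered from them,
  the latter as connected components.

  For the algebra the mesh is drawn on the grid of all its lines. A chain becomes a function on the
  unit segments of the grid, with value 0 where no line is drawn. Boundaries, jumps and path
  integrals are then differences between neighbouring grid squares, and their formulas hold at every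
  inner grid point, whether or not it is a vertex.

  The weight counts the useful powers: at a vertex with first coordinate a on a horizontal segment,
  the powers (s - a)^k with r_h(a) < k <= m lie in the ideal of the crossing line, and there are m -
  r_h(a) of them. Over the distinct a of a segment, m + 1 such powers suffice to span the
  polynomials of degree at most m; this is proved by duality, because the powers belong to different
  base points.\<close>

definition finitely_spanned :: "('k::field \<Rightarrow> 'v::ab_group_add \<Rightarrow> 'v) \<Rightarrow> 'v set \<Rightarrow> bool" where
  "finitely_spanned s V \<longleftrightarrow> (\<exists>B. finite B \<and> V \<subseteq> module.span s B)"

lemma finitely_spanned_subset: "finitely_spanned s W \<Longrightarrow> V \<subseteq> W \<Longrightarrow> finitely_spanned s V"
  unfolding finitely_spanned_def by blast

context vector_space begin

text \<open>Coordinates with respect to \<open>C\<close> restrict to coordinates with respect to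
  \<open>B\<close> and to \<open>D\<close>; a nonzero one would belong to a vector of
  \<open>B \<inter> D\<close>.\<close>

lemma span_Int_independent:
  assumes "independent C" "B \<subseteq> C" "D \<subseteq> C" "B \<inter> D = {}" "x \<in> span B" "x \<in> span D"
  shows "x = 0"
proof -
  have B: "representation C x = representation B x" and D: "representation C x = representation D x"
    using assms representation_extend by blast+
  have "representation B x b = 0" for b
    using representation_ne_zero[of B x b] representation_ne_zero[of D x b] B D assms(4) by auto
  then have "(\<Sum>b | representation B x b \<noteq> 0. scale (representation B x b) b) = 0" by simp
  then show ?thesis
    using sum_nonzero_representation_eq[of B x] assms independent_mono by metis
qed

end

context vector_space_pair begin

text \<open>Relative form for a subspace: chains are functions on all sets, and only a subspace of
  these matters. Since \<open>dim\<close> is 0 on infinite-dimensional sets,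
  \<open>finitely_spanned\<close> secures that it has its usual meaning.\<close>

lemma rank_nullity:
  assumes lf: "Vector_Spaces.linear s1 s2 f" and V: "vs1.subspace V" and fin: "finitely_spanned s1 V"
  shows "vs1.dim V = vs2.dim (f ` V) + vs1.dim {v\<in>V. f v = 0}"
proof -
  let ?K = "{v\<in>V. f v = 0}"
  obtain B0 where B0: "finite B0" "V \<subseteq> vs1.span B0"
    using fin unfolding finitely_spanned_def by blast
  obtain B where B: "B \<subseteq> ?K" "vs1.independent B" "?K \<subseteq> vs1.span B"
    using vs1.maximal_independent_subset[of ?K] by blast
  have "B \<subseteq> V" using B by blast
  then obtain C where C: "B \<subseteq> C" "C \<subseteq> V" "vs1.independent C" "V \<subseteq> vs1.span C"
    using vs1.maximal_independent_subset_extend[of B V] B by metis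
  have finC: "finite C"
    using vs1.independent_span_bound[OF B0(1) C(3)] C(2) B0(2) by blast
  \<comment> \<open>\<open>D\<close> completes a basis \<open>B\<close> of the kernel to a basis of
    \<open>V\<close>; its image will be a basis of the image of \<open>V\<close>.\<close>
  define D where "D = C - B"
  have D: "D \<subseteq> C" "B \<inter> D = {}" "C = B \<union> D" using C(1) by (auto simp: D_def)
  have spD: "vs1.span D \<subseteq> V"
    using D C(2) vs1.span_minimal[OF _ V] by blast
  have inj: "inj_on f (vs1.span D)"
  proof (subst linear_inj_on_iff_eq_0[OF lf])
    show "vs1.subspace (vs1.span D)" by simp
    show "\<forall>x\<in>vs1.span D. f x = 0 \<longrightarrow> x = 0"
    proof (intro ballI impI)
      fix x assume x: "x \<in> vs1.span D" "f x = 0"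
      then have "x \<in> vs1.span B" using spD B(3) by blast
      with vs1.span_Int_independent[OF C(3) C(1) D(1) D(2) _ x(1)] show "x = 0" by simp
    qed
  qed
  have ind: "vs2.independent (f ` D)"
    using linear_independent_injective_image[OF lf vs1.independent_mono[OF C(3) D(1)] inj] .
  have "f ` V \<subseteq> vs2.span (f ` D)"
  proof -
    have "f ` V \<subseteq> f ` vs1.span C" using C by blast
    also have "\<dots> = vs2.span (f ` C)" using linear_span_image[OF lf] by simp
    also have "\<dots> \<subseteq> vs2.span (f ` D)"
    proof (rule vs2.span_minimal)
      show "f ` C \<subseteq> vs2.span (f ` D)"
      proof
        fix y assume "y \<in> f ` C"
        then obtain c where c: "c \<in> C" "y = f c" by blast
        show "y \<in> vs2.span (f ` D)"
        proof (cases "c \<in> D")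
          case True then show ?thesis using c by (simp add: vs2.span_base)
        next
          case False then have "f c = 0" using c D B by blast
          then show ?thesis using c vs2.span_zero by simp
        qed
      qed
    qed simp
    finally show ?thesis .
  qed
  moreover have "f ` D \<subseteq> f ` V" using C D by blast
  ultimately have 1: "vs2.dim (f ` V) = card (f ` D)"
    using vs2.basis_card_eq_dim[OF _ _ ind] by simp
  have 2: "card (f ` D) = card D"
    using inj inj_on_subset vs1.span_superset card_image by metis
  have 3: "vs1.dim ?K = card B" using vs1.basis_card_eq_dim[OF B(1) B(3) B(2)] by simp
  have 4: "vs1.dim V = card C" using vs1.basis_card_eq_dim[OF C(2) C(4) C(3)] by simp
  have "card C = card B + card D"
    using D finC by (metis card_Un_disjoint finite_Un)
  then show ?thesis using 1 2 3 4 by simp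
qed

lemma dim_inj_image:
  assumes "Vector_Spaces.linear s1 s2 f" "vs1.subspace V" "finitely_spanned s1 V" "\<And>v. v \<in> V \<Longrightarrow> f v = 0 \<Longrightarrow> v = 0"
  shows "vs2.dim (f ` V) = vs1.dim V"
proof -
  have "{v\<in>V. f v = 0} = {0}"
    using assms linear_0[OF assms(1)] vs1.subspace_0 by auto
  moreover have "vs1.dim {0} = 0"
    using vs1.dim_unique[of "{}" "{0}" 0] by (simp add: vs1.span_zero vs1.independent_empty)
  ultimately show ?thesis using rank_nullity[OF assms(1-3)] by simp
qed

end

section \<open>Finite direct sums of subspaces\<close>

lemma sum_fun_apply: "(\<Sum>i\<in>I. f i) x = (\<Sum>i\<in>I. f i x)"
  for f :: "'i \<Rightarrow> 'a \<Rightarrow> 'b::comm_monoid_add"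
  by (induction I rule: infinite_finite_induct) auto

definition pointwise :: "('k \<Rightarrow> 'v \<Rightarrow> 'v) \<Rightarrow> 'k \<Rightarrow> ('i \<Rightarrow> 'v) \<Rightarrow> 'i \<Rightarrow> 'v" where
  "pointwise s c x = (\<lambda>i. s c (x i))"

text \<open>The same encoding of a direct sum as in \<open>edge_chains\<close> and
  \<open>vertex_chains\<close>, which thereby become instances.\<close>

definition families :: "'i set \<Rightarrow> ('i \<Rightarrow> 'v set) \<Rightarrow> ('i \<Rightarrow> 'v::zero) set" where
  "families I A = {x. (\<forall>i\<in>I. x i \<in> A i) \<and> (\<forall>i. i \<notin> I \<longrightarrow> x i = 0)}"

definition single :: "'i \<Rightarrow> 'v \<Rightarrow> 'i \<Rightarrow> 'v::zero" where
  "single i v = (\<lambda>j. if j = i then v else 0)"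

context vector_space begin

lemma vector_space_pointwise: "vector_space (pointwise scale :: 'a \<Rightarrow> ('i \<Rightarrow> 'b) \<Rightarrow> _)"
  by unfold_locales (auto simp: pointwise_def fun_eq_iff algebra_simps)

lemma subspace_families:
  fixes I :: "'i set"
  assumes "\<And>i. i \<in> I \<Longrightarrow> subspace (A i)"
  shows "module.subspace (pointwise scale) (families I A)"
proof -
  interpret p: vector_space "pointwise scale :: 'a \<Rightarrow> ('i \<Rightarrow> 'b) \<Rightarrow> _" by (rule vector_space_pointwise)
  show ?thesis using assms
    by (intro p.subspaceI) (auto simp: families_def pointwise_def subspace_0 subspace_add subspace_scale)
qed

lemma linear_single: "Vector_Spaces.linear scale (pointwise scale) (single i)" for i :: 'i
proof -
  interpret p: vector_space "pointwise scale :: 'a \<Rightarrow> ('i \<Rightarrow> 'b) \<Rightarrow> _" by (rule vector_space_pointwise)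
  show ?thesis
    by unfold_locales (auto simp: single_def pointwise_def fun_eq_iff)
qed

lemma linear_eval: "Vector_Spaces.linear (pointwise scale) scale (\<lambda>x. x i)" for i :: 'i
proof -
  interpret p: vector_space "pointwise scale :: 'a \<Rightarrow> ('i \<Rightarrow> 'b) \<Rightarrow> _" by (rule vector_space_pointwise)
  show ?thesis
    by unfold_locales (auto simp: pointwise_def)
qed

lemma families_eq_sum_single:
  assumes "finite I" "x \<in> families I A"
  shows "x = (\<Sum>i\<in>I. single i (x i))"
proof
  fix j
  have "(\<Sum>i\<in>I. single i (x i)) j = (\<Sum>i\<in>I. if j = i then x i else 0)"
    by (subst sum_fun_apply) (simp add: single_def)
  also have "\<dots> = (if j \<in> I then x j else 0)" using assms(1) by simp
  also have "\<dots> = x j" using assms(2) by (simp add: families_def)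
  finally show "x j = (\<Sum>i\<in>I. single i (x i)) j" by simp
qed

lemma finitely_spanned_families:
  fixes I :: "'i set"
  assumes "finite I" "\<And>i. i \<in> I \<Longrightarrow> finitely_spanned scale (A i)"
  shows "finitely_spanned (pointwise scale) (families I A)"
proof -
  interpret p: vector_space "pointwise scale :: 'a \<Rightarrow> ('i \<Rightarrow> 'b) \<Rightarrow> _" by (rule vector_space_pointwise)
  interpret vp: vector_space_pair scale "pointwise scale :: 'a \<Rightarrow> ('i \<Rightarrow> 'b) \<Rightarrow> _" ..
  have "\<forall>i. \<exists>B. i \<in> I \<longrightarrow> finite B \<and> A i \<subseteq> span B" using assms(2) unfolding finitely_spanned_def by blast
  then obtain B where B: "\<And>i. i \<in> I \<Longrightarrow> finite (B i) \<and> A i \<subseteq> span (B i)" by metis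
  let ?S = "\<Union>i\<in>I. single i ` B i"
  have "families I A \<subseteq> p.span ?S"
  proof
    fix x assume x: "x \<in> families I A"
    have "single i (x i) \<in> p.span ?S" if "i \<in> I" for i
    proof -
      have "x i \<in> span (B i)" using x that B by (auto simp: families_def)
      then have "single i (x i) \<in> p.span (single i ` B i)"
        using vp.linear_span_image[OF linear_single, of i "B i"] by blast
      moreover have "single i ` B i \<subseteq> ?S" using that by blast
      ultimately show ?thesis using p.span_mono by blast
    qed
    then show "x \<in> p.span ?S"
      by (subst families_eq_sum_single[OF assms(1) x]) (auto intro: p.span_sum)
  qed
  moreover have "finite ?S" using assms(1) B by auto
  ultimately show ?thesis unfolding finitely_spanned_def by blast
qed

text \<open>Rank-nullity for the evaluation at a new index: its image is the new summand, its kernel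
  the direct sum over the old indices.\<close>

lemma dim_families:
  fixes I :: "'i set"
  assumes "finite I" "\<And>i. i \<in> I \<Longrightarrow> subspace (A i)" "\<And>i. i \<in> I \<Longrightarrow> finitely_spanned scale (A i)"
  shows "vector_space.dim (pointwise scale) (families I A) = (\<Sum>i\<in>I. dim (A i))"
proof -
  interpret p: vector_space "pointwise scale :: 'a \<Rightarrow> ('i \<Rightarrow> 'b) \<Rightarrow> _" by (rule vector_space_pointwise)
  interpret vp: vector_space_pair "pointwise scale :: 'a \<Rightarrow> ('i \<Rightarrow> 'b) \<Rightarrow> _" scale ..
  show ?thesis using assms
  proof (induction I rule: finite_induct)
    case empty
    have "families {} A = {0}" by (auto simp: families_def)
    then show ?case using p.dim_unique[of "{}" "{0}" 0] by (simp add: p.span_zero p.independent_empty)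
  next
    case (insert i I)
    let ?V = "families (insert i I) A"
    have "p.dim ?V = dim ((\<lambda>x. x i) ` ?V) + p.dim {x\<in>?V. x i = 0}"
      using insert by (intro vp.rank_nullity linear_eval subspace_families finitely_spanned_families) auto
    also have "(\<lambda>x. x i) ` ?V = A i"
    proof
      show "A i \<subseteq> (\<lambda>x. x i) ` ?V"
      proof
        fix v assume "v \<in> A i"
        then have "single i v \<in> ?V" using insert subspace_0 by (auto simp: families_def single_def)
        then show "v \<in> (\<lambda>x. x i) ` ?V" by (rule rev_image_eqI) (simp add: single_def)
      qed
    qed (use insert subspace_0 in \<open>auto simp: families_def\<close>)
    also have "{x\<in>?V. x i = 0} = families I A" using insert(2) subspace_0[OF insert.prems(1)[of i]] by (auto simp: families_def)
    finally show ?case using insert by simp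
  qed
qed

end

section \<open>Bivariate polynomials\<close>

definition poly_scale :: "real \<Rightarrow> real poly poly \<Rightarrow> real poly poly" where
  "poly_scale c = smult [:c:]"

interpretation poly1: vector_space "smult :: real \<Rightarrow> real poly \<Rightarrow> real poly"
  by unfold_locales (auto simp: smult_add_right smult_add_left)

interpretation poly2: vector_space poly_scale
proof
  fix a b :: real and x :: "real poly poly"
  have "[:a + b:] = [:a:] + [:b:]" by simp
  then show "poly_scale (a + b) x = poly_scale a x + poly_scale b x"
    unfolding poly_scale_def by (metis smult_add_left)
qed (auto simp: poly_scale_def smult_add_right pCons_one mult.commute)

lemma coeff_poly_scale [simp]: "coeff (poly_scale c p) j = smult c (coeff p j)"
  by (simp add: poly_scale_def)

text \<open>The product of \<open>f(s)\<close> and \<open>g(t)\<close>: the outer variable of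
  \<open>real poly poly\<close> is \<open>t\<close>, so \<open>f\<close> goes into the
  coefficients.\<close>

definition tensor :: "real poly \<Rightarrow> real poly \<Rightarrow> real poly poly" where
  "tensor f g = map_poly (\<lambda>c. smult c f) g"

lemma coeff_tensor [simp]: "coeff (tensor f g) j = smult (coeff g j) f"
  by (simp add: tensor_def coeff_map_poly)

lemma tensor_simps:
  "tensor (f + f') g = tensor f g + tensor f' g" "tensor f (g + g') = tensor f g + tensor f g'"
  "tensor (smult c f) g = poly_scale c (tensor f g)" "tensor f (smult c g) = poly_scale c (tensor f g)"
  "tensor 0 g = 0" "tensor f 0 = 0" "tensor 1 1 = 1"
  by (auto intro!: poly_eqI simp: smult_add_left smult_add_right mult.commute coeff_pCons one_pCons split: nat.splits)

lemma tensor_mult: "tensor f g * tensor f' g' = tensor (f * f') (g * g')"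
  by (rule poly_eqI) (simp add: coeff_mult smult_sum mult_ac)

lemma tensor_power: "tensor f g ^ n = tensor (f ^ n) (g ^ n)"
  by (induction n) (simp_all add: tensor_simps tensor_mult)

lemma tensor_pCons: "tensor f (pCons a g) = pCons (smult a f) (tensor f g)"
  by (rule poly_eqI) (auto simp: coeff_pCons split: nat.splits)

lemma bieval_tensor: "bieval (tensor f g) z = poly f (fst z) * poly g (snd z)"
proof -
  have "poly (tensor f g) [:y:] = smult (poly g y) f" for y
    by (induction g) (auto simp: tensor_simps tensor_pCons smult_add_left mult_ac)
  then show ?thesis by (simp add: bieval_def)
qed

lemma bieval_simps [simp]:
  "bieval (p + q) z = bieval p z + bieval q z" "bieval (p - q) z = bieval p z - bieval q z"
  "bieval (p * q) z = bieval p z * bieval q z" "bieval (poly_scale c p) z = c * bieval p z"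
  "bieval 0 z = 0"
  by (auto simp: bieval_def poly_scale_def)

lemma bieval_sum: "bieval (\<Sum>i\<in>A. f i) z = (\<Sum>i\<in>A. bieval (f i) z)"
  by (induction A rule: infinite_finite_induct) auto

text \<open>The coefficient of \<open>s^i\<close>, a polynomial in \<open>t\<close>; the counterpart
  of \<open>coeff p j\<close>, the coefficient of \<open>t^j\<close>, which the nested
  representation offers directly.\<close>

definition coeff1 :: "real poly poly \<Rightarrow> nat \<Rightarrow> real poly" where
  "coeff1 p i = map_poly (\<lambda>c. coeff c i) p"

lemma coeff_coeff1 [simp]: "coeff (coeff1 p i) j = coeff (coeff p j) i"
  by (simp add: coeff1_def coeff_map_poly)

lemma coeff1_mult: "coeff1 (tensor 1 l * q) i = l * coeff1 q i"
  by (rule poly_eqI) (simp add: coeff_mult coeff_sum)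

lemma bideg_le_iff:
  "p \<in> bideg_le m m' \<longleftrightarrow> (\<forall>i j. coeff (coeff p j) i \<noteq> 0 \<longrightarrow> i \<le> m \<and> j \<le> m')"
proof
  assume "p \<in> bideg_le m m'"
  then show "\<forall>i j. coeff (coeff p j) i \<noteq> 0 \<longrightarrow> i \<le> m \<and> j \<le> m'"
    unfolding bideg_le_def using le_degree
    by (metis (mono_tags, lifting) coeff_0 coeff_eq_0 leI le_trans mem_Collect_eq)
next
  assume *: "\<forall>i j. coeff (coeff p j) i \<noteq> 0 \<longrightarrow> i \<le> m \<and> j \<le> m'"
  have "degree p \<le> m'"
  proof (rule degree_le, intro allI impI)
    fix j assume "m' < j"
    then show "coeff p j = 0" using * by (intro poly_eqI) (metis coeff_0 leD)
  qed
  moreover have "degree (coeff p j) \<le> m" for j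
    by (rule degree_le) (use * leD in blast)
  ultimately show "p \<in> bideg_le m m'" by (simp add: bideg_le_def)
qed

text \<open>This expansion and its twin \<open>coeff_tensor_sum1\<close> carry one-variable
  arguments over to two variables, one tensor factor at a time.\<close>

lemma coeff_tensor_sum2:
  assumes "p \<in> bideg_le m m'"
  shows "p = (\<Sum>j\<le>m'. tensor (coeff p j) (monom 1 j))"
proof (rule poly_eqI)
  fix n
  have "coeff (\<Sum>j\<le>m'. tensor (coeff p j) (monom 1 j)) n = (\<Sum>j\<le>m'. if n = j then coeff p j else 0)"
    unfolding coeff_sum by (rule sum.cong) auto
  also have "\<dots> = coeff p n" using assms by (auto simp: bideg_le_def coeff_eq_0)
  finally show "coeff p n = coeff (\<Sum>j\<le>m'. tensor (coeff p j) (monom 1 j)) n" by simp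
qed

lemma coeff_tensor_sum1:
  assumes "p \<in> bideg_le m m'"
  shows "p = (\<Sum>i\<le>m. tensor (monom 1 i) (coeff1 p i))"
proof (intro poly_eqI)
  fix j n
  have "coeff (coeff (\<Sum>i\<le>m. tensor (monom 1 i) (coeff1 p i)) j) n =
      (\<Sum>i\<le>m. if n = i then coeff (coeff p j) i else 0)"
    unfolding coeff_sum by (rule sum.cong) auto
  also have "\<dots> = coeff (coeff p j) n" using assms by (auto simp: bideg_le_iff)
  finally show "coeff (coeff p j) n = coeff (coeff (\<Sum>i\<le>m. tensor (monom 1 i) (coeff1 p i)) j) n" by simp
qed

lemma subspace_bideg_le: "poly2.subspace (bideg_le m m')"
  by (intro poly2.subspaceI) (auto simp: bideg_le_def intro!: degree_add_le order_trans[OF degree_smult_le]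
    simp: poly_scale_def)

lemma tensor_bideg_le: "degree f \<le> m \<Longrightarrow> degree g \<le> m' \<Longrightarrow> tensor f g \<in> bideg_le m m'"
  by (auto simp: bideg_le_iff) (use le_degree order_trans in blast)+

section \<open>Ideals of vertical and horizontal lines\<close>

definition videal :: "nat \<Rightarrow> nat \<Rightarrow> real \<Rightarrow> nat \<Rightarrow> real poly poly set" where
  "videal m m' a r = {p \<in> bideg_le m m'. tensor [:-a, 1:] 1 ^ r dvd p}"

text \<open>In both ideals \<open>r\<close> is the exponent of the linear form, which is the order
  of smoothness plus one.\<close>

definition hideal :: "nat \<Rightarrow> nat \<Rightarrow> real \<Rightarrow> nat \<Rightarrow> real poly poly set" where
  "hideal m m' b r = {p \<in> bideg_le m m'. tensor 1 [:-b, 1:] ^ r dvd p}"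

lemma subspace_dvd_poly2: "poly2.subspace {p. q dvd p}"
  by (intro poly2.subspaceI) (auto simp: poly_scale_def dvd_smult)

lemma subspace_videal: "poly2.subspace (videal m m' a r)"
  using poly2.subspace_inter[OF subspace_bideg_le subspace_dvd_poly2] by (simp add: videal_def Collect_conj_eq)

lemma subspace_hideal: "poly2.subspace (hideal m m' b r)"
  using poly2.subspace_inter[OF subspace_bideg_le subspace_dvd_poly2] by (simp add: hideal_def Collect_conj_eq)

text \<open>A power of a linear form in \<open>s\<close> is constant with respect to the outer
  variable, so divisibility can be tested coefficient by coefficient.\<close>

lemma vdvd_iff: "tensor [:-a, 1:] 1 ^ r dvd p \<longleftrightarrow> (\<forall>j. [:-a, 1:] ^ r dvd coeff p j)"
proof -
  have "tensor [:-a, 1:] 1 ^ r = [:[:-a, 1:] ^ r:]"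
    unfolding tensor_power by (rule poly_eqI) (auto simp: coeff_pCons split: nat.splits)
  then show ?thesis by (simp add: const_poly_dvd_iff)
qed

lemma hdvd_imp: "tensor 1 [:-b, 1:] ^ r dvd p \<Longrightarrow> [:-b, 1:] ^ r dvd coeff1 p i"
  by (auto simp: dvd_def tensor_power coeff1_mult)

text \<open>The form in \<open>t\<close> is not constant in the outer variable, so the expansion in
  powers of \<open>s\<close> takes over the part of the coefficients.\<close>

lemma hdvd_if:
  assumes "p \<in> bideg_le m m'" "\<And>i. i \<le> m \<Longrightarrow> [:-b, 1:] ^ r dvd coeff1 p i"
  shows "tensor 1 [:-b, 1:] ^ r dvd p"
proof -
  have "tensor 1 [:-b, 1:] ^ r dvd tensor (monom 1 i) (coeff1 p i)" if i: "i \<le> m" for i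
  proof -
    obtain q where "coeff1 p i = [:-b, 1:] ^ r * q" using assms(2)[OF i] by (elim dvdE)
    then have "tensor (monom 1 i) (coeff1 p i) = tensor 1 [:-b, 1:] ^ r * tensor (monom 1 i) q"
      by (simp add: tensor_power tensor_mult)
    then show ?thesis by simp
  qed
  then show ?thesis by (subst coeff_tensor_sum1[OF assms(1)]) (auto intro: dvd_sum)
qed

lemma degree_coeff1: "p \<in> bideg_le m m' \<Longrightarrow> degree (coeff1 p i) \<le> m'"
  by (rule degree_le) (auto simp: bideg_le_iff, use leD in blast)

text \<open>Synthetic division at \<open>a\<close> splits off the value \<open>f(a)\<close> and
  leaves a multiple of \<open>s - a\<close> whose cofactor has smaller degree.\<close>

lemma shifted_powers_span:
  assumes "degree f \<le> m"
  shows "f \<in> poly1.span ((\<lambda>i. [:-a, 1:] ^ i) ` {..m})"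
  using assms
proof (induction m arbitrary: f)
  case 0
  then obtain c where "f = [:c:]" by (auto elim: degree_eq_zeroE)
  then have "f = smult c ([:-a, 1:] ^ 0)" by (simp add: pCons_one)
  then show ?case by (metis atMost_iff image_eqI le0 poly1.span_base poly1.span_scale)
next
  case (Suc m)
  define q where "q = synthetic_div f a"
  have f: "f = [:-a, 1:] * q + smult (poly f a) ([:-a, 1:] ^ 0)"
    unfolding q_def using synthetic_div_correct'[of a f] by (simp add: pCons_one)
  have "degree q \<le> m" using Suc(2) by (simp add: q_def degree_synthetic_div)
  then have "q \<in> poly1.span ((\<lambda>i. [:-a, 1:] ^ i) ` {..m})" by (rule Suc)
  then have "[:-a, 1:] * q \<in> poly1.span ((\<lambda>i. [:-a, 1:] ^ i) ` {..Suc m})"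
  proof (induction q rule: poly1.span_induct_alt)
    case base then show ?case using poly1.span_zero by simp
  next
    case (step c x y)
    then obtain i where "i \<le> m" "x = [:-a, 1:] ^ i" by auto
    then have "[:-a, 1:] * x \<in> (\<lambda>i. [:-a, 1:] ^ i) ` {..Suc m}"
      by (intro image_eqI[where x = "Suc i"]) auto
    then have "smult c ([:-a, 1:] * x) + [:-a, 1:] * y \<in> poly1.span ((\<lambda>i. [:-a, 1:] ^ i) ` {..Suc m})"
      using step by (blast intro: poly1.span_add poly1.span_scale poly1.span_base)
    then show ?case by (simp add: distrib_left)
  qed
  moreover have "smult (poly f a) ([:-a, 1:] ^ 0) \<in> poly1.span ((\<lambda>i. [:-a, 1:] ^ i) ` {..Suc m})"
    by (intro poly1.span_scale poly1.span_base image_eqI[where x = 0]) auto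
  ultimately show ?case by (subst f) (rule poly1.span_add)
qed

lemma shifted_powers_span_dvd:
  assumes "degree f \<le> m" "[:-a, 1:] ^ r dvd f"
  shows "f \<in> poly1.span ((\<lambda>i. [:-a, 1:] ^ i) ` {r..m})"
proof (cases "f = 0")
  case True then show ?thesis using poly1.span_zero by simp
next
  case False
  obtain q where q: "f = [:-a, 1:] ^ r * q" using assms(2) by (elim dvdE)
  with False have "degree f = r + degree q" by (simp add: degree_mult_eq degree_linear_power)
  then have rm: "r \<le> m" and "degree q \<le> m - r" using assms(1) by auto
  then have "q \<in> poly1.span ((\<lambda>i. [:-a, 1:] ^ i) ` {..m - r})" by (intro shifted_powers_span)
  then have "[:-a, 1:] ^ r * q \<in> poly1.span ((\<lambda>i. [:-a, 1:] ^ i) ` {r..m})"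
  proof (induction q rule: poly1.span_induct_alt)
    case base then show ?case using poly1.span_zero by simp
  next
    case (step c x y)
    then obtain i where i: "i \<le> m - r" "x = [:-a, 1:] ^ i" by auto
    then have "[:-a, 1:] ^ r * x \<in> (\<lambda>i. [:-a, 1:] ^ i) ` {r..m}"
      using rm by (intro image_eqI[where x = "r + i"]) (auto simp: power_add)
    then have "smult c ([:-a, 1:] ^ r * x) + [:-a, 1:] ^ r * y \<in> poly1.span ((\<lambda>i. [:-a, 1:] ^ i) ` {r..m})"
      using step by (blast intro: poly1.span_add poly1.span_scale poly1.span_base)
    then show ?case by (simp add: distrib_left)
  qed
  then show ?thesis using q by simp
qed

lemma tensor_span:
  assumes "f \<in> poly1.span F" "g \<in> poly1.span G"
  shows "tensor f g \<in> poly2.span ((\<lambda>(f, g). tensor f g) ` (F \<times> G))"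
  using assms(1)
proof (induction f rule: poly1.span_induct_alt)
  case base then show ?case by (simp add: tensor_simps poly2.span_zero)
next
  case (step c f f')
  have "tensor f g \<in> poly2.span ((\<lambda>(f, g). tensor f g) ` (F \<times> G))"
    using assms(2)
  proof (induction g rule: poly1.span_induct_alt)
    case base then show ?case by (simp add: tensor_simps poly2.span_zero)
  next
    case (step d g g')
    moreover have "tensor f g \<in> (\<lambda>(f, g). tensor f g) ` (F \<times> G)"
      using \<open>f \<in> F\<close> step by auto
    ultimately show ?case unfolding tensor_simps
      by (blast intro: poly2.span_add poly2.span_scale poly2.span_base)
  qed
  then show ?case using step by (auto simp: tensor_simps intro!: poly2.span_add poly2.span_scale)
qed

text \<open>The monomials shifted to the point \<open>(a, b)\<close>. At a vertex both line ideals
  are spanned by parts of this one basis, so that sums of ideals become unions of index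
  sets.\<close>

definition basis_elt :: "real \<Rightarrow> real \<Rightarrow> nat \<times> nat \<Rightarrow> real poly poly" where
  "basis_elt a b = (\<lambda>(i, j). tensor ([:-a, 1:] ^ i) ([:-b, 1:] ^ j))"

lemma basis_elt_bideg: "i \<le> m \<Longrightarrow> j \<le> m' \<Longrightarrow> basis_elt a b (i, j) \<in> bideg_le m m'"
  by (auto simp: basis_elt_def intro!: tensor_bideg_le simp: degree_linear_power)

lemma tensor_span_basis_elt:
  assumes "f \<in> poly1.span ((\<lambda>i. [:-a, 1:] ^ i) ` I)" "g \<in> poly1.span ((\<lambda>i. [:-b, 1:] ^ i) ` J)"
  shows "tensor f g \<in> poly2.span (basis_elt a b ` (I \<times> J))"
proof -
  have "(\<lambda>(f, g). tensor f g) ` ((\<lambda>i. [:-a, 1:] ^ i) ` I \<times> (\<lambda>i. [:-b, 1:] ^ i) ` J) = basis_elt a b ` (I \<times> J)"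
    by (auto simp: basis_elt_def image_iff)
  then show ?thesis using tensor_span[OF assms] by simp
qed

text \<open>\<open>b\<close> is free here, as is \<open>a\<close> in \<open>hideal_span\<close>: the
  ideal of a line can be described by the basis at any of its points, in particular at a
  crossing.\<close>

lemma videal_span: "videal m m' a r = poly2.span (basis_elt a b ` ({r..m} \<times> {..m'}))"
proof
  show "videal m m' a r \<subseteq> poly2.span (basis_elt a b ` ({r..m} \<times> {..m'}))"
  proof
    fix p assume p: "p \<in> videal m m' a r"
    have "tensor (coeff p j) (monom 1 j) \<in> poly2.span (basis_elt a b ` ({r..m} \<times> {..m'}))" if "j \<le> m'" for j
      using p that
      by (intro tensor_span_basis_elt shifted_powers_span shifted_powers_span_dvd)
         (auto simp: videal_def vdvd_iff bideg_le_def degree_monom_eq)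
    then show "p \<in> poly2.span (basis_elt a b ` ({r..m} \<times> {..m'}))"
      using p by (subst coeff_tensor_sum2[of p m m']) (auto simp: videal_def intro: poly2.span_sum)
  qed
  show "poly2.span (basis_elt a b ` ({r..m} \<times> {..m'})) \<subseteq> videal m m' a r"
  proof (intro poly2.span_minimal subspace_videal image_subsetI)
    fix z assume "z \<in> {r..m} \<times> {..m'}"
    moreover from this have "basis_elt a b z \<in> bideg_le m m'" by (auto intro: basis_elt_bideg)
    ultimately show "basis_elt a b z \<in> videal m m' a r"
      by (auto simp: videal_def vdvd_iff basis_elt_def intro!: dvd_smult le_imp_power_dvd)
  qed
qed

lemma hideal_span: "hideal m m' b r = poly2.span (basis_elt a b ` ({..m} \<times> {r..m'}))"
proof
  show "hideal m m' b r \<subseteq> poly2.span (basis_elt a b ` ({..m} \<times> {r..m'}))"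
  proof
    fix p assume p: "p \<in> hideal m m' b r"
    have "tensor (monom 1 i) (coeff1 p i) \<in> poly2.span (basis_elt a b ` ({..m} \<times> {r..m'}))" if "i \<le> m" for i
      using p that
      by (intro tensor_span_basis_elt shifted_powers_span shifted_powers_span_dvd)
         (auto simp: hideal_def degree_coeff1 degree_monom_eq intro: hdvd_imp)
    then show "p \<in> poly2.span (basis_elt a b ` ({..m} \<times> {r..m'}))"
      using p by (subst coeff_tensor_sum1[of p m m']) (auto simp: hideal_def intro: poly2.span_sum)
  qed
  have "tensor 1 [:-b, 1:] ^ r dvd basis_elt a b (i, j)" if "r \<le> j" for i j
  proof -
    have "basis_elt a b (i, j) = tensor 1 [:-b, 1:] ^ r * tensor ([:-a, 1:] ^ i) ([:-b, 1:] ^ (j - r))"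
      using that by (simp add: basis_elt_def tensor_power tensor_mult flip: power_add)
    then show ?thesis by simp
  qed
  then show "poly2.span (basis_elt a b ` ({..m} \<times> {r..m'})) \<subseteq> hideal m m' b r"
    using subspace_hideal
    by (intro poly2.span_minimal) (auto simp: hideal_def basis_elt_bideg)
qed

lemma bideg_le_span: "bideg_le m m' = poly2.span (basis_elt a b ` ({..m} \<times> {..m'}))"
  using videal_span[of m m' a 0 b] by (simp add: videal_def atLeast0AtMost)

text \<open>At the origin these are the monomials, whose independence is read off from the
  coefficients. This yields the dimension of \<open>bideg_le\<close>, from which independence at the
  other points follows by counting.\<close>

lemma basis_elt_0_independent:
  "poly2.independent (basis_elt 0 0 ` ({..m} \<times> {..m'}))" "inj_on (basis_elt 0 0) ({..m} \<times> {..m'})"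
proof -
  have c: "coeff (coeff (basis_elt 0 0 z) j) i = (if z = (i, j) then 1 else 0)" for z i j
  proof -
    have "[:0, 1::real:] ^ n = monom 1 n" for n by (metis monom_altdef smult_1_left)
    then show ?thesis by (cases z) (auto simp: basis_elt_def)
  qed
  show inj: "inj_on (basis_elt 0 0) ({..m} \<times> {..m'})"
  proof (rule inj_onI)
    fix z z' :: "nat \<times> nat" assume "basis_elt 0 0 z = basis_elt 0 0 z'"
    then show "z = z'" using c[of z "snd z'" "fst z'"] c[of z' "snd z'" "fst z'"] by (auto split: if_splits)
  qed
  show "poly2.independent (basis_elt 0 0 ` ({..m} \<times> {..m'}))"
  proof (rule poly2.independent_if_scalars_zero)
    fix f x assume 0: "(\<Sum>x\<in>basis_elt 0 0 ` ({..m} \<times> {..m'}). poly_scale (f x) x) = 0"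
      and "x \<in> basis_elt 0 0 ` ({..m} \<times> {..m'})"
    then obtain i j where ij: "i \<le> m" "j \<le> m'" "x = basis_elt 0 0 (i, j)" by auto
    have "0 = coeff (coeff (\<Sum>z\<in>{..m} \<times> {..m'}. poly_scale (f (basis_elt 0 0 z)) (basis_elt 0 0 z)) j) i"
      using 0 by (simp add: sum.reindex[OF inj])
    also have "\<dots> = (\<Sum>z\<in>{..m} \<times> {..m'}. if z = (i, j) then f (basis_elt 0 0 z) else 0)"
      unfolding coeff_sum by (rule sum.cong) (auto simp: c)
    also have "\<dots> = f x" using ij by simp
    finally show "f x = 0" by simp
  qed simp
qed

lemma dim_bideg_le: "poly2.dim (bideg_le m m') = (m + 1) * (m' + 1)"
  unfolding bideg_le_span[of m m' 0 0] poly2.dim_span_eq_card_independent[OF basis_elt_0_independent(1)]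
  by (simp add: card_image[OF basis_elt_0_independent(2)] card_cartesian_product)

lemma (in vector_space) independent_if_card_le_dim:
  assumes "finite B" "card B \<le> dim (span B)"
  shows "independent B"
proof -
  obtain C where C: "C \<subseteq> B" "independent C" "B \<subseteq> span C"
    using maximal_independent_subset by blast
  then have "span B = span C" using span_mono span_minimal by (metis subset_antisym subspace_span)
  then have "card B \<le> card C" using assms(2) dim_span_eq_card_independent[OF C(2)] by simp
  then have "C = B" using C(1) assms(1) by (meson card_seteq)
  then show ?thesis using C by simp
qed

lemma basis_elt_independent:
  "poly2.independent (basis_elt a b ` ({..m} \<times> {..m'}))" "inj_on (basis_elt a b) ({..m} \<times> {..m'})"
proof -
  let ?I = "{..m} \<times> {..m'}"
  have le: "card (basis_elt a b ` ?I) \<le> card ?I" by (intro card_image_le) simp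
  have d: "poly2.dim (poly2.span (basis_elt a b ` ?I)) = card ?I"
    using dim_bideg_le[of m m'] unfolding bideg_le_span[of m m' a b] by (simp add: card_cartesian_product)
  show 1: "poly2.independent (basis_elt a b ` ?I)"
    using le d by (intro poly2.independent_if_card_le_dim) auto
  show "inj_on (basis_elt a b) ?I"
    using d poly2.dim_span_eq_card_independent[OF 1] by (intro eq_card_imp_inj_on) auto
qed

lemma dim_span_basis_elt:
  assumes "J \<subseteq> {..m} \<times> {..m'}"
  shows "poly2.dim (poly2.span (basis_elt a b ` J)) = card J"
proof -
  have "poly2.independent (basis_elt a b ` J)"
    using basis_elt_independent(1) poly2.independent_mono image_mono[OF assms] by metis
  then show ?thesis
    using poly2.dim_span_eq_card_independent basis_elt_independent(2)[of a b m m'] assms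
    by (metis card_image inj_on_subset)
qed

lemma dim_videal: "poly2.dim (videal m m' a r) = (m + 1 - r) * (m' + 1)"
  unfolding videal_span[of m m' a r 0]
  by (subst dim_span_basis_elt[of _ m m']) (auto simp: card_cartesian_product)

lemma dim_hideal: "poly2.dim (hideal m m' b r) = (m + 1) * (m' + 1 - r)"
  unfolding hideal_span[of m m' b r 0]
  by (subst dim_span_basis_elt[of _ m m']) (auto simp: card_cartesian_product)

text \<open>Of the exponents in \<open>{..m} \<times> {..m'}\<close> the sum of the ideals misses
  exactly the box \<open>{..<r} \<times> {..<r'}\<close>; the bounds on \<open>r\<close> and
  \<open>r'\<close> keep this box inside.\<close>

lemma dim_ideal_sum:
  assumes "r \<le> m + 1" "r' \<le> m' + 1"
  shows "poly2.dim {p + q | p q. p \<in> videal m m' a r \<and> q \<in> hideal m m' b r'} = (m + 1) * (m' + 1) - r * r'"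
proof -
  have "{p + q | p q. p \<in> videal m m' a r \<and> q \<in> hideal m m' b r'} =
      poly2.span (basis_elt a b ` ({r..m} \<times> {..m'} \<union> {..m} \<times> {r'..m'}))"
    unfolding image_Un poly2.span_Un videal_span[of m m' a r b] hideal_span[of m m' b r' a] by auto
  also have "poly2.dim \<dots> = card ({r..m} \<times> {..m'} \<union> {..m} \<times> {r'..m'})"
    by (rule dim_span_basis_elt[of _ m m']) auto
  also have "{r..m} \<times> {..m'} \<union> {..m} \<times> {r'..m'} = {..m} \<times> {..m'} - {..<r} \<times> {..<r'}" by auto
  also have "card \<dots> = (m + 1) * (m' + 1) - r * r'"
    using assms by (subst card_Diff_subset) (auto simp: card_cartesian_product)
  finally show ?thesis .
qed

lemma finitely_spanned_bideg_le: "finitely_spanned poly_scale (bideg_le m m')"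
  unfolding finitely_spanned_def bideg_le_span[of m m' 0 0]
  by (intro exI[of _ "basis_elt 0 0 ` ({..m} \<times> {..m'})"]) auto

section \<open>Univariate polynomials\<close>

text \<open>A functional \<open>g\<close> vanishing on \<open>U\<close> yields the polynomial \<open>a \<mapsto> g ((s - a)^m)\<close> of degree at most
  \<open>m\<close>, whose Taylor coefficients at \<open>a\<close> are the values of \<open>g\<close> on the powers of \<open>s - a\<close>.  So it has
  more than \<open>m\<close> zeros, and \<open>g = 0\<close>.\<close>

lemma shifted_powers_generate:
  fixes I :: "real set" and d :: "real \<Rightarrow> nat"
  assumes I: "finite I" and d: "m + 1 \<le> sum d I"
    and U: "poly1.subspace U"
    and pow: "\<And>a k. a \<in> I \<Longrightarrow> k \<le> m \<Longrightarrow> m < k + d a \<Longrightarrow> [:-a, 1:] ^ k \<in> U"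
    and f: "degree f \<le> m"
  shows "f \<in> U"
proof (rule ccontr)
  assume nf: "f \<notin> U"
  interpret vp: vector_space_pair "smult :: real \<Rightarrow> real poly \<Rightarrow> real poly" "(*) :: real \<Rightarrow> real \<Rightarrow> real"
    by unfold_locales (auto simp: algebra_simps)
  \<comment> \<open>If \<open>f\<close> is outside \<open>U\<close>, some linear functional is 0 on
    \<open>U\<close> and 1 at \<open>f\<close>; it is obtained by extension from an independent
    set.\<close>
  obtain B where B: "B \<subseteq> U" "poly1.independent B" "U \<subseteq> poly1.span B"
    using poly1.maximal_independent_subset by blast
  have "f \<notin> poly1.span B" using nf B(1) U poly1.span_minimal by blast
  then have ind: "poly1.independent (insert f B)" using B(2) by (rule poly1.independent_insertI)
  obtain g where g: "Vector_Spaces.linear smult (*) g"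
    and gB: "\<forall>x\<in>insert f B. g x = (if x = f then 1 else 0 :: real)"
    using vp.linear_independent_extend[OF ind, of "\<lambda>x. if x = f then 1 else 0"] by auto
  have gU: "g x = 0" if "x \<in> U" for x
  proof (rule vp.linear_eq_0_on_span[OF g])
    show "x \<in> poly1.span B" using that B by blast
    show "g y = 0" if "y \<in> B" for y using that gB nf B(1) by auto
  qed
  \<comment> \<open>The binomial expansion of \<open>g ((s - (a + x))^m)\<close> in powers of
    \<open>x\<close>. So every \<open>\<psi> a\<close> is a shift of \<open>\<psi> 0\<close>, and a
    zero of \<open>\<psi> a\<close> at 0 is a zero of \<open>\<psi> 0\<close> at
    \<open>a\<close>.\<close>
  define \<psi> where "\<psi> a = (\<Sum>k\<le>m. monom (real (m choose k) * (-1) ^ k * g ([:-a, 1:] ^ (m - k))) k)" for a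
  have poly_\<psi>: "poly (\<psi> a) x = g ([:-(a + x), 1:] ^ m)" for a x
  proof -
    have "[:-(a + x), 1:] ^ m = ([:-x:] + [:-a, 1:]) ^ m" by (simp add: algebra_simps)
    also have "\<dots> = (\<Sum>k\<le>m. smult (real (m choose k) * (- x) ^ k) ([:-a, 1:] ^ (m - k)))"
      unfolding binomial_ring
      by (intro sum.cong refl) (simp add: poly_const_pow of_nat_poly)
    finally have *: "[:-(a + x), 1:] ^ m = (\<Sum>k\<le>m. smult (real (m choose k) * (- x) ^ k) ([:-a, 1:] ^ (m - k)))" .
    have "g ([:-(a + x), 1:] ^ m) = (\<Sum>k\<le>m. real (m choose k) * (- x) ^ k * g ([:-a, 1:] ^ (m - k)))"
      unfolding * vp.linear_sum[OF g] vp.linear_scale[OF g] ..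
    also have "\<dots> = poly (\<psi> a) x"
      unfolding \<psi>_def poly_sum poly_monom by (intro sum.cong refl) (simp add: power_minus[of x])
    finally show ?thesis ..
  qed
  have coeff_\<psi>: "coeff (\<psi> a) k = (if k \<le> m then real (m choose k) * (-1) ^ k * g ([:-a, 1:] ^ (m - k)) else 0)" for a k
    by (simp add: \<psi>_def coeff_sum)
  have dvd: "[:-a, 1:] ^ d a dvd \<psi> 0" if a: "a \<in> I" for a
  proof -
    \<comment> \<open>For \<open>k \<le> m\<close> this coefficient is a multiple of the value of
      \<open>g\<close> at the power with exponent \<open>m - k\<close>, and \<open>k < d a\<close>
      is the condition of \<open>pow\<close> for that exponent.\<close>
    have "coeff (\<psi> a) k = 0" if "k < d a" for k
      using that gU pow[OF a, of "m - k"] by (auto simp: coeff_\<psi>)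
    then have "monom 1 (d a) dvd \<psi> a" by (simp add: monom_1_dvd_iff')
    then obtain q where q: "\<psi> a = monom 1 (d a) * q" by (elim dvdE)
    have "poly (\<psi> 0) x = poly ([:-a, 1:] ^ d a * pcompose q [:-a, 1:]) x" for x
    proof -
      have "poly (\<psi> 0) x = poly (\<psi> a) (x - a)" by (simp add: poly_\<psi>)
      then show ?thesis by (simp add: q poly_monom poly_pcompose)
    qed
    then have "\<psi> 0 = [:-a, 1:] ^ d a * pcompose q [:-a, 1:]"
      by (subst poly_eq_poly_eq_iff[symmetric]) auto
    then show ?thesis by simp
  qed
  have "\<psi> 0 = 0"
  proof (rule ccontr)
    assume nz: "\<psi> 0 \<noteq> 0"
    have "sum d I \<le> (\<Sum>a\<in>I. order a (\<psi> 0))"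
      using dvd nz by (intro sum_mono) (simp add: order_divides)
    also have "\<dots> = (\<Sum>a\<in>I. count (proots (\<psi> 0)) a)" using nz by simp
    also have "\<dots> = (\<Sum>a\<in>I \<inter> set_mset (proots (\<psi> 0)). count (proots (\<psi> 0)) a)"
      using I by (intro sum.mono_neutral_right) (auto simp: not_in_iff)
    also have "\<dots> \<le> (\<Sum>a\<in>set_mset (proots (\<psi> 0)). count (proots (\<psi> 0)) a)"
      by (intro sum_mono2) auto
    also have "\<dots> \<le> degree (\<psi> 0)" using size_proots_le by (simp add: size_multiset_overloaded_eq)
    also have "\<dots> \<le> m" by (rule degree_le) (simp add: coeff_\<psi>)
    finally show False using d by simp
  qed
  \<comment> \<open>The coefficients of \<open>\<psi> 0\<close> are nonzero multiples of the values
    of \<open>g\<close> on the monomials, since the binomial coefficients do not vanish.\<close>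
  have "g (monom 1 j) = 0" if "j \<le> m" for j
  proof -
    have "coeff (\<psi> 0) (m - j) = 0" using \<open>\<psi> 0 = 0\<close> by simp
    moreover have "[:0, 1::real:] ^ j = monom 1 j" by (metis monom_altdef smult_1_left)
    ultimately show ?thesis using that by (auto simp: coeff_\<psi>)
  qed
  moreover have "f = (\<Sum>j\<le>degree f. smult (coeff f j) (monom 1 j))"
    by (subst poly_as_sum_of_monoms[symmetric]) (simp add: smult_monom)
  then have "g f = (\<Sum>j\<le>degree f. coeff f j * g (monom 1 j))"
    using vp.linear_sum[OF g] vp.linear_scale[OF g] by (metis (no_types, lifting) sum.cong)
  ultimately have "g f = 0" using f by simp
  then show False using gB by simp
qed

text \<open>Modulo \<open>L\<close> the sum stays polynomial in \<open>y\<close>, and each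
  coefficient of its remainder is a real polynomial in \<open>y\<close> with infinitely many zeros.
  This is how smoothness at the points of an edge becomes divisibility in two variables.\<close>

lemma dvd_coeffs_if_dvd_values:
  fixes L :: "real poly" and c :: "nat \<Rightarrow> real poly"
  assumes "infinite Y" "\<And>y. y \<in> Y \<Longrightarrow> L dvd (\<Sum>j\<le>N. smult (y ^ j) (c j))" "j \<le> N"
  shows "L dvd c j"
proof -
  have "coeff (c j mod L) i = 0" for i
  proof -
    define R where "R = (\<Sum>j\<le>N. monom (coeff (c j mod L) i) j)"
    have "poly R y = 0" if "y \<in> Y" for y
    proof -
      have "(\<Sum>j\<le>N. smult (y ^ j) (c j)) mod L = (\<Sum>j\<le>N. smult (y ^ j) (c j mod L))"
        by (induction N) (simp_all add: poly_mod_add_left mod_smult_left)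
      then have "(\<Sum>j\<le>N. smult (y ^ j) (c j mod L)) = 0" using assms(2)[OF that] by auto
      then have "coeff (\<Sum>j\<le>N. smult (y ^ j) (c j mod L)) i = 0" by simp
      then show ?thesis by (simp add: R_def poly_sum poly_monom coeff_sum mult.commute)
    qed
    then have "R = 0" using assms(1) poly_roots_finite[of R] finite_subset[of Y "{y. poly R y = 0}"] by blast
    then have "coeff R j = 0" by simp
    then show ?thesis using assms(3) by (simp add: R_def coeff_sum)
  qed
  then have "c j mod L = 0" by (intro poly_eqI) simp
  then show ?thesis by auto
qed

section \<open>Order of contact of two glued polynomials\<close>

lemma shifted_power_dvd_iff_pderiv:
  fixes p :: "real poly"
  shows "[:-a, 1:] ^ n dvd p \<longleftrightarrow> (\<forall>i<n. poly ((pderiv ^^ i) p) a = 0)"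
proof (induction n arbitrary: p)
  case (Suc n)
  have "[:-a, 1:] ^ Suc n dvd p \<longleftrightarrow> poly p a = 0 \<and> [:-a, 1:] ^ n dvd pderiv p"
  proof (cases "p = 0")
    case False
    note nz = False
    show ?thesis
    proof (cases "poly p a = 0")
      case True
      have pd: "pderiv p \<noteq> 0"
      proof
        assume "pderiv p = 0"
        then obtain c where "p = [:c:]" by (metis pderiv_eq_0_iff degree_eq_zeroE)
        then show False using True nz by simp
      qed
      \<comment> \<open>In characteristic zero, differentiation lowers the order of a root by
        exactly one.\<close>
      have "order a p = Suc (order a (pderiv p))" using nz True by (rule order_pderiv)
      then show ?thesis using True nz pd unfolding order_divides by auto
    next
      case False
      then show ?thesis by (metis dvd_power_same dvd_trans dvd_triv_left poly_eq_0_iff_dvd power_Suc)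
    qed
  qed auto
  also have "\<dots> \<longleftrightarrow> poly p a = 0 \<and> (\<forall>i<n. poly ((pderiv ^^ Suc i) p) a = 0)"
    unfolding Suc by (simp add: funpow_swap1)
  also have "\<dots> \<longleftrightarrow> (\<forall>i<Suc n. poly ((pderiv ^^ i) p) a = 0)"
    by (auto simp: less_Suc_eq_0_disj simp del: funpow.simps(2))
  finally show ?case .
qed simp

definition glue :: "real \<Rightarrow> real poly \<Rightarrow> real poly \<Rightarrow> real \<Rightarrow> real" where
  "glue a p q = (\<lambda>y. if y \<le> a then poly p y else poly q y)"

lemma glue_has_left_derivative:
  "(glue a p q has_field_derivative poly (pderiv p) a) (at a within {..a})"
  by (rule has_field_derivative_transform_within[OF has_field_derivative_at_within[OF poly_DERIV], where d = 1]) (auto simp: glue_def)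

lemma glue_has_right_derivative:
  assumes "poly p a = poly q a"
  shows "(glue a p q has_field_derivative poly (pderiv q) a) (at a within {a..})"
  by (rule has_field_derivative_transform_within[OF has_field_derivative_at_within[OF poly_DERIV], where d = 1])
     (use assms in \<open>auto simp: glue_def\<close>)

lemma glue_derivative:
  assumes "poly p a = poly q a" "poly (pderiv p) a = poly (pderiv q) a"
  shows "(glue a p q has_field_derivative glue a (pderiv p) (pderiv q) y) (at y)"
proof -
  consider "y < a" | "y = a" | "y > a" by linarith
  then show ?thesis
  proof cases
    case 1
    have "(poly p has_field_derivative poly (pderiv p) y) (at y)" by (rule poly_DERIV)
    then have "(glue a p q has_field_derivative poly (pderiv p) y) (at y)"
      by (rule has_field_derivative_transform_within_open[where S = "{..<a}"]) (use 1 in \<open>auto simp: glue_def\<close>)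
    then show ?thesis using 1 by (simp add: glue_def)
  next
    case 2
    have "(glue a p q has_field_derivative poly (pderiv p) a) (at a within {..a} \<union> {a..})"
      using glue_has_left_derivative[of a p q] glue_has_right_derivative[OF assms(1)] assms(2)
      unfolding has_field_derivative_iff by (intro Lim_Un) auto
    moreover have "{..a} \<union> {a..} = UNIV" by auto
    ultimately show ?thesis using 2 by (simp add: glue_def)
  next
    case 3
    have "(poly q has_field_derivative poly (pderiv q) y) (at y)" by (rule poly_DERIV)
    then have "(glue a p q has_field_derivative poly (pderiv q) y) (at y)"
      by (rule has_field_derivative_transform_within_open[where S = "{a<..}"]) (use 3 in \<open>auto simp: glue_def\<close>)
    then show ?thesis using 3 by (simp add: glue_def)
  qed
qed

lemma glue_differentiable_imp:
  assumes "glue a p q differentiable at a" "poly p a = poly q a"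
  shows "poly (pderiv p) a = poly (pderiv q) a"
proof -
  obtain D where D: "(glue a p q has_field_derivative D) (at a)"
    using assms(1) by (metis real_differentiable_def)
  have "D = E" if "(glue a p q has_field_derivative E) (at a within S)" "at a within S \<noteq> bot" for E S
    using that tendsto_unique[OF that(2)] DERIV_subset[OF D, of S] unfolding has_field_derivative_iff by auto
  from this[OF DERIV_subset[OF glue_has_left_derivative], of "{..<a}"]
    this[OF DERIV_subset[OF glue_has_right_derivative[OF assms(2)]], of "{a<..}"]
  moreover have "{..<a} \<subseteq> {..a}" "{a<..} \<subseteq> {a..}" by auto
  ultimately show ?thesis using trivial_limit_at_left_real[of a] trivial_limit_at_right_real[of a] by auto
qed

text \<open>\<open>deriv\<close> depends only on nearby values, so on the open ball \<open>g\<close>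
  may be replaced by the glued function; agreement of the next derivatives at \<open>a\<close> keeps
  the result of the same form.\<close>

lemma higher_deriv_glue:
  assumes g: "\<And>y. y \<in> ball a e \<Longrightarrow> g y = glue a p q y"
    and eq: "\<And>k. k \<le> i \<Longrightarrow> poly ((pderiv ^^ k) p) a = poly ((pderiv ^^ k) q) a"
    and y: "y \<in> ball a e"
  shows "(deriv ^^ i) g y = glue a ((pderiv ^^ i) p) ((pderiv ^^ i) q) y"
  using eq y
proof (induction i arbitrary: y)
  case (Suc i)
  have "(glue a ((pderiv ^^ i) p) ((pderiv ^^ i) q) has_field_derivative
      glue a ((pderiv ^^ Suc i) p) ((pderiv ^^ Suc i) q) y) (at y)"
    using Suc.prems(1)[of i] Suc.prems(1)[of "Suc i"] by (auto intro: glue_derivative)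
  then have "((deriv ^^ i) g has_field_derivative glue a ((pderiv ^^ Suc i) p) ((pderiv ^^ Suc i) q) y) (at y)"
    by (rule has_field_derivative_transform_within_open[OF _ open_ball Suc.prems(2)]) (use Suc in auto)
  then show ?case by (simp add: DERIV_imp_deriv)
qed (simp add: g)

lemma higher_pderiv_diff_real: "(pderiv ^^ i) (p - q) = (pderiv ^^ i) p - (pderiv ^^ i) q"
  for p q :: "real poly"
  by (induction i) (simp_all add: pderiv_diff)

text \<open>As long as the derivatives up to order \<open>i\<close> agree at \<open>a\<close>, the
  \<open>i\<close>-th derivative of \<open>g\<close> is again a glued function, and it is
  differentiable at \<open>a\<close> precisely if the derivatives of order \<open>i + 1\<close>
  agree too. Hence class \<open>r\<close> means agreement in the orders 0 to \<open>r\<close>, which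
  is divisibility by the power \<open>r + 1\<close>.\<close>

lemma class_C_at_glue_iff:
  assumes e: "e > 0" and g: "\<And>y. y \<in> ball a e \<Longrightarrow> g y = glue a p q y" and pq: "poly p a = poly q a"
  shows "class_C_at r g a \<longleftrightarrow> [:-a, 1:] ^ (r + 1) dvd q - p"
proof -
  define eq where "eq i \<longleftrightarrow> poly ((pderiv ^^ i) p) a = poly ((pderiv ^^ i) q) a" for i
  have "class_C_at r g a \<longleftrightarrow> (\<forall>i\<le>r. eq i)"
  proof
    assume "class_C_at r g a"
    then have diff: "(deriv ^^ i) g differentiable at a" if "i < r" for i
      using that by (auto simp: class_C_at_def)
    have "i \<le> r \<Longrightarrow> \<forall>k\<le>i. eq k" for i
    proof (induction i)
      case (Suc i)
      then have IH: "\<forall>k\<le>i. eq k" by simp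
      then have "(deriv ^^ i) g y = glue a ((pderiv ^^ i) p) ((pderiv ^^ i) q) y" if "y \<in> ball a e" for y
        using higher_deriv_glue[OF g] that by (simp add: eq_def)
      moreover obtain D where "((deriv ^^ i) g has_field_derivative D) (at a)"
        using diff[of i] Suc.prems by (auto simp: real_differentiable_def)
      ultimately have "(glue a ((pderiv ^^ i) p) ((pderiv ^^ i) q) has_field_derivative D) (at a)"
        using e by (auto intro: has_field_derivative_transform_within_open[where S = "ball a e"])
      then have "eq (Suc i)"
        using glue_differentiable_imp[of a "(pderiv ^^ i) p" "(pderiv ^^ i) q"] IH
        by (auto simp: eq_def real_differentiable_def)
      then show ?case using IH le_Suc_eq by auto
    qed (simp add: eq_def pq)
    then show "\<forall>i\<le>r. eq i" by blast
  next
    assume eq: "\<forall>i\<le>r. eq i"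
    have d: "(deriv ^^ i) g y = glue a ((pderiv ^^ i) p) ((pderiv ^^ i) q) y" if "i \<le> r" "y \<in> ball a e" for i y
      using higher_deriv_glue[OF g, where i = i and y = y] that eq by (simp add: eq_def)
    have "(deriv ^^ i) g differentiable at y" if "i < r" "y \<in> ball a e" for i y
    proof -
      have "(glue a ((pderiv ^^ i) p) ((pderiv ^^ i) q) has_field_derivative
        glue a ((pderiv ^^ Suc i) p) ((pderiv ^^ Suc i) q) y) (at y)"
        using eq[rule_format, of i] eq[rule_format, of "Suc i"] that by (auto simp: eq_def intro: glue_derivative)
      then have "((deriv ^^ i) g has_field_derivative glue a ((pderiv ^^ Suc i) p) ((pderiv ^^ Suc i) q) y) (at y)"
        by (rule has_field_derivative_transform_within_open[OF _ open_ball that(2)]) (use d that in auto)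
      then show ?thesis by (auto simp: real_differentiable_def)
    qed
    moreover have "continuous_on (ball a e) (glue a ((pderiv ^^ r) p) ((pderiv ^^ r) q))"
      unfolding glue_def using eq
      by (intro continuous_on_cases_le continuous_intros) (auto simp: eq_def)
    then have "continuous_on (ball a e) ((deriv ^^ r) g)"
      by (rule continuous_on_eq) (use d[of r] in simp)
    ultimately show "class_C_at r g a" using e by (auto simp: class_C_at_def)
  qed
  also have "\<dots> \<longleftrightarrow> [:-a, 1:] ^ (r + 1) dvd q - p"
    unfolding shifted_power_dvd_iff_pderiv higher_pderiv_diff_real by (auto simp: eq_def less_Suc_eq_le)
  finally show ?thesis .
qed

section \<open>Lines of a T-mesh\<close>

text \<open>A finite set has no limit points. The lemma disposes of the finitely many points where a
  horizontal segment is crossed by vertical ones.\<close>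

lemma Icc_subset_closed_if_subset_Un_finite:
  fixes u v :: real
  assumes "u < v" "{u..v} \<subseteq> K \<union> F" "closed K" "finite F"
  shows "{u..v} \<subseteq> K"
proof
  fix x assume x: "x \<in> {u..v}"
  have "x islimpt {u..v}" using x assms(1) by (simp add: connected_imp_perfect)
  then have "x islimpt F \<union> K" using assms(2) islimpt_subset by blast
  then have "x islimpt K" using islimpt_Un_finite[OF assms(4)] by blast
  then show "x \<in> K" using assms(3) closed_limpt by blast
qed

lemma is_tmeshD:
  assumes "is_tmesh M"
  shows "finite (cells M)" "\<And>\<sigma>. \<sigma> \<in> cells M \<Longrightarrow> rectangle \<sigma>" "finite (edges M)"
    "\<And>\<tau>. \<tau> \<in> edges M \<Longrightarrow> horizontal \<tau> \<or> vertical \<tau>"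
    "\<And>\<tau>. \<tau> \<in> edges M \<Longrightarrow> \<tau> \<subseteq> (\<Union>\<sigma>\<in>cells M. frontier \<sigma>)"
    "\<And>\<sigma>. \<sigma> \<in> cells M \<Longrightarrow> \<exists>F\<subseteq>edges M. frontier \<sigma> = \<Union>F"
    "\<And>\<sigma> \<sigma>'. \<sigma> \<in> cells M \<Longrightarrow> \<sigma>' \<in> cells M \<Longrightarrow> \<sigma> \<noteq> \<sigma>' \<Longrightarrow> \<sigma> \<inter> \<sigma>' = frontier \<sigma> \<inter> frontier \<sigma>'"
    "\<And>\<sigma> \<sigma>'. \<sigma> \<in> cells M \<Longrightarrow> \<sigma>' \<in> cells M \<Longrightarrow> \<sigma> \<noteq> \<sigma>' \<Longrightarrow>
      \<exists>F\<subseteq>edges M. \<exists>G\<subseteq>vertices M. \<sigma> \<inter> \<sigma>' = \<Union>F \<union> G"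
    "\<And>\<tau> \<tau>'. \<tau> \<in> edges M \<Longrightarrow> \<tau>' \<in> edges M \<Longrightarrow> \<tau> \<noteq> \<tau>' \<Longrightarrow> \<tau> \<inter> \<tau>' = rel_frontier \<tau> \<inter> rel_frontier \<tau>'"
    "\<And>\<tau> \<tau>'. \<tau> \<in> edges M \<Longrightarrow> \<tau>' \<in> edges M \<Longrightarrow> \<tau> \<noteq> \<tau>' \<Longrightarrow> \<tau> \<inter> \<tau>' \<subseteq> vertices M"
    "\<And>\<gamma>. \<gamma> \<in> vertices M \<Longrightarrow> \<exists>\<tau>\<in>edges M. horizontal \<tau> \<and> \<gamma> \<in> \<tau>"
    "\<And>\<gamma>. \<gamma> \<in> vertices M \<Longrightarrow> \<exists>\<tau>\<in>edges M. vertical \<tau> \<and> \<gamma> \<in> \<tau>"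
proof -
  have c: "\<forall>\<sigma>\<in>cells M. \<forall>\<sigma>'\<in>cells M. \<sigma> \<noteq> \<sigma>' \<longrightarrow>
        \<sigma> \<inter> \<sigma>' = frontier \<sigma> \<inter> frontier \<sigma>' \<and>
        (\<exists>F\<subseteq>edges M. \<exists>G\<subseteq>vertices M. \<sigma> \<inter> \<sigma>' = \<Union>F \<union> G)"
    and e: "\<forall>\<tau>\<in>edges M. \<forall>\<tau>'\<in>edges M. \<tau> \<noteq> \<tau>' \<longrightarrow>
        \<tau> \<inter> \<tau>' = rel_frontier \<tau> \<inter> rel_frontier \<tau>' \<and> \<tau> \<inter> \<tau>' \<subseteq> vertices M"
    using assms unfolding is_tmesh_def by - (elim conjE, assumption)+
  show "\<And>\<sigma> \<sigma>'. \<sigma> \<in> cells M \<Longrightarrow> \<sigma>' \<in> cells M \<Longrightarrow> \<sigma> \<noteq> \<sigma>' \<Longrightarrow> \<sigma> \<inter> \<sigma>' = frontier \<sigma> \<inter> frontier \<sigma>'"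
    "\<And>\<sigma> \<sigma>'. \<sigma> \<in> cells M \<Longrightarrow> \<sigma>' \<in> cells M \<Longrightarrow> \<sigma> \<noteq> \<sigma>' \<Longrightarrow>
      \<exists>F\<subseteq>edges M. \<exists>G\<subseteq>vertices M. \<sigma> \<inter> \<sigma>' = \<Union>F \<union> G"
    by (rule c[rule_format, THEN conjunct1] c[rule_format, THEN conjunct2]; assumption)+
  show "\<And>\<tau> \<tau>'. \<tau> \<in> edges M \<Longrightarrow> \<tau>' \<in> edges M \<Longrightarrow> \<tau> \<noteq> \<tau>' \<Longrightarrow> \<tau> \<inter> \<tau>' = rel_frontier \<tau> \<inter> rel_frontier \<tau>'"
    "\<And>\<tau> \<tau>'. \<tau> \<in> edges M \<Longrightarrow> \<tau>' \<in> edges M \<Longrightarrow> \<tau> \<noteq> \<tau>' \<Longrightarrow> \<tau> \<inter> \<tau>' \<subseteq> vertices M"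
    by (rule e[rule_format, THEN conjunct1] e[rule_format, THEN conjunct2]; assumption)+
qed (use assms in \<open>simp_all add: is_tmesh_def\<close>)

section \<open>Exchange of the two coordinates\<close>

abbreviation flip :: "point set \<Rightarrow> point set" where
  "flip \<equiv> image prod.swap"

lemma flip_flip [simp]: "flip (flip \<sigma>) = \<sigma>"
  by (simp add: image_image)

lemma flip_eq_iff [simp]: "flip \<sigma> = flip \<sigma>' \<longleftrightarrow> \<sigma> = \<sigma>'"
  by (metis flip_flip)

lemma flip_subset_iff [simp]: "flip \<sigma> \<subseteq> flip \<sigma>' \<longleftrightarrow> \<sigma> \<subseteq> \<sigma>'"
  by (metis flip_flip image_mono)

lemma swap_in_flip [simp]: "prod.swap z \<in> flip \<sigma> \<longleftrightarrow> z \<in> \<sigma>"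
  by (metis flip_flip image_eqI swap_swap)

lemma in_flip: "z \<in> flip \<sigma> \<longleftrightarrow> prod.swap z \<in> \<sigma>"
  by (metis swap_in_flip swap_swap)

lemma pair_in_flip [simp]: "(x, y) \<in> flip \<sigma> \<longleftrightarrow> (y, x) \<in> \<sigma>"
  by (simp add: in_flip)

lemma flip_Int: "flip (\<sigma> \<inter> \<sigma>') = flip \<sigma> \<inter> flip \<sigma>'"
  by (auto simp: in_flip)

lemma flip_Diff: "flip (\<sigma> - \<sigma>') = flip \<sigma> - flip \<sigma>'"
  by (auto simp: in_flip)

lemma flip_times [simp]: "flip (A \<times> B) = B \<times> A"
  by (rule product_swap)

lemma linear_swap: "linear (prod.swap :: point \<Rightarrow> point)"
  by unfold_locales auto

lemma interior_flip: "interior (flip \<sigma>) = flip (interior \<sigma>)"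
  by (rule interior_injective_linear_image[OF linear_swap inj_swap])

lemma frontier_flip: "frontier (flip \<sigma>) = flip (frontier \<sigma>)"
  unfolding frontier_def interior_flip flip_Diff closure_injective_linear_image[OF linear_swap inj_swap] ..

lemma rel_frontier_flip: "rel_frontier (flip \<sigma>) = flip (rel_frontier \<sigma>)"
  unfolding rel_frontier_def flip_Diff closure_injective_linear_image[OF linear_swap inj_swap]
    rel_interior_injective_linear_image[OF linear_swap[unfolded linear_conv_bounded_linear] inj_swap] ..

lemma rectangle_flip [simp]: "rectangle (flip \<sigma>) \<longleftrightarrow> rectangle \<sigma>"
proof -
  have "rectangle \<sigma> \<Longrightarrow> rectangle (flip \<sigma>)" for \<sigma> unfolding rectangle_def by (metis flip_times)
  then show ?thesis by (metis flip_flip)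
qed

lemma horizontal_flip [simp]: "horizontal (flip \<tau>) \<longleftrightarrow> vertical \<tau>"
  and vertical_flip [simp]: "vertical (flip \<tau>) \<longleftrightarrow> horizontal \<tau>"
proof -
  have "vertical \<tau> \<Longrightarrow> horizontal (flip \<tau>)" for \<tau> unfolding vertical_def horizontal_def by (metis flip_times)
  moreover have "horizontal \<tau> \<Longrightarrow> vertical (flip \<tau>)" for \<tau> unfolding vertical_def horizontal_def by (metis flip_times)
  ultimately show "horizontal (flip \<tau>) \<longleftrightarrow> vertical \<tau>" "vertical (flip \<tau>) \<longleftrightarrow> horizontal \<tau>" by (metis flip_flip)+
qed

definition transpose_mesh :: "tmesh \<Rightarrow> tmesh" where
  "transpose_mesh M = \<lparr>cells = flip ` cells M, edges = flip ` edges M\<rparr>"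

lemma transpose_mesh_simps [simp]:
  "cells (transpose_mesh M) = flip ` cells M" "edges (transpose_mesh M) = flip ` edges M"
  by (simp_all add: transpose_mesh_def)

lemma inj_flip: "inj flip"
  by (rule injI) simp

lemma flip_in_flip_image [simp]: "flip \<sigma> \<in> flip ` S \<longleftrightarrow> \<sigma> \<in> S"
  by (rule inj_image_mem_iff[OF inj_flip])

lemma transpose_transpose_mesh [simp]: "transpose_mesh (transpose_mesh M) = M"
  by (cases M) (simp add: transpose_mesh_def image_image)

lemma vertices_transpose [simp]: "vertices (transpose_mesh M) = flip (vertices M)"
  by (simp add: vertices_def rel_frontier_flip image_UN)

lemma domain_transpose [simp]: "domain (transpose_mesh M) = flip (domain M)"
  by (simp add: domain_def image_Union)

lemma is_tmesh_transpose_imp: assumes "is_tmesh M" shows "is_tmesh (transpose_mesh M)"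
proof -
  have sub: "\<exists>F\<subseteq>flip ` E. P F" if "\<exists>F\<subseteq>E. P (flip ` F)" for P E
    using that by (metis image_mono)
  have sub': "\<exists>G\<subseteq>flip V. P G" if "\<exists>G\<subseteq>V. P (flip G)" for P V
    using that by (metis image_mono)
  have Un: "\<Union> (flip ` F) = flip (\<Union> F)" for F by (simp add: image_Union)
  note M = is_tmeshD[OF assms]
  have 1: "\<forall>\<tau>\<in>edges M. (vertical \<tau> \<or> horizontal \<tau>) \<and> flip \<tau> \<subseteq> flip (\<Union>\<sigma>\<in>cells M. frontier \<sigma>)"
    unfolding flip_subset_iff using M(4,5) by blast
  have 2: "\<forall>\<sigma>\<in>cells M. \<exists>F\<subseteq>edges M. flip (frontier \<sigma>) = flip (\<Union>F)" unfolding flip_eq_iff using M(6) by (intro ballI)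
  have 5: "\<forall>\<gamma>\<in>vertices M. (\<exists>\<tau>\<in>edges M. vertical \<tau> \<and> \<gamma> \<in> \<tau>) \<and>
                      (\<exists>\<tau>\<in>edges M. horizontal \<tau> \<and> \<gamma> \<in> \<tau>)" using M(11,12) by blast
  show ?thesis
    unfolding is_tmesh_def transpose_mesh_simps vertices_transpose ball_simps bex_simps
      rectangle_flip horizontal_flip vertical_flip swap_in_flip
  proof (intro conjI)
    show "\<forall>\<sigma>\<in>cells M. \<exists>F\<subseteq>flip ` edges M. frontier (flip \<sigma>) = \<Union> F"
      using 2 unfolding frontier_flip by (intro ballI sub) (simp add: Un)
    show "\<forall>\<sigma>\<in>cells M. \<forall>\<sigma>'\<in>cells M. flip \<sigma> \<noteq> flip \<sigma>' \<longrightarrow>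
      flip \<sigma> \<inter> flip \<sigma>' = frontier (flip \<sigma>) \<inter> frontier (flip \<sigma>') \<and>
      (\<exists>F\<subseteq>flip ` edges M. \<exists>G\<subseteq>flip (vertices M). flip \<sigma> \<inter> flip \<sigma>' = \<Union> F \<union> G)"
    proof (intro ballI impI conjI sub sub')
      fix \<sigma> \<sigma>' assume *: "\<sigma> \<in> cells M" "\<sigma>' \<in> cells M" "flip \<sigma> \<noteq> flip \<sigma>'"
      then have ne: "\<sigma> \<noteq> \<sigma>'" by blast
      have "flip (\<sigma> \<inter> \<sigma>') = flip (frontier \<sigma> \<inter> frontier \<sigma>')" using M(7)[OF *(1,2) ne] by (rule arg_cong)
      then show "flip \<sigma> \<inter> flip \<sigma>' = frontier (flip \<sigma>) \<inter> frontier (flip \<sigma>')"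
        unfolding frontier_flip flip_Int .
      have "\<exists>F\<subseteq>edges M. \<exists>G\<subseteq>vertices M. \<sigma> \<inter> \<sigma>' = \<Union>F \<union> G" using M(8)[OF *(1,2) ne] .
      then obtain F G where FG: "F \<subseteq> edges M" "G \<subseteq> vertices M" "\<sigma> \<inter> \<sigma>' = \<Union>F \<union> G" by auto
      have "flip \<sigma> \<inter> flip \<sigma>' = flip (\<Union>F \<union> G)" unfolding FG(3)[symmetric] flip_Int ..
      then have "flip \<sigma> \<inter> flip \<sigma>' = \<Union> (flip ` F) \<union> flip G" unfolding image_Un Un .
      then show "\<exists>F\<subseteq>edges M. \<exists>G\<subseteq>flip (vertices M). flip \<sigma> \<inter> flip \<sigma>' = \<Union> (flip ` F) \<union> G"
        using FG(1,2) by (intro exI[of _ F] conjI exI[of _ "flip G"]) auto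
    qed
    show "\<forall>\<tau>\<in>edges M. \<forall>\<tau>'\<in>edges M. flip \<tau> \<noteq> flip \<tau>' \<longrightarrow>
      flip \<tau> \<inter> flip \<tau>' = rel_frontier (flip \<tau>) \<inter> rel_frontier (flip \<tau>') \<and> flip \<tau> \<inter> flip \<tau>' \<subseteq> flip (vertices M)"
    proof (intro ballI impI conjI)
      fix \<tau> \<tau>' assume *: "\<tau> \<in> edges M" "\<tau>' \<in> edges M" "flip \<tau> \<noteq> flip \<tau>'"
      then have ne: "\<tau> \<noteq> \<tau>'" by blast
      have "flip (\<tau> \<inter> \<tau>') = flip (rel_frontier \<tau> \<inter> rel_frontier \<tau>')" using M(9)[OF *(1,2) ne] by (rule arg_cong)
      then show "flip \<tau> \<inter> flip \<tau>' = rel_frontier (flip \<tau>) \<inter> rel_frontier (flip \<tau>')"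
        unfolding rel_frontier_flip flip_Int .
      have "flip (\<tau> \<inter> \<tau>') \<subseteq> flip (vertices M)" using M(10)[OF *(1,2) ne] by (rule image_mono)
      then show "flip \<tau> \<inter> flip \<tau>' \<subseteq> flip (vertices M)" unfolding flip_Int .
    qed
    show "\<forall>\<tau>\<in>edges M. (vertical \<tau> \<or> horizontal \<tau>) \<and> flip \<tau> \<subseteq> (\<Union>\<sigma>\<in>flip ` cells M. frontier \<sigma>)"
      using 1 by (simp add: frontier_flip image_UN)
  qed (use M(1-3) 5 in auto)
qed

lemma is_tmesh_transpose [simp]: "is_tmesh (transpose_mesh M) \<longleftrightarrow> is_tmesh M"
  by (metis is_tmesh_transpose_imp transpose_transpose_mesh)

lemma interior_edges_transpose: "interior_edges (transpose_mesh M) = flip ` interior_edges M"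
  by (auto simp: interior_edges_def interior_flip simp flip: flip_Int)

lemma interior_hvedges_transpose:
  "interior_hedges (transpose_mesh M) = flip ` interior_vedges M"
  "interior_vedges (transpose_mesh M) = flip ` interior_hedges M"
  by (auto simp: interior_hedges_def interior_vedges_def interior_edges_transpose)

section \<open>Sides of cells and the lines that they form\<close>

lemma interior_rectangle: "interior ({a..b} \<times> {c..d}) = {a<..<b} \<times> {c<..<d::real}" for a b :: real
  by (simp add: interior_Times)

lemma frontier_rectangle:
  fixes a b c d :: real
  assumes "a < b" "c < d"
  shows "frontier ({a..b} \<times> {c..d}) = {a..b} \<times> {c, d} \<union> {a, b} \<times> {c..d}"
  using assms unfolding frontier_def interior_rectangle by (subst closure_closed) (auto intro: closed_Times)

lemma rel_frontier_horizontal: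
  fixes a b c :: real
  assumes "a < b"
  shows "rel_frontier ({a..b} \<times> {c}) = {(a, c), (b, c)}"
proof -
  have "rel_interior ({a..b} \<times> {c}) = {a<..<b} \<times> {c}"
    using assms by (simp add: rel_interior_Times rel_interior_interior affine_hull_nonempty_interior)
  then show ?thesis using assms unfolding rel_frontier_def by (subst closure_closed) (auto intro: closed_Times)
qed

lemma rel_frontier_vertical:
  fixes a c d :: real
  assumes "c < d"
  shows "rel_frontier ({a} \<times> {c..d}) = {(a, c), (a, d)}"
  using rel_frontier_flip[of "{c..d} \<times> {a}"] rel_frontier_horizontal[OF assms, of a] by simp

lemma rectangle_eq_iff:
  fixes a b c d :: real
  assumes "a < b" "c < d"
  shows "{a..b} \<times> {c..d} = {a'..b'} \<times> {c'..d'} \<longleftrightarrow> a = a' \<and> b = b' \<and> c = c' \<and> d = d'"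
  using assms by (auto simp: times_eq_iff Icc_eq_Icc)

definition hsides :: "point set \<Rightarrow> point set" where
  "hsides \<sigma> = {z. \<exists>a b c d. a < b \<and> c < d \<and> \<sigma> = {a..b} \<times> {c..d} \<and> z \<in> {a..b} \<times> {c, d}}"

definition vsides :: "point set \<Rightarrow> point set" where
  "vsides \<sigma> = flip (hsides (flip \<sigma>))"

text \<open>Determined by the cells alone, unlike \<open>edges\<close>, which \<open>splits\<close>
  leaves implicit; \<open>hedges_Union\<close> identifies it with the union of the horizontal
  edges.\<close>

definition hgrid :: "tmesh \<Rightarrow> point set" where "hgrid M = \<Union> (hsides ` cells M)"
definition vgrid :: "tmesh \<Rightarrow> point set" where "vgrid M = \<Union> (vsides ` cells M)"

lemma hsides_rectangle: "a < b \<Longrightarrow> c < d \<Longrightarrow> hsides ({a..b} \<times> {c..d}) = {a..b} \<times> {c, d}"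
  unfolding hsides_def by (auto simp: rectangle_eq_iff)

lemma vsides_rectangle: "a < b \<Longrightarrow> c < d \<Longrightarrow> vsides ({a..b} \<times> {c..d}) = {a, b} \<times> {c..d}"
  unfolding vsides_def by (simp add: hsides_rectangle del: insert_commute)

lemma hgrid_transpose [simp]: "hgrid (transpose_mesh M) = flip (vgrid M)"
  and vgrid_transpose [simp]: "vgrid (transpose_mesh M) = flip (hgrid M)"
  by (simp_all add: hgrid_def vgrid_def vsides_def image_UN image_image)

lemma rectangleE:
  assumes "rectangle \<sigma>"
  obtains a b c d where "a < b" "c < d" "\<sigma> = {a..b} \<times> {c..d}"
  using assms unfolding rectangle_def by blast

lemma frontier_sides: assumes "rectangle \<sigma>" shows "frontier \<sigma> = hsides \<sigma> \<union> vsides \<sigma>"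
  using assms by (rule rectangleE) (simp add: frontier_rectangle hsides_rectangle vsides_rectangle)

lemma grid_props:
  assumes "finite (cells M)" "\<forall>\<sigma>\<in>cells M. rectangle \<sigma>"
  shows "closed (hgrid M)" "finite (snd ` hgrid M)"
proof -
  have "closed (hsides \<sigma>) \<and> finite (snd ` hsides \<sigma>)" if s: "\<sigma> \<in> cells M" for \<sigma>
  proof -
    obtain a b c d where "a < b" "c < d" "\<sigma> = {a..b} \<times> {c..d}" by (rule rectangleE[OF assms(2)[rule_format, OF s]])
    then show ?thesis by (auto simp: hsides_rectangle closed_Times intro: finite_subset[of _ "{c, d}"])
  qed
  then show "closed (hgrid M)" "finite (snd ` hgrid M)"
    using assms(1) by (auto simp: hgrid_def image_UN)
qed

text \<open>The axioms cover edges by sides, and sides by edges, of both directions together. Along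
  a horizontal segment the vertical ones contribute only finitely many points, and a closed set
  containing all other points contains these as well.\<close>

lemma hedges_Union:
  assumes M: "is_tmesh M"
  shows "\<Union>{\<tau>\<in>edges M. horizontal \<tau>} = hgrid M"
proof
  have fin: "finite (cells M)" "\<forall>\<sigma>\<in>cells M. rectangle \<sigma>" "finite (edges M)" using is_tmeshD(1-3)[OF M] by auto
  have fin': "finite (cells (transpose_mesh M))" "\<forall>\<sigma>\<in>cells (transpose_mesh M). rectangle \<sigma>" using fin by auto
  have vfin: "finite (fst ` vgrid M)"
    using grid_props(2)[OF fin'] by (simp add: image_image)
  have fr: "(\<Union>\<sigma>\<in>cells M. frontier \<sigma>) = hgrid M \<union> vgrid M"
    using fin(2) by (auto simp: hgrid_def vgrid_def frontier_sides)
  have cl: "closed {x. (x, y) \<in> S}" if "closed S" for S :: "point set" and y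
    using continuous_closed_vimage[OF that, of "\<lambda>x. (x, y)"] by (simp add: vimage_def continuous_intros)
  let ?H = "\<Union>{\<tau>\<in>edges M. horizontal \<tau>}" and ?V = "\<Union>{\<tau>\<in>edges M. vertical \<tau>}"
  show "?H \<subseteq> hgrid M"
  proof (rule Union_least, clarify)
    fix \<tau> x y assume t: "\<tau> \<in> edges M" "horizontal \<tau>" "(x, y) \<in> \<tau>"
    then obtain a b c where ab: "a < b" "\<tau> = {a..b} \<times> {c}" unfolding horizontal_def by blast
    have "\<tau> \<subseteq> hgrid M \<union> vgrid M" using is_tmeshD(5)[OF M t(1)] fr by simp
    then have "{a..b} \<subseteq> {x. (x, c) \<in> hgrid M} \<union> fst ` vgrid M" using ab by force
    then have "{a..b} \<subseteq> {x. (x, c) \<in> hgrid M}"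
      by (rule Icc_subset_closed_if_subset_Un_finite[OF ab(1) _ cl[OF grid_props(1)[OF fin(1,2)]] vfin])
    then show "(x, y) \<in> hgrid M" using t ab by auto
  qed
  have "closed ?H" using fin(3) by (intro closed_Union) (auto simp: horizontal_def intro!: closed_Times)
  have "finite (fst ` ?V)"
  proof -
    have "finite (fst ` \<tau>)" if "\<tau> \<in> {\<tau>\<in>edges M. vertical \<tau>}" for \<tau>
      using that by (auto simp: vertical_def)
    then show ?thesis using fin(3) by (simp add: image_Union)
  qed
  have sub: "frontier \<sigma> \<subseteq> ?H \<union> ?V" if s: "\<sigma> \<in> cells M" for \<sigma>
  proof -
    obtain F where "F \<subseteq> edges M" "frontier \<sigma> = \<Union>F" using is_tmeshD(6)[OF M s] by blast
    then show ?thesis using is_tmeshD(4)[OF M] by blast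
  qed
  show "hgrid M \<subseteq> ?H"
  proof
    fix z assume "z \<in> hgrid M"
    then obtain \<sigma> where s: "\<sigma> \<in> cells M" "z \<in> hsides \<sigma>" by (auto simp: hgrid_def)
    obtain a b c d where r: "a < b" "c < d" "\<sigma> = {a..b} \<times> {c..d}" by (rule rectangleE[OF fin(2)[rule_format, OF s(1)]])
    have z: "fst z \<in> {a..b}" "snd z \<in> {c, d}" using s r by (auto simp: hsides_rectangle)
    have "{a..b} \<times> {snd z} \<subseteq> ?H \<union> ?V" using sub[OF s(1)] z r by (auto simp: frontier_rectangle)
    then have "{a..b} \<subseteq> {x. (x, snd z) \<in> ?H} \<union> fst ` ?V" by force
    then have "{a..b} \<subseteq> {x. (x, snd z) \<in> ?H}"
      by (rule Icc_subset_closed_if_subset_Un_finite[OF r(1) _ cl[OF \<open>closed ?H\<close>] \<open>finite (fst ` ?V)\<close>])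
    then show "z \<in> ?H" using z by (cases z) auto
  qed
qed

lemma vedges_Union:
  assumes "is_tmesh M"
  shows "\<Union>{\<tau>\<in>edges M. vertical \<tau>} = vgrid M"
proof -
  have "{\<tau>\<in>edges (transpose_mesh M). horizontal \<tau>} = flip ` {\<tau>\<in>edges M. vertical \<tau>}" by auto
  then have "flip (\<Union>{\<tau>\<in>edges M. vertical \<tau>}) = flip (vgrid M)"
    using hedges_Union[of "transpose_mesh M"] assms by (simp add: image_Union)
  then show ?thesis by simp
qed

lemma not_horizontal_and_vertical: "horizontal \<tau> \<Longrightarrow> vertical \<tau> \<Longrightarrow> False"
  unfolding horizontal_def vertical_def by (auto simp: times_eq_iff)

text \<open>One inclusion is the standing assumption on vertices. For the other, a horizontal and a
  vertical edge through a point are distinct, so their common points are vertices.\<close>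

lemma vertices_eq:
  assumes M: "is_tmesh M"
  shows "vertices M = hgrid M \<inter> vgrid M"
proof
  show "vertices M \<subseteq> hgrid M \<inter> vgrid M"
    unfolding hedges_Union[OF M, symmetric] vedges_Union[OF M, symmetric] using is_tmeshD(11,12)[OF M] by fast
  show "hgrid M \<inter> vgrid M \<subseteq> vertices M"
  proof
    fix z assume "z \<in> hgrid M \<inter> vgrid M"
    then obtain \<tau> \<tau>' where t: "\<tau> \<in> edges M" "horizontal \<tau>" "z \<in> \<tau>" "\<tau>' \<in> edges M" "vertical \<tau>'" "z \<in> \<tau>'"
      unfolding hedges_Union[OF M, symmetric] vedges_Union[OF M, symmetric] by blast
    then have "\<tau> \<noteq> \<tau>'" using not_horizontal_and_vertical by blast
    then show "z \<in> vertices M" using is_tmeshD(10)[OF M t(1,4)] t by blast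
  qed
qed

lemma interior_cell_notin_grid:
  assumes M: "is_tmesh M" and s: "\<sigma> \<in> cells M" "z \<in> interior \<sigma>"
  shows "z \<notin> hgrid M" "z \<notin> vgrid M"
proof -
  have nf: "z \<notin> frontier \<sigma>" using s(2) by (simp add: frontier_def)
  have "z \<notin> frontier \<sigma>'" if "\<sigma>' \<in> cells M" for \<sigma>'
  proof
    assume zf: "z \<in> frontier \<sigma>'"
    then have "\<sigma>' \<noteq> \<sigma>" using nf by blast
    then have "\<sigma> \<inter> \<sigma>' = frontier \<sigma> \<inter> frontier \<sigma>'" using is_tmeshD(7)[OF M s(1) that] by blast
    moreover have "rectangle \<sigma>'" using is_tmeshD(2)[OF M that] .
    then have "frontier \<sigma>' \<subseteq> \<sigma>'" by (intro frontier_subset_closed) (auto simp: rectangle_def intro: closed_Times)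
    ultimately show False using zf nf s interior_subset by blast
  qed
  then show "z \<notin> hgrid M" "z \<notin> vgrid M"
    using is_tmeshD(2)[OF M] unfolding hgrid_def vgrid_def by (auto simp: frontier_sides)
qed

text \<open>The invariant of every construction: a split leaves the domain unchanged.\<close>

definition mesh_of_rectangle :: "tmesh \<Rightarrow> real \<Rightarrow> real \<Rightarrow> real \<Rightarrow> real \<Rightarrow> bool" where
  "mesh_of_rectangle M A B C D \<longleftrightarrow> is_tmesh M \<and> A < B \<and> C < D \<and> domain M = {A..B} \<times> {C..D}"

lemma mesh_of_rectangle_transpose: "mesh_of_rectangle M A B C D \<Longrightarrow> mesh_of_rectangle (transpose_mesh M) C D A B"
  by (auto simp: mesh_of_rectangle_def)

definition hlines :: "tmesh \<Rightarrow> point set" where "hlines M = \<Union> (interior_hedges M)"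
definition vlines :: "tmesh \<Rightarrow> point set" where "vlines M = \<Union> (interior_vedges M)"

lemma grid_subset_domain:
  assumes "is_tmesh M"
  shows "hgrid M \<subseteq> domain M" "vgrid M \<subseteq> domain M"
proof -
  have "hsides \<sigma> \<subseteq> \<sigma> \<and> vsides \<sigma> \<subseteq> \<sigma>" if s: "\<sigma> \<in> cells M" for \<sigma>
  proof -
    obtain a b c d where "a < b" "c < d" "\<sigma> = {a..b} \<times> {c..d}"
      by (rule rectangleE[OF is_tmeshD(2)[OF assms s]])
    then show ?thesis by (auto simp: hsides_rectangle vsides_rectangle)
  qed
  then show "hgrid M \<subseteq> domain M" "vgrid M \<subseteq> domain M" by (auto simp: hgrid_def vgrid_def domain_def)
qed

lemma interior_hedge_iff:
  assumes M: "mesh_of_rectangle M A B C D" and t: "\<tau> \<in> edges M" "a < b" "\<tau> = {a..b} \<times> {c}"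
  shows "\<tau> \<in> interior_hedges M \<longleftrightarrow> C < c \<and> c < D"
proof -
  have tm: "is_tmesh M" and dom: "domain M = {A..B} \<times> {C..D}" using M by (auto simp: mesh_of_rectangle_def)
  have "horizontal \<tau>" using t by (auto simp: horizontal_def)
  then have "\<tau> \<subseteq> hgrid M" using t(1) hedges_Union[OF tm] by blast
  then have sub: "{a..b} \<times> {c} \<subseteq> {A..B} \<times> {C..D}" using grid_subset_domain(1)[OF tm] dom t(3) by blast
  then have "A \<le> a" "b \<le> B" using t(2) by (auto simp: times_subset_iff)
  \<comment> \<open>The midpoint serves as witness because the end points may lie on the boundary of
    the domain.\<close>
  then have "(a + b) / 2 \<in> {a..b} \<inter> {A<..<B}" using t(2) by auto
  then have "{a..b} \<inter> {A<..<B} \<noteq> {}" by blast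
  then have "\<tau> \<inter> interior (domain M) \<noteq> {} \<longleftrightarrow> C < c \<and> c < D"
    unfolding dom interior_rectangle t(3) Times_Int_Times by (auto simp: Sigma_empty_iff)
  then show ?thesis using t(1) \<open>horizontal \<tau>\<close> by (simp add: interior_hedges_def interior_edges_def)
qed

lemma hlines_eq:
  assumes M: "mesh_of_rectangle M A B C D"
  shows "hlines M = {z \<in> hgrid M. C < snd z \<and> snd z < D}"
proof -
  have tm: "is_tmesh M" using M by (simp add: mesh_of_rectangle_def)
  have "z \<in> hlines M \<longleftrightarrow> z \<in> hgrid M \<and> C < snd z \<and> snd z < D" for z
  proof
    assume "z \<in> hlines M"
    then obtain \<tau> where t: "\<tau> \<in> interior_hedges M" "z \<in> \<tau>" by (auto simp: hlines_def)
    then have e: "\<tau> \<in> edges M" "horizontal \<tau>" by (auto simp: interior_hedges_def interior_edges_def)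
    then obtain a b c where "a < b" "\<tau> = {a..b} \<times> {c}" by (auto simp: horizontal_def)
    then show "z \<in> hgrid M \<and> C < snd z \<and> snd z < D"
      using interior_hedge_iff[OF M e(1)] t e hedges_Union[OF tm] by auto
  next
    assume z: "z \<in> hgrid M \<and> C < snd z \<and> snd z < D"
    then obtain \<tau> where e: "\<tau> \<in> edges M" "horizontal \<tau>" "z \<in> \<tau>" using hedges_Union[OF tm] by blast
    then obtain a b c where "a < b" "\<tau> = {a..b} \<times> {c}" by (auto simp: horizontal_def)
    then show "z \<in> hlines M" using interior_hedge_iff[OF M e(1)] e z by (auto simp: hlines_def)
  qed
  then show ?thesis by blast
qed

lemma lines_transpose [simp]:
  "hlines (transpose_mesh M) = flip (vlines M)" "vlines (transpose_mesh M) = flip (hlines M)"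
  by (simp_all add: hlines_def vlines_def interior_hvedges_transpose image_Union)

lemma vlines_eq:
  assumes M: "mesh_of_rectangle M A B C D"
  shows "vlines M = {z \<in> vgrid M. A < fst z \<and> fst z < B}"
proof -
  have "flip (vlines M) = {z \<in> flip (vgrid M). A < snd z \<and> snd z < B}"
    using hlines_eq[OF mesh_of_rectangle_transpose[OF M]] by simp
  then show ?thesis by (auto simp: set_eq_iff in_flip)
qed

text \<open>A connected set that meets a component lies inside it. So every component is the union
  of the edges in it, and no connected union of edges extends beyond one. This makes the theory of
  components available for maximal segments.\<close>

lemma max_connected_unions_eq_components:
  assumes E: "\<And>\<tau>. \<tau> \<in> E \<Longrightarrow> connected \<tau> \<and> \<tau> \<noteq> {}"
  shows "max_connected_unions E = components (\<Union>E)"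
proof -
  have 1: "C = \<Union>{\<tau>\<in>E. \<tau> \<subseteq> C}" if C: "C \<in> components (\<Union>E)" for C
  proof
    show "C \<subseteq> \<Union>{\<tau>\<in>E. \<tau> \<subseteq> C}"
    proof
      fix z assume "z \<in> C"
      then obtain \<tau> where t: "\<tau> \<in> E" "z \<in> \<tau>" using in_components_subset[OF C] by blast
      then have "\<tau> \<subseteq> C"
        using E[OF t(1)] \<open>z \<in> C\<close> by (intro components_maximal[OF C]) auto
      then show "z \<in> \<Union>{\<tau>\<in>E. \<tau> \<subseteq> C}" using t by blast
    qed
  qed blast
  have 2: "C \<in> max_connected_unions E" if C: "C \<in> components (\<Union>E)" for C
    unfolding max_connected_unions_def
  proof (intro CollectI exI[of _ "{\<tau>\<in>E. \<tau> \<subseteq> C}"] conjI allI impI)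
    show "{\<tau>\<in>E. \<tau> \<subseteq> C} \<noteq> {}" using 1[OF C] in_components_nonempty[OF C] by auto
    show "connected C" using in_components_connected[OF C] .
    fix G assume "G \<subseteq> E" and G: "connected (\<Union>G) \<and> C \<subseteq> \<Union>G"
    then have "\<Union>G \<subseteq> C"
      using components_maximal[OF C, of "\<Union>G"] in_components_nonempty[OF C] by blast
    then show "\<Union>G = C" using G by blast
  qed (use 1[OF C] in auto)
  have "\<rho> \<in> components (\<Union>E)" if r: "\<rho> \<in> max_connected_unions E" for \<rho>
  proof -
    obtain F where F: "F \<subseteq> E" "F \<noteq> {}" "\<rho> = \<Union>F" "connected \<rho>"
      and max: "\<forall>G\<subseteq>E. connected (\<Union>G) \<and> \<rho> \<subseteq> \<Union>G \<longrightarrow> \<Union>G = \<rho>"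
      using r unfolding max_connected_unions_def mem_Collect_eq by (elim exE conjE) (rule that; assumption)
    have "\<rho> \<noteq> {}" using F E by blast
    then obtain C where C: "C \<in> components (\<Union>E)" "\<rho> \<subseteq> C"
      using exists_component_superset[of \<rho> "\<Union>E"] F by auto
    have "\<Union>{\<tau>\<in>E. \<tau> \<subseteq> C} = \<rho>"
      using 1[OF C(1)] C in_components_connected[OF C(1)] by (intro max[rule_format]) auto
    then show ?thesis using 1[OF C(1)] C(1) by simp
  qed
  then show ?thesis using 2 by blast
qed

lemma connected_if_horizontal: "horizontal \<tau> \<Longrightarrow> connected \<tau> \<and> \<tau> \<noteq> {}"
  unfolding horizontal_def by (auto intro!: convex_connected convex_Times)

lemma connected_if_vertical: "vertical \<tau> \<Longrightarrow> connected \<tau> \<and> \<tau> \<noteq> {}"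
  unfolding vertical_def by (auto intro!: convex_connected convex_Times)

lemma max_connected_unions_interior_edges:
  "max_connected_unions (interior_hedges M) = components (hlines M)"
  "max_connected_unions (interior_vedges M) = components (vlines M)"
  unfolding hlines_def vlines_def
  by (rule max_connected_unions_eq_components connected_if_horizontal connected_if_vertical,
      simp add: interior_hedges_def interior_vedges_def connected_if_horizontal connected_if_vertical)+

section \<open>Maximal segments under subdivision\<close>

lemma hsplit_effect:
  assumes M: "mesh_of_rectangle M A B C D" and M': "is_tmesh M'"
    and s: "{a..b} \<times> {c..d} \<in> cells M" "a < b" "c < y" "y < d"
    and cells: "cells M' = (cells M - {{a..b} \<times> {c..d}}) \<union> {{a..b} \<times> {c..y}, {a..b} \<times> {y..d}}"
  shows "mesh_of_rectangle M' A B C D" "hgrid M' = hgrid M \<union> {a..b} \<times> {y}" "vgrid M' = vgrid M"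
    "hlines M' = hlines M \<union> {a..b} \<times> {y}" "vlines M' = vlines M" "\<not> {a..b} \<times> {y} \<subseteq> hlines M"
proof -
  let ?\<sigma> = "{a..b} \<times> {c..d}"
  have tm: "is_tmesh M" and dom: "domain M = {A..B} \<times> {C..D}" using M by (auto simp: mesh_of_rectangle_def)
  \<comment> \<open>The effect of a split on any set assembled cell by cell. It is used for the
    cells themselves, for their horizontal sides and for their vertical sides; \<open>X\<close> is
    the new edge in the second case and empty in the others.\<close>
  have U: "\<Union> (f ` cells M') = \<Union> (f ` cells M) \<union> X"
    if "f ({a..b} \<times> {c..y}) \<union> f ({a..b} \<times> {y..d}) = f ?\<sigma> \<union> X" for f :: "point set \<Rightarrow> point set" and X
  proof -
    have "\<Union> (f ` cells M') = \<Union> (f ` (cells M - {?\<sigma>})) \<union> (f ({a..b} \<times> {c..y}) \<union> f ({a..b} \<times> {y..d}))"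
      unfolding cells by auto
    also have "\<dots> = (\<Union> (f ` (cells M - {?\<sigma>})) \<union> f ?\<sigma>) \<union> X" unfolding that by auto
    also have "\<Union> (f ` (cells M - {?\<sigma>})) \<union> f ?\<sigma> = \<Union> (f ` cells M)" using s(1) by blast
    finally show ?thesis .
  qed
  have cd: "c < d" using s by simp
  have "\<Union> ((\<lambda>\<sigma>. \<sigma>) ` cells M') = \<Union> ((\<lambda>\<sigma>. \<sigma>) ` cells M) \<union> {}" by (rule U) (use s in auto)
  then have dom': "domain M' = domain M" by (simp add: domain_def)
  then show M'': "mesh_of_rectangle M' A B C D" using M M' by (simp add: mesh_of_rectangle_def)
  show h: "hgrid M' = hgrid M \<union> {a..b} \<times> {y}" unfolding hgrid_def
    by (rule U) (use s cd in \<open>auto simp: hsides_rectangle\<close>)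
  have "vgrid M' = vgrid M \<union> {}" unfolding vgrid_def
    by (rule U) (use s cd in \<open>auto simp: vsides_rectangle\<close>)
  then show v: "vgrid M' = vgrid M" by simp
  have "?\<sigma> \<subseteq> {A..B} \<times> {C..D}" using s(1) dom by (auto simp: domain_def)
  then have "C \<le> c" "d \<le> D" using s cd by (auto simp: times_subset_iff)
  then show "hlines M' = hlines M \<union> {a..b} \<times> {y}"
    unfolding hlines_eq[OF M] hlines_eq[OF M''] h using s by auto
  show "vlines M' = vlines M" unfolding vlines_eq[OF M] vlines_eq[OF M''] v ..
  \<comment> \<open>The middle of the new edge was interior to the old cell and hence on no side of
    any cell, so old lines do not cover the new edge.\<close>
  have "((a + b) / 2, y) \<in> interior ?\<sigma>" using s unfolding interior_rectangle by auto
  then have "((a + b) / 2, y) \<notin> hgrid M" using interior_cell_notin_grid(1)[OF tm s(1)] by blast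
  then have "((a + b) / 2, y) \<notin> hlines M" unfolding hlines_eq[OF M] by blast
  moreover have "((a + b) / 2, y) \<in> {a..b} \<times> {y}" using s by auto
  ultimately show "\<not> {a..b} \<times> {y} \<subseteq> hlines M" by blast
qed

text \<open>Both directions are treated at once: \<open>True\<close> stands for horizontal.\<close>

definition lines :: "bool \<Rightarrow> tmesh \<Rightarrow> point set" where
  "lines d M = (if d then hlines M else vlines M)"

definition directed :: "bool \<Rightarrow> point set \<Rightarrow> bool" where
  "directed d \<tau> \<longleftrightarrow> (if d then horizontal \<tau> else vertical \<tau>)"

definition MIS_dir :: "bool \<Rightarrow> tmesh \<Rightarrow> point set set" where
  "MIS_dir d M = {\<rho> \<in> components (lines d M). \<rho> \<inter> frontier (domain M) = {}}"

lemma MIS_hv_eq: "MIS_h M = MIS_dir True M" "MIS_v M = MIS_dir False M"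
  by (simp_all add: MIS_h_def MIS_v_def MIS_dir_def lines_def max_connected_unions_interior_edges)

lemma in_MIS_iff: "\<rho> \<in> MIS M \<longleftrightarrow> (\<exists>d. \<rho> \<in> MIS_dir d M)"
  by (auto simp: MIS_def MIS_hv_eq ex_bool_eq)

lemma in_max_segments_iff: "\<rho> \<in> max_segments M \<longleftrightarrow> (\<exists>d. \<rho> \<in> components (lines d M))"
  by (auto simp: max_segments_def lines_def max_connected_unions_interior_edges ex_bool_eq)

lemma connected_if_directed: "directed d \<tau> \<Longrightarrow> connected \<tau> \<and> \<tau> \<noteq> {}"
  using connected_if_horizontal connected_if_vertical by (auto simp: directed_def split: if_splits)

lemma component_mono:
  assumes "C \<in> components S" "S \<subseteq> S'"
  shows "\<exists>C'\<in>components S'. C \<subseteq> C'"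
  using exists_component_superset[of C S'] in_components_subset[OF assms(1)] in_components_connected[OF assms(1)]
    in_components_nonempty[OF assms(1)] assms(2) by blast

text \<open>A vertical split is a horizontal split of the transposed mesh. The study of segments and
  weights uses a split only through this effect on lines and vertices.\<close>

lemma split_effect:
  assumes M: "mesh_of_rectangle M A B C D" and sp: "splits M \<sigma> \<tau> M'"
  obtains d where "mesh_of_rectangle M' A B C D" "directed d \<tau>"
    "lines d M' = lines d M \<union> \<tau>" "lines (\<not> d) M' = lines (\<not> d) M" "\<not> \<tau> \<subseteq> lines d M"
    "vertices M \<subseteq> vertices M'"
proof -
  have M': "is_tmesh M'" using sp by (simp add: splits_def)
  have tm: "is_tmesh M" using M by (simp add: mesh_of_rectangle_def)
  obtain a b c d where s: "a < b" "c < d" "\<sigma> = {a..b} \<times> {c..d}" "\<sigma> \<in> cells M" and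
    "(\<exists>x. a < x \<and> x < b \<and> \<tau> = {x} \<times> {c..d} \<and>
              cells M' = (cells M - {\<sigma>}) \<union> {{a..x} \<times> {c..d}, {x..b} \<times> {c..d}}) \<or>
         (\<exists>y. c < y \<and> y < d \<and> \<tau> = {a..b} \<times> {y} \<and>
              cells M' = (cells M - {\<sigma>}) \<union> {{a..b} \<times> {c..y}, {a..b} \<times> {y..d}})"
    using sp unfolding splits_def by blast
  then consider
    (v) x where "a < x" "x < b" "\<tau> = {x} \<times> {c..d}" "cells M' = (cells M - {\<sigma>}) \<union> {{a..x} \<times> {c..d}, {x..b} \<times> {c..d}}"
  | (h) y where "c < y" "y < d" "\<tau> = {a..b} \<times> {y}" "cells M' = (cells M - {\<sigma>}) \<union> {{a..b} \<times> {c..y}, {a..b} \<times> {y..d}}"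
    by blast
  then show ?thesis
  proof cases
    case h
    note e = hsplit_effect[OF M M' s(4)[unfolded s(3)] s(1) h(1,2) h(4)[unfolded s(3)]]
    have "horizontal \<tau>" unfolding horizontal_def h(3) using s(1) by blast
    then show ?thesis
      using e(1,6) unfolding h(3)[symmetric]
      by (intro that[of True])
        (simp_all add: lines_def directed_def e(2-5) h(3) vertices_eq[OF tm] vertices_eq[OF M'], blast)
  next
    case v
    have "flip ` cells M' = (flip ` cells M - {flip \<sigma>}) \<union> {flip ({a..x} \<times> {c..d}), flip ({x..b} \<times> {c..d})}"
      unfolding v(4) by (simp add: image_set_diff[OF inj_flip] image_Un)
    then have "cells (transpose_mesh M') = (cells (transpose_mesh M) - {{c..d} \<times> {a..b}})
        \<union> {{c..d} \<times> {a..x}, {c..d} \<times> {x..b}}" using s(3) by simp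
    moreover have "{c..d} \<times> {a..b} \<in> cells (transpose_mesh M)"
      using s(3,4) flip_in_flip_image[of \<sigma>] by (simp del: flip_in_flip_image)
    ultimately have e: "mesh_of_rectangle (transpose_mesh M') C D A B"
      "hgrid (transpose_mesh M') = hgrid (transpose_mesh M) \<union> {c..d} \<times> {x}"
      "vgrid (transpose_mesh M') = vgrid (transpose_mesh M)"
      "hlines (transpose_mesh M') = hlines (transpose_mesh M) \<union> {c..d} \<times> {x}"
      "vlines (transpose_mesh M') = vlines (transpose_mesh M)"
      "\<not> {c..d} \<times> {x} \<subseteq> hlines (transpose_mesh M)"
      using hsplit_effect[OF mesh_of_rectangle_transpose[OF M], of "transpose_mesh M'" c d a b x] M' s v(1,2)
      by simp_all
    have t: "{c..d} \<times> {x} = flip \<tau>" using v(3) by simp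
    have "vlines M' = vlines M \<union> \<tau>" "\<not> \<tau> \<subseteq> vlines M" "hlines M' = hlines M" "vgrid M' = vgrid M \<union> \<tau>" "hgrid M' = hgrid M"
      using e(2-6) unfolding t by (simp_all flip: image_Un)
    moreover have "mesh_of_rectangle M' A B C D" using mesh_of_rectangle_transpose[OF e(1)] by simp
    moreover have "vertical \<tau>" unfolding vertical_def v(3) using s(2) by blast
    ultimately show ?thesis
      by (intro that[of False])
        (simp_all add: lines_def directed_def vertices_eq[OF tm] vertices_eq[OF M'], blast)
  qed
qed

lemma mesh_of_rectangle_split:
  "mesh_of_rectangle M A B C D \<Longrightarrow> splits M \<sigma> \<tau> M' \<Longrightarrow> mesh_of_rectangle M' A B C D"
  by (erule (1) split_effect)

lemma component_lines_directed:
  assumes "C \<in> components (lines d M)"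
  shows "\<exists>\<tau>. directed d \<tau> \<and> \<tau> \<subseteq> C"
proof -
  obtain z where z: "z \<in> C" using in_components_nonempty[OF assms] by blast
  have "\<exists>\<tau>. directed d \<tau> \<and> z \<in> \<tau> \<and> \<tau> \<subseteq> lines d M"
    using z in_components_subset[OF assms]
    by (fastforce simp: lines_def hlines_def vlines_def directed_def interior_hedges_def interior_vedges_def)
  then obtain \<tau> where t: "directed d \<tau>" "z \<in> \<tau>" "\<tau> \<subseteq> lines d M" by blast
  then have "\<tau> \<subseteq> C" using components_maximal[OF assms, of \<tau>] connected_if_directed[OF t(1)] z by blast
  then show ?thesis using t by blast
qed

text \<open>The heights of horizontal lines form a finite set, and the projection of a component to
  the second axis is connected, hence a single point.\<close>

lemma component_hlines_level:
  assumes M: "is_tmesh M" and C: "C \<in> components (hlines M)" and z: "z \<in> C" "w \<in> C"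
  shows "snd z = snd w"
proof -
  have "hlines M \<subseteq> hgrid M"
    unfolding hlines_def interior_hedges_def interior_edges_def hedges_Union[OF M, symmetric] by blast
  then have "snd ` C \<subseteq> snd ` hgrid M" using in_components_subset[OF C] by blast
  moreover have "finite (snd ` hgrid M)" using grid_props(2) is_tmeshD(1,2)[OF M] by blast
  ultimately have "finite (snd ` C)" by (rule finite_subset)
  moreover have "connected (snd ` C)"
    using in_components_connected[OF C] by (intro connected_continuous_image continuous_intros)
  ultimately have "snd ` C = {} \<or> (\<exists>a. snd ` C = {a})" using connected_finite_iff_sing by blast
  then show ?thesis using z by (metis empty_iff imageI singletonD)
qed

lemma component_vlines_level:
  assumes M: "is_tmesh M" and C: "C \<in> components (vlines M)" and z: "z \<in> C" "w \<in> C"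
  shows "fst z = fst w"
proof -
  have "vlines M \<subseteq> vgrid M"
    unfolding vlines_def interior_vedges_def interior_edges_def vedges_Union[OF M, symmetric] by blast
  then have "fst ` C \<subseteq> fst ` vgrid M" using in_components_subset[OF C] by blast
  moreover have "finite (fst ` vgrid M)"
    using grid_props(2)[of "transpose_mesh M"] is_tmeshD(1,2)[OF M] by (simp add: image_image)
  ultimately have "finite (fst ` C)" by (rule finite_subset)
  moreover have "connected (fst ` C)"
    using in_components_connected[OF C] by (intro connected_continuous_image continuous_intros)
  ultimately have "fst ` C = {} \<or> (\<exists>a. fst ` C = {a})" using connected_finite_iff_sing by blast
  then show ?thesis using z by (metis empty_iff imageI singletonD)
qed

text \<open>A component lies on one line and cannot contain two points of a perpendicular line. So a
  maximal segment, although given as a mere set, has a definite direction; this matters because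
  \<open>MIS\<close> and \<open>max_segments\<close> mix both directions.\<close>

lemma direction_unique:
  assumes "is_tmesh M" "C \<in> components (lines d M)" "\<tau> \<subseteq> C" "directed d' \<tau>"
  shows "d' = d"
proof (rule ccontr)
  assume "d' \<noteq> d"
  then consider "d" "vertical \<tau>" | "\<not> d" "horizontal \<tau>" using assms(4) by (cases d) (auto simp: directed_def)
  then show False
  proof cases
    case 1
    then obtain a c d where "c < d" "\<tau> = {a} \<times> {c..d}" by (auto simp: vertical_def)
    then have "(a, c) \<in> C" "(a, d) \<in> C" "c \<noteq> d" using assms(3) by auto
    then show False
      using component_hlines_level[OF assms(1), of C "(a, c)" "(a, d)"] assms(2) 1 by (simp add: lines_def)
  next
    case 2
    then obtain a b c where "a < b" "\<tau> = {a..b} \<times> {c}" by (auto simp: horizontal_def)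
    then have "(a, c) \<in> C" "(b, c) \<in> C" "a \<noteq> b" using assms(3) by auto
    then show False
      using component_vlines_level[OF assms(1), of C "(a, c)" "(b, c)"] assms(2) 2 by (simp add: lines_def)
  qed
qed

lemma direction_components_unique:
  assumes "is_tmesh M" "is_tmesh N" "C \<in> components (lines d M)" "C \<subseteq> C'" "C' \<in> components (lines d' N)"
  shows "d = d'"
  using component_lines_directed[OF assms(3)] direction_unique[OF assms(2,5)] assms(4) by blast

text \<open>As directions are unique, the component containing \<open>\<tau>\<close> is the only
  candidate for the definite description in \<open>max_segment\<close>.\<close>

lemma max_segment_component:
  assumes "is_tmesh M" "directed d \<tau>" "\<tau> \<subseteq> lines d M"
  shows "max_segment M \<tau> \<in> components (lines d M)" "\<tau> \<subseteq> max_segment M \<tau>"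
proof -
  obtain C where C: "C \<in> components (lines d M)" "\<tau> \<subseteq> C"
    using exists_component_superset[OF assms(3)] connected_if_directed[OF assms(2)] assms(3) by blast
  have "max_segment M \<tau> = C" unfolding max_segment_def
  proof (rule the_equality)
    show "C \<in> max_segments M \<and> \<tau> \<subseteq> C" using C in_max_segments_iff by blast
    fix \<rho> assume r: "\<rho> \<in> max_segments M \<and> \<tau> \<subseteq> \<rho>"
    then obtain d' where d': "\<rho> \<in> components (lines d' M)" using in_max_segments_iff by blast
    then have "d = d'" using direction_unique[OF assms(1) d'] r assms(2) by blast
    then show "\<rho> = C"
      using d' C r connected_if_directed[OF assms(2)] components_eq[of \<rho> "lines d M" C] by blast
  qed
  then show "max_segment M \<tau> \<in> components (lines d M)" "\<tau> \<subseteq> max_segment M \<tau>" using C by auto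
qed

section \<open>Constructions and the order of appearance\<close>

lemma hier_construction_props:
  assumes "hier_construction Ms"
  shows "Ms \<noteq> [] \<and> (\<exists>A B C D. \<forall>M\<in>set Ms. mesh_of_rectangle M A B C D) \<and>
    (\<forall>i. Suc i < length Ms \<longrightarrow> (\<exists>\<sigma> \<tau>. splits (Ms ! i) \<sigma> \<tau> (Ms ! Suc i))) \<and> (\<exists>\<Omega>. cells (Ms ! 0) = {\<Omega>})"
  using assms
proof (induction rule: hier_construction.induct)
  case (single M \<Omega>)
  then obtain a b c d where "a < b" "c < d" "\<Omega> = {a..b} \<times> {c..d}" by (elim rectangleE)
  then have "mesh_of_rectangle M a b c d" using single by (simp add: mesh_of_rectangle_def domain_def)
  then show ?case using single by auto
next
  case (split Ms \<sigma> \<tau> M')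
  then have ne: "Ms \<noteq> []" and ex: "\<exists>A B C D. \<forall>M\<in>set Ms. mesh_of_rectangle M A B C D"
    and sp: "\<forall>i. Suc i < length Ms \<longrightarrow> (\<exists>\<sigma> \<tau>. splits (Ms ! i) \<sigma> \<tau> (Ms ! Suc i))"
    and om: "\<exists>\<Omega>. cells (Ms ! 0) = {\<Omega>}" by - (elim conjE, assumption)+
  from ex obtain A B C D where m: "\<forall>M\<in>set Ms. mesh_of_rectangle M A B C D" by (elim exE)
  then have "mesh_of_rectangle (last Ms) A B C D" using ne by simp
  then have "mesh_of_rectangle M' A B C D" using mesh_of_rectangle_split split.hyps(2) by blast
  then have 1: "\<forall>M\<in>set (Ms @ [M']). mesh_of_rectangle M A B C D" using m by simp
  have "\<exists>\<sigma> \<tau>. splits ((Ms @ [M']) ! i) \<sigma> \<tau> ((Ms @ [M']) ! Suc i)" if "Suc i < length (Ms @ [M'])" for i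
  proof (cases "Suc i < length Ms")
    case True then show ?thesis using sp by (simp add: nth_append)
  next
    case False
    then have "i = length Ms - 1" "Suc i = length Ms" using that by auto
    then show ?thesis using split.hyps(2) ne by (auto simp: nth_append last_conv_nth)
  qed
  then show ?case using 1 ne om by (auto simp: nth_append)
qed

lemmas hier_construction_nonempty = hier_construction_props[THEN conjunct1]
lemmas hier_construction_meshes = hier_construction_props[THEN conjunct2, THEN conjunct1]
lemmas hier_construction_splits = hier_construction_props[THEN conjunct2, THEN conjunct2, THEN conjunct1, rule_format]
lemmas hier_construction_start = hier_construction_props[THEN conjunct2, THEN conjunct2, THEN conjunct2]

text \<open>Sets of lines are compared because single edges do not persist: a later vertex may cut
  them.\<close>

lemma lines_mono_hier:
  assumes "hier_construction Ms" "i \<le> j" "j < length Ms"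
  shows "lines d (Ms ! i) \<subseteq> lines d (Ms ! j)"
  using assms(2,3)
proof (induction j rule: dec_induct)
  case (step j)
  obtain A B C D where "\<forall>M\<in>set Ms. mesh_of_rectangle M A B C D"
    using hier_construction_meshes[OF assms(1)] by (elim exE)
  then have m: "mesh_of_rectangle (Ms ! j) A B C D" using step by simp
  obtain \<sigma> \<tau> where "splits (Ms ! j) \<sigma> \<tau> (Ms ! Suc j)"
    using hier_construction_splits[OF assms(1) step.prems] by (elim exE)
  with m obtain e where "lines e (Ms ! Suc j) = lines e (Ms ! j) \<union> \<tau>" "lines (\<not> e) (Ms ! Suc j) = lines (\<not> e) (Ms ! j)"
    by (rule split_effect)
  then have "lines d (Ms ! j) \<subseteq> lines d (Ms ! Suc j)" by (cases "d = e") auto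
  then show ?case using step by auto
qed simp

lemma appearance_le:
  "i < length Ms \<Longrightarrow> \<rho>0 \<in> MIS (Ms ! i) \<Longrightarrow> \<rho>0 \<subseteq> \<rho> \<Longrightarrow> appearance Ms \<rho> \<le> i"
  unfolding appearance_def by (rule Least_le) blast

lemma appearance_witness:
  assumes "i < length Ms" "\<rho>0 \<in> MIS (Ms ! i)" "\<rho>0 \<subseteq> \<rho>"
  shows "appearance Ms \<rho> < length Ms \<and> (\<exists>\<rho>0\<in>MIS (Ms ! appearance Ms \<rho>). \<rho>0 \<subseteq> \<rho>)"
  unfolding appearance_def by (rule LeastI) (use assms in blast)

lemma appearance_last_witness:
  assumes "Ms \<noteq> []" "\<rho> \<in> MIS (last Ms)"
  shows "appearance Ms \<rho> < length Ms \<and> (\<exists>\<rho>0\<in>MIS (Ms ! appearance Ms \<rho>). \<rho>0 \<subseteq> \<rho>)"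
  using assms by (intro appearance_witness[of "length Ms - 1"]) (auto simp: last_conv_nth)

lemma appearance_append:
  assumes "Ms \<noteq> []" "\<rho> \<in> MIS (last Ms)"
  shows "appearance (Ms @ Ns) \<rho> = appearance Ms \<rho>"
proof (rule antisym)
  note w = appearance_last_witness[OF assms]
  then obtain \<rho>0 where r: "\<rho>0 \<in> MIS (Ms ! appearance Ms \<rho>)" "\<rho>0 \<subseteq> \<rho>" by blast
  then show le: "appearance (Ms @ Ns) \<rho> \<le> appearance Ms \<rho>"
    using w by (intro appearance_le[of _ _ \<rho>0]) (auto simp: nth_append)
  have "appearance (Ms @ Ns) \<rho> < length (Ms @ Ns) \<and> (\<exists>\<rho>0\<in>MIS ((Ms @ Ns) ! appearance (Ms @ Ns) \<rho>). \<rho>0 \<subseteq> \<rho>)"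
    using w r by (intro appearance_witness[of "appearance Ms \<rho>" _ \<rho>0]) (auto simp: nth_append)
  then obtain \<rho>1 where "\<rho>1 \<in> MIS ((Ms @ Ns) ! appearance (Ms @ Ns) \<rho>)" "\<rho>1 \<subseteq> \<rho>" by blast
  then show "appearance Ms \<rho> \<le> appearance (Ms @ Ns) \<rho>"
    using le w by (intro appearance_le[of _ _ \<rho>1]) (auto simp: nth_append)
qed

text \<open>The added part \<open>X\<close> belongs to the one component \<open>\<rho>\<close>, so a
  component disjoint from \<open>\<rho>\<close> lies in \<open>S\<close> already.\<close>

lemma components_growth:
  assumes "\<rho> \<in> components S'" "X \<subseteq> \<rho>" "S' = S \<union> X" "C \<in> components S'"
  shows "C \<in> components S \<or> C = \<rho>"
proof (cases "C \<inter> \<rho> = {}")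
  case True
  then have "C \<subseteq> S" using in_components_subset[OF assms(4)] assms(2,3) by blast
  then show ?thesis using components_intermediate_subset[OF assms(4)] assms(3) by blast
next
  case False then show ?thesis using components_eq[OF assms(4,1)] by blast
qed

text \<open>An interior segment takes the place in the ordering of the first of its pieces, and every
  piece of it comes from a splitting; so two segments with the same place share an edge.\<close>

lemma inj_on_appearance:
  assumes h: "hier_construction Ms"
  shows "inj_on (appearance Ms) (MIS (last Ms))"
proof (rule inj_onI)
  fix \<rho> \<rho>' assume r: "\<rho> \<in> MIS (last Ms)" "\<rho>' \<in> MIS (last Ms)" and eq: "appearance Ms \<rho> = appearance Ms \<rho>'"
  note p = hier_construction_nonempty[OF h]
  obtain A B C D where m: "\<forall>M\<in>set Ms. mesh_of_rectangle M A B C D"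
    using hier_construction_meshes[OF h] by (elim exE)
  define i where "i = appearance Ms \<rho>"
  have i: "i < length Ms" using appearance_last_witness r(1) p unfolding i_def by blast
  \<comment> \<open>The first mesh has a single cell and therefore no interior lines, so no segment
    appears at place 0.\<close>
  have "\<exists>k. i = Suc k"
  proof (rule ccontr)
    assume "\<nexists>k. i = Suc k"
    then have "i = 0" by (cases i) auto
    then obtain \<rho>0 where "\<rho>0 \<in> MIS (Ms ! 0)" using appearance_last_witness r(1) p unfolding i_def by metis
    then obtain d where "\<rho>0 \<in> components (lines d (Ms ! 0))" by (auto simp: in_MIS_iff MIS_dir_def)
    then have ne: "lines d (Ms ! 0) \<noteq> {}" by force
    obtain \<Omega> where om: "cells (Ms ! 0) = {\<Omega>}" using hier_construction_start[OF h] by (elim exE)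
    have m0: "mesh_of_rectangle (Ms ! 0) A B C D" using m p by simp
    then have "\<Omega> = {A..B} \<times> {C..D}" using om by (simp add: mesh_of_rectangle_def domain_def)
    then have "hgrid (Ms ! 0) = {A..B} \<times> {C, D}" "vgrid (Ms ! 0) = {A, B} \<times> {C..D}"
      using om m0 by (auto simp: hgrid_def vgrid_def mesh_of_rectangle_def hsides_rectangle vsides_rectangle)
    then have "lines d (Ms ! 0) = {}" using hlines_eq[OF m0] vlines_eq[OF m0] by (auto simp: lines_def)
    then show False using ne by simp
  qed
  then obtain k where k: "i = Suc k" by blast
  obtain \<sigma> \<tau> where sp: "splits (Ms ! k) \<sigma> \<tau> (Ms ! i)"
    using hier_construction_splits[OF h, of k] i k by auto
  have mk: "mesh_of_rectangle (Ms ! k) A B C D" using m i k by simp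
  obtain d where e: "mesh_of_rectangle (Ms ! i) A B C D" "directed d \<tau>" "lines d (Ms ! i) = lines d (Ms ! k) \<union> \<tau>"
    "lines (\<not> d) (Ms ! i) = lines (\<not> d) (Ms ! k)"
    by (rule split_effect[OF mk sp]) (rule that)
  have tmi: "is_tmesh (Ms ! i)" using e(1) by (simp add: mesh_of_rectangle_def)
  have contains: "\<tau> \<subseteq> \<rho>" if r: "\<rho> \<in> MIS (last Ms)" and ir: "appearance Ms \<rho> = i" for \<rho>
  proof -
    obtain \<rho>0 where r0: "\<rho>0 \<in> MIS (Ms ! i)" "\<rho>0 \<subseteq> \<rho>" using appearance_last_witness r p ir by metis
    then obtain d' where d': "\<rho>0 \<in> components (lines d' (Ms ! i))" "\<rho>0 \<inter> frontier (domain (Ms ! i)) = {}"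
      by (auto simp: in_MIS_iff MIS_dir_def)
    \<comment> \<open>A piece present one step earlier would give \<open>\<rho>\<close> an earlier
      place. So \<open>\<rho>0\<close> is the component that the split has changed, the one
      containing \<open>\<tau>\<close>.\<close>
    have "\<rho>0 \<notin> components (lines d' (Ms ! k))"
    proof
      assume "\<rho>0 \<in> components (lines d' (Ms ! k))"
      then have "\<rho>0 \<in> MIS (Ms ! k)" using d'(2) mk e(1) by (auto simp: in_MIS_iff MIS_dir_def mesh_of_rectangle_def)
      then have "appearance Ms \<rho> \<le> k" using r0(2) i k by (intro appearance_le) auto
      then show False using ir k by simp
    qed
    moreover have "\<tau> \<subseteq> lines d (Ms ! i)" using e(3) by blast
    note ms = max_segment_component[OF tmi e(2) this]
    ultimately have "d' = d" "\<rho>0 = max_segment (Ms ! i) \<tau>"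
      using d'(1) e(4) components_growth[OF ms e(3)] by (cases "d' = d"; force)+
    then show ?thesis using ms r0 by blast
  qed
  have t: "\<tau> \<subseteq> \<rho>" "\<tau> \<subseteq> \<rho>'" using contains[OF r(1)] contains[OF r(2)] eq by (auto simp: i_def)
  obtain d1 d2 where d: "\<rho> \<in> components (lines d1 (last Ms))" "\<rho>' \<in> components (lines d2 (last Ms))"
    using r by (auto simp: in_MIS_iff MIS_dir_def)
  have "is_tmesh (last Ms)" using m p by (simp add: mesh_of_rectangle_def)
  then have "d = d1" "d = d2" using direction_unique d t e(2) by blast+
  then show "\<rho> = \<rho>'" using d t components_eq[of \<rho> "lines d (last Ms)" \<rho>'] connected_if_directed[OF e(2)] by blast
qed

section \<open>Weights under subdivision\<close>

lemma edge_src_vertical: "c \<le> d \<Longrightarrow> edge_src ({a} \<times> {c..d}) = (a, c)"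
  and edge_tgt_vertical: "c \<le> d \<Longrightarrow> edge_tgt ({a} \<times> {c..d}) = (a, d)"
  and edge_src_horizontal: "c \<le> d \<Longrightarrow> edge_src ({c..d} \<times> {a}) = (c, a)"
  and edge_tgt_horizontal: "c \<le> d \<Longrightarrow> edge_tgt ({c..d} \<times> {a}) = (d, a)"
  by (simp_all add: edge_src_def edge_tgt_def)

lemma edge_smoothness_vertical:
  assumes "vertical \<tau>" "z \<in> \<tau>"
  shows "edge_smoothness rh rv \<tau> = rh (fst z)"
proof -
  obtain a c d where "c < d" "\<tau> = {a} \<times> {c..d}" using assms(1) by (auto simp: vertical_def)
  then show ?thesis using assms by (auto simp: edge_smoothness_def edge_src_vertical)
qed

lemma edge_smoothness_horizontal:
  assumes "horizontal \<tau>" "z \<in> \<tau>"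
  shows "edge_smoothness rh rv \<tau> = rv (snd z)"
proof -
  obtain a b c where "a < b" "\<tau> = {a..b} \<times> {c}" using assms(1) by (auto simp: horizontal_def)
  moreover have "\<not> vertical \<tau>" using assms(1) not_horizontal_and_vertical by blast
  ultimately show ?thesis using assms by (auto simp: edge_smoothness_def edge_src_horizontal)
qed

text \<open>In this pointwise form the bound passes to meshes with fewer lines and applies directly
  to interior vertices, which lie on lines of both directions.\<close>

lemma smoothness_le_iff:
  "smoothness_le m m' rh rv M \<longleftrightarrow>
    (\<forall>z\<in>lines False M. rh (fst z) \<le> m) \<and> (\<forall>z\<in>lines True M. rv (snd z) \<le> m')"
proof -
  have "(\<forall>\<tau>\<in>interior_vedges M. edge_smoothness rh rv \<tau> \<le> m) \<longleftrightarrow> (\<forall>z\<in>vlines M. rh (fst z) \<le> m)"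
  proof
    assume "\<forall>\<tau>\<in>interior_vedges M. edge_smoothness rh rv \<tau> \<le> m"
    then show "\<forall>z\<in>vlines M. rh (fst z) \<le> m"
      using edge_smoothness_vertical[of _ _ rh rv] by (fastforce simp: vlines_def interior_vedges_def)
  next
    assume *: "\<forall>z\<in>vlines M. rh (fst z) \<le> m"
    show "\<forall>\<tau>\<in>interior_vedges M. edge_smoothness rh rv \<tau> \<le> m"
    proof
      fix \<tau> assume t: "\<tau> \<in> interior_vedges M"
      then have v: "vertical \<tau>" by (simp add: interior_vedges_def)
      then obtain z where z: "z \<in> \<tau>" using connected_if_vertical by blast
      then have "z \<in> vlines M" using t by (auto simp: vlines_def)
      then show "edge_smoothness rh rv \<tau> \<le> m" using * edge_smoothness_vertical[OF v z] by metis
    qed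
  qed
  moreover have "(\<forall>\<tau>\<in>interior_hedges M. edge_smoothness rh rv \<tau> \<le> m') \<longleftrightarrow> (\<forall>z\<in>hlines M. rv (snd z) \<le> m')"
  proof
    assume "\<forall>\<tau>\<in>interior_hedges M. edge_smoothness rh rv \<tau> \<le> m'"
    then show "\<forall>z\<in>hlines M. rv (snd z) \<le> m'"
      using edge_smoothness_horizontal[of _ _ rh rv] by (fastforce simp: hlines_def interior_hedges_def)
  next
    assume *: "\<forall>z\<in>hlines M. rv (snd z) \<le> m'"
    show "\<forall>\<tau>\<in>interior_hedges M. edge_smoothness rh rv \<tau> \<le> m'"
    proof
      fix \<tau> assume t: "\<tau> \<in> interior_hedges M"
      then have v: "horizontal \<tau>" by (simp add: interior_hedges_def)
      then obtain z where z: "z \<in> \<tau>" using connected_if_horizontal by blast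
      then have "z \<in> hlines M" using t by (auto simp: hlines_def)
      then show "edge_smoothness rh rv \<tau> \<le> m'" using * edge_smoothness_horizontal[OF v z] by metis
    qed
  qed
  ultimately show ?thesis by (simp add: smoothness_le_def lines_def)
qed

lemma interior_vertex_lines:
  assumes M: "mesh_of_rectangle M A B C D" and "\<gamma> \<in> vertices M" "\<gamma> \<in> interior (domain M)"
  shows "\<gamma> \<in> lines d M"
proof -
  have tm: "is_tmesh M" and dom: "domain M = {A..B} \<times> {C..D}" using M by (auto simp: mesh_of_rectangle_def)
  then have "\<gamma> \<in> {A<..<B} \<times> {C<..<D}" using assms(3) by (simp add: interior_rectangle)
  then show ?thesis
    using assms(2) by (auto simp: lines_def hlines_eq[OF M] vlines_eq[OF M] vertices_eq[OF tm] mem_Times_iff)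
qed

lemma lines_subset_domain:
  assumes M: "mesh_of_rectangle M A B C D"
  shows "lines d M \<subseteq> domain M"
proof -
  have "is_tmesh M" using M by (simp add: mesh_of_rectangle_def)
  from grid_subset_domain[OF this] show ?thesis by (auto simp: lines_def hlines_eq[OF M] vlines_eq[OF M])
qed

lemma MIS_dir_subset_interior:
  assumes M: "mesh_of_rectangle M A B C D" and r: "\<rho> \<in> MIS_dir d M"
  shows "\<rho> \<subseteq> interior (domain M)"
proof -
  have "\<rho> \<subseteq> domain M"
    using r lines_subset_domain[OF M, of d] in_components_subset[of \<rho> "lines d M"] by (auto simp: MIS_dir_def)
  moreover have "domain M \<subseteq> interior (domain M) \<union> frontier (domain M)"
    using closure_Un_frontier[of "domain M"] by (auto simp: frontier_def)
  ultimately show ?thesis using r by (auto simp: MIS_dir_def)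
qed

lemma MIS_dir_unique: "is_tmesh M \<Longrightarrow> \<rho> \<in> MIS_dir d M \<Longrightarrow> \<rho> \<in> MIS_dir e M \<Longrightarrow> d = e"
  using direction_components_unique[of M M \<rho> d \<rho> e] by (auto simp: MIS_dir_def)

lemma finite_vertices: "is_tmesh M \<Longrightarrow> finite (vertices M)"
proof -
  assume M: "is_tmesh M"
  have "finite (rel_frontier \<tau>)" if "\<tau> \<in> edges M" for \<tau>
    using is_tmeshD(4)[OF M that] unfolding horizontal_def vertical_def
    by (auto simp: rel_frontier_horizontal rel_frontier_vertical)
  then show ?thesis using is_tmeshD(3)[OF M] by (auto simp: vertices_def)
qed

lemma seg_weight_MIS_dir:
  assumes "is_tmesh (last Ms)" "\<rho> \<in> MIS_dir d (last Ms)"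
  shows "seg_weight m m' rh rv Ms \<rho> = (\<Sum>\<gamma>\<in>counted_vertices Ms \<rho>.
      if d then int m - int (rh (fst \<gamma>)) else int m' - int (rv (snd \<gamma>)))"
proof -
  have "\<rho> \<in> MIS_h (last Ms) \<longleftrightarrow> d"
    using MIS_dir_unique[OF assms, of True] assms(2) unfolding MIS_hv_eq by (cases d) auto
  then show ?thesis by (simp add: seg_weight_def)
qed

lemma weighted_iff:
  assumes "is_tmesh (last Ms)"
  shows "weighted m m' k k' rh rv Ms \<longleftrightarrow>
    (\<forall>d. \<forall>\<rho>\<in>MIS_dir d (last Ms). seg_weight m m' rh rv Ms \<rho> \<ge> int (if d then k else k'))"
  by (simp add: weighted_def MIS_hv_eq all_bool_eq)

lemma heavy_segment_iff:
  assumes "is_tmesh (last Ms)" "\<rho> \<in> MIS_dir d (last Ms)"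
  shows "heavy_segment m m' k k' rh rv Ms \<rho> \<longleftrightarrow> seg_weight m m' rh rv Ms \<rho> \<ge> int (if d then k else k')"
  using MIS_dir_unique[OF assms, of True] MIS_dir_unique[OF assms, of False] assms(2)
  by (cases d) (auto simp: heavy_segment_def MIS_hv_eq)

text \<open>The mesh \<open>last (Ms @ Ns)\<close> arises from \<open>last Ms\<close> by adding a part \<open>X\<close> of its segment \<open>\<rho>\<close>.\<close>

locale segment_growth =
  fixes Ms Ns :: "tmesh list" and \<rho> \<tau> X :: "point set" and d :: bool and A B C D :: real
  assumes hier: "hier_construction Ms" "hier_construction (Ms @ Ns)"
    and M: "mesh_of_rectangle (last Ms) A B C D" and N: "mesh_of_rectangle (last (Ms @ Ns)) A B C D"
    and \<rho>: "\<rho> \<in> components (lines d (last (Ms @ Ns)))" and X: "X \<subseteq> \<rho>"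
    and grow: "lines d (last (Ms @ Ns)) = lines d (last Ms) \<union> X"
      "lines (\<not> d) (last (Ms @ Ns)) = lines (\<not> d) (last Ms)"
    and new: "\<tau> \<subseteq> \<rho>" "\<not> \<tau> \<subseteq> lines d (last Ms)"
    and verts: "vertices (last Ms) \<subseteq> vertices (last (Ms @ Ns))"
begin

abbreviation "Ms' \<equiv> Ms @ Ns"

lemma tm: "is_tmesh (last Ms)" "is_tmesh (last Ms')" and dom: "domain (last Ms') = domain (last Ms)"
  using M N by (simp_all add: mesh_of_rectangle_def)

lemma nonempty: "Ms \<noteq> []"
  using hier(1) by (rule hier_construction_nonempty)

lemma MIS_cases:
  assumes "\<mu> \<in> MIS_dir e (last Ms')"
  shows "\<mu> \<in> MIS_dir e (last Ms) \<or> \<mu> = \<rho> \<and> e = d"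
proof (cases "e = d")
  case True
  then show ?thesis
    using assms components_growth[OF \<rho> X grow(1), of \<mu>] dom by (auto simp: MIS_dir_def)
next
  case False
  then have "e = (\<not> d)" by simp
  then show ?thesis using assms grow(2) dom by (auto simp: MIS_dir_def)
qed

lemma component_below:
  assumes "\<rho>0 \<in> components (lines d (last Ms))" "\<rho>0 \<inter> \<rho> \<noteq> {}"
  shows "\<rho>0 \<subseteq> \<rho>"
proof -
  have "\<rho>0 \<subseteq> lines d (last Ms')" using in_components_subset[OF assms(1)] grow(1) by blast
  then show ?thesis
    using components_maximal[OF \<rho>, of \<rho>0] in_components_connected[OF assms(1)] assms(2) by blast
qed

text \<open>Since \<open>\<rho>\<close> contains an old segment, its place falls into
  \<open>Ms\<close>. The piece that realises this place has grown to a component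
  \<open>\<rho>1\<close> of the last old mesh, which has the same place; it differs from
  \<open>\<rho>\<close> because \<open>\<tau>\<close> is new.\<close>

lemma oldest_piece:
  assumes "\<rho> \<in> MIS_dir d (last Ms')" "\<rho>0 \<in> components (lines e (last Ms))" "\<rho>0 \<subseteq> \<rho>"
  obtains \<rho>1 where "\<rho>1 \<in> MIS_dir d (last Ms)" "\<rho>1 \<subset> \<rho>" "appearance Ms \<rho>1 = appearance Ms' \<rho>"
proof -
  define i where "i = appearance Ms' \<rho>"
  have fr: "\<rho> \<inter> frontier (domain (last Ms)) = {}" using assms(1) dom by (simp add: MIS_dir_def)
  have upper: "\<exists>j<length Ms. appearance Ms' \<rho> \<le> j" "appearance Ms' \<rho> \<le> appearance Ms \<mu>"
    if "\<mu> \<in> MIS (last Ms)" "\<mu> \<subseteq> \<rho>" for \<mu>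
  proof -
    note w = appearance_last_witness[OF nonempty that(1)]
    then obtain \<nu> where "\<nu> \<in> MIS (Ms ! appearance Ms \<mu>)" "\<nu> \<subseteq> \<mu>" by blast
    then show "appearance Ms' \<rho> \<le> appearance Ms \<mu>"
      using w that(2) by (intro appearance_le[of _ _ \<nu>]) (auto simp: nth_append)
    then show "\<exists>j<length Ms. appearance Ms' \<rho> \<le> j" using w by blast
  qed
  have "\<rho>0 \<in> MIS (last Ms)" using assms(2,3) fr by (auto simp: in_MIS_iff MIS_dir_def)
  then have i: "i < length Ms" using upper(1) assms(3) unfolding i_def by fastforce
  have "\<rho> \<in> MIS (last Ms')" using assms(1) in_MIS_iff by blast
  then obtain \<rho>2 where "\<rho>2 \<in> MIS (Ms' ! i)" and r2: "\<rho>2 \<subseteq> \<rho>"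
    using appearance_last_witness[of Ms' \<rho>] nonempty unfolding i_def by auto
  then have r2m: "\<rho>2 \<in> MIS (Ms ! i)" using i by (simp add: nth_append)
  then obtain e' where e': "\<rho>2 \<in> components (lines e' (Ms ! i))" by (auto simp: in_MIS_iff MIS_dir_def)
  obtain A' B' C' D' where "\<forall>M\<in>set Ms. mesh_of_rectangle M A' B' C' D'"
    using hier_construction_meshes[OF hier(1)] by (elim exE)
  then have "is_tmesh (Ms ! i)" using i by (simp add: mesh_of_rectangle_def)
  then have "e' = d" using direction_components_unique[OF _ tm(2) e' r2 \<rho>] by simp
  moreover have "lines d (Ms ! i) \<subseteq> lines d (last Ms)"
    using lines_mono_hier[OF hier(1), of i "length Ms - 1"] i nonempty by (simp add: last_conv_nth)
  ultimately obtain \<rho>1 where r1: "\<rho>1 \<in> components (lines d (last Ms))" "\<rho>2 \<subseteq> \<rho>1"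
    using component_mono e' by blast
  have "\<rho>2 \<noteq> {}" using in_components_nonempty[OF e'] .
  then have sub: "\<rho>1 \<subseteq> \<rho>" using component_below[OF r1(1)] r1(2) r2 by blast
  then have mis: "\<rho>1 \<in> MIS_dir d (last Ms)" using r1(1) fr by (auto simp: MIS_dir_def)
  have "appearance Ms \<rho>1 \<le> i" using appearance_le[OF i r2m r1(2)] .
  moreover have "i \<le> appearance Ms \<rho>1" using upper(2) mis sub in_MIS_iff unfolding i_def by blast
  moreover have "\<rho>1 \<noteq> \<rho>" using in_components_subset[OF r1(1)] new by blast
  ultimately show ?thesis using that[OF mis] sub by (simp add: i_def psubset_eq)
qed

text \<open>A counted vertex could be lost only to a segment through it with a later place. Old
  segments keep their places. If \<open>\<rho>\<close> passes through the vertex, then a line of its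
  direction did so before, since an interior vertex has lines of both directions; the place of
  \<open>\<rho>\<close> is at most that of the old piece there.\<close>

lemma counted_vertices_mono:
  assumes "\<mu> \<in> MIS_dir e (last Ms)" "\<mu> \<subseteq> \<mu>'" "appearance Ms' \<mu>' = appearance Ms \<mu>"
  shows "counted_vertices Ms \<mu> \<subseteq> counted_vertices Ms' \<mu>'"
proof
  fix \<gamma> assume g: "\<gamma> \<in> counted_vertices Ms \<mu>"
  then have v: "\<gamma> \<in> vertices (last Ms)" "\<gamma> \<in> \<mu>"
    and c: "\<And>\<nu>. \<nu> \<in> MIS (last Ms) \<Longrightarrow> \<gamma> \<in> \<nu> \<Longrightarrow> appearance Ms \<nu> \<le> appearance Ms \<mu>"
    by (auto simp: counted_vertices_def not_less)
  have "appearance Ms' \<nu> \<le> appearance Ms' \<mu>'" if n: "\<nu> \<in> MIS (last Ms')" "\<gamma> \<in> \<nu>" for \<nu>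
  proof -
    obtain e' where e': "\<nu> \<in> MIS_dir e' (last Ms')" using n(1) in_MIS_iff by blast
    then consider "\<nu> \<in> MIS_dir e' (last Ms)" | "\<nu> = \<rho>" "e' = d" using MIS_cases by blast
    then show ?thesis
    proof cases
      case 1
      then have "\<nu> \<in> MIS (last Ms)" using in_MIS_iff by blast
      then show ?thesis using c[of \<nu>] n(2) appearance_append[OF nonempty, of \<nu> Ns] assms(3) by simp
    next
      case 2
      have "\<gamma> \<in> interior (domain (last Ms))" using MIS_dir_subset_interior[OF M assms(1)] v(2) by blast
      then have "\<gamma> \<in> lines d (last Ms)" using interior_vertex_lines[OF M v(1)] by blast
      then obtain \<rho>0 where r0: "\<rho>0 \<in> components (lines d (last Ms))" "\<gamma> \<in> \<rho>0"
        using Union_components by blast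
      then have sub: "\<rho>0 \<subseteq> \<rho>" using component_below n(2) 2 by blast
      then have mis: "\<rho>0 \<in> MIS (last Ms)" using r0 e' 2 dom by (auto simp: in_MIS_iff MIS_dir_def)
      note w = appearance_last_witness[OF nonempty mis]
      then obtain \<rho>1 where "\<rho>1 \<in> MIS (Ms ! appearance Ms \<rho>0)" "\<rho>1 \<subseteq> \<rho>0" by blast
      then have "appearance Ms' \<rho> \<le> appearance Ms \<rho>0"
        using w sub by (intro appearance_le[of _ _ \<rho>1]) (auto simp: nth_append)
      then show ?thesis using c[OF mis r0(2)] assms(3) 2 by simp
    qed
  qed
  then show "\<gamma> \<in> counted_vertices Ms' \<mu>'"
    using v assms(2) verts by (auto simp: counted_vertices_def not_less)
qed

text \<open>No vertex is lost, and the smoothness bound makes every additional summand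
  nonnegative.\<close>

lemma seg_weight_mono:
  assumes sm: "smoothness_le m m' rh rv (last Ms')"
    and mu: "\<mu> \<in> MIS_dir e (last Ms)" "\<mu>' \<in> MIS_dir e (last Ms')" "\<mu> \<subseteq> \<mu>'" "appearance Ms' \<mu>' = appearance Ms \<mu>"
  shows "seg_weight m m' rh rv Ms \<mu> \<le> seg_weight m m' rh rv Ms' \<mu>'"
  unfolding seg_weight_MIS_dir[OF tm(1) mu(1)] seg_weight_MIS_dir[OF tm(2) mu(2)]
proof (rule sum_mono2)
  show "finite (counted_vertices Ms' \<mu>')"
    using finite_vertices[OF tm(2)] by (rule rev_finite_subset) (auto simp: counted_vertices_def)
  show "counted_vertices Ms \<mu> \<subseteq> counted_vertices Ms' \<mu>'" using counted_vertices_mono mu(1,3,4) .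
  fix \<gamma> assume "\<gamma> \<in> counted_vertices Ms' \<mu>' - counted_vertices Ms \<mu>"
  then have "\<gamma> \<in> vertices (last Ms')" "\<gamma> \<in> interior (domain (last Ms'))"
    using MIS_dir_subset_interior[OF N mu(2)] by (auto simp: counted_vertices_def)
  then have "\<gamma> \<in> lines e (last Ms')" for e using interior_vertex_lines[OF N] by blast
  then show "0 \<le> (if e then int m - int (rh (fst \<gamma>)) else int m' - int (rv (snd \<gamma>)))"
    using sm unfolding smoothness_le_iff by (auto dest!: bspec)
qed

text \<open>Only \<open>\<rho>\<close> itself can be a new segment. If it has an old piece, it
  inherits the weight of the oldest one; otherwise the rule has to provide the weight.\<close>

lemma weighted_growth:
  assumes sm: "smoothness_le m m' rh rv (last Ms')" and w: "weighted m m' k k' rh rv Ms"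
    and r: "\<rho> \<in> MIS_dir d (last Ms') \<Longrightarrow>
      (\<exists>\<rho>0\<in>components (lines d (last Ms)). \<rho>0 \<subseteq> \<rho>) \<or> heavy_segment m m' k k' rh rv Ms' \<rho>"
  shows "weighted m m' k k' rh rv Ms'"
  unfolding weighted_iff[OF tm(2)]
proof (intro allI ballI)
  fix e \<mu> assume mu: "\<mu> \<in> MIS_dir e (last Ms')"
  consider (old) "\<mu> \<in> MIS_dir e (last Ms)" | (new) "\<mu> = \<rho>" "e = d" using MIS_cases[OF mu] by blast
  then show "int (if e then k else k') \<le> seg_weight m m' rh rv Ms' \<mu>"
  proof cases
    case old
    then have "\<mu> \<in> MIS (last Ms)" using in_MIS_iff by blast
    then have "seg_weight m m' rh rv Ms \<mu> \<le> seg_weight m m' rh rv Ms' \<mu>"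
      using seg_weight_mono[OF sm old mu] appearance_append[OF nonempty] by blast
    moreover have "int (if e then k else k') \<le> seg_weight m m' rh rv Ms \<mu>"
      using w old unfolding weighted_iff[OF tm(1)] by blast
    ultimately show ?thesis by linarith
  next
    case new
    then have rm: "\<rho> \<in> MIS_dir d (last Ms')" using mu by simp
    from r[OF rm] show ?thesis
    proof
      assume "\<exists>\<rho>0\<in>components (lines d (last Ms)). \<rho>0 \<subseteq> \<rho>"
      then obtain \<rho>1 where r1: "\<rho>1 \<in> MIS_dir d (last Ms)" "\<rho>1 \<subset> \<rho>" "appearance Ms \<rho>1 = appearance Ms' \<rho>"
        using oldest_piece[OF rm] by blast
      then have "seg_weight m m' rh rv Ms \<rho>1 \<le> seg_weight m m' rh rv Ms' \<rho>"
        using seg_weight_mono[OF sm r1(1) rm] by (simp add: psubset_imp_subset)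
      moreover have "int (if d then k else k') \<le> seg_weight m m' rh rv Ms \<rho>1"
        using w r1(1) unfolding weighted_iff[OF tm(1)] by blast
      ultimately show ?thesis using new by simp
    next
      assume "heavy_segment m m' k k' rh rv Ms' \<rho>"
      then show ?thesis using heavy_segment_iff[OF tm(2) rm] new by simp
    qed
  qed
qed

end

section \<open>One application of the subdivision rule\<close>

lemma hier_construction_extension:
  assumes "extension \<tau> M Ns" "hier_construction Ms" "last Ms = M"
  shows "hier_construction (Ms @ Ns)"
  using assms
proof (induction arbitrary: Ms rule: extension.induct)
  case (step M \<sigma> \<tau>' M' Ns)
  then have "hier_construction (Ms @ [M'])" by (metis hier_construction.split)
  then have "hier_construction ((Ms @ [M']) @ Ns)" by (rule step.IH) simp
  then show ?case by simp
qed simp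

text \<open>Each prolongation lies in the maximal segment of \<open>\<tau>\<close> at its time,
  which has the direction of \<open>\<tau>\<close> and is contained in the final one.
  \<open>X\<close> collects the prolongations.\<close>

lemma extension_growth:
  assumes "extension \<tau> M Ns" "mesh_of_rectangle M A B C D" "directed d \<tau>" "\<tau> \<subseteq> lines d M"
  shows "mesh_of_rectangle (last (M # Ns)) A B C D \<and>
    lines (\<not> d) (last (M # Ns)) = lines (\<not> d) M \<and> vertices M \<subseteq> vertices (last (M # Ns)) \<and>
    (\<exists>X\<subseteq>max_segment (last (M # Ns)) \<tau>. lines d (last (M # Ns)) = lines d M \<union> X)"
  using assms
proof (induction rule: extension.induct)
  case (step M \<sigma> \<tau>' M' Ns)
  obtain e where e: "mesh_of_rectangle M' A B C D" "directed e \<tau>'"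
    "lines e M' = lines e M \<union> \<tau>'" "lines (\<not> e) M' = lines (\<not> e) M" "vertices M \<subseteq> vertices M'"
    by (rule split_effect[OF step.prems(1) step.hyps(1)]) (rule that)
  have tm': "is_tmesh M'" using e(1) by (simp add: mesh_of_rectangle_def)
  have sub: "\<tau> \<subseteq> lines d M'" using e(3,4) step.prems(3) by (cases "d = e") auto
  note ms' = max_segment_component[OF tm' step.prems(2) sub]
  have ed: "e = d" using direction_unique[OF tm' ms'(1) step.hyps(2) e(2)] .
  from step.IH[OF e(1) step.prems(2) sub]
  obtain X where N: "mesh_of_rectangle (last (M' # Ns)) A B C D"
    "lines (\<not> d) (last (M' # Ns)) = lines (\<not> d) M'" "vertices M' \<subseteq> vertices (last (M' # Ns))" and
    X: "X \<subseteq> max_segment (last (M' # Ns)) \<tau>" "lines d (last (M' # Ns)) = lines d M' \<union> X" by blast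
  have tmN: "is_tmesh (last (M' # Ns))" using N(1) by (simp add: mesh_of_rectangle_def)
  have "\<tau> \<subseteq> lines d (last (M' # Ns))" using sub X(2) by blast
  note msN = max_segment_component[OF tmN step.prems(2) this]
  have "max_segment M' \<tau> \<subseteq> max_segment (last (M' # Ns)) \<tau>"
  proof (rule components_maximal[OF msN(1)])
    show "connected (max_segment M' \<tau>)" using in_components_connected[OF ms'(1)] .
    show "max_segment M' \<tau> \<subseteq> lines d (last (M' # Ns))" using in_components_subset[OF ms'(1)] X(2) by blast
    show "max_segment (last (M' # Ns)) \<tau> \<inter> max_segment M' \<tau> \<noteq> {}"
      using ms'(2) msN(2) connected_if_directed[OF step.prems(2)] by blast
  qed
  then have "\<tau>' \<union> X \<subseteq> max_segment (last (M' # Ns)) \<tau>" using step.hyps(2) X(1) by blast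
  moreover have "lines d (last (M' # Ns)) = lines d M \<union> (\<tau>' \<union> X)" using X(2) e(3) ed by auto
  ultimately show ?case using N e ed by (auto simp del: last.simps simp: last_ConsR)
qed auto

text \<open>An application, however many cells it cuts, enlarges one maximal segment only, by
  \<open>\<tau> \<union> X\<close>. It is treated as a single growth step because the meshes in
  between need not be weighted.\<close>

lemma rule_application_growth:
  assumes h: "hier_construction Ms" and ra: "rule_application m m' k k' rh rv \<tau> Ms Ms'"
  obtains Ns X d A B C D where "Ms' = Ms @ Ns" "directed d \<tau>"
    "segment_growth Ms Ns (max_segment (last Ms') \<tau>) \<tau> X d A B C D"
    "extends_segment (last Ms) \<tau> \<or> max_segment (last Ms') \<tau> \<inter> frontier (domain (last Ms')) \<noteq> {} \<or>
      heavy_segment m m' k k' rh rv Ms' (max_segment (last Ms') \<tau>)"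
proof -
  obtain \<sigma> M1 Ns where sp: "splits (last Ms) \<sigma> \<tau> M1" and Ms': "Ms' = Ms @ M1 # Ns"
    and rule: "if extends_segment (last Ms) \<tau> then Ns = [] else extension \<tau> M1 Ns \<and>
              (max_segment (last Ms') \<tau> \<inter> frontier (domain (last Ms')) \<noteq> {} \<or>
               heavy_segment m m' k k' rh rv Ms' (max_segment (last Ms') \<tau>))"
    using ra unfolding rule_application_def by (elim exE conjE) (rule that)
  \<comment> \<open>If \<open>\<tau>\<close> extends a segment, \<open>Ns\<close> is empty, which is
    the trivial extension; so both branches of the rule are covered.\<close>
  have ext: "extension \<tau> M1 Ns" using rule extension.stop by (auto split: if_splits)
  have ne: "Ms \<noteq> []" using hier_construction_nonempty[OF h] .
  obtain A B C D where "\<forall>M\<in>set Ms. mesh_of_rectangle M A B C D"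
    using hier_construction_meshes[OF h] by (elim exE)
  then have M: "mesh_of_rectangle (last Ms) A B C D" using ne by simp
  obtain d where d: "mesh_of_rectangle M1 A B C D" "directed d \<tau>"
    "lines d M1 = lines d (last Ms) \<union> \<tau>" "lines (\<not> d) M1 = lines (\<not> d) (last Ms)" "\<not> \<tau> \<subseteq> lines d (last Ms)"
    "vertices (last Ms) \<subseteq> vertices M1"
    by (rule split_effect[OF M sp]) (rule that)
  have l: "last Ms' = last (M1 # Ns)" by (simp add: Ms')
  have sub: "\<tau> \<subseteq> lines d M1" using d(3) by blast
  obtain X where N: "mesh_of_rectangle (last Ms') A B C D"
    "lines (\<not> d) (last Ms') = lines (\<not> d) M1" "vertices M1 \<subseteq> vertices (last Ms')"
    and X: "X \<subseteq> max_segment (last Ms') \<tau>" "lines d (last Ms') = lines d M1 \<union> X"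
    using extension_growth[OF ext d(1,2) sub] unfolding l by blast
  have tmN: "is_tmesh (last Ms')" using N(1) by (simp add: mesh_of_rectangle_def)
  have "\<tau> \<subseteq> lines d (last Ms')" using sub X(2) by blast
  note ms = max_segment_component[OF tmN d(2) this]
  have "hier_construction (Ms @ [M1])" using h sp by (rule hier_construction.split)
  from hier_construction_extension[OF ext this] have h': "hier_construction Ms'" by (simp add: Ms')
  have "segment_growth Ms (M1 # Ns) (max_segment (last Ms') \<tau>) \<tau> (\<tau> \<union> X) d A B C D"
    using h h' M N X ms d unfolding Ms' by unfold_locales auto
  then show ?thesis using that[OF Ms' d(2)] rule by (auto split: if_splits)
qed

text \<open>The cases are separated by whether \<open>\<rho>\<close> reaches the boundary and
  whether it contains an old segment. If neither happens, \<open>\<tau>\<close> extends nothing and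
  the rule demands a heavy segment.\<close>

lemma rule_application_classification:
  assumes h: "hier_construction Ms" and ra: "rule_application m m' k k' rh rv \<tau> Ms Ms'"
    and sm: "smoothness_le m m' rh rv (last Ms')" and \<rho>: "\<rho> = max_segment (last Ms') \<tau>"
  shows "((\<forall>\<rho>0\<in>max_segments (last Ms). \<not> \<rho>0 \<subseteq> \<rho>) \<and> heavy_segment m m' k k' rh rv Ms' \<rho>) \<or>
           (\<exists>\<rho>0\<in>MIS (last Ms). \<rho> \<in> MIS (last Ms') \<and> \<rho>0 \<subset> \<rho> \<and>
              seg_weight m m' rh rv Ms \<rho>0 \<le> seg_weight m m' rh rv Ms' \<rho>) \<or>
           (\<rho> \<in> max_segments (last Ms') \<and> \<rho> \<inter> frontier (domain (last Ms')) \<noteq> {})"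
    and "weighted m m' k k' rh rv Ms \<Longrightarrow> weighted m m' k k' rh rv Ms'"
    and "hier_construction Ms'" "smoothness_le m m' rh rv (last Ms)"
proof -
  obtain Ns X d A B C D where Ms': "Ms' = Ms @ Ns" and d: "directed d \<tau>" and g: "segment_growth Ms Ns \<rho> \<tau> X d A B C D"
    and rule: "extends_segment (last Ms) \<tau> \<or> \<rho> \<inter> frontier (domain (last Ms')) \<noteq> {} \<or> heavy_segment m m' k k' rh rv Ms' \<rho>"
    by (rule rule_application_growth[OF h ra]) (rule that; simp add: \<rho>)
  interpret segment_growth Ms Ns \<rho> \<tau> X d A B C D by (rule g)
  have piece: "\<exists>\<rho>0\<in>components (lines d (last Ms)). \<rho>0 \<subseteq> \<rho>" if e: "extends_segment (last Ms) \<tau>"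
  proof -
    have "\<exists>\<rho>0\<in>components (lines d (last Ms)). \<rho>0 \<inter> \<tau> \<noteq> {}"
      using e d not_horizontal_and_vertical[of \<tau>]
      unfolding extends_segment_def lines_def directed_def max_connected_unions_interior_edges by (cases d) auto
    then show ?thesis using component_below new(1) by blast
  qed
  show "weighted m m' k k' rh rv Ms \<Longrightarrow> weighted m m' k k' rh rv Ms'"
    unfolding Ms'
  proof (rule weighted_growth)
    assume "\<rho> \<in> MIS_dir d (last (Ms @ Ns))"
    then show "(\<exists>\<rho>0\<in>components (lines d (last Ms)). \<rho>0 \<subseteq> \<rho>) \<or> heavy_segment m m' k k' rh rv (Ms @ Ns) \<rho>"
      using rule piece unfolding Ms' by (auto simp: MIS_dir_def)
  qed (use sm Ms' in auto)
  show "hier_construction Ms'" using hier(2) Ms' by simp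
  have "lines e (last Ms) \<subseteq> lines e (last Ms')" for e using grow unfolding Ms' by (cases "e = d") auto
  then show "smoothness_le m m' rh rv (last Ms)" using sm unfolding smoothness_le_iff by blast
  show "((\<forall>\<rho>0\<in>max_segments (last Ms). \<not> \<rho>0 \<subseteq> \<rho>) \<and> heavy_segment m m' k k' rh rv Ms' \<rho>) \<or>
           (\<exists>\<rho>0\<in>MIS (last Ms). \<rho> \<in> MIS (last Ms') \<and> \<rho>0 \<subset> \<rho> \<and>
              seg_weight m m' rh rv Ms \<rho>0 \<le> seg_weight m m' rh rv Ms' \<rho>) \<or>
           (\<rho> \<in> max_segments (last Ms') \<and> \<rho> \<inter> frontier (domain (last Ms')) \<noteq> {})"
  proof (cases "\<rho> \<inter> frontier (domain (last Ms')) = {}")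
    case False
    then show ?thesis using segment_growth.\<rho>[OF g] in_max_segments_iff Ms' by blast
  next
    case True
    then have mis: "\<rho> \<in> MIS_dir d (last Ms')" using segment_growth.\<rho>[OF g] by (simp add: MIS_dir_def Ms')
    show ?thesis
    proof (cases "\<exists>\<rho>0\<in>max_segments (last Ms). \<rho>0 \<subseteq> \<rho>")
      case True
      then obtain \<rho>0 e where "\<rho>0 \<in> components (lines e (last Ms))" "\<rho>0 \<subseteq> \<rho>" using in_max_segments_iff by blast
      then obtain \<rho>1 where r1: "\<rho>1 \<in> MIS_dir d (last Ms)" "\<rho>1 \<subset> \<rho>" "appearance Ms \<rho>1 = appearance Ms' \<rho>"
        using oldest_piece mis unfolding Ms' by metis
      then have "seg_weight m m' rh rv Ms \<rho>1 \<le> seg_weight m m' rh rv Ms' \<rho>"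
        using seg_weight_mono[of m m' rh rv \<rho>1 d \<rho>] sm mis unfolding Ms' by auto
      moreover have "\<rho>1 \<in> MIS (last Ms)" "\<rho> \<in> MIS (last Ms')" using r1(1) mis in_MIS_iff by blast+
      ultimately show ?thesis using r1(2) by blast
    next
      case False
      then have "\<not> extends_segment (last Ms) \<tau>" using piece in_max_segments_iff by blast
      then show ?thesis using rule True False by blast
    qed
  qed
qed

lemma obtained_by_rule_weighted:
  assumes "obtained_by_rule m m' k k' rh rv M" "smoothness_le m m' rh rv M"
  obtains Ms where "hier_construction Ms" "last Ms = M" "weighted m m' k k' rh rv Ms"
proof -
  obtain Ms0 Ms where Ms0: "hier_construction Ms0" "weighted m m' k k' rh rv Ms0"
    and steps: "(\<lambda>Ns Ns'. \<exists>\<tau>. rule_application m m' k k' rh rv \<tau> Ns Ns')\<^sup>*\<^sup>* Ms0 Ms" and M: "M = last Ms"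
    using assms(1) unfolding obtained_by_rule_def by (elim exE conjE) (rule that)
  \<comment> \<open>Smoothness is assumed for the final mesh only, so the invariant is an
    implication; the bound for a mesh implies the bound for its predecessor.\<close>
  from steps have "smoothness_le m m' rh rv (last Ms) \<longrightarrow> hier_construction Ms \<and> weighted m m' k k' rh rv Ms"
    and "hier_construction Ms"
  proof (induction rule: rtranclp_induct)
    case base
    show "smoothness_le m m' rh rv (last Ms0) \<longrightarrow> hier_construction Ms0 \<and> weighted m m' k k' rh rv Ms0"
      "hier_construction Ms0" using Ms0 by auto
  next
    case (step Ns Ns')
    from step.hyps(2) obtain \<tau> where ra: "rule_application m m' k k' rh rv \<tau> Ns Ns'" by (elim exE)
    obtain Ls X d A B C D where "Ns' = Ns @ Ls" "segment_growth Ns Ls (max_segment (last Ns') \<tau>) \<tau> X d A B C D"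
      by (rule rule_application_growth[OF step.IH(2) ra]) (rule that)
    then show "hier_construction Ns'" using segment_growth.hier(2) by blast
    show "smoothness_le m m' rh rv (last Ns') \<longrightarrow> hier_construction Ns' \<and> weighted m m' k k' rh rv Ns'"
    proof
      assume sm: "smoothness_le m m' rh rv (last Ns')"
      note c = rule_application_classification[OF step.IH(2) ra sm refl]
      show "hier_construction Ns' \<and> weighted m m' k k' rh rv Ns'" using c(2-4) step.IH by blast
    qed
  qed
  then show ?thesis using that M assms(2) by blast
qed

section \<open>T-meshes on a grid\<close>

lemma interior_vedge_iff:
  assumes M: "mesh_of_rectangle M A B C D" and t: "\<tau> \<in> edges M" "c < d" "\<tau> = {a} \<times> {c..d}"
  shows "\<tau> \<in> interior_vedges M \<longleftrightarrow> A < a \<and> a < B"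
proof -
  have "flip \<tau> \<in> edges (transpose_mesh M)" using t(1) by (simp only: transpose_mesh_simps flip_in_flip_image)
  then have "flip \<tau> \<in> interior_hedges (transpose_mesh M) \<longleftrightarrow> A < a \<and> a < B"
    using t(2,3) interior_hedge_iff[OF mesh_of_rectangle_transpose[OF M]] by simp
  then show ?thesis by (simp add: interior_hvedges_transpose)
qed

text \<open>The lines through the sides of the cells are numbered by \<open>S\<close> and \<open>T\<close>; only the values up to
  \<open>n\<close> and \<open>l\<close> matter.\<close>

locale mesh_grid =
  fixes M :: tmesh and S T :: "nat \<Rightarrow> real" and n l :: nat
  assumes mesh: "is_tmesh M" and S: "strict_mono S" and T: "strict_mono T" and pos: "0 < n" "0 < l"
    and dom: "domain M = {S 0..S n} \<times> {T 0..T l}"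
    and cells_grid: "\<And>\<sigma>. \<sigma> \<in> cells M \<Longrightarrow>
      \<exists>i1 i2 j1 j2. i1 < i2 \<and> i2 \<le> n \<and> j1 < j2 \<and> j2 \<le> l \<and> \<sigma> = {S i1..S i2} \<times> {T j1..T j2}"
begin

lemma S_simps [simp]: "S i \<le> S j \<longleftrightarrow> i \<le> j" "S i < S j \<longleftrightarrow> i < j" "S i = S j \<longleftrightarrow> i = j"
  using S by (auto simp: strict_mono_less_eq strict_mono_less strict_mono_eq)

lemma T_simps [simp]: "T i \<le> T j \<longleftrightarrow> i \<le> j" "T i < T j \<longleftrightarrow> i < j" "T i = T j \<longleftrightarrow> i = j"
  using T by (auto simp: strict_mono_less_eq strict_mono_less strict_mono_eq)

lemma transpose_grid: "mesh_grid (transpose_mesh M) T S l n"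
proof
  fix \<sigma> assume "\<sigma> \<in> cells (transpose_mesh M)"
  then obtain \<sigma>' where "\<sigma>' \<in> cells M" "\<sigma> = flip \<sigma>'" by auto
  then obtain i1 i2 j1 j2 where "i1 < i2" "i2 \<le> n" "j1 < j2" "j2 \<le> l" "\<sigma> = {T j1..T j2} \<times> {S i1..S i2}"
    using cells_grid[of \<sigma>'] by auto
  then show "\<exists>j1 j2 i1 i2. j1 < j2 \<and> j2 \<le> l \<and> i1 < i2 \<and> i2 \<le> n \<and> \<sigma> = {T j1..T j2} \<times> {S i1..S i2}" by blast
qed (use mesh S T pos dom in auto)

lemma rect: "mesh_of_rectangle M (S 0) (S n) (T 0) (T l)"
  using mesh dom pos by (simp add: mesh_of_rectangle_def)

definition square :: "nat \<Rightarrow> nat \<Rightarrow> point set" where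
  "square i j = {S i..S (Suc i)} \<times> {T j..T (Suc j)}"

text \<open>Meaningful for \<open>i < n\<close> and \<open>j < l\<close> only: there exactly one
  cell contains the square.\<close>

definition cell_at :: "nat \<Rightarrow> nat \<Rightarrow> point set" where
  "cell_at i j = (THE \<sigma>. \<sigma> \<in> cells M \<and> square i j \<subseteq> \<sigma>)"

lemma square_subset_iff:
  "square i j \<subseteq> {S i1..S i2} \<times> {T j1..T j2} \<longleftrightarrow> i1 \<le> i \<and> i < i2 \<and> j1 \<le> j \<and> j < j2"
proof -
  have "S i \<le> S (Suc i)" "T j \<le> T (Suc j)" by simp_all
  then show ?thesis unfolding square_def times_subset_iff by (auto simp: Suc_le_eq)
qed

text \<open>No grid line passes through a midpoint, so a membership test at midpoints decides about
  a whole unit segment or square.\<close>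

definition midS :: "nat \<Rightarrow> real" where "midS i = (S i + S (Suc i)) / 2"
definition midT :: "nat \<Rightarrow> real" where "midT j = (T j + T (Suc j)) / 2"

lemma midS_bounds: "S i < midS i" "midS i < S (Suc i)"
  using S_simps(2)[of i "Suc i"] unfolding midS_def by (simp_all del: S_simps)

lemma midT_bounds: "T j < midT j" "midT j < T (Suc j)"
  using T_simps(2)[of j "Suc j"] unfolding midT_def by (simp_all del: T_simps)

lemma midS_simps [simp]: "S i \<le> midS j \<longleftrightarrow> i \<le> j" "midS j \<le> S i \<longleftrightarrow> j < i"
  "S i < midS j \<longleftrightarrow> i \<le> j" "midS j < S i \<longleftrightarrow> j < i" "midS j \<noteq> S i" "S i \<noteq> midS j"
proof -
  have 1: "S i < midS j" if "i \<le> j" using that midS_bounds(1)[of j] S_simps(1)[of i j] by linarith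
  have 2: "midS j < S i" if "j < i" using that midS_bounds(2)[of j] S_simps(1)[of "Suc j" i] by linarith
  show "S i \<le> midS j \<longleftrightarrow> i \<le> j" "midS j \<le> S i \<longleftrightarrow> j < i"
    "S i < midS j \<longleftrightarrow> i \<le> j" "midS j < S i \<longleftrightarrow> j < i" "midS j \<noteq> S i" "S i \<noteq> midS j"
    using 1 2 by fastforce+
qed

lemma midT_simps [simp]: "T i \<le> midT j \<longleftrightarrow> i \<le> j" "midT j \<le> T i \<longleftrightarrow> j < i"
  "T i < midT j \<longleftrightarrow> i \<le> j" "midT j < T i \<longleftrightarrow> j < i" "midT j \<noteq> T i" "T i \<noteq> midT j"
proof -
  have 1: "T i < midT j" if "i \<le> j" using that midT_bounds(1)[of j] T_simps(1)[of i j] by linarith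
  have 2: "midT j < T i" if "j < i" using that midT_bounds(2)[of j] T_simps(1)[of "Suc j" i] by linarith
  show "T i \<le> midT j \<longleftrightarrow> i \<le> j" "midT j \<le> T i \<longleftrightarrow> j < i"
    "T i < midT j \<longleftrightarrow> i \<le> j" "midT j < T i \<longleftrightarrow> j < i" "midT j \<noteq> T i" "T i \<noteq> midT j"
    using 1 2 by fastforce+
qed

lemma center_in_interior:
  assumes "\<sigma> \<in> cells M" "square i j \<subseteq> \<sigma>"
  shows "(midS i, midT j) \<in> interior \<sigma>"
proof -
  have "(midS i, midT j) \<in> interior (square i j)"
    unfolding square_def interior_rectangle by simp
  then show ?thesis using interior_mono[OF assms(2)] by blast
qed

lemma cell_at_unique: "i < n \<Longrightarrow> j < l \<Longrightarrow> \<exists>!\<sigma>. \<sigma> \<in> cells M \<and> square i j \<subseteq> \<sigma>"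
proof (rule ex_ex1I)
  assume "i < n" "j < l"
  then have "(midS i, midT j) \<in> domain M" unfolding dom by simp
  then obtain \<sigma> where s: "\<sigma> \<in> cells M" "(midS i, midT j) \<in> \<sigma>" by (auto simp: domain_def)
  then obtain i1 i2 j1 j2 where "\<sigma> = {S i1..S i2} \<times> {T j1..T j2}" using cells_grid by metis
  then have "square i j \<subseteq> \<sigma>" using s(2) by (simp add: square_subset_iff)
  then show "\<exists>\<sigma>. \<sigma> \<in> cells M \<and> square i j \<subseteq> \<sigma>" using s(1) by blast
next
  fix \<sigma> \<sigma>' assume s: "\<sigma> \<in> cells M \<and> square i j \<subseteq> \<sigma>" and s': "\<sigma>' \<in> cells M \<and> square i j \<subseteq> \<sigma>'"
  show "\<sigma> = \<sigma>'"
  proof (rule ccontr)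
    assume "\<sigma> \<noteq> \<sigma>'"
    then have eq: "\<sigma> \<inter> \<sigma>' = frontier \<sigma> \<inter> frontier \<sigma>'" using is_tmeshD(7)[OF mesh] s s' by blast
    have c: "(midS i, midT j) \<in> interior \<sigma>" "(midS i, midT j) \<in> interior \<sigma>'"
      using center_in_interior s s' by blast+
    then have "(midS i, midT j) \<in> \<sigma> \<inter> \<sigma>'" using interior_subset by blast
    then have "(midS i, midT j) \<in> frontier \<sigma>" unfolding eq by blast
    then show False using c(1) by (simp add: frontier_def)
  qed
qed

lemma cell_at:
  assumes "i < n" "j < l"
  shows "cell_at i j \<in> cells M" "square i j \<subseteq> cell_at i j"
  using theI'[OF cell_at_unique[OF assms]] unfolding cell_at_def by auto

lemma cell_at_eq:
  assumes "i < n" "j < l" "\<sigma> \<in> cells M" "square i j \<subseteq> \<sigma>"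
  shows "cell_at i j = \<sigma>"
  using the1_equality[OF cell_at_unique[OF assms(1,2)]] assms(3,4) unfolding cell_at_def by blast

text \<open>The squares of a cell form a box of indices. This convexity is what turns local
  arguments on the grid into statements about cells.\<close>

lemma cell_at_box:
  assumes "i < n" "j < l"
  obtains i1 i2 j1 j2 where "i1 \<le> i" "i < i2" "i2 \<le> n" "j1 \<le> j" "j < j2" "j2 \<le> l"
    "cell_at i j = {S i1..S i2} \<times> {T j1..T j2}"
    "\<And>i' j'. i1 \<le> i' \<Longrightarrow> i' < i2 \<Longrightarrow> j1 \<le> j' \<Longrightarrow> j' < j2 \<Longrightarrow> cell_at i' j' = cell_at i j"
    "\<And>i' j'. i' < n \<Longrightarrow> j' < l \<Longrightarrow> cell_at i' j' = cell_at i j \<Longrightarrow> i1 \<le> i' \<and> i' < i2 \<and> j1 \<le> j' \<and> j' < j2"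
proof -
  note c = cell_at[OF assms]
  obtain i1 i2 j1 j2 where b: "i2 \<le> n" "j2 \<le> l" "cell_at i j = {S i1..S i2} \<times> {T j1..T j2}"
    using cells_grid[OF c(1)] by blast
  have ij: "i1 \<le> i" "i < i2" "j1 \<le> j" "j < j2" using c(2) unfolding b(3) by (simp_all add: square_subset_iff)
  show ?thesis
  proof (rule that[OF ij(1,2) b(1) ij(3,4) b(2,3)])
    fix i' j' assume "i1 \<le> i'" "i' < i2" "j1 \<le> j'" "j' < j2"
    then show "cell_at i' j' = cell_at i j"
      using b by (intro cell_at_eq c(1)) (auto simp: square_subset_iff)
  next
    fix i' j' assume "i' < n" "j' < l" "cell_at i' j' = cell_at i j"
    then have "square i' j' \<subseteq> {S i1..S i2} \<times> {T j1..T j2}" using cell_at(2)[of i' j'] b(3) by simp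
    then show "i1 \<le> i' \<and> i' < i2 \<and> j1 \<le> j' \<and> j' < j2" by (simp add: square_subset_iff)
  qed
qed

lemma cells_cell_at:
  assumes "\<sigma> \<in> cells M"
  obtains i j where "i < n" "j < l" "cell_at i j = \<sigma>"
proof -
  obtain i1 i2 j1 j2 where b: "i1 < i2" "i2 \<le> n" "j1 < j2" "j2 \<le> l" "\<sigma> = {S i1..S i2} \<times> {T j1..T j2}"
    using cells_grid[OF assms] by blast
  then have "cell_at i1 j1 = \<sigma>" using assms by (intro cell_at_eq) (auto simp: square_subset_iff)
  then show ?thesis using b by (intro that[of i1 j1]) auto
qed

section \<open>Unit segments of the grid and edges of the mesh\<close>

definition von :: "nat \<Rightarrow> nat \<Rightarrow> bool" where
  "von i j \<longleftrightarrow> {S i} \<times> {T j..T (Suc j)} \<subseteq> vgrid M"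

definition hon :: "nat \<Rightarrow> nat \<Rightarrow> bool" where
  "hon i j \<longleftrightarrow> {S i..S (Suc i)} \<times> {T j} \<subseteq> hgrid M"

lemma vgrid_iff:
  "(x, y) \<in> vgrid M \<longleftrightarrow> (\<exists>i1 i2 j1 j2. i1 < i2 \<and> i2 \<le> n \<and> j1 < j2 \<and> j2 \<le> l \<and>
    {S i1..S i2} \<times> {T j1..T j2} \<in> cells M \<and> (x = S i1 \<or> x = S i2) \<and> T j1 \<le> y \<and> y \<le> T j2)"
proof
  assume "(x, y) \<in> vgrid M"
  then obtain \<sigma> where s: "\<sigma> \<in> cells M" "(x, y) \<in> vsides \<sigma>" by (auto simp: vgrid_def)
  obtain i1 i2 j1 j2 where b: "i1 < i2" "i2 \<le> n" "j1 < j2" "j2 \<le> l" "\<sigma> = {S i1..S i2} \<times> {T j1..T j2}"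
    using cells_grid[OF s(1)] by blast
  then have "(x = S i1 \<or> x = S i2) \<and> T j1 \<le> y \<and> y \<le> T j2" using s(2) by (simp add: vsides_rectangle)
  then show "\<exists>i1 i2 j1 j2. i1 < i2 \<and> i2 \<le> n \<and> j1 < j2 \<and> j2 \<le> l \<and>
    {S i1..S i2} \<times> {T j1..T j2} \<in> cells M \<and> (x = S i1 \<or> x = S i2) \<and> T j1 \<le> y \<and> y \<le> T j2"
    using b s(1) by blast
next
  assume "\<exists>i1 i2 j1 j2. i1 < i2 \<and> i2 \<le> n \<and> j1 < j2 \<and> j2 \<le> l \<and>
    {S i1..S i2} \<times> {T j1..T j2} \<in> cells M \<and> (x = S i1 \<or> x = S i2) \<and> T j1 \<le> y \<and> y \<le> T j2"
  then show "(x, y) \<in> vgrid M" unfolding vgrid_def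
    by (elim exE conjE) (rule UnionI, erule imageI, auto simp: vsides_rectangle)
qed

lemma vgrid_point: "(x, y) \<in> vgrid M \<Longrightarrow> \<exists>i\<le>n. x = S i"
  unfolding vgrid_iff by (elim exE conjE disjE) auto

text \<open>Sides of cells end at grid points, so a side through the midpoint covers the unit
  segment.\<close>

lemma von_if_mid:
  assumes "(S i, midT j) \<in> vgrid M"
  shows "von i j"
proof -
  obtain i1 i2 j1 j2 where b: "i1 < i2" "i2 \<le> n" "j1 < j2" "j2 \<le> l"
    "{S i1..S i2} \<times> {T j1..T j2} \<in> cells M" "S i = S i1 \<or> S i = S i2" "T j1 \<le> midT j" "midT j \<le> T j2"
    using assms unfolding vgrid_iff by blast
  then have j: "T j1 \<le> T j" "T (Suc j) \<le> T j2" by (auto simp: Suc_le_eq)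
  show ?thesis unfolding von_def
  proof clarify
    fix y assume "y \<in> {T j..T (Suc j)}"
    then have "T j1 \<le> y" "y \<le> T j2" using j by (auto simp del: T_simps)
    then show "(S i, y) \<in> vgrid M" unfolding vgrid_iff using b by blast
  qed
qed

lemma von_mid: "von i j \<Longrightarrow> (S i, midT j) \<in> vgrid M"
  unfolding von_def by auto

text \<open>A drawn segment is part of a side of some cell, which then cannot contain the squares on
  both sides of it. Conversely, if the two cells differ, the box of the right one starts at this
  line.\<close>

lemma von_iff:
  assumes i: "Suc i < n" and j: "j < l"
  shows "von (Suc i) j \<longleftrightarrow> cell_at i j \<noteq> cell_at (Suc i) j"
proof
  assume "von (Suc i) j"
  then obtain i1 i2 j1 j2 where b: "i2 \<le> n" "j2 \<le> l"
    "{S i1..S i2} \<times> {T j1..T j2} \<in> cells M" "Suc i = i1 \<or> Suc i = i2" "i1 < i2" "j1 \<le> j" "j < j2"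
    using von_mid unfolding vgrid_iff by fastforce
  let ?\<sigma> = "{S i1..S i2} \<times> {T j1..T j2}"
  show "cell_at i j \<noteq> cell_at (Suc i) j"
  proof
    assume eq: "cell_at i j = cell_at (Suc i) j"
    have "square i j \<subseteq> ?\<sigma> \<or> square (Suc i) j \<subseteq> ?\<sigma>" using b by (auto simp: square_subset_iff)
    then have "cell_at i j = ?\<sigma>"
      using cell_at_eq[OF Suc_lessD[OF i] j b(3)] cell_at_eq[OF i j b(3)] eq by metis
    then have "square i j \<subseteq> ?\<sigma>" "square (Suc i) j \<subseteq> ?\<sigma>"
      using cell_at(2)[of i j] cell_at(2)[of "Suc i" j] i j eq by auto
    then show False using b(4) by (auto simp: square_subset_iff)
  qed
next
  assume ne: "cell_at i j \<noteq> cell_at (Suc i) j"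
  obtain i1 i2 j1 j2 where b: "i1 \<le> Suc i" "Suc i < i2" "i2 \<le> n" "j1 \<le> j" "j < j2" "j2 \<le> l"
    "cell_at (Suc i) j = {S i1..S i2} \<times> {T j1..T j2}"
    "\<And>i' j'. i1 \<le> i' \<Longrightarrow> i' < i2 \<Longrightarrow> j1 \<le> j' \<Longrightarrow> j' < j2 \<Longrightarrow> cell_at i' j' = cell_at (Suc i) j"
    by (rule cell_at_box[OF i j]) (rule that)
  have "i1 = Suc i"
  proof (rule ccontr)
    assume "i1 \<noteq> Suc i"
    then have "cell_at i j = cell_at (Suc i) j" using b(1-6) by (intro b(8)) auto
    then show False using ne by simp
  qed
  then have "(S (Suc i), midT j) \<in> vgrid M"
    unfolding vgrid_iff using b(2-7) cell_at(1)[OF i j]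
    by (intro exI[of _ i1] exI[of _ i2] exI[of _ j1] exI[of _ j2]) auto
  then show "von (Suc i) j" by (rule von_if_mid)
qed

lemma von_boundary:
  assumes j: "j < l"
  shows "von 0 j" "von n j"
proof -
  obtain i1 i2 j1 j2 where b: "i1 \<le> 0" "0 < i2" "i2 \<le> n" "j1 \<le> j" "j < j2" "j2 \<le> l"
    "cell_at 0 j = {S i1..S i2} \<times> {T j1..T j2}"
    by (rule cell_at_box[OF pos(1) j]) (rule that)
  then have "(S 0, midT j) \<in> vgrid M"
    unfolding vgrid_iff using cell_at(1)[OF pos(1) j]
    by (intro exI[of _ i1] exI[of _ i2] exI[of _ j1] exI[of _ j2]) auto
  then show "von 0 j" by (rule von_if_mid)
  have n: "n - 1 < n" using pos by simp
  obtain i1 i2 j1 j2 where b: "i1 \<le> n - 1" "n - 1 < i2" "i2 \<le> n" "j1 \<le> j" "j < j2" "j2 \<le> l"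
    "cell_at (n - 1) j = {S i1..S i2} \<times> {T j1..T j2}"
    by (rule cell_at_box[OF n j]) (rule that)
  moreover from this have "i2 = n" by simp
  ultimately have "(S n, midT j) \<in> vgrid M"
    unfolding vgrid_iff using cell_at(1)[OF n j] pos
    by (intro exI[of _ i1] exI[of _ i2] exI[of _ j1] exI[of _ j2]) auto
  then show "von n j" by (rule von_if_mid)
qed

lemma hon_eq: "hon i j \<longleftrightarrow> mesh_grid.von (transpose_mesh M) T S j i"
proof -
  interpret t: mesh_grid "transpose_mesh M" T S l n by (rule transpose_grid)
  have "{T j} \<times> {S i..S (Suc i)} = flip ({S i..S (Suc i)} \<times> {T j})" by simp
  then show ?thesis unfolding hon_def t.von_def vgrid_transpose by (simp only: flip_subset_iff)
qed

lemma cell_at_transpose: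
  assumes "i < n" "j < l"
  shows "mesh_grid.cell_at (transpose_mesh M) T S j i = flip (cell_at i j)"
proof -
  interpret t: mesh_grid "transpose_mesh M" T S l n by (rule transpose_grid)
  have "t.square j i = flip (square i j)" by (simp add: square_def t.square_def)
  then show ?thesis using cell_at[OF assms] assms by (intro t.cell_at_eq) auto
qed

lemma hon_iff:
  assumes "i < n" "Suc j < l"
  shows "hon i (Suc j) \<longleftrightarrow> cell_at i j \<noteq> cell_at i (Suc j)"
proof -
  interpret t: mesh_grid "transpose_mesh M" T S l n by (rule transpose_grid)
  show ?thesis unfolding hon_eq using t.von_iff[OF assms(2,1)] assms by (simp add: cell_at_transpose)
qed

lemma hon_boundary: "i < n \<Longrightarrow> hon i 0" "i < n \<Longrightarrow> hon i l"
proof -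
  interpret t: mesh_grid "transpose_mesh M" T S l n by (rule transpose_grid)
  show "i < n \<Longrightarrow> hon i 0" "i < n \<Longrightarrow> hon i l" unfolding hon_eq using t.von_boundary by auto
qed

lemma hgrid_point: "(x, y) \<in> hgrid M \<Longrightarrow> \<exists>j\<le>l. y = T j"
proof -
  interpret t: mesh_grid "transpose_mesh M" T S l n by (rule transpose_grid)
  show "(x, y) \<in> hgrid M \<Longrightarrow> \<exists>j\<le>l. y = T j" using t.vgrid_point[of y x] by simp
qed

lemma vertex_grid:
  assumes "z \<in> vertices M"
  obtains i j where "i \<le> n" "j \<le> l" "z = (S i, T j)"
proof -
  have "z \<in> hgrid M" "z \<in> vgrid M" using assms vertices_eq[OF mesh] by auto
  then show ?thesis using that vgrid_point[of "fst z" "snd z"] hgrid_point[of "fst z" "snd z"] by (cases z) auto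
qed

definition vedge :: "point set \<Rightarrow> nat \<Rightarrow> nat \<Rightarrow> nat \<Rightarrow> bool" where
  "vedge \<tau> i j1 j2 \<longleftrightarrow> \<tau> \<in> edges M \<and> \<tau> = {S i} \<times> {T j1..T j2} \<and> i \<le> n \<and> j1 < j2 \<and> j2 \<le> l"

lemma vedgeI:
  assumes "\<tau> \<in> edges M" "vertical \<tau>"
  obtains i j1 j2 where "vedge \<tau> i j1 j2"
proof -
  obtain a c d where t: "c < d" "\<tau> = {a} \<times> {c..d}" using assms(2) by (auto simp: vertical_def)
  have "(a, c) \<in> vertices M" "(a, d) \<in> vertices M"
    using assms(1) rel_frontier_vertical[OF t(1), of a] t(2) unfolding vertices_def by blast+
  then obtain i j1 i' j2 where "i \<le> n" "j1 \<le> l" "(a, c) = (S i, T j1)" "i' \<le> n" "j2 \<le> l" "(a, d) = (S i', T j2)"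
    by (elim vertex_grid)
  then show ?thesis using that[of i j1 j2] t assms(1) by (auto simp: vedge_def)
qed

lemma vedge_vertical: "vedge \<tau> i j1 j2 \<Longrightarrow> vertical \<tau>"
proof -
  assume "vedge \<tau> i j1 j2"
  then have "\<tau> = {S i} \<times> {T j1..T j2}" "T j1 < T j2" by (auto simp: vedge_def)
  then show ?thesis unfolding vertical_def by blast
qed

lemma vedge_ends: "vedge \<tau> i j1 j2 \<Longrightarrow> edge_src \<tau> = (S i, T j1) \<and> edge_tgt \<tau> = (S i, T j2)"
  by (auto simp: vedge_def edge_src_vertical edge_tgt_vertical)

lemma vedge_rel_frontier: "vedge \<tau> i j1 j2 \<Longrightarrow> rel_frontier \<tau> = {(S i, T j1), (S i, T j2)}"
  by (auto simp: vedge_def rel_frontier_vertical)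

lemma vedge_vertices: "vedge \<tau> i j1 j2 \<Longrightarrow> (S i, T j1) \<in> vertices M \<and> (S i, T j2) \<in> vertices M"
  using vedge_rel_frontier[of \<tau> i j1 j2] unfolding vertices_def by (auto simp: vedge_def)

text \<open>Through every vertex passes a horizontal edge, and it can meet a vertical edge only in
  an end point.\<close>

lemma vedge_vertex:
  assumes v: "vedge \<tau> i j1 j2" and "(S i, T j) \<in> vertices M" "j1 \<le> j" "j \<le> j2"
  shows "j = j1 \<or> j = j2"
proof -
  obtain \<tau>' where t: "\<tau>' \<in> edges M" "horizontal \<tau>'" "(S i, T j) \<in> \<tau>'" using is_tmeshD(11)[OF mesh assms(2)] by blast
  have te: "\<tau> \<in> edges M" "(S i, T j) \<in> \<tau>" using v assms(3,4) by (auto simp: vedge_def)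
  have "\<tau> \<noteq> \<tau>'" using vedge_vertical[OF v] t(2) not_horizontal_and_vertical by blast
  then have "(S i, T j) \<in> rel_frontier \<tau>" using is_tmeshD(9)[OF mesh te(1) t(1)] te t by blast
  then show ?thesis using vedge_rel_frontier[OF v] by simp
qed

lemma vedge_interior_iff: "vedge \<tau> i j1 j2 \<Longrightarrow> \<tau> \<in> interior_vedges M \<longleftrightarrow> 0 < i \<and> i < n"
  using interior_vedge_iff[OF rect, of \<tau> "T j1" "T j2" "S i"] by (auto simp: vedge_def)

text \<open>A midpoint is no end point of an edge, so at most one vertical edge contains it.\<close>

definition vedge_at :: "nat \<Rightarrow> nat \<Rightarrow> point set" where
  "vedge_at i j = (THE \<tau>. \<tau> \<in> edges M \<and> vertical \<tau> \<and> (S i, midT j) \<in> \<tau>)"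

lemma vedge_at_eq:
  assumes v: "vedge \<tau> i j1 j2" and j: "j1 \<le> j" "j < j2"
  shows "vedge_at i j = \<tau>" "von i j"
proof -
  have t: "\<tau> \<in> edges M" "vertical \<tau>" "(S i, midT j) \<in> \<tau>" using v vedge_vertical[OF v] j by (auto simp: vedge_def)
  then have "(S i, midT j) \<in> vgrid M" using vedges_Union[OF mesh] by blast
  then show "von i j" by (rule von_if_mid)
  show "vedge_at i j = \<tau>" unfolding vedge_at_def
  proof (rule the_equality)
    show "\<tau> \<in> edges M \<and> vertical \<tau> \<and> (S i, midT j) \<in> \<tau>" using t by blast
    fix \<tau>' assume t': "\<tau>' \<in> edges M \<and> vertical \<tau>' \<and> (S i, midT j) \<in> \<tau>'"
    show "\<tau>' = \<tau>"
    proof (rule ccontr)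
      assume "\<tau>' \<noteq> \<tau>"
      then have "(S i, midT j) \<in> rel_frontier \<tau>" using is_tmeshD(9)[OF mesh t(1), of \<tau>'] t t' by blast
      then show False unfolding vedge_rel_frontier[OF v] by simp
    qed
  qed
qed

lemma von_vedge:
  assumes "von i j"
  obtains j1 j2 where "vedge (vedge_at i j) i j1 j2" "j1 \<le> j" "j < j2"
proof -
  obtain \<tau> where t: "\<tau> \<in> edges M" "vertical \<tau>" "(S i, midT j) \<in> \<tau>"
    using von_mid[OF assms] unfolding vedges_Union[OF mesh, symmetric] by blast
  obtain i' j1 j2 where v: "vedge \<tau> i' j1 j2" using t(1,2) by (rule vedgeI)
  then have j: "i' = i" "j1 \<le> j" "j < j2" using t(3) by (auto simp: vedge_def)
  then show ?thesis using that vedge_at_eq[of \<tau> i j1 j2 j] v by simp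
qed

lemma vedges_with_tgt:
  assumes i: "0 < i" "i < n" and v: "(S i, T (Suc j)) \<in> vertices M"
  shows "{\<tau> \<in> interior_vedges M. edge_tgt \<tau> = (S i, T (Suc j))} = (if von i j then {vedge_at i j} else {})"
proof -
  have 1: "von i j \<and> \<tau> = vedge_at i j" if t: "\<tau> \<in> interior_vedges M" "edge_tgt \<tau> = (S i, T (Suc j))" for \<tau>
  proof -
    have "\<tau> \<in> edges M" "vertical \<tau>" using t by (auto simp: interior_vedges_def interior_edges_def)
    then obtain i' j1 j2 where e: "vedge \<tau> i' j1 j2" by (rule vedgeI)
    then have "i' = i" "j2 = Suc j" "j1 \<le> j" using vedge_ends[OF e] t(2) by (auto simp: vedge_def)
    then show ?thesis using vedge_at_eq[of \<tau> i j1 j2 j] e by simp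
  qed
  have 2: "vedge_at i j \<in> interior_vedges M \<and> edge_tgt (vedge_at i j) = (S i, T (Suc j))" if o: "von i j"
  proof -
    obtain j1 j2 where e: "vedge (vedge_at i j) i j1 j2" "j1 \<le> j" "j < j2" using o by (rule von_vedge)
    then have "Suc j = j2" using vedge_vertex[OF e(1) v] by auto
    then show ?thesis using vedge_ends[OF e(1)] vedge_interior_iff[OF e(1)] i by simp
  qed
  show ?thesis using 1 2 by auto
qed

lemma vedges_with_src:
  assumes i: "0 < i" "i < n" and v: "(S i, T j) \<in> vertices M"
  shows "{\<tau> \<in> interior_vedges M. edge_src \<tau> = (S i, T j)} = (if von i j then {vedge_at i j} else {})"
proof -
  have 1: "von i j \<and> \<tau> = vedge_at i j" if t: "\<tau> \<in> interior_vedges M" "edge_src \<tau> = (S i, T j)" for \<tau>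
  proof -
    have "\<tau> \<in> edges M" "vertical \<tau>" using t by (auto simp: interior_vedges_def interior_edges_def)
    then obtain i' j1 j2 where e: "vedge \<tau> i' j1 j2" by (rule vedgeI)
    then have "i' = i" "j1 = j" "j < j2" using vedge_ends[OF e] t(2) by (auto simp: vedge_def)
    then show ?thesis using vedge_at_eq[of \<tau> i j1 j2 j] e by simp
  qed
  have 2: "vedge_at i j \<in> interior_vedges M \<and> edge_src (vedge_at i j) = (S i, T j)" if o: "von i j"
  proof -
    obtain j1 j2 where e: "vedge (vedge_at i j) i j1 j2" "j1 \<le> j" "j < j2" using o by (rule von_vedge)
    then have "j = j1" using vedge_vertex[OF e(1) v] by auto
    then show ?thesis using vedge_ends[OF e(1)] vedge_interior_iff[OF e(1)] i by simp
  qed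
  show ?thesis using 1 2 by auto
qed

text \<open>Spreads a chain over the unit segments of the grid, so that formulas at grid points need
  no case distinction about vertices.\<close>

definition vvalue :: "(point set \<Rightarrow> 'v::zero) \<Rightarrow> nat \<Rightarrow> nat \<Rightarrow> 'v" where
  "vvalue x i j = (if von i j then x (vedge_at i j) else 0)"

text \<open>Where a line ends or passes to another edge there is a vertex; otherwise the same edge,
  or none, lies below and above.\<close>

lemma vvalue_nonvertex:
  assumes "(S i, T (Suc j)) \<notin> vertices M"
  shows "vvalue x i j = vvalue x i (Suc j)"
proof -
  have 1: "von i (Suc j) \<and> vedge_at i (Suc j) = vedge_at i j" if o: "von i j"
  proof -
    obtain j1 j2 where e: "vedge (vedge_at i j) i j1 j2" "j1 \<le> j" "j < j2" using o by (rule von_vedge)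
    then have "Suc j \<noteq> j2" using vedge_vertices[OF e(1)] assms by auto
    then show ?thesis using vedge_at_eq[OF e(1), of "Suc j"] e by auto
  qed
  have 2: "von i j \<and> vedge_at i (Suc j) = vedge_at i j" if o: "von i (Suc j)"
  proof -
    obtain j1 j2 where e: "vedge (vedge_at i (Suc j)) i j1 j2" "j1 \<le> Suc j" "Suc j < j2" using o by (rule von_vedge)
    then have "Suc j \<noteq> j1" using vedge_vertices[OF e(1)] assms by auto
    then show ?thesis using vedge_at_eq[OF e(1), of j] e by auto
  qed
  show ?thesis using 1 2 by (auto simp: vvalue_def)
qed

lemma edges_with_end:
  fixes x :: "point set \<Rightarrow> 'v::ab_group_add"
  assumes "{\<tau> \<in> interior_vedges M. P \<tau>} = (if von i j then {vedge_at i j} else {})"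
  shows "(\<Sum>\<tau> | \<tau> \<in> interior_vedges M \<and> P \<tau>. x \<tau>) = vvalue x i j"
  using assms by (simp add: vvalue_def)

text \<open>A change of the cell along the edge would put a horizontal side there, hence a vertex in
  the relative interior of the edge. So the jump may be read off at the lower end, as
  \<open>vjump\<close> does.\<close>

lemma vedge_at_cells:
  assumes v: "vedge \<tau> i j1 j2" and i: "0 < i" "i < n" and j: "j1 \<le> j" "j < j2"
  shows "cell_at i j = cell_at i j1 \<and> cell_at (i - 1) j = cell_at (i - 1) j1"
  using j
proof (induction j rule: dec_induct)
  case (step j)
  have jl: "Suc j < l" using step v by (simp add: vedge_def)
  have nh: "\<not> hon i' (Suc j)" if "i' = i \<or> Suc i' = i" for i'
  proof
    assume h: "hon i' (Suc j)"
    have "(S i, T (Suc j)) \<in> hgrid M" using h that unfolding hon_def by auto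
    moreover have "(S i, T (Suc j)) \<in> vgrid M"
    proof -
      have "von i j" using vedge_at_eq[OF v, of j] step by simp
      then show ?thesis unfolding von_def by auto
    qed
    ultimately have "(S i, T (Suc j)) \<in> vertices M" using vertices_eq[OF mesh] by blast
    then show False using vedge_vertex[OF v, of "Suc j"] step by auto
  qed
  have "cell_at i (Suc j) = cell_at i j" using nh[of i] hon_iff[OF i(2) jl] by auto
  moreover have "cell_at (i - 1) (Suc j) = cell_at (i - 1) j" using nh[of "i - 1"] hon_iff[of "i - 1" j] i jl by auto
  ultimately show ?case using step by simp
qed simp

end

section \<open>Chains on a grid\<close>

lemma edge_tgt_flip: "edge_tgt (flip \<tau>) = prod.swap (edge_tgt \<tau>)"
  and edge_src_flip: "edge_src (flip \<tau>) = prod.swap (edge_src \<tau>)"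
  by (simp_all add: edge_tgt_def edge_src_def image_image)

lemma swap_eq_iff [simp]: "prod.swap z = prod.swap w \<longleftrightarrow> z = w"
  by (auto simp: prod_eq_iff)

lemma interior_edges_split:
  assumes "is_tmesh M"
  shows "interior_edges M = interior_vedges M \<union> interior_hedges M" "interior_vedges M \<inter> interior_hedges M = {}"
  using is_tmeshD(4)[OF assms] not_horizontal_and_vertical
  by (auto simp: interior_vedges_def interior_hedges_def interior_edges_def)

lemma finite_interior_edges:
  assumes "is_tmesh M"
  shows "finite (interior_edges M)" "finite (interior_vedges M)" "finite (interior_hedges M)"
  using is_tmeshD(3)[OF assms] by (auto simp: interior_vedges_def interior_hedges_def interior_edges_def)

lemma sum_interior_edges:
  assumes "is_tmesh M"
  shows "(\<Sum>\<tau> | \<tau> \<in> interior_edges M \<and> P \<tau>. x \<tau>) =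
    (\<Sum>\<tau> | \<tau> \<in> interior_vedges M \<and> P \<tau>. x \<tau>) + (\<Sum>\<tau> | \<tau> \<in> interior_hedges M \<and> P \<tau>. x \<tau>)"
proof -
  have "{\<tau>. \<tau> \<in> interior_edges M \<and> P \<tau>} = {\<tau>. \<tau> \<in> interior_vedges M \<and> P \<tau>} \<union> {\<tau>. \<tau> \<in> interior_hedges M \<and> P \<tau>}"
    unfolding interior_edges_split(1)[OF assms] by blast
  then show ?thesis
    using finite_interior_edges[OF assms] interior_edges_split(2)[OF assms]
    by (auto intro!: sum.union_disjoint)
qed

lemma interior_vertices_transpose: "interior_vertices (transpose_mesh M) = flip (interior_vertices M)"
  by (auto simp: interior_vertices_def interior_flip in_flip)

text \<open>The exchange of coordinates preserves the orientation from lower left to upper right, so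
  no sign appears.\<close>

lemma boundary1_transpose:
  "boundary1 (transpose_mesh M) (\<lambda>\<tau>. x (flip \<tau>)) (prod.swap z) = boundary1 M x z"
proof -
  have "(\<Sum>\<tau> | \<tau> \<in> interior_edges (transpose_mesh M) \<and> f \<tau> = prod.swap z. x (flip \<tau>)) =
      (\<Sum>\<tau> | \<tau> \<in> interior_edges M \<and> f \<tau> = z. x \<tau>)"
    if "\<And>\<tau>. f (flip \<tau>) = prod.swap (f \<tau>)" for f :: "point set \<Rightarrow> point"
  proof -
    have "{\<tau>. \<tau> \<in> interior_edges (transpose_mesh M) \<and> f \<tau> = prod.swap z} =
        flip ` {\<tau>. \<tau> \<in> interior_edges M \<and> f \<tau> = z}"
      by (auto simp: interior_edges_transpose that)
    then show ?thesis by (simp add: sum.reindex inj_on_subset[OF inj_flip])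
  qed
  then show ?thesis
    unfolding boundary1_def interior_vertices_transpose swap_in_flip
    using edge_tgt_flip edge_src_flip by presburger
qed

context mesh_grid begin

definition hedge :: "point set \<Rightarrow> nat \<Rightarrow> nat \<Rightarrow> nat \<Rightarrow> bool" where
  "hedge \<tau> j i1 i2 \<longleftrightarrow> \<tau> \<in> edges M \<and> \<tau> = {S i1..S i2} \<times> {T j} \<and> j \<le> l \<and> i1 < i2 \<and> i2 \<le> n"

definition hedge_at :: "nat \<Rightarrow> nat \<Rightarrow> point set" where
  "hedge_at i j = flip (mesh_grid.vedge_at (transpose_mesh M) T S j i)"

definition hvalue :: "(point set \<Rightarrow> 'v::zero) \<Rightarrow> nat \<Rightarrow> nat \<Rightarrow> 'v" where
  "hvalue x i j = (if hon i j then x (hedge_at i j) else 0)"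

lemma hedge_eq: "hedge \<tau> j i1 i2 \<longleftrightarrow> mesh_grid.vedge (transpose_mesh M) T S l n (flip \<tau>) j i1 i2"
proof -
  interpret t: mesh_grid "transpose_mesh M" T S l n by (rule transpose_grid)
  have "flip \<tau> = {T j} \<times> {S i1..S i2} \<longleftrightarrow> \<tau> = {S i1..S i2} \<times> {T j}"
    by (metis flip_eq_iff flip_times)
  then show ?thesis unfolding hedge_def t.vedge_def transpose_mesh_simps flip_in_flip_image by blast
qed

lemma hvalue_eq: "hvalue x i j = mesh_grid.vvalue (transpose_mesh M) T S (\<lambda>\<tau>. x (flip \<tau>)) j i"
proof -
  interpret t: mesh_grid "transpose_mesh M" T S l n by (rule transpose_grid)
  show ?thesis unfolding hvalue_def t.vvalue_def hon_eq hedge_at_def ..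
qed

lemma hedgeI:
  assumes "\<tau> \<in> edges M" "horizontal \<tau>"
  obtains j i1 i2 where "hedge \<tau> j i1 i2"
proof -
  interpret t: mesh_grid "transpose_mesh M" T S l n by (rule transpose_grid)
  show ?thesis using t.vedgeI[of "flip \<tau>"] that assms unfolding hedge_eq
    by (metis flip_in_flip_image transpose_mesh_simps(2) vertical_flip)
qed

lemma hedge_interior_iff: "hedge \<tau> j i1 i2 \<Longrightarrow> \<tau> \<in> interior_hedges M \<longleftrightarrow> 0 < j \<and> j < l"
proof -
  interpret t: mesh_grid "transpose_mesh M" T S l n by (rule transpose_grid)
  show "hedge \<tau> j i1 i2 \<Longrightarrow> \<tau> \<in> interior_hedges M \<longleftrightarrow> 0 < j \<and> j < l"
    unfolding hedge_eq using t.vedge_interior_iff[of "flip \<tau>"] by (simp add: interior_hvedges_transpose)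
qed

lemma hedge_at_eq:
  assumes "hedge \<tau> j i1 i2" "i1 \<le> i" "i < i2"
  shows "hedge_at i j = \<tau>" "hon i j"
proof -
  interpret t: mesh_grid "transpose_mesh M" T S l n by (rule transpose_grid)
  show "hedge_at i j = \<tau>" "hon i j"
    using t.vedge_at_eq[OF assms(1)[unfolded hedge_eq] assms(2,3)] unfolding hedge_at_def hon_eq by auto
qed

lemma hon_hedge:
  assumes "hon i j"
  obtains i1 i2 where "hedge (hedge_at i j) j i1 i2" "i1 \<le> i" "i < i2"
proof -
  interpret t: mesh_grid "transpose_mesh M" T S l n by (rule transpose_grid)
  show ?thesis using t.von_vedge[OF assms[unfolded hon_eq]] that unfolding hedge_eq hedge_at_def flip_flip by blast
qed

lemma hedge_horizontal: "hedge \<tau> j i1 i2 \<Longrightarrow> horizontal \<tau>"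
proof -
  assume "hedge \<tau> j i1 i2"
  then have "\<tau> = {S i1..S i2} \<times> {T j}" "S i1 < S i2" by (auto simp: hedge_def)
  then show ?thesis unfolding horizontal_def by blast
qed

lemma hedges_with_end:
  assumes v: "(S (Suc i), T (Suc j)) \<in> vertices M" and ij: "Suc i < n" "Suc j < l"
  shows "(\<Sum>\<tau> | \<tau> \<in> interior_hedges M \<and> edge_tgt \<tau> = (S (Suc i), T (Suc j)). x \<tau>) = hvalue x i (Suc j)"
    and "(\<Sum>\<tau> | \<tau> \<in> interior_hedges M \<and> edge_src \<tau> = (S (Suc i), T (Suc j)). x \<tau>) = hvalue x (Suc i) (Suc j)"
proof -
  interpret t: mesh_grid "transpose_mesh M" T S l n by (rule transpose_grid)
  have v': "(T (Suc j), S (Suc i)) \<in> vertices (transpose_mesh M)" using v by simp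
  have reindex: "(\<Sum>\<tau> | \<tau> \<in> interior_vedges (transpose_mesh M) \<and> f \<tau> = prod.swap z. x (flip \<tau>)) =
      (\<Sum>\<tau> | \<tau> \<in> interior_hedges M \<and> f \<tau> = z. x \<tau>)"
    if "\<And>\<tau>. f (flip \<tau>) = prod.swap (f \<tau>)" for f :: "point set \<Rightarrow> point" and z
  proof -
    have "{\<tau>. \<tau> \<in> interior_vedges (transpose_mesh M) \<and> f \<tau> = prod.swap z} =
        flip ` {\<tau>. \<tau> \<in> interior_hedges M \<and> f \<tau> = z}"
      by (auto simp: interior_hvedges_transpose that)
    then show ?thesis by (simp add: sum.reindex inj_on_subset[OF inj_flip])
  qed
  show "(\<Sum>\<tau> | \<tau> \<in> interior_hedges M \<and> edge_tgt \<tau> = (S (Suc i), T (Suc j)). x \<tau>) = hvalue x i (Suc j)"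
    using reindex[of edge_tgt, OF edge_tgt_flip, of "(S (Suc i), T (Suc j))"] ij
      t.vedges_with_tgt[of "Suc j" i] v'
    by (auto simp: hvalue_eq t.vvalue_def split: if_splits)
  show "(\<Sum>\<tau> | \<tau> \<in> interior_hedges M \<and> edge_src \<tau> = (S (Suc i), T (Suc j)). x \<tau>) = hvalue x (Suc i) (Suc j)"
    using reindex[of edge_src, OF edge_src_flip, of "(S (Suc i), T (Suc j))"] ij
      t.vedges_with_src[of "Suc j" "Suc i"] v'
    by (auto simp: hvalue_eq t.vvalue_def split: if_splits)
qed

lemma hvalue_nonvertex:
  assumes "(S (Suc i), T j) \<notin> vertices M"
  shows "hvalue x i j = hvalue x (Suc i) j"
proof -
  interpret t: mesh_grid "transpose_mesh M" T S l n by (rule transpose_grid)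
  show ?thesis unfolding hvalue_eq using assms by (intro t.vvalue_nonvertex) simp
qed

lemma interior_vertex_iff:
  assumes "i \<le> n" "j \<le> l"
  shows "(S i, T j) \<in> interior_vertices M \<longleftrightarrow> (S i, T j) \<in> vertices M \<and> 0 < i \<and> i < n \<and> 0 < j \<and> j < l"
  unfolding interior_vertices_def dom interior_rectangle by auto

lemma interior_vertexE:
  assumes "z \<in> interior_vertices M"
  obtains i j where "Suc i < n" "Suc j < l" "z = (S (Suc i), T (Suc j))" "z \<in> vertices M"
proof -
  have v: "z \<in> vertices M" using assms by (simp add: interior_vertices_def)
  then obtain i j where ij: "i \<le> n" "j \<le> l" "z = (S i, T j)" by (rule vertex_grid)
  then have "0 < i" "i < n" "0 < j" "j < l" using assms interior_vertex_iff[OF ij(1,2)] by auto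
  then show ?thesis using that[of "i - 1" "j - 1"] ij v by simp
qed

text \<open>At a grid point that is no vertex both sides vanish, because the values below and above,
  and those to the left and right, coincide.\<close>

lemma boundary1_grid:
  assumes ij: "Suc i < n" "Suc j < l"
  shows "boundary1 M x (S (Suc i), T (Suc j)) =
    (vvalue x (Suc i) j + hvalue x i (Suc j)) - (vvalue x (Suc i) (Suc j) + hvalue x (Suc i) (Suc j))"
proof (cases "(S (Suc i), T (Suc j)) \<in> vertices M")
  case True
  then have "(S (Suc i), T (Suc j)) \<in> interior_vertices M" using ij by (simp add: interior_vertex_iff)
  then have "boundary1 M x (S (Suc i), T (Suc j)) =
      (\<Sum>\<tau> | \<tau> \<in> interior_edges M \<and> edge_tgt \<tau> = (S (Suc i), T (Suc j)). x \<tau>)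
         - (\<Sum>\<tau> | \<tau> \<in> interior_edges M \<and> edge_src \<tau> = (S (Suc i), T (Suc j)). x \<tau>)"
    by (simp add: boundary1_def)
  then show ?thesis
    unfolding sum_interior_edges[OF mesh] hedges_with_end[OF True ij]
      edges_with_end[OF vedges_with_tgt[OF zero_less_Suc ij(1) True]]
      edges_with_end[OF vedges_with_src[OF zero_less_Suc ij(1) True]] .
next
  case False
  then have "boundary1 M x (S (Suc i), T (Suc j)) = 0"
    by (simp add: boundary1_def interior_vertices_def)
  then show ?thesis using vvalue_nonvertex[OF False, of x] hvalue_nonvertex[OF False, of x] by simp
qed

text \<open>The jump of a family of polynomials on the cells across an edge: right minus left, and lower
  minus upper, so that the sum around a vertex vanishes.\<close>

definition vjump :: "(point set \<Rightarrow> 'v::ab_group_add) \<Rightarrow> point set \<Rightarrow> 'v" where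
  "vjump p \<tau> = (let i = inv S (fst (edge_src \<tau>)); j = inv T (snd (edge_src \<tau>)) in
     p (cell_at i j) - p (cell_at (i - 1) j))"

definition jump :: "(point set \<Rightarrow> 'v::ab_group_add) \<Rightarrow> point set \<Rightarrow> 'v" where
  "jump p \<tau> = (if \<tau> \<in> interior_vedges M then vjump p \<tau>
     else if \<tau> \<in> interior_hedges M then - mesh_grid.vjump (transpose_mesh M) T S (\<lambda>\<sigma>. p (flip \<sigma>)) (flip \<tau>)
     else 0)"

lemma inv_S [simp]: "inv S (S i) = i" and inv_T [simp]: "inv T (T i) = i"
  using S T by (simp_all add: strict_mono_imp_inj_on)

lemma vjump_vedge_at:
  assumes "von (Suc i) j" "Suc i < n"
  shows "vjump p (vedge_at (Suc i) j) = p (cell_at (Suc i) j) - p (cell_at i j)"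
proof -
  obtain j1 j2 where e: "vedge (vedge_at (Suc i) j) (Suc i) j1 j2" "j1 \<le> j" "j < j2" using assms(1) by (rule von_vedge)
  show ?thesis
    using vedge_ends[OF e(1)] vedge_at_cells[OF e(1) _ assms(2) e(2,3)] by (simp add: vjump_def Let_def)
qed

lemma interior_vedgeE:
  assumes "\<tau> \<in> interior_vedges M"
  obtains i j1 j2 where "vedge \<tau> (Suc i) j1 j2" "Suc i < n"
proof -
  have "\<tau> \<in> edges M" "vertical \<tau>" using assms by (auto simp: interior_vedges_def interior_edges_def)
  then obtain i j1 j2 where e: "vedge \<tau> i j1 j2" by (rule vedgeI)
  then show ?thesis using that[of "i - 1" j1 j2] vedge_interior_iff[OF e] assms by simp
qed

lemma interior_hedgeE:
  assumes "\<tau> \<in> interior_hedges M"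
  obtains j i1 i2 where "hedge \<tau> (Suc j) i1 i2" "Suc j < l"
proof -
  have "\<tau> \<in> edges M" "horizontal \<tau>" using assms by (auto simp: interior_hedges_def interior_edges_def)
  then obtain j i1 i2 where e: "hedge \<tau> j i1 i2" by (rule hedgeI)
  then show ?thesis using that[of "j - 1" i1 i2] hedge_interior_iff[OF e] assms by simp
qed

lemma vedge_at_interior:
  assumes "von (Suc i) j" "Suc i < n"
  shows "vedge_at (Suc i) j \<in> interior_vedges M"
proof -
  obtain j1 j2 where e: "vedge (vedge_at (Suc i) j) (Suc i) j1 j2" "j1 \<le> j" "j < j2" using assms(1) by (rule von_vedge)
  show ?thesis using vedge_interior_iff[OF e(1)] assms(2) by simp
qed

lemma hedge_at_interior:
  assumes "hon i (Suc j)" "Suc j < l"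
  shows "hedge_at i (Suc j) \<in> interior_hedges M" "hedge_at i (Suc j) \<notin> interior_vedges M"
proof -
  obtain i1 i2 where e: "hedge (hedge_at i (Suc j)) (Suc j) i1 i2" "i1 \<le> i" "i < i2" using assms(1) by (rule hon_hedge)
  show "hedge_at i (Suc j) \<in> interior_hedges M" using hedge_interior_iff[OF e(1)] assms(2) by simp
  then show "hedge_at i (Suc j) \<notin> interior_vedges M" using interior_edges_split(2)[OF mesh] by blast
qed

text \<open>Undrawn segments separate no cells, so the formula holds for them too; this lets jumps
  telescope over grid squares.\<close>

lemma vvalue_jump:
  assumes "Suc i < n" "j < l"
  shows "vvalue (jump p) (Suc i) j = p (cell_at (Suc i) j) - p (cell_at i j)"
proof (cases "von (Suc i) j")
  case True
  then show ?thesis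
    using vjump_vedge_at[OF True assms(1)] vedge_at_interior[OF True assms(1)] by (simp add: vvalue_def jump_def)
next
  case False
  then show ?thesis using von_iff[OF assms] by (simp add: vvalue_def)
qed

lemma hvalue_jump:
  assumes "i < n" "Suc j < l"
  shows "hvalue (jump p) i (Suc j) = p (cell_at i j) - p (cell_at i (Suc j))"
proof (cases "hon i (Suc j)")
  case True
  interpret t: mesh_grid "transpose_mesh M" T S l n by (rule transpose_grid)
  have "t.vjump (\<lambda>\<sigma>. p (flip \<sigma>)) (flip (hedge_at i (Suc j))) = p (cell_at i (Suc j)) - p (cell_at i j)"
    using t.vjump_vedge_at[OF True[unfolded hon_eq] assms(2), of "\<lambda>\<sigma>. p (flip \<sigma>)"] assms
    by (simp add: hedge_at_def cell_at_transpose)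
  then show ?thesis
    using True hedge_at_interior[OF True assms(2)] by (simp add: hvalue_def jump_def)
next
  case False
  then show ?thesis using hon_iff[OF assms] by (simp add: hvalue_def)
qed

text \<open>The four squares around a grid point are traversed in a circle, and the differences
  cancel.\<close>

lemma boundary1_jump: "boundary1 M (jump p) z = 0"
proof (cases "z \<in> interior_vertices M")
  case True
  then obtain i j where "Suc i < n" "Suc j < l" "z = (S (Suc i), T (Suc j))" by (rule interior_vertexE)
  then show ?thesis by (simp add: boundary1_grid vvalue_jump hvalue_jump)
qed (simp add: boundary1_def)

lemma chain_eqI:
  assumes "\<And>\<tau>. \<tau> \<notin> interior_edges M \<Longrightarrow> x \<tau> = 0" "\<And>\<tau>. \<tau> \<notin> interior_edges M \<Longrightarrow> y \<tau> = 0"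
    and v: "\<And>i j. Suc i < n \<Longrightarrow> j < l \<Longrightarrow> vvalue x (Suc i) j = vvalue y (Suc i) j"
    and h: "\<And>i j. i < n \<Longrightarrow> Suc j < l \<Longrightarrow> hvalue x i (Suc j) = hvalue y i (Suc j)"
  shows "x = y"
proof
  fix \<tau>
  consider "\<tau> \<in> interior_vedges M" | "\<tau> \<in> interior_hedges M" | "\<tau> \<notin> interior_edges M"
    using interior_edges_split(1)[OF mesh] by blast
  then show "x \<tau> = y \<tau>"
  proof cases
    case 1
    then obtain i j1 j2 where e: "vedge \<tau> (Suc i) j1 j2" "Suc i < n" by (rule interior_vedgeE)
    then have "j1 < j2" "j2 \<le> l" by (auto simp: vedge_def)
    then show ?thesis using v[OF e(2), of j1] vedge_at_eq[OF e(1), of j1] by (simp add: vvalue_def)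
  next
    case 2
    then obtain j i1 i2 where e: "hedge \<tau> (Suc j) i1 i2" "Suc j < l" by (rule interior_hedgeE)
    then have "i1 < i2" "i2 \<le> n" by (auto simp: hedge_def)
    then show ?thesis using h[OF _ e(2), of i1] hedge_at_eq[OF e(1), of i1] by (simp add: hvalue_def)
  next
    case 3
    then show ?thesis using assms(1,2) by simp
  qed
qed

lemma jump_eq_0: "\<tau> \<notin> interior_edges M \<Longrightarrow> jump p \<tau> = 0"
  using interior_edges_split(1)[OF mesh] by (simp add: jump_def)

text \<open>A cycle is integrated along the path that first ascends in the leftmost column of the grid.\<close>

lemma cycle_is_jump:
  fixes x :: "point set \<Rightarrow> real poly poly"
  assumes x0: "\<And>\<tau>. \<tau> \<notin> interior_edges M \<Longrightarrow> x \<tau> = 0" and cyc: "\<And>z. boundary1 M x z = 0"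
  shows "\<exists>p. (\<forall>\<sigma>. \<sigma> \<notin> cells M \<longrightarrow> p \<sigma> = 0) \<and> jump p = x \<and>
    p ` cells M \<subseteq> {(\<Sum>i'<i. vvalue x (Suc i') j) - (\<Sum>j'<j. hvalue x 0 (Suc j')) | i j. i < n \<and> j < l}"
proof -
  define P where "P i j = (\<Sum>i'<i. vvalue x (Suc i') j) - (\<Sum>j'<j. hvalue x 0 (Suc j'))" for i j
  have stepv: "P (Suc i) j = P i j + vvalue x (Suc i) j" for i j by (simp add: P_def)
  \<comment> \<open>In column 0 this is the definition of \<open>P\<close>. The cycle condition at
    the grid point between two columns carries it from one column to the next.\<close>
  have steph: "P i (Suc j) = P i j - hvalue x i (Suc j)" if "i < n" "Suc j < l" for i j
    using that(1)
  proof (induction i)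
    case (Suc i)
    then show ?case using stepv[of i j] stepv[of i "Suc j"] boundary1_grid[OF Suc.prems that(2), of x] cyc
      by (simp add: algebra_simps)
  qed (simp add: P_def)
  \<comment> \<open>No line is drawn inside a cell, so \<open>P\<close> does not change within its
    box of squares, first along the rows and then down the leftmost column of the box.\<close>
  have const: "P i j = P i' j'" if ij: "i < n" "j < l" "i' < n" "j' < l" and eq: "cell_at i j = cell_at i' j'" for i j i' j'
  proof -
    obtain i1 i2 j1 j2 where b: "i1 \<le> i" "i < i2" "i2 \<le> n" "j1 \<le> j" "j < j2" "j2 \<le> l"
      and c: "\<And>i' j'. i1 \<le> i' \<Longrightarrow> i' < i2 \<Longrightarrow> j1 \<le> j' \<Longrightarrow> j' < j2 \<Longrightarrow> cell_at i' j' = cell_at i j"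
      and in_box: "\<And>i' j'. i' < n \<Longrightarrow> j' < l \<Longrightarrow> cell_at i' j' = cell_at i j \<Longrightarrow> i1 \<le> i' \<and> i' < i2 \<and> j1 \<le> j' \<and> j' < j2"
      by (rule cell_at_box[OF ij(1,2)]) (rule that)
    have row: "P a e = P i1 e" if "i1 \<le> a" "a < i2" "j1 \<le> e" "e < j2" for a e
      using that(1,2)
    proof (induction a rule: dec_induct)
      case (step a)
      have "cell_at a e = cell_at (Suc a) e" using c[of a e] c[of "Suc a" e] step that by simp
      then have "\<not> von (Suc a) e" using von_iff[of a e] step b that by simp
      then show ?case using stepv[of a e] step by (simp add: vvalue_def)
    qed simp
    have col: "P i1 e = P i1 j1" if "j1 \<le> e" "e < j2" for e
      using that
    proof (induction e rule: dec_induct)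
      case (step e)
      have "cell_at i1 e = cell_at i1 (Suc e)" using c[of i1 e] c[of i1 "Suc e"] step b by simp
      then have "\<not> hon i1 (Suc e)" using hon_iff[of i1 e] step b by simp
      then show ?case using steph[of i1 e] step b by (simp add: hvalue_def)
    qed simp
    have "P a e = P i1 j1" if "i1 \<le> a \<and> a < i2 \<and> j1 \<le> e \<and> e < j2" for a e
      using row[of a e] col[of e] that by (elim conjE) (rule trans)
    from this[of i j] this[of i' j'] show ?thesis using b in_box[OF ij(3,4) eq[symmetric]] by simp
  qed
  define idx where "idx \<sigma> = (SOME z. fst z < n \<and> snd z < l \<and> cell_at (fst z) (snd z) = \<sigma>)" for \<sigma>
  have idx: "fst (idx \<sigma>) < n \<and> snd (idx \<sigma>) < l \<and> cell_at (fst (idx \<sigma>)) (snd (idx \<sigma>)) = \<sigma>" if s: "\<sigma> \<in> cells M" for \<sigma>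
  proof -
    obtain i j where "i < n" "j < l" "cell_at i j = \<sigma>" by (rule cells_cell_at[OF s])
    then show ?thesis
      using someI[of "\<lambda>z. fst z < n \<and> snd z < l \<and> cell_at (fst z) (snd z) = \<sigma>" "(i, j)"]
      unfolding idx_def by simp
  qed
  define p where "p \<sigma> = (if \<sigma> \<in> cells M then P (fst (idx \<sigma>)) (snd (idx \<sigma>)) else 0)" for \<sigma>
  have p: "p (cell_at i j) = P i j" if "i < n" "j < l" for i j
  proof -
    note c = cell_at(1)[OF that]
    have "p (cell_at i j) = P (fst (idx (cell_at i j))) (snd (idx (cell_at i j)))" unfolding p_def using c by simp
    also have "\<dots> = P i j" using idx[OF c] that by (intro const) auto
    finally show ?thesis .
  qed
  have "jump p = x"
  proof (rule chain_eqI)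
    fix i j assume ij: "Suc i < n" "j < l"
    show "vvalue (jump p) (Suc i) j = vvalue x (Suc i) j"
      unfolding vvalue_jump[OF ij] using p[OF ij] p[of i j] ij stepv[of i j] by simp
  next
    fix i j assume ij: "i < n" "Suc j < l"
    show "hvalue (jump p) i (Suc j) = hvalue x i (Suc j)"
      unfolding hvalue_jump[OF ij] using p[OF ij] p[of i j] ij steph[OF ij] by simp
  qed (simp_all add: jump_eq_0 x0)
  \<comment> \<open>Recorded because a subspace that contains the values of \<open>x\<close> also
    contains these sums; this will bound the bidegree of \<open>p\<close>.\<close>
  moreover have "p ` cells M \<subseteq> {P i j | i j. i < n \<and> j < l}" using idx by (auto simp: p_def)
  ultimately show ?thesis unfolding P_def by (intro exI[of _ p]) (auto simp: p_def)
qed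

text \<open>Neighbouring squares have equal values, and every square is joined to the first one
  along a row and a column.\<close>

lemma jump_0_constant:
  assumes "jump p = (\<lambda>_. 0)"
  shows "\<sigma> \<in> cells M \<Longrightarrow> p \<sigma> = p (cell_at 0 0)"
proof -
  have v: "p (cell_at (Suc i) j) = p (cell_at i j)" if "Suc i < n" "j < l" for i j
    using vvalue_jump[OF that, of p] unfolding assms by (simp add: vvalue_def)
  have h: "p (cell_at i (Suc j)) = p (cell_at i j)" if "i < n" "Suc j < l" for i j
    using hvalue_jump[OF that, of p] unfolding assms by (simp add: hvalue_def)
  have "p (cell_at i j) = p (cell_at 0 j)" if "i < n" "j < l" for i j
    using that by (induction i) (simp_all add: v)
  moreover have "p (cell_at 0 j) = p (cell_at 0 0)" if "j < l" for j
    using that pos by (induction j) (simp_all add: h)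
  ultimately show "\<sigma> \<in> cells M \<Longrightarrow> p \<sigma> = p (cell_at 0 0)" by (metis cells_cell_at)
qed

text \<open>With the constant coefficient \<open>p\<close> on consecutive edges, the contributions
  at intermediate vertices cancel.\<close>

lemma vertical_chain:
  fixes p :: "real poly poly"
  assumes i: "0 < i" "i < n" and j: "j1 \<le> j2" "j2 \<le> l" and on: "\<And>j. j1 \<le> j \<Longrightarrow> j < j2 \<Longrightarrow> von i j"
    and ends: "(S i, T j1) \<in> vertices M" "(S i, T j2) \<in> vertices M"
  defines "x \<equiv> (\<lambda>\<tau>. if \<tau> \<in> interior_vedges M \<and> \<tau> \<subseteq> {S i} \<times> {T j1..T j2} then p else 0)"
  shows "boundary1 M x z = (if z \<in> interior_vertices M then
    (if z = (S i, T j2) then p else 0) - (if z = (S i, T j1) then p else 0) else 0)"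
proof (cases "z \<in> interior_vertices M")
  case True
  then obtain i' j' where z: "Suc i' < n" "Suc j' < l" "z = (S (Suc i'), T (Suc j'))" by (rule interior_vertexE)
  have h: "hvalue x a (Suc j') = 0" for a
    using hedge_at_interior[of a j'] z(2) by (auto simp: hvalue_def x_def)
  have v: "vvalue x a b = (if a = i \<and> j1 \<le> b \<and> b < j2 then p else 0)" for a b
  proof (cases "von a b")
    case True
    then obtain c d where e: "vedge (vedge_at a b) a c d" "c \<le> b" "b < d" by (rule von_vedge)
    have eq: "vedge_at a b = {S a} \<times> {T c..T d}" "c < d" using e(1) by (auto simp: vedge_def)
    then have sub: "vedge_at a b \<subseteq> {S i} \<times> {T j1..T j2} \<longleftrightarrow> a = i \<and> j1 \<le> c \<and> d \<le> j2"
      by (auto simp: times_subset_iff)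
    \<comment> \<open>An edge that overlaps the interval cannot reach beyond its ends, since these
      are vertices.\<close>
    have "j1 \<le> c \<and> d \<le> j2 \<longleftrightarrow> j1 \<le> b \<and> b < j2" if "a = i"
    proof
      assume b: "j1 \<le> b \<and> b < j2"
      have "j1 \<le> c" using vedge_vertex[OF e(1), of j1] ends(1) that b e by force
      moreover have "d \<le> j2" using vedge_vertex[OF e(1), of j2] ends(2) that b e by force
      ultimately show "j1 \<le> c \<and> d \<le> j2" ..
    qed (use e in auto)
    moreover have "a = i \<Longrightarrow> vedge_at a b \<in> interior_vedges M" using vedge_interior_iff[OF e(1)] i by simp
    ultimately show ?thesis using True sub by (auto simp: vvalue_def x_def)
  next
    case False then show ?thesis using on by (auto simp: vvalue_def)
  qed
  have *: "z = (S i, T b) \<longleftrightarrow> Suc i' = i \<and> Suc j' = b" for b using z(3) by auto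
  show ?thesis
    unfolding * using boundary1_grid[OF z(1,2), of x] z(3) True j by (auto simp: v h)
qed (simp add: boundary1_def)

end

section \<open>The cokernel vanishes for weighted meshes\<close>

lemma chain_scale_eq: "chain_scale = pointwise poly_scale"
  by (simp add: fun_eq_iff chain_scale_def pointwise_def poly_scale_def)

interpretation chains: vector_space "pointwise poly_scale :: real \<Rightarrow> ('i \<Rightarrow> real poly poly) \<Rightarrow> _"
  by (rule poly2.vector_space_pointwise)

lemma subspace_tensor_preimage:
  assumes "poly2.subspace U"
  shows "poly1.subspace {f. tensor f g \<in> U}" "poly1.subspace {g. tensor f g \<in> U}"
  using assms
  by (auto intro!: poly1.subspaceI simp: tensor_simps poly2.subspace_0 poly2.subspace_add poly2.subspace_scale)

lemma edge_ideal_vertical: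
  assumes "vertical \<tau>" "z \<in> \<tau>"
  shows "edge_ideal m m' rh rv \<tau> = videal m m' (fst z) (rh (fst z) + 1)"
proof -
  obtain a c d where t: "c < d" "\<tau> = {a} \<times> {c..d}" using assms(1) by (auto simp: vertical_def)
  then have "line_poly \<tau> = [:[:- a, 1:]:]" using assms(1) by (simp add: line_poly_def edge_src_vertical)
  also have "\<dots> = tensor [:- a, 1:] 1" by (rule poly_eqI) (auto simp: coeff_pCons one_pCons split: nat.splits)
  finally have "line_poly \<tau> = tensor [:- a, 1:] 1" .
  moreover have "fst z = a" using t assms(2) by auto
  ultimately show ?thesis by (simp add: edge_ideal_def videal_def edge_smoothness_vertical[OF assms])
qed

lemma edge_ideal_horizontal:
  assumes "horizontal \<tau>" "z \<in> \<tau>"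
  shows "edge_ideal m m' rh rv \<tau> = hideal m m' (snd z) (rv (snd z) + 1)"
proof -
  obtain a b c where t: "a < b" "\<tau> = {a..b} \<times> {c}" using assms(1) by (auto simp: horizontal_def)
  have "\<not> vertical \<tau>" using assms(1) not_horizontal_and_vertical by blast
  then have "line_poly \<tau> = [:[:- c:], 1:]" using t by (simp add: line_poly_def edge_src_horizontal)
  also have "\<dots> = tensor 1 [:- c, 1:]" by (rule poly_eqI) (auto simp: coeff_pCons one_pCons split: nat.splits)
  finally have "line_poly \<tau> = tensor 1 [:- c, 1:]" .
  moreover have "snd z = c" using t assms(2) by auto
  ultimately show ?thesis by (simp add: edge_ideal_def hideal_def edge_smoothness_horizontal[OF assms])
qed

lemma subspace_edge_ideal:
  "horizontal \<tau> \<or> vertical \<tau> \<Longrightarrow> poly2.subspace (edge_ideal m m' rh rv \<tau>)"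
  using edge_ideal_vertical[of \<tau>] edge_ideal_horizontal[of \<tau>] connected_if_vertical[of \<tau>] connected_if_horizontal[of \<tau>]
    subspace_videal subspace_hideal by fastforce

lemma vertex_ideal_eq:
  assumes "is_tmesh M" "\<gamma> \<in> vertices M"
  shows "vertex_ideal m m' rh rv M \<gamma> =
    {p + q | p q. p \<in> videal m m' (fst \<gamma>) (rh (fst \<gamma>) + 1) \<and> q \<in> hideal m m' (snd \<gamma>) (rv (snd \<gamma>) + 1)}"
proof -
  obtain \<tau>v \<tau>h where t: "\<tau>v \<in> edges M" "vertical \<tau>v" "\<gamma> \<in> \<tau>v" "\<tau>h \<in> edges M" "horizontal \<tau>h" "\<gamma> \<in> \<tau>h"
    using is_tmeshD(11,12)[OF assms] by blast
  show ?thesis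
  proof (intro equalityI subsetI)
    fix y assume "y \<in> vertex_ideal m m' rh rv M \<gamma>"
    then show "y \<in> {p + q | p q. p \<in> videal m m' (fst \<gamma>) (rh (fst \<gamma>) + 1) \<and> q \<in> hideal m m' (snd \<gamma>) (rv (snd \<gamma>) + 1)}"
      unfolding vertex_ideal_def using edge_ideal_vertical[of _ \<gamma>] edge_ideal_horizontal[of _ \<gamma>] by fastforce
  next
    fix y assume "y \<in> {p + q | p q. p \<in> videal m m' (fst \<gamma>) (rh (fst \<gamma>) + 1) \<and> q \<in> hideal m m' (snd \<gamma>) (rv (snd \<gamma>) + 1)}"
    then obtain p q where "y = p + q" "p \<in> edge_ideal m m' rh rv \<tau>v" "q \<in> edge_ideal m m' rh rv \<tau>h"
      using edge_ideal_vertical[OF t(2,3)] edge_ideal_horizontal[OF t(5,6)] by auto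
    then show "y \<in> vertex_ideal m m' rh rv M \<gamma>" unfolding vertex_ideal_def using t by blast
  qed
qed

lemma subspace_vertex_ideal:
  assumes "is_tmesh M" "\<gamma> \<in> vertices M"
  shows "poly2.subspace (vertex_ideal m m' rh rv M \<gamma>)"
  unfolding vertex_ideal_eq[OF assms] by (intro poly2.subspace_sums subspace_videal subspace_hideal)

lemma edge_chains_eq: "edge_chains m m' rh rv M = families (interior_edges M) (edge_ideal m m' rh rv)"
  by (simp add: edge_chains_def families_def)

lemma vertex_chains_eq: "vertex_chains m m' rh rv M = families (interior_vertices M) (vertex_ideal m m' rh rv M)"
  by (simp add: vertex_chains_def families_def)

lemma linear_boundary1: "Vector_Spaces.linear (pointwise poly_scale) (pointwise poly_scale) (boundary1 M)"
proof
  fix x y :: "point set \<Rightarrow> real poly poly" and c :: real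
  show "boundary1 M (x + y) = boundary1 M x + boundary1 M y"
    by (auto simp: boundary1_def fun_eq_iff sum.distrib)
  show "boundary1 M (pointwise poly_scale c x) = pointwise poly_scale c (boundary1 M x)"
    by (auto simp: boundary1_def fun_eq_iff pointwise_def poly2.scale_sum_right poly2.scale_right_diff_distrib)
qed

interpretation chain_maps: vector_space_pair
  "pointwise poly_scale :: real \<Rightarrow> ('i \<Rightarrow> real poly poly) \<Rightarrow> _"
  "pointwise poly_scale :: real \<Rightarrow> ('j \<Rightarrow> real poly poly) \<Rightarrow> _" ..

lemma subspace_edge_chains:
  assumes "is_tmesh M"
  shows "chains.subspace (edge_chains m m' rh rv M)"
  unfolding edge_chains_eq using is_tmeshD(4)[OF assms]
  by (intro poly2.subspace_families subspace_edge_ideal) (auto simp: interior_edges_def)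

lemma subspace_boundary1_image:
  assumes "is_tmesh M"
  shows "chains.subspace (boundary1 M ` edge_chains m m' rh rv M)"
  by (intro chain_maps.linear_subspace_image linear_boundary1 subspace_edge_chains assms)

text \<open>An element of a nonempty basis would have two representations modulo \<open>W\<close>,
  by itself and by zero.\<close>

lemma quotient_dim_0:
  assumes "V \<subseteq> W" "\<And>v. scl 0 v = 0" "\<And>v. scl 1 v = v" "0 \<in> W"
  shows "quotient_dim scl V W = 0"
  unfolding quotient_dim_def
proof (rule the_equality)
  have "quotient_basis scl V W {}" unfolding quotient_basis_def
  proof (intro conjI ballI)
    fix v assume "v \<in> V"
    then show "\<exists>!c. (\<forall>b. b \<notin> {} \<longrightarrow> c b = 0) \<and> v - (\<Sum>b\<in>{}. scl (c b) b) \<in> W"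
      using assms(1) by (intro ex1I[of _ "\<lambda>_. 0"]) auto
  qed auto
  then show "\<exists>B. quotient_basis scl V W B \<and> card B = 0" by (intro exI[of _ "{}"]) simp
  fix n assume "\<exists>B. quotient_basis scl V W B \<and> card B = n"
  then obtain B where B: "quotient_basis scl V W B" "card B = n" by blast
  then have fin: "finite B" "B \<subseteq> V" by (auto simp: quotient_basis_def)
  have "B = {}"
  proof (rule ccontr)
    assume "B \<noteq> {}"
    then obtain b where b: "b \<in> B" by blast
    then have bV: "b \<in> V" using fin by blast
    define P where "P c \<longleftrightarrow> (\<forall>b. b \<notin> B \<longrightarrow> c b = 0) \<and> b - (\<Sum>b\<in>B. scl (c b) b) \<in> W" for c
    have ex1: "\<exists>!c. P c"
      using B(1) bV unfolding quotient_basis_def P_def by blast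
    have "(\<Sum>b'\<in>B. scl (if b' = b then 1 else 0) b') = (\<Sum>b'\<in>B. if b' = b then b' else 0)"
      using assms(2,3) by (intro sum.cong) auto
    then have "P (\<lambda>b'. if b' = b then 1 else 0)" using b fin assms(4) by (auto simp: P_def)
    moreover have "P (\<lambda>_. 0)" using assms(1,2) bV by (auto simp: P_def)
    ultimately have "(\<lambda>b'. if b' = b then 1 else 0) = (\<lambda>_. 0 :: real)" using ex1 by blast
    then show False by (metis zero_neq_one)
  qed
  then show "n = 0" using B(2) by simp
qed

context mesh_grid begin

lemma horizontal_chain:
  fixes p :: "real poly poly"
  assumes "0 < j" "j < l" "i1 \<le> i2" "i2 \<le> n" "\<And>i. i1 \<le> i \<Longrightarrow> i < i2 \<Longrightarrow> hon i j"
    and "(S i1, T j) \<in> vertices M" "(S i2, T j) \<in> vertices M"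
  defines "x \<equiv> (\<lambda>\<tau>. if \<tau> \<in> interior_hedges M \<and> \<tau> \<subseteq> {S i1..S i2} \<times> {T j} then p else 0)"
  shows "boundary1 M x z = (if z \<in> interior_vertices M then
    (if z = (S i2, T j) then p else 0) - (if z = (S i1, T j) then p else 0) else 0)"
proof -
  interpret t: mesh_grid "transpose_mesh M" T S l n by (rule transpose_grid)
  have "flip \<tau> \<in> interior_hedges M \<longleftrightarrow> \<tau> \<in> interior_vedges (transpose_mesh M)" for \<tau>
    by (metis flip_flip flip_in_flip_image interior_hvedges_transpose(2))
  moreover have "flip \<tau> \<subseteq> {S i1..S i2} \<times> {T j} \<longleftrightarrow> \<tau> \<subseteq> {T j} \<times> {S i1..S i2}" for \<tau>
    by (metis flip_subset_iff flip_times)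
  ultimately have x: "(\<lambda>\<tau>. x (flip \<tau>)) =
      (\<lambda>\<tau>. if \<tau> \<in> interior_vedges (transpose_mesh M) \<and> \<tau> \<subseteq> {T j} \<times> {S i1..S i2} then p else 0)"
    by (simp add: x_def fun_eq_iff)
  have eq: "prod.swap z = (T j, S i) \<longleftrightarrow> z = (S i, T j)" for i by (cases z) auto
  have "boundary1 M x z = boundary1 (transpose_mesh M) (\<lambda>\<tau>. x (flip \<tau>)) (prod.swap z)"
    by (simp only: boundary1_transpose)
  also have "\<dots> = (if prod.swap z \<in> interior_vertices (transpose_mesh M) then
    (if prod.swap z = (T j, S i2) then p else 0) - (if prod.swap z = (T j, S i1) then p else 0) else 0)"
    unfolding x by (rule t.vertical_chain) (use assms(1-7) in \<open>auto simp: hon_eq\<close>)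
  finally show ?thesis unfolding eq interior_vertices_transpose swap_in_flip .
qed

text \<open>A segment reaches the boundary of the rectangle at a perpendicular boundary side, and
  the common point is a vertex by \<open>vertices_eq\<close>.\<close>

lemma frontier_line_vertex:
  assumes "z \<in> lines d M" "z \<in> frontier (domain M)"
  shows "z \<in> vertices M"
proof -
  have v: "(S i, T j) \<in> vgrid M" if "i = 0 \<or> i = n" "j \<le> l" for i j
  proof -
    \<comment> \<open>The topmost grid point belongs to the last unit segment, whose index is
      \<open>l - 1\<close>.\<close>
    have "von i (if j = l then j - 1 else j)" using von_boundary that pos by auto
    then show ?thesis using that pos unfolding von_def by (auto split: if_splits)
  qed
  have h: "(S i, T j) \<in> hgrid M" if "j = 0 \<or> j = l" "i \<le> n" for i j
  proof -
    have "hon (if i = n then i - 1 else i) j" using hon_boundary that pos by auto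
    then show ?thesis using that pos unfolding hon_def by (auto split: if_splits)
  qed
  obtain x y where z: "z = (x, y)" by fastforce
  have f: "(x, y) \<in> {S 0..S n} \<times> {T 0, T l} \<union> {S 0, S n} \<times> {T 0..T l}"
    using assms(2) pos unfolding dom z by (subst (asm) frontier_rectangle) auto
  show ?thesis
  proof (cases d)
    case True
    then have g: "(x, y) \<in> hgrid M" "T 0 < y" "y < T l" using assms(1) hlines_eq[OF rect] z by (auto simp: lines_def)
    then obtain j where "y = T j" "j \<le> l" using hgrid_point by blast
    moreover have "x = S 0 \<or> x = S n" using f g by auto
    ultimately have "(x, y) \<in> vgrid M" using v by auto
    then show ?thesis using g z vertices_eq[OF mesh] by blast
  next
    case False
    then have g: "(x, y) \<in> vgrid M" "S 0 < x" "x < S n" using assms(1) vlines_eq[OF rect] z by (auto simp: lines_def)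
    then obtain i where "x = S i" "i \<le> n" using vgrid_point by blast
    moreover have "y = T 0 \<or> y = T l" using f g by auto
    ultimately have "(x, y) \<in> hgrid M" using h by auto
    then show ?thesis using g z vertices_eq[OF mesh] by blast
  qed
qed

end

section \<open>Classes of vertices modulo the image of the boundary map\<close>

locale spline_grid = mesh_grid +
  fixes m m' :: nat and rh rv :: "real \<Rightarrow> nat"
  assumes smooth: "smoothness_le m m' rh rv M"
begin

abbreviation "im_boundary \<equiv> boundary1 M ` edge_chains m m' rh rv M"

definition line_ideal :: "bool \<Rightarrow> point \<Rightarrow> real poly poly set" where
  "line_ideal d z = (if d then hideal m m' (snd z) (rv (snd z) + 1) else videal m m' (fst z) (rh (fst z) + 1))"

lemma subspace_im: "chains.subspace im_boundary"
  by (rule subspace_boundary1_image[OF mesh])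

text \<open>This is \<open>[z] p\<close>, with the convention that the symbol is 0 unless
  \<open>z\<close> is an interior vertex.\<close>

definition restricted_single :: "point \<Rightarrow> real poly poly \<Rightarrow> point \<Rightarrow> real poly poly" where
  "restricted_single z p = (\<lambda>w. if w \<in> interior_vertices M \<and> w = z then p else 0)"

text \<open>It is the boundary of the chain with coefficient \<open>p\<close> on all edges between
  \<open>z\<close> and \<open>w\<close>. The order of the two points fixes the sign relative to the
  orientation of the edges.\<close>

lemma path_in_image_le:
  assumes \<rho>: "\<rho> \<in> components (lines d M)" and z: "z \<in> \<rho>" "z \<in> vertices M" and w: "w \<in> \<rho>" "w \<in> vertices M"
    and p: "p \<in> line_ideal d z" and le: "fst z \<le> fst w" "snd z \<le> snd w"
  shows "restricted_single w p - restricted_single z p \<in> im_boundary"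
proof -
  obtain i j where zg: "i \<le> n" "j \<le> l" "z = (S i, T j)" by (rule vertex_grid[OF z(2)])
  obtain i' j' where wg: "i' \<le> n" "j' \<le> l" "w = (S i', T j')" by (rule vertex_grid[OF w(2)])
  have conn: "connected \<rho>" using in_components_connected[OF \<rho>] .
  have "z \<in> lines d M" using in_components_subset[OF \<rho>] z(1) by blast
  show ?thesis
  proof (cases d)
    case False
    then have r: "\<rho> \<in> components (vlines M)" using \<rho> by (simp add: lines_def)
    have i: "i' = i" "0 < i" "i < n" and j: "j \<le> j'"
      using component_vlines_level[OF mesh r z(1) w(1)] \<open>z \<in> lines d M\<close> False zg wg le vlines_eq[OF rect]
      by (auto simp: lines_def)
    have "connected (snd ` \<rho>)" using conn by (intro connected_continuous_image continuous_intros)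
    \<comment> \<open>The projection of the connected segment contains the whole interval, so every
      unit segment between the two points is drawn.\<close>
    then have snd: "{T j..T j'} \<subseteq> snd ` \<rho>"
      by (rule connected_contains_Icc) (use z(1) w(1) zg wg in force)+
    have on: "von i e" if "j \<le> e" "e < j'" for e
    proof (rule von_if_mid)
      have "midT e \<in> snd ` \<rho>" using snd that by auto
      then obtain u where u: "u \<in> \<rho>" "snd u = midT e" by auto
      then have "u = (S i, midT e)" using component_vlines_level[OF mesh r z(1) u(1)] zg by (cases u) auto
      then show "(S i, midT e) \<in> vgrid M" using u in_components_subset[OF r] vlines_eq[OF rect] by blast
    qed
    let ?x = "\<lambda>\<tau>. if \<tau> \<in> interior_vedges M \<and> \<tau> \<subseteq> {S i} \<times> {T j..T j'} then p else 0"
    have "boundary1 M ?x = restricted_single w p - restricted_single z p"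
      using vertical_chain[OF i(2,3) j wg(2) on, of p] z w zg wg i(1)
      by (auto simp: fun_eq_iff restricted_single_def)
    moreover have "?x \<in> edge_chains m m' rh rv M"
    proof -
      have "p \<in> edge_ideal m m' rh rv \<tau>" if t: "\<tau> \<in> interior_vedges M" "\<tau> \<subseteq> {S i} \<times> {T j..T j'}" for \<tau>
      proof -
        have v: "vertical \<tau>" using t(1) by (simp add: interior_vedges_def)
        then obtain u where u: "u \<in> \<tau>" using connected_if_vertical by blast
        then have "fst u = fst z" using t(2) zg by auto
        then show ?thesis using edge_ideal_vertical[OF v u] p False by (simp add: line_ideal_def)
      qed
      moreover have "0 \<in> edge_ideal m m' rh rv \<tau>" if "\<tau> \<in> interior_edges M" for \<tau>
        using that is_tmeshD(4)[OF mesh] by (intro poly2.subspace_0 subspace_edge_ideal) (auto simp: interior_edges_def)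
      ultimately show ?thesis
        unfolding edge_chains_def using interior_edges_split(1)[OF mesh] by auto
    qed
    ultimately show ?thesis by (intro image_eqI[where x = ?x]) simp_all
  next
    case True
    then have r: "\<rho> \<in> components (hlines M)" using \<rho> by (simp add: lines_def)
    have j: "j' = j" "0 < j" "j < l" and i: "i \<le> i'"
      using component_hlines_level[OF mesh r z(1) w(1)] \<open>z \<in> lines d M\<close> True zg wg le hlines_eq[OF rect]
      by (auto simp: lines_def)
    have "connected (fst ` \<rho>)" using conn by (intro connected_continuous_image continuous_intros)
    then have fst: "{S i..S i'} \<subseteq> fst ` \<rho>"
      by (rule connected_contains_Icc) (use z(1) w(1) zg wg in force)+
    interpret t: mesh_grid "transpose_mesh M" T S l n by (rule transpose_grid)
    have on: "hon e j" if "i \<le> e" "e < i'" for e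
      unfolding hon_eq
    proof (rule t.von_if_mid)
      have "midS e \<in> fst ` \<rho>" using fst that by auto
      then obtain u where u: "u \<in> \<rho>" "fst u = midS e" by auto
      then have "u = (midS e, T j)" using component_hlines_level[OF mesh r z(1) u(1)] zg by (cases u) auto
      then have "(midS e, T j) \<in> hgrid M" using u in_components_subset[OF r] hlines_eq[OF rect] by blast
      then show "(T j, t.midT e) \<in> vgrid (transpose_mesh M)" by (simp add: t.midT_def midS_def)
    qed
    let ?x = "\<lambda>\<tau>. if \<tau> \<in> interior_hedges M \<and> \<tau> \<subseteq> {S i..S i'} \<times> {T j} then p else 0"
    have "boundary1 M ?x = restricted_single w p - restricted_single z p"
      using horizontal_chain[OF j(2,3) i wg(1) on, of p] z w zg wg j(1)
      by (auto simp: fun_eq_iff restricted_single_def)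
    moreover have "?x \<in> edge_chains m m' rh rv M"
    proof -
      have "p \<in> edge_ideal m m' rh rv \<tau>" if t: "\<tau> \<in> interior_hedges M" "\<tau> \<subseteq> {S i..S i'} \<times> {T j}" for \<tau>
      proof -
        have v: "horizontal \<tau>" using t(1) by (simp add: interior_hedges_def)
        then obtain u where u: "u \<in> \<tau>" using connected_if_horizontal by blast
        then have "snd u = snd z" using t(2) zg by auto
        then show ?thesis using edge_ideal_horizontal[OF v u] p True by (simp add: line_ideal_def)
      qed
      moreover have "0 \<in> edge_ideal m m' rh rv \<tau>" if "\<tau> \<in> interior_edges M" for \<tau>
        using that is_tmeshD(4)[OF mesh] by (intro poly2.subspace_0 subspace_edge_ideal) (auto simp: interior_edges_def)
      ultimately show ?thesis
        unfolding edge_chains_def using interior_edges_split(1)[OF mesh] by auto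
    qed
    ultimately show ?thesis by (intro image_eqI[where x = ?x]) simp_all
  qed
qed

lemma component_level:
  assumes "\<rho> \<in> components (lines d M)" "z \<in> \<rho>" "w \<in> \<rho>"
  shows "if d then snd z = snd w else fst z = fst w"
  using assms component_hlines_level[OF mesh, of \<rho> z w] component_vlines_level[OF mesh, of \<rho> z w]
  by (auto simp: lines_def)

lemma line_ideal_component:
  assumes "\<rho> \<in> components (lines d M)" "z \<in> \<rho>" "w \<in> \<rho>"
  shows "line_ideal d z = line_ideal d w"
  using component_level[OF assms] by (auto simp: line_ideal_def)

lemma path_in_image:
  assumes \<rho>: "\<rho> \<in> components (lines d M)" and z: "z \<in> \<rho>" "z \<in> vertices M" and w: "w \<in> \<rho>" "w \<in> vertices M"
    and p: "p \<in> line_ideal d z"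
  shows "restricted_single w p - restricted_single z p \<in> im_boundary"
proof (cases "fst z \<le> fst w \<and> snd z \<le> snd w")
  case True then show ?thesis using path_in_image_le assms by blast
next
  case False
  then have "fst w \<le> fst z \<and> snd w \<le> snd z" using component_level[OF \<rho> z(1) w(1)] by (auto split: if_splits)
  then have "restricted_single z p - restricted_single w p \<in> im_boundary"
    using path_in_image_le[OF \<rho> w z] p line_ideal_component[OF \<rho> z(1) w(1)] by blast
  from chains.subspace_neg[OF subspace_im this] show ?thesis by simp
qed

lemma single_in_image_transfer:
  assumes "\<rho> \<in> components (lines d M)" "z \<in> \<rho>" "z \<in> vertices M" "w \<in> \<rho>" "w \<in> vertices M" "p \<in> line_ideal d z"
    and "restricted_single z p \<in> im_boundary"
  shows "restricted_single w p \<in> im_boundary"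
  using chains.subspace_add[OF subspace_im path_in_image[OF assms(1-6)] assms(7)] by simp

text \<open>Transport to a point of \<open>\<rho>\<close> on the boundary of the domain, where the
  symbol is 0.\<close>

lemma single_in_image_boundary:
  assumes "\<rho> \<in> components (lines d M)" "z \<in> \<rho>" "z \<in> vertices M" "p \<in> line_ideal d z"
    and "\<rho> \<inter> frontier (domain M) \<noteq> {}"
  shows "restricted_single z p \<in> im_boundary"
proof -
  obtain w where w: "w \<in> \<rho>" "w \<in> frontier (domain M)" using assms(5) by blast
  then have wv: "w \<in> vertices M" using frontier_line_vertex in_components_subset[OF assms(1)] by blast
  have "w \<notin> interior_vertices M" using w(2) by (simp add: interior_vertices_def frontier_def)
  then have "restricted_single w p = 0" by (auto simp: restricted_single_def fun_eq_iff)
  then have "restricted_single w p \<in> im_boundary" using chains.subspace_0[OF subspace_im] by simp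
  moreover have "p \<in> line_ideal d w" using assms(4) line_ideal_component[OF assms(1,2) w(1)] by simp
  ultimately show ?thesis using single_in_image_transfer[OF assms(1) w(1) wv assms(2,3)] by blast
qed

lemma linear_restricted_single: "Vector_Spaces.linear poly_scale (pointwise poly_scale) (restricted_single z)"
  by unfold_locales (auto simp: restricted_single_def pointwise_def fun_eq_iff)

lemma subspace_restricted_single: "poly2.subspace {p. restricted_single z p \<in> im_boundary}"
proof -
  interpret vp: vector_space_pair poly_scale "pointwise poly_scale :: real \<Rightarrow> (point \<Rightarrow> real poly poly) \<Rightarrow> _" ..
  show ?thesis by (rule vp.linear_subspace_linear_preimage[OF linear_restricted_single subspace_im])
qed

text \<open>For a fixed factor \<open>g\<close> in the ideal of the segment, the polynomials
  \<open>f\<close> for which \<open>[z] f(s) g(t)\<close> is a boundary form a subspace. A counted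
  vertex with first coordinate \<open>a\<close> supplies the powers of \<open>s - a\<close> in the
  ideal of the crossing line: they give boundaries at that vertex, hence also at \<open>z\<close> by
  transport along the segment.\<close>

lemma heavy_segment_in_image_h:
  assumes \<rho>: "\<rho> \<in> components (hlines M)" and z: "z \<in> \<rho>" "z \<in> vertices M" and p: "p \<in> line_ideal True z"
    and G: "finite G" "G \<subseteq> \<rho> \<inter> vertices M" "m + 1 \<le> (\<Sum>\<gamma>\<in>G. m - rh (fst \<gamma>))"
    and cross: "\<And>\<gamma> q. \<gamma> \<in> G \<Longrightarrow> q \<in> line_ideal False \<gamma> \<Longrightarrow> restricted_single \<gamma> q \<in> im_boundary"
  shows "restricted_single z p \<in> im_boundary"
proof -
  have r: "\<rho> \<in> components (lines True M)" using \<rho> by (simp add: lines_def)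
  define b r where "b = snd z" and "r = rv b + 1"
  have p': "p \<in> hideal m m' b r" using p by (simp add: line_ideal_def b_def r_def)
  have "tensor f g \<in> {p. restricted_single z p \<in> im_boundary}"
    if f: "degree f \<le> m" and g: "degree g \<le> m'" "[:-b, 1:] ^ r dvd g" for f g
  proof -
    have "f \<in> {f. tensor f g \<in> {p. restricted_single z p \<in> im_boundary}}"
    \<comment> \<open>\<open>m - rh a\<close> is the number of exponents \<open>k\<close> with
      \<open>rh a < k \<le> m\<close>, those for which the power lies in the ideal of the vertical
      line.\<close>
    proof (rule shifted_powers_generate[where I = "fst ` G" and d = "\<lambda>a. m - rh a"])
      \<comment> \<open>Points of a horizontal segment differ in the first coordinate, so the sum
        over vertices is a sum over distinct base points.\<close>
      have "inj_on fst G"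
      proof (rule inj_onI)
        fix u v assume uv: "u \<in> G" "v \<in> G" "fst u = fst v"
        then have "snd u = snd v" using component_level[OF r, of u v] G(2) by auto
        then show "u = v" using uv(3) by (simp add: prod_eq_iff)
      qed
      then show "m + 1 \<le> (\<Sum>a\<in>fst ` G. m - rh a)" using G(3) by (simp add: sum.reindex)
      show "poly1.subspace {f. tensor f g \<in> {p. restricted_single z p \<in> im_boundary}}"
        by (rule subspace_tensor_preimage[OF subspace_restricted_single])
      fix a k assume ak: "a \<in> fst ` G" "k \<le> m" "m < k + (m - rh a)"
      then obtain \<gamma> where \<gamma>: "\<gamma> \<in> G" "a = fst \<gamma>" by blast
      have k: "rh a + 1 \<le> k" using ak by auto
      let ?q = "tensor ([:-a, 1:] ^ k) g"
      have bd: "?q \<in> bideg_le m m'" using ak(2) g(1) by (intro tensor_bideg_le) (auto simp: degree_linear_power)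
      then have "?q \<in> line_ideal False \<gamma>"
        using k by (auto simp: line_ideal_def \<gamma> videal_def vdvd_iff intro!: dvd_smult le_imp_power_dvd simp del: power_Suc)
      then have c: "restricted_single \<gamma> ?q \<in> im_boundary" by (rule cross[OF \<gamma>(1)])
      obtain g' where "g = [:-b, 1:] ^ r * g'" using g(2) by (elim dvdE)
      then have "?q = tensor 1 [:-b, 1:] ^ r * tensor ([:-a, 1:] ^ k) g'" by (simp add: tensor_power tensor_mult)
      then have "?q \<in> hideal m m' b r" using bd by (simp add: hideal_def)
      then have "?q \<in> line_ideal True z" by (simp add: line_ideal_def b_def r_def)
      moreover have \<gamma>': "\<gamma> \<in> \<rho>" "\<gamma> \<in> vertices M" using G(2) \<gamma> by auto
      ultimately have "?q \<in> line_ideal True \<gamma>" using line_ideal_component[OF r z(1)] by blast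
      from single_in_image_transfer[OF r \<gamma>' z this c]
      show "[:-a, 1:] ^ k \<in> {f. tensor f g \<in> {p. restricted_single z p \<in> im_boundary}}" by simp
    qed (use G(1) f in auto)
    then show ?thesis by simp
  qed
  then have "(\<Sum>i\<le>m. tensor (monom 1 i) (coeff1 p i)) \<in> {p. restricted_single z p \<in> im_boundary}"
    using p' hdvd_imp[of b r p] by (intro poly2.subspace_sum[OF subspace_restricted_single])
      (auto simp: hideal_def degree_coeff1 degree_monom_eq)
  then show ?thesis using coeff_tensor_sum1[of p m m'] p' by (simp add: hideal_def)
qed

text \<open>The same argument with the variables exchanged: the first factor stays fixed and the
  second one varies.\<close>

lemma heavy_segment_in_image_v:
  assumes \<rho>: "\<rho> \<in> components (vlines M)" and z: "z \<in> \<rho>" "z \<in> vertices M" and p: "p \<in> line_ideal False z"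
    and G: "finite G" "G \<subseteq> \<rho> \<inter> vertices M" "m' + 1 \<le> (\<Sum>\<gamma>\<in>G. m' - rv (snd \<gamma>))"
    and cross: "\<And>\<gamma> q. \<gamma> \<in> G \<Longrightarrow> q \<in> line_ideal True \<gamma> \<Longrightarrow> restricted_single \<gamma> q \<in> im_boundary"
  shows "restricted_single z p \<in> im_boundary"
proof -
  have r: "\<rho> \<in> components (lines False M)" using \<rho> by (simp add: lines_def)
  define a r where "a = fst z" and "r = rh a + 1"
  have p': "p \<in> videal m m' a r" using p by (simp add: line_ideal_def a_def r_def)
  have "tensor f g \<in> {p. restricted_single z p \<in> im_boundary}"
    if f: "degree f \<le> m" "[:-a, 1:] ^ r dvd f" and g: "degree g \<le> m'" for f g
  proof -
    have "g \<in> {g. tensor f g \<in> {p. restricted_single z p \<in> im_boundary}}"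
    proof (rule shifted_powers_generate[where I = "snd ` G" and d = "\<lambda>b. m' - rv b"])
      have "inj_on snd G"
      proof (rule inj_onI)
        fix u v assume uv: "u \<in> G" "v \<in> G" "snd u = snd v"
        then have "fst u = fst v" using component_level[OF r, of u v] G(2) by auto
        then show "u = v" using uv(3) by (simp add: prod_eq_iff)
      qed
      then show "m' + 1 \<le> (\<Sum>a\<in>snd ` G. m' - rv a)" using G(3) by (simp add: sum.reindex)
      show "poly1.subspace {g. tensor f g \<in> {p. restricted_single z p \<in> im_boundary}}"
        by (rule subspace_tensor_preimage[OF subspace_restricted_single])
      fix b k assume bk: "b \<in> snd ` G" "k \<le> m'" "m' < k + (m' - rv b)"
      then obtain \<gamma> where \<gamma>: "\<gamma> \<in> G" "b = snd \<gamma>" by blast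
      have k: "rv b + 1 \<le> k" using bk by auto
      let ?q = "tensor f ([:-b, 1:] ^ k)"
      have bd: "?q \<in> bideg_le m m'" using bk(2) f(1) by (intro tensor_bideg_le) (auto simp: degree_linear_power)
      have "?q = tensor 1 [:-b, 1:] ^ (rv b + 1) * tensor f ([:-b, 1:] ^ (k - (rv b + 1)))"
        using k by (simp add: tensor_power tensor_mult del: power_Suc flip: power_add)
      then have "tensor 1 [:-b, 1:] ^ (rv b + 1) dvd ?q" by simp
      then have "?q \<in> line_ideal True \<gamma>" using bd \<gamma>(2) unfolding line_ideal_def hideal_def by simp
      then have c: "restricted_single \<gamma> ?q \<in> im_boundary" by (rule cross[OF \<gamma>(1)])
      have "?q \<in> videal m m' a r" using bd f(2) by (simp add: videal_def vdvd_iff dvd_smult)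
      then have "?q \<in> line_ideal False z" by (simp add: line_ideal_def a_def r_def)
      moreover have \<gamma>': "\<gamma> \<in> \<rho>" "\<gamma> \<in> vertices M" using G(2) \<gamma> by auto
      ultimately have "?q \<in> line_ideal False \<gamma>" using line_ideal_component[OF r z(1)] by blast
      from single_in_image_transfer[OF r \<gamma>' z this c]
      show "[:-b, 1:] ^ k \<in> {g. tensor f g \<in> {p. restricted_single z p \<in> im_boundary}}" by simp
    qed (use G(1) g in auto)
    then show ?thesis by simp
  qed
  then have "(\<Sum>j\<le>m'. tensor (coeff p j) (monom 1 j)) \<in> {p. restricted_single z p \<in> im_boundary}"
    using p' by (intro poly2.subspace_sum[OF subspace_restricted_single])
      (auto simp: videal_def vdvd_iff bideg_le_def degree_monom_eq)
  then show ?thesis using coeff_tensor_sum2[of p m m'] p' by (simp add: videal_def)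
qed

text \<open>The segments are treated in the order of their appearance: at a vertex counted for \<open>\<rho>\<close>, the
  crossing segment reaches the boundary of the domain or has appeared before \<open>\<rho>\<close>.\<close>

lemma MIS_in_image:
  assumes h: "hier_construction Ms" "last Ms = M" and w: "weighted m m' k k' rh rv Ms"
    and k: "m + 1 \<le> k" "m' + 1 \<le> k'"
    and \<rho>: "\<rho> \<in> MIS_dir d M" and z: "z \<in> \<rho>" "z \<in> vertices M" and p: "p \<in> line_ideal d z"
  shows "restricted_single z p \<in> im_boundary"
  using \<rho> z p
proof (induction "appearance Ms \<rho>" arbitrary: \<rho> d z p rule: less_induct)
  case less
  note \<rho> = less.prems(1)
  have tm: "is_tmesh (last Ms)" using mesh h(2) by simp
  have comp: "\<rho> \<in> components (lines d M)" using \<rho> by (simp add: MIS_dir_def)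
  define G where "G = counted_vertices Ms \<rho>"
  have G: "finite G" "G \<subseteq> \<rho> \<inter> vertices M"
    using finite_vertices[OF mesh] h(2) by (auto simp: G_def counted_vertices_def)
  have Gi: "\<gamma> \<in> lines e M" if "\<gamma> \<in> G" for \<gamma> e
    using interior_vertex_lines[OF rect] MIS_dir_subset_interior[OF rect \<rho>] G(2) that by blast
  have cross: "restricted_single \<gamma> q \<in> im_boundary" if \<gamma>: "\<gamma> \<in> G" and q: "q \<in> line_ideal (\<not> d) \<gamma>" for \<gamma> q
  proof -
    have v: "\<gamma> \<in> vertices M" "\<gamma> \<in> \<rho>" using \<gamma> G(2) by auto
    obtain \<mu> where \<mu>: "\<mu> \<in> components (lines (\<not> d) M)" "\<gamma> \<in> \<mu>"
      using Gi[OF \<gamma>] Union_components[of "lines (\<not> d) M"] by blast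
    show ?thesis
    proof (cases "\<mu> \<inter> frontier (domain M) = {}")
      case True
      then have mis: "\<mu> \<in> MIS_dir (\<not> d) M" using \<mu> by (simp add: MIS_dir_def)
      have "\<mu> \<in> MIS (last Ms)" "\<rho> \<in> MIS (last Ms)" using mis \<rho> h(2) in_MIS_iff by blast+
      moreover have "\<mu> \<noteq> \<rho>" using MIS_dir_unique[OF mesh mis, of d] \<rho> by auto
      \<comment> \<open>Counting excludes only strictly later segments. Injectivity of the order
        excludes a tie, so that the induction hypothesis applies.\<close>
      ultimately have "appearance Ms \<mu> \<noteq> appearance Ms \<rho>" using inj_on_appearance[OF h(1)] by (meson inj_onD)
      moreover have "\<not> appearance Ms \<mu> > appearance Ms \<rho>"
        using \<gamma> \<open>\<mu> \<in> MIS (last Ms)\<close> \<mu>(2) unfolding G_def counted_vertices_def by blast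
      ultimately have "appearance Ms \<mu> < appearance Ms \<rho>" by simp
      then show ?thesis using less.hyps mis \<mu>(2) v(1) q by blast
    next
      case False then show ?thesis using single_in_image_boundary[OF \<mu> v(1) q] by blast
    qed
  qed
  have sw: "int (if d then k else k') \<le> seg_weight m m' rh rv Ms \<rho>"
    using w \<rho> h(2) unfolding weighted_iff[OF tm] by blast
  show ?case
  proof (cases d)
    case True
    have "rh (fst \<gamma>) \<le> m" if "\<gamma> \<in> G" for \<gamma> using smooth Gi[OF that, of False] unfolding smoothness_le_iff by blast
    \<comment> \<open>\<open>seg_weight\<close> subtracts in the integers, the lemma on heavy
      segments in the naturals; the smoothness bound on the crossing lines reconciles them.\<close>
    then have "int (\<Sum>\<gamma>\<in>G. m - rh (fst \<gamma>)) = (\<Sum>\<gamma>\<in>G. int m - int (rh (fst \<gamma>)))"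
      unfolding of_nat_sum by (intro sum.cong) (auto simp: of_nat_diff)
    moreover have "int (m + 1) \<le> (\<Sum>\<gamma>\<in>G. int m - int (rh (fst \<gamma>)))"
      using sw k True unfolding seg_weight_MIS_dir[OF tm, unfolded h(2), OF \<rho>] G_def by simp
    ultimately have "int (m + 1) \<le> int (\<Sum>\<gamma>\<in>G. m - rh (fst \<gamma>))" by simp
    then have "m + 1 \<le> (\<Sum>\<gamma>\<in>G. m - rh (fst \<gamma>))" unfolding of_nat_le_iff .
    then show ?thesis
      using heavy_segment_in_image_h[of \<rho> z p G] comp less.prems(2-4) G cross True by (simp add: lines_def)
  next
    case False
    have "rv (snd \<gamma>) \<le> m'" if "\<gamma> \<in> G" for \<gamma> using smooth Gi[OF that, of True] unfolding smoothness_le_iff by blast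
    then have "int (\<Sum>\<gamma>\<in>G. m' - rv (snd \<gamma>)) = (\<Sum>\<gamma>\<in>G. int m' - int (rv (snd \<gamma>)))"
      unfolding of_nat_sum by (intro sum.cong) (auto simp: of_nat_diff)
    moreover have "int (m' + 1) \<le> (\<Sum>\<gamma>\<in>G. int m' - int (rv (snd \<gamma>)))"
      using sw k False unfolding seg_weight_MIS_dir[OF tm, unfolded h(2), OF \<rho>] G_def by simp
    ultimately have "int (m' + 1) \<le> int (\<Sum>\<gamma>\<in>G. m' - rv (snd \<gamma>))" by simp
    then have "m' + 1 \<le> (\<Sum>\<gamma>\<in>G. m' - rv (snd \<gamma>))" unfolding of_nat_le_iff .
    then show ?thesis
      using heavy_segment_in_image_v[of \<rho> z p G] comp less.prems(2-4) G cross False by (simp add: lines_def)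
  qed
qed

text \<open>An element of a vertex ideal splits into parts from the ideals of the two lines through
  the vertex, and a vertex chain is a finite sum of single terms.\<close>

lemma boundary1_surjective:
  assumes h: "hier_construction Ms" "last Ms = M" and w: "weighted m m' k k' rh rv Ms"
    and k: "m + 1 \<le> k" "m' + 1 \<le> k'"
  shows "vertex_chains m m' rh rv M \<subseteq> im_boundary"
proof
  fix y assume y: "y \<in> vertex_chains m m' rh rv M"
  have fin: "finite (interior_vertices M)"
    using finite_vertices[OF mesh] by (auto simp: interior_vertices_def)
  have one: "restricted_single \<gamma> p \<in> im_boundary" if g: "\<gamma> \<in> interior_vertices M" and p: "p \<in> line_ideal d \<gamma>" for \<gamma> p d
  proof -
    have v: "\<gamma> \<in> vertices M" "\<gamma> \<in> lines d M"
      using g interior_vertex_lines[OF rect] by (auto simp: interior_vertices_def)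
    then obtain \<rho> where r: "\<rho> \<in> components (lines d M)" "\<gamma> \<in> \<rho>" using Union_components[of "lines d M"] by blast
    show ?thesis
    proof (cases "\<rho> \<inter> frontier (domain M) = {}")
      case True then show ?thesis using MIS_in_image[OF assms, of \<rho> d] r v p by (simp add: MIS_dir_def)
    next
      case False then show ?thesis using single_in_image_boundary r v p by blast
    qed
  qed
  have "single \<gamma> (y \<gamma>) \<in> im_boundary" if g: "\<gamma> \<in> interior_vertices M" for \<gamma>
  proof -
    have "\<gamma> \<in> vertices M" using g by (simp add: interior_vertices_def)
    moreover have "y \<gamma> \<in> vertex_ideal m m' rh rv M \<gamma>" using y g by (simp add: vertex_chains_def)
    ultimately obtain p q where pq: "y \<gamma> = p + q" "p \<in> line_ideal False \<gamma>" "q \<in> line_ideal True \<gamma>"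
      using vertex_ideal_eq[OF mesh] by (auto simp: line_ideal_def)
    have "restricted_single \<gamma> p + restricted_single \<gamma> q \<in> im_boundary"
      using one[OF g pq(2)] one[OF g pq(3)] by (rule chains.subspace_add[OF subspace_im])
    moreover have "single \<gamma> (y \<gamma>) = restricted_single \<gamma> p + restricted_single \<gamma> q"
      using g pq(1) by (auto simp: single_def restricted_single_def fun_eq_iff)
    ultimately show ?thesis by simp
  qed
  then have "(\<Sum>\<gamma>\<in>interior_vertices M. single \<gamma> (y \<gamma>)) \<in> im_boundary"
    by (intro chains.subspace_sum[OF subspace_im])
  then show "y \<in> im_boundary"
    using poly2.families_eq_sum_single[OF fin y[unfolded vertex_chains_eq]] by simp
qed

lemma h_number_0:
  assumes "hier_construction Ms" "last Ms = M" "weighted m m' k k' rh rv Ms" "m + 1 \<le> k" "m' + 1 \<le> k'"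
  shows "h_number m m' rh rv M = 0"
  unfolding h_number_def chain_scale_eq
  using boundary1_surjective[OF assms] chains.subspace_0[OF subspace_im] by (intro quotient_dim_0) auto

end

section \<open>Splines and their jumps\<close>

lemma infinite_poly_eq_0:
  fixes p :: "'a::idom poly"
  assumes "infinite Y" "\<And>y. y \<in> Y \<Longrightarrow> poly p y = 0"
  shows "p = 0"
  using poly_roots_finite[of p] finite_subset[of Y "{y. poly p y = 0}"] assms by blast

text \<open>Infinitely many zeros, first in \<open>s\<close> for each fixed \<open>t\<close> and
  then in \<open>t\<close>. Hence a spline determines its polynomial on each cell.\<close>

lemma bieval_0_on_rectangle:
  assumes "a < b" "c < d" and 0: "\<And>z. z \<in> {a..b} \<times> {c..d} \<Longrightarrow> bieval p z = 0"
  shows "p = 0"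
proof (rule infinite_poly_eq_0)
  have "inj (\<lambda>y::real. [:y:])" by (rule injI) simp
  then show "infinite ((\<lambda>y. [:y:]) ` {c..d})"
    using assms(2) infinite_Icc[of c d] finite_imageD inj_on_subset by blast
  fix q assume "q \<in> (\<lambda>y. [:y:]) ` {c..d}"
  then obtain y where y: "y \<in> {c..d}" "q = [:y:]" by blast
  show "poly p q = 0"
  proof (rule infinite_poly_eq_0)
    show "infinite {a..b}" using assms(1) by (rule infinite_Icc)
    show "poly (poly p q) x = 0" if "x \<in> {a..b}" for x using 0[of "(x, y)"] that y by (simp add: bieval_def)
  qed
qed

text \<open>The restriction to the line \<open>t = y\<close>, a polynomial in \<open>s\<close>. This
  line crosses the vertical lines, whose ideals are tested on it.\<close>

definition vslice :: "nat \<Rightarrow> real poly poly \<Rightarrow> real \<Rightarrow> real poly" where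
  "vslice m' p y = (\<Sum>j\<le>m'. smult (y ^ j) (coeff p j))"

definition hslice :: "nat \<Rightarrow> real poly poly \<Rightarrow> real \<Rightarrow> real poly" where
  "hslice m p x = (\<Sum>i\<le>m. smult (x ^ i) (coeff1 p i))"

lemma poly_vslice:
  assumes "p \<in> bideg_le m m'"
  shows "poly (vslice m' p y) x = bieval p (x, y)"
  by (subst coeff_tensor_sum2[OF assms])
    (simp add: vslice_def poly_sum bieval_sum bieval_tensor poly_monom mult.commute)

lemma poly_hslice:
  assumes "p \<in> bideg_le m m'"
  shows "poly (hslice m p x) y = bieval p (x, y)"
  by (subst coeff_tensor_sum1[OF assms])
    (simp add: hslice_def poly_sum bieval_sum bieval_tensor poly_monom)

lemma coeff1_diff: "coeff1 (p - q) i = coeff1 p i - coeff1 q i"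
  by (rule poly_eqI) simp

lemma vslice_diff: "vslice m' (p - q) y = vslice m' p y - vslice m' q y"
  by (simp add: vslice_def smult_diff_right sum_subtractf)

lemma hslice_diff: "hslice m (p - q) x = hslice m p x - hslice m q x"
  by (simp add: hslice_def smult_diff_right sum_subtractf coeff1_diff)

text \<open>Smoothness is a condition on each restriction separately;
  \<open>dvd_coeffs_if_dvd_values\<close> assembles the conditions for infinitely many
  \<open>y\<close>.\<close>

lemma videal_iff_slices:
  assumes "p \<in> bideg_le m m'" "infinite Y"
  shows "p \<in> videal m m' a r \<longleftrightarrow> (\<forall>y\<in>Y. [:-a, 1:] ^ r dvd vslice m' p y)"
proof
  assume "p \<in> videal m m' a r"
  then show "\<forall>y\<in>Y. [:-a, 1:] ^ r dvd vslice m' p y"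
    by (auto simp: videal_def vdvd_iff vslice_def intro!: dvd_sum dvd_smult)
next
  assume *: "\<forall>y\<in>Y. [:-a, 1:] ^ r dvd vslice m' p y"
  have "[:-a, 1:] ^ r dvd coeff p j" for j
  proof (cases "j \<le> m'")
    case True
    then show ?thesis
      using dvd_coeffs_if_dvd_values[OF assms(2), where L = "[:-a, 1:] ^ r" and N = m' and c = "coeff p" and j = j] * by (simp add: vslice_def)
  next
    case False
    then show ?thesis using assms(1) by (simp add: bideg_le_def coeff_eq_0)
  qed
  then show "p \<in> videal m m' a r" using assms(1) by (simp add: videal_def vdvd_iff)
qed

lemma hideal_iff_slices:
  assumes "p \<in> bideg_le m m'" "infinite X"
  shows "p \<in> hideal m m' b r \<longleftrightarrow> (\<forall>x\<in>X. [:-b, 1:] ^ r dvd hslice m p x)"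
proof
  assume "p \<in> hideal m m' b r"
  then show "\<forall>x\<in>X. [:-b, 1:] ^ r dvd hslice m p x"
    using hdvd_imp[of b r p] by (auto simp: hideal_def hslice_def intro!: dvd_sum dvd_smult)
next
  assume *: "\<forall>x\<in>X. [:-b, 1:] ^ r dvd hslice m p x"
  have "[:-b, 1:] ^ r dvd coeff1 p i" if "i \<le> m" for i
    using dvd_coeffs_if_dvd_values[OF assms(2), where L = "[:-b, 1:] ^ r" and N = m and c = "coeff1 p" and j = i] * that by (simp add: hslice_def)
  then show "p \<in> hideal m m' b r" using assms(1) hdvd_if[OF assms(1)] by (simp add: hideal_def)
qed

lemma bieval_videal: "p \<in> videal m m' (fst z) (Suc r) \<Longrightarrow> bieval p z = 0"
proof -
  assume "p \<in> videal m m' (fst z) (Suc r)"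
  then obtain q where "p = tensor [:- fst z, 1:] 1 ^ Suc r * q" by (auto simp: videal_def elim: dvdE)
  then show ?thesis by (simp add: bieval_tensor)
qed

lemma bieval_hideal: "p \<in> hideal m m' (snd z) (Suc r) \<Longrightarrow> bieval p z = 0"
proof -
  assume "p \<in> hideal m m' (snd z) (Suc r)"
  then obtain q where "p = tensor 1 [:- snd z, 1:] ^ Suc r * q" by (auto simp: hideal_def elim: dvdE)
  then show ?thesis by (simp add: bieval_tensor)
qed

lemma strict_mono_bracket:
  fixes S :: "nat \<Rightarrow> real"
  assumes "i1 < i2" "S i1 \<le> x" "x \<le> S i2"
  shows "\<exists>i\<ge>i1. i < i2 \<and> S i \<le> x \<and> x \<le> S (Suc i)"
  using assms
proof (induction i2)
  case (Suc k)
  show ?case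
  proof (cases "i1 < k \<and> x \<le> S k")
    case True
    then obtain i where "i \<ge> i1" "i < k" "S i \<le> x" "x \<le> S (Suc i)" using Suc by blast
    then show ?thesis by (intro exI[of _ i]) simp
  next
    case False
    then show ?thesis using Suc.prems by (intro exI[of _ k]) (cases "i1 = k"; auto)
  qed
qed simp

context mesh_grid begin

lemma cell_square:
  assumes "\<sigma> \<in> cells M" "(x, y) \<in> \<sigma>"
  obtains i j where "i < n" "j < l" "cell_at i j = \<sigma>" "(x, y) \<in> square i j"
proof -
  obtain i1 i2 j1 j2 where b: "i1 < i2" "i2 \<le> n" "j1 < j2" "j2 \<le> l" "\<sigma> = {S i1..S i2} \<times> {T j1..T j2}"
    using cells_grid[OF assms(1)] by blast
  obtain i where i: "i1 \<le> i" "i < i2" "S i \<le> x" "x \<le> S (Suc i)"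
    using strict_mono_bracket[OF b(1), of S x] assms(2) b(5) by auto
  obtain j where j: "j1 \<le> j" "j < j2" "T j \<le> y" "y \<le> T (Suc j)"
    using strict_mono_bracket[OF b(3), of T y] assms(2) b(5) by auto
  have "cell_at i j = \<sigma>" using i j b assms(1) by (intro cell_at_eq) (auto simp: square_subset_iff)
  then show ?thesis using that[of i j] i j b by (simp add: square_def)
qed

lemma jump_at_von: "von (Suc i) j \<Longrightarrow> Suc i < n \<Longrightarrow> j < l \<Longrightarrow>
    jump p (vedge_at (Suc i) j) = p (cell_at (Suc i) j) - p (cell_at i j)"
  using vvalue_jump[of i j p] by (simp add: vvalue_def)

lemma jump_at_hon: "hon i (Suc j) \<Longrightarrow> i < n \<Longrightarrow> Suc j < l \<Longrightarrow>
    jump p (hedge_at i (Suc j)) = p (cell_at i j) - p (cell_at i (Suc j))"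
  using hvalue_jump[of i j p] by (simp add: hvalue_def)

end

context spline_grid begin

text \<open>The algebraic model of splines: smoothness across an edge is membership of the jump in
  the ideal of the edge.\<close>

definition spline_families :: "(point set \<Rightarrow> real poly poly) set" where
  "spline_families = {p \<in> families (cells M) (\<lambda>_. bideg_le m m'). jump p \<in> edge_chains m m' rh rv M}"

lemma edge_ideal_vedge:
  assumes "vedge \<tau> i j1 j2"
  shows "edge_ideal m m' rh rv \<tau> = videal m m' (S i) (rh (S i) + 1)" "edge_smoothness rh rv \<tau> = rh (S i)"
proof -
  have "(S i, T j1) \<in> \<tau>" using assms by (auto simp: vedge_def)
  then show "edge_ideal m m' rh rv \<tau> = videal m m' (S i) (rh (S i) + 1)" "edge_smoothness rh rv \<tau> = rh (S i)"
    using edge_ideal_vertical[OF vedge_vertical[OF assms]] edge_smoothness_vertical[OF vedge_vertical[OF assms]] by fastforce+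
qed

lemma edge_ideal_hedge:
  assumes "hedge \<tau> j i1 i2"
  shows "edge_ideal m m' rh rv \<tau> = hideal m m' (T j) (rv (T j) + 1)" "edge_smoothness rh rv \<tau> = rv (T j)"
proof -
  have "(S i1, T j) \<in> \<tau>" using assms by (auto simp: hedge_def)
  then show "edge_ideal m m' rh rv \<tau> = hideal m m' (T j) (rv (T j) + 1)" "edge_smoothness rh rv \<tau> = rv (T j)"
    using edge_ideal_horizontal[OF hedge_horizontal[OF assms]] edge_smoothness_horizontal[OF hedge_horizontal[OF assms]] by fastforce+
qed

text \<open>Covers all neighbouring squares: where no segment is drawn, the two cells coincide and
  the difference is 0.\<close>

lemma spline_families_videal:
  assumes p: "p \<in> spline_families" and ij: "Suc i < n" "j < l"
  shows "p (cell_at (Suc i) j) - p (cell_at i j) \<in> videal m m' (S (Suc i)) (rh (S (Suc i)) + 1)"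
proof (cases "von (Suc i) j")
  case True
  then obtain j1 j2 where e: "vedge (vedge_at (Suc i) j) (Suc i) j1 j2" by (rule von_vedge)
  have "vedge_at (Suc i) j \<in> interior_edges M"
    using vedge_at_interior[OF True ij(1)] by (simp add: interior_vedges_def)
  then have "jump p (vedge_at (Suc i) j) \<in> edge_ideal m m' rh rv (vedge_at (Suc i) j)"
    using p by (simp add: spline_families_def edge_chains_def)
  then show ?thesis using edge_ideal_vedge[OF e] jump_at_von[OF True ij, of p] by simp
next
  case False
  then show ?thesis using von_iff[OF ij] poly2.subspace_0[OF subspace_videal] by simp
qed

lemma spline_families_hideal:
  assumes p: "p \<in> spline_families" and ij: "i < n" "Suc j < l"
  shows "p (cell_at i j) - p (cell_at i (Suc j)) \<in> hideal m m' (T (Suc j)) (rv (T (Suc j)) + 1)"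
proof (cases "hon i (Suc j)")
  case True
  then obtain i1 i2 where e: "hedge (hedge_at i (Suc j)) (Suc j) i1 i2" by (rule hon_hedge)
  have "hedge_at i (Suc j) \<in> interior_edges M"
    using hedge_at_interior[OF True ij(2)] by (simp add: interior_hedges_def)
  then have "jump p (hedge_at i (Suc j)) \<in> edge_ideal m m' rh rv (hedge_at i (Suc j))"
    using p by (simp add: spline_families_def edge_chains_def)
  then show ?thesis using edge_ideal_hedge[OF e] jump_at_hon[OF True ij, of p] by simp
next
  case False
  then show ?thesis using hon_iff[OF ij] poly2.subspace_0[OF subspace_hideal] by simp
qed

text \<open>Two closed squares containing \<open>z\<close> have indices that differ by at most one
  in each direction, so a horizontal and a vertical step lead from one to the other. The difference
  met in a step lies in the ideal of a line through \<open>z\<close> and vanishes at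
  \<open>z\<close>.\<close>

lemma spline_families_consistent:
  assumes p: "p \<in> spline_families" and s: "\<sigma> \<in> cells M" "z \<in> \<sigma>" "\<sigma>' \<in> cells M" "z \<in> \<sigma>'"
  shows "bieval (p \<sigma>) z = bieval (p \<sigma>') z"
proof -
  obtain x y where z: "z = (x, y)" by fastforce
  have vert: "bieval (p (cell_at i j)) z = bieval (p (cell_at i' j)) z"
    if lt: "i < i'" "i' < n" "j < l" "S i' \<le> x" "x \<le> S (Suc i)" for i i' j
  proof -
    have "i' \<le> Suc i" using lt(4,5) S_simps(1)[of i' "Suc i"] by linarith
    then have i': "i' = Suc i" using lt(1) by simp
    then have "x = S (Suc i)" using lt(4,5) by simp
    then have "bieval (p (cell_at (Suc i) j) - p (cell_at i j)) z = 0"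
      using spline_families_videal[OF p, of i j] lt i' z by (intro bieval_videal[of _ m m' z]) simp
    then show ?thesis using i' by simp
  qed
  have horz: "bieval (p (cell_at i j)) z = bieval (p (cell_at i j')) z"
    if lt: "j < j'" "j' < l" "i < n" "T j' \<le> y" "y \<le> T (Suc j)" for i j j'
  proof -
    have "j' \<le> Suc j" using lt(4,5) T_simps(1)[of j' "Suc j"] by linarith
    then have j': "j' = Suc j" using lt(1) by simp
    then have "y = T (Suc j)" using lt(4,5) by simp
    then have "bieval (p (cell_at i j) - p (cell_at i (Suc j))) z = 0"
      using spline_families_hideal[OF p, of i j] lt j' z by (intro bieval_hideal[of _ m m' z]) simp
    then show ?thesis using j' by simp
  qed
  obtain i j where ij: "i < n" "j < l" "cell_at i j = \<sigma>" "z \<in> square i j" using cell_square s(1,2) z by metis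
  obtain i' j' where ij': "i' < n" "j' < l" "cell_at i' j' = \<sigma>'" "z \<in> square i' j'" using cell_square s(3,4) z by metis
  have b: "S i \<le> x" "x \<le> S (Suc i)" "S i' \<le> x" "x \<le> S (Suc i')"
    "T j \<le> y" "y \<le> T (Suc j)" "T j' \<le> y" "y \<le> T (Suc j')" using ij(4) ij'(4) z by (auto simp: square_def)
  have "bieval (p (cell_at i j)) z = bieval (p (cell_at i' j)) z"
  proof (cases i i' rule: linorder_cases)
    case less then show ?thesis using ij'(1) ij(2) b by (intro vert)
  next
    case greater then show ?thesis using ij(1,2) b by (intro vert[symmetric])
  qed simp
  also have "\<dots> = bieval (p (cell_at i' j')) z"
  proof (cases j j' rule: linorder_cases)
    case less then show ?thesis using ij'(1,2) b by (intro horz)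
  next
    case greater then show ?thesis using ij(2) ij'(1) b by (intro horz[symmetric])
  qed simp
  finally show ?thesis unfolding ij(3) ij'(3) .
qed

lemma class_C_at_vslice_iff:
  assumes ij: "Suc i < n" "j < l" and y: "T j \<le> y" "y \<le> T (Suc j)"
    and p: "\<And>\<sigma>. \<sigma> \<in> cells M \<Longrightarrow> p \<sigma> \<in> bideg_le m m'"
    and F: "\<And>\<sigma> z. \<sigma> \<in> cells M \<Longrightarrow> z \<in> \<sigma> \<Longrightarrow> F z = bieval (p \<sigma>) z"
  shows "class_C_at r (\<lambda>s. F (s, y)) (S (Suc i)) \<longleftrightarrow>
    [:- S (Suc i), 1:] ^ (r + 1) dvd vslice m' (p (cell_at (Suc i) j) - p (cell_at i j)) y"
  unfolding vslice_diff
proof (rule class_C_at_glue_iff)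
  \<comment> \<open>Within this distance of the line only the two adjacent squares are met, so there
    the function is glued from two polynomials.\<close>
  define e where "e = min (S (Suc i) - S i) (S (Suc (Suc i)) - S (Suc i))"
  show "e > 0" using S_simps(2)[of i "Suc i"] S_simps(2)[of "Suc i" "Suc (Suc i)"] by (simp add: e_def)
  have L: "cell_at i j \<in> cells M" "square i j \<subseteq> cell_at i j" using cell_at ij by auto
  have R: "cell_at (Suc i) j \<in> cells M" "square (Suc i) j \<subseteq> cell_at (Suc i) j" using cell_at ij by auto
  have left: "F (s, y) = poly (vslice m' (p (cell_at i j)) y) s" if "S i \<le> s" "s \<le> S (Suc i)" for s
  proof -
    have "(s, y) \<in> square i j" using that y by (simp add: square_def)
    then show ?thesis using F[OF L(1)] L(2) poly_vslice[OF p[OF L(1)]] by auto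
  qed
  have right: "F (s, y) = poly (vslice m' (p (cell_at (Suc i) j)) y) s" if "S (Suc i) \<le> s" "s \<le> S (Suc (Suc i))" for s
  proof -
    have "(s, y) \<in> square (Suc i) j" using that y by (simp add: square_def)
    then show ?thesis using F[OF R(1)] R(2) poly_vslice[OF p[OF R(1)]] by auto
  qed
  show "poly (vslice m' (p (cell_at i j)) y) (S (Suc i)) = poly (vslice m' (p (cell_at (Suc i) j)) y) (S (Suc i))"
    using left[of "S (Suc i)"] right[of "S (Suc i)"] by simp
  fix s assume "s \<in> ball (S (Suc i)) e"
  then have "S i < s" "s < S (Suc (Suc i))" by (auto simp: e_def dist_real_def abs_less_iff)
  then show "F (s, y) = glue (S (Suc i)) (vslice m' (p (cell_at i j)) y) (vslice m' (p (cell_at (Suc i) j)) y) s"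
    using left right by (simp add: glue_def)
qed

lemma class_C_at_hslice_iff:
  assumes ij: "i < n" "Suc j < l" and x: "S i \<le> x" "x \<le> S (Suc i)"
    and p: "\<And>\<sigma>. \<sigma> \<in> cells M \<Longrightarrow> p \<sigma> \<in> bideg_le m m'"
    and F: "\<And>\<sigma> z. \<sigma> \<in> cells M \<Longrightarrow> z \<in> \<sigma> \<Longrightarrow> F z = bieval (p \<sigma>) z"
  shows "class_C_at r (\<lambda>t. F (x, t)) (T (Suc j)) \<longleftrightarrow>
    [:- T (Suc j), 1:] ^ (r + 1) dvd hslice m (p (cell_at i (Suc j)) - p (cell_at i j)) x"
  unfolding hslice_diff
proof (rule class_C_at_glue_iff)
  define e where "e = min (T (Suc j) - T j) (T (Suc (Suc j)) - T (Suc j))"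
  show "e > 0" using T_simps(2)[of j "Suc j"] T_simps(2)[of "Suc j" "Suc (Suc j)"] by (simp add: e_def)
  have L: "cell_at i j \<in> cells M" "square i j \<subseteq> cell_at i j" using cell_at ij by auto
  have U: "cell_at i (Suc j) \<in> cells M" "square i (Suc j) \<subseteq> cell_at i (Suc j)" using cell_at ij by auto
  have lower: "F (x, t) = poly (hslice m (p (cell_at i j)) x) t" if "T j \<le> t" "t \<le> T (Suc j)" for t
  proof -
    have "(x, t) \<in> square i j" using that x by (simp add: square_def)
    then show ?thesis using F[OF L(1)] L(2) poly_hslice[OF p[OF L(1)]] by auto
  qed
  have upper: "F (x, t) = poly (hslice m (p (cell_at i (Suc j))) x) t" if "T (Suc j) \<le> t" "t \<le> T (Suc (Suc j))" for t
  proof -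
    have "(x, t) \<in> square i (Suc j)" using that x by (simp add: square_def)
    then show ?thesis using F[OF U(1)] U(2) poly_hslice[OF p[OF U(1)]] by auto
  qed
  show "poly (hslice m (p (cell_at i j)) x) (T (Suc j)) = poly (hslice m (p (cell_at i (Suc j))) x) (T (Suc j))"
    using lower[of "T (Suc j)"] upper[of "T (Suc j)"] by simp
  fix t assume "t \<in> ball (T (Suc j)) e"
  then have "T j < t" "t < T (Suc (Suc j))" by (auto simp: e_def dist_real_def abs_less_iff)
  then show "F (x, t) = glue (T (Suc j)) (hslice m (p (cell_at i j)) x) (hslice m (p (cell_at i (Suc j))) x) t"
    using lower upper by (simp add: glue_def)
qed

text \<open>The choice of the cell is harmless by \<open>spline_families_consistent\<close>.\<close>

definition spline_of :: "(point set \<Rightarrow> real poly poly) \<Rightarrow> point \<Rightarrow> real" where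
  "spline_of p z = (if z \<in> domain M then bieval (p (SOME \<sigma>. \<sigma> \<in> cells M \<and> z \<in> \<sigma>)) z else 0)"

lemma some_cell: "z \<in> domain M \<Longrightarrow> (SOME \<sigma>. \<sigma> \<in> cells M \<and> z \<in> \<sigma>) \<in> cells M \<and> z \<in> (SOME \<sigma>. \<sigma> \<in> cells M \<and> z \<in> \<sigma>)"
  by (rule someI_ex) (auto simp: domain_def)

lemma spline_of_cell:
  assumes "p \<in> spline_families" "\<sigma> \<in> cells M" "z \<in> \<sigma>"
  shows "spline_of p z = bieval (p \<sigma>) z"
proof -
  have z: "z \<in> domain M" using assms(2,3) by (auto simp: domain_def)
  note c = some_cell[OF z]
  show ?thesis
    using spline_families_consistent[OF assms(1) conjunct1[OF c] conjunct2[OF c] assms(2,3)] z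
    by (simp only: spline_of_def if_True)
qed

lemma spline_of_in_spline_space:
  assumes p: "p \<in> spline_families"
  shows "spline_of p \<in> spline_space m m' rh rv M"
proof -
  have bd: "p \<sigma> \<in> bideg_le m m'" if "\<sigma> \<in> cells M" for \<sigma> using p that by (simp add: spline_families_def families_def)
  note F = spline_of_cell[OF p]
  have v: "class_C_at (edge_smoothness rh rv \<tau>) (\<lambda>s. spline_of p (s, snd z)) (fst z)"
    if t: "\<tau> \<in> interior_vedges M" "z \<in> \<tau>" for \<tau> z
  proof -
    obtain i j1 j2 where e: "vedge \<tau> (Suc i) j1 j2" and i: "Suc i < n" using t(1) by (rule interior_vedgeE)
    have ez: "fst z = S (Suc i)" "T j1 \<le> snd z" "snd z \<le> T j2" "j1 < j2" "j2 \<le> l" using t(2) e by (auto simp: vedge_def)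
    \<comment> \<open>Any unit segment of the edge that contains the point will do, also when the
      point is a vertex.\<close>
    obtain j where j: "j1 \<le> j" "j < j2" "T j \<le> snd z" "snd z \<le> T (Suc j)"
      using strict_mono_bracket[OF ez(4,2,3)] by blast
    then have jl: "j < l" using ez(5) by simp
    let ?q = "p (cell_at (Suc i) j) - p (cell_at i j)"
    have "?q \<in> videal m m' (S (Suc i)) (rh (S (Suc i)) + 1)" by (rule spline_families_videal[OF p i jl])
    moreover from this have "?q \<in> bideg_le m m'" by (simp add: videal_def)
    ultimately have "[:- S (Suc i), 1:] ^ (rh (S (Suc i)) + 1) dvd vslice m' ?q (snd z)"
      using videal_iff_slices[of ?q m m' UNIV] infinite_UNIV_char_0 by blast
    then show ?thesis
      unfolding ez(1) edge_ideal_vedge(2)[OF e]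
      using class_C_at_vslice_iff[where p = p and F = "spline_of p", OF i jl j(3,4) bd F] by blast
  qed
  have h: "class_C_at (edge_smoothness rh rv \<tau>) (\<lambda>t. spline_of p (fst z, t)) (snd z)"
    if t: "\<tau> \<in> interior_hedges M" "z \<in> \<tau>" for \<tau> z
  proof -
    obtain j i1 i2 where e: "hedge \<tau> (Suc j) i1 i2" and j: "Suc j < l" using t(1) by (rule interior_hedgeE)
    have ez: "snd z = T (Suc j)" "S i1 \<le> fst z" "fst z \<le> S i2" "i1 < i2" "i2 \<le> n" using t(2) e by (auto simp: hedge_def)
    obtain i where i: "i1 \<le> i" "i < i2" "S i \<le> fst z" "fst z \<le> S (Suc i)"
      using strict_mono_bracket[OF ez(4,2,3)] by blast
    then have il: "i < n" using ez(5) by simp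
    let ?q = "p (cell_at i (Suc j)) - p (cell_at i j)"
    have "?q \<in> hideal m m' (T (Suc j)) (rv (T (Suc j)) + 1)"
      using poly2.subspace_neg[OF subspace_hideal spline_families_hideal[OF p il j]] by simp
    moreover from this have "?q \<in> bideg_le m m'" by (simp add: hideal_def)
    ultimately have "[:- T (Suc j), 1:] ^ (rv (T (Suc j)) + 1) dvd hslice m ?q (fst z)"
      using hideal_iff_slices[of ?q m m' UNIV] infinite_UNIV_char_0 by blast
    then show ?thesis
      unfolding ez(1) edge_ideal_hedge(2)[OF e]
      using class_C_at_hslice_iff[where p = p and F = "spline_of p", OF il j i(3,4) bd F] by blast
  qed
  have "\<exists>q\<in>bideg_le m m'. \<forall>z\<in>\<sigma>. spline_of p z = bieval q z" if "\<sigma> \<in> cells M" for \<sigma>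
    using spline_of_cell[OF p that] bd[OF that] by blast
  then show ?thesis using v h unfolding spline_space_def by (simp add: spline_of_def)
qed

lemma spline_space_imp_family:
  assumes f: "f \<in> spline_space m m' rh rv M"
  shows "\<exists>p\<in>spline_families. f = spline_of p"
proof -
  have f0: "f z = 0" if "z \<notin> domain M" for z using f that unfolding spline_space_def by blast
  have "\<forall>\<sigma>\<in>cells M. \<exists>p\<in>bideg_le m m'. \<forall>z\<in>\<sigma>. f z = bieval p z" using f by (simp add: spline_space_def)
  then obtain p0 where p0: "\<And>\<sigma>. \<sigma> \<in> cells M \<Longrightarrow> p0 \<sigma> \<in> bideg_le m m' \<and> (\<forall>z\<in>\<sigma>. f z = bieval (p0 \<sigma>) z)" by metis
  define p where "p \<sigma> = (if \<sigma> \<in> cells M then p0 \<sigma> else 0)" for \<sigma>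
  have bd: "p \<sigma> \<in> bideg_le m m'" if "\<sigma> \<in> cells M" for \<sigma> using p0 that by (simp add: p_def)
  have ev: "f z = bieval (p \<sigma>) z" if "\<sigma> \<in> cells M" "z \<in> \<sigma>" for \<sigma> z using p0 that by (simp add: p_def)
  have v: "jump p \<tau> \<in> edge_ideal m m' rh rv \<tau>" if t: "\<tau> \<in> interior_vedges M" for \<tau>
  proof -
    obtain i j j2 where e: "vedge \<tau> (Suc i) j j2" and i: "Suc i < n" using t by (rule interior_vedgeE)
    then have j: "j < j2" "j < l" by (auto simp: vedge_def)
    let ?q = "p (cell_at (Suc i) j) - p (cell_at i j)"
    \<comment> \<open>The points over the open unit interval are interior to the domain, where the
      smoothness condition applies, and there are infinitely many of them.\<close>
    have "[:- S (Suc i), 1:] ^ (rh (S (Suc i)) + 1) dvd vslice m' ?q y" if y: "y \<in> {T j<..<T (Suc j)}" for y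
    proof -
      have "y \<le> T j2" "T 0 < y" "y < T l"
        using y j T_simps(1)[of "Suc j" j2] T_simps(1)[of 0 j] T_simps(1)[of "Suc j" l] by (auto simp del: T_simps)
      then have "(S (Suc i), y) \<in> \<tau> \<inter> interior (domain M)"
        using e y i unfolding dom interior_rectangle by (auto simp: vedge_def)
      then have "class_C_at (edge_smoothness rh rv \<tau>) (\<lambda>s. f (s, snd (S (Suc i), y))) (fst (S (Suc i), y))"
        using f t unfolding spline_space_def by blast
      then show ?thesis
        using class_C_at_vslice_iff[where p = p and F = f and y = y, OF i j(2) _ _ bd ev] y edge_ideal_vedge(2)[OF e] by simp
    qed
    moreover have "?q \<in> bideg_le m m'" using bd cell_at(1) i j(2) by (intro poly2.subspace_diff[OF subspace_bideg_le]) auto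
    moreover have "infinite {T j<..<T (Suc j)}" by (rule infinite_Ioo) simp
    ultimately have "?q \<in> videal m m' (S (Suc i)) (rh (S (Suc i)) + 1)" using videal_iff_slices by blast
    then show ?thesis
      using edge_ideal_vedge(1)[OF e] vedge_at_eq[OF e order_refl j(1)] jump_at_von[of i j p] i j(2) by simp
  qed
  have h: "jump p \<tau> \<in> edge_ideal m m' rh rv \<tau>" if t: "\<tau> \<in> interior_hedges M" for \<tau>
  proof -
    obtain j i i2 where e: "hedge \<tau> (Suc j) i i2" and j: "Suc j < l" using t by (rule interior_hedgeE)
    then have i: "i < i2" "i < n" by (auto simp: hedge_def)
    let ?q = "p (cell_at i (Suc j)) - p (cell_at i j)"
    have "[:- T (Suc j), 1:] ^ (rv (T (Suc j)) + 1) dvd hslice m ?q x" if x: "x \<in> {S i<..<S (Suc i)}" for x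
    proof -
      have "x \<le> S i2" "S 0 < x" "x < S n"
        using x i S_simps(1)[of "Suc i" i2] S_simps(1)[of 0 i] S_simps(1)[of "Suc i" n] by (auto simp del: S_simps)
      then have "(x, T (Suc j)) \<in> \<tau> \<inter> interior (domain M)"
        using e x j unfolding dom interior_rectangle by (auto simp: hedge_def)
      then have "class_C_at (edge_smoothness rh rv \<tau>) (\<lambda>t. f (fst (x, T (Suc j)), t)) (snd (x, T (Suc j)))"
        using f t unfolding spline_space_def by blast
      then show ?thesis
        using class_C_at_hslice_iff[where p = p and F = f and x = x, OF i(2) j _ _ bd ev] x edge_ideal_hedge(2)[OF e] by simp
    qed
    moreover have "?q \<in> bideg_le m m'" using bd cell_at(1) j i(2) by (intro poly2.subspace_diff[OF subspace_bideg_le]) auto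
    moreover have "infinite {S i<..<S (Suc i)}" by (rule infinite_Ioo) simp
    ultimately have "?q \<in> hideal m m' (T (Suc j)) (rv (T (Suc j)) + 1)" using hideal_iff_slices by blast
    then have "- ?q \<in> hideal m m' (T (Suc j)) (rv (T (Suc j)) + 1)" by (rule poly2.subspace_neg[OF subspace_hideal])
    then show ?thesis
      using edge_ideal_hedge(1)[OF e] hedge_at_eq[OF e order_refl i(1)] jump_at_hon[of i j p] j i(2) by simp
  qed
  have "p \<in> spline_families"
    unfolding spline_families_def edge_chains_def
    using bd v h jump_eq_0[of _ p] interior_edges_split(1)[OF mesh] by (auto simp: families_def p_def)
  moreover have "f = spline_of p"
    using f0 ev some_cell by (auto simp: fun_eq_iff spline_of_def)
  ultimately show ?thesis by blast
qed

end

section \<open>The dimension formula\<close>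

context mesh_grid begin

section \<open>Counting cells, edges and vertices by their lower left grid points\<close>

lemma vgrid_von_iff:
  assumes "j < l"
  shows "(S i, T j) \<in> vgrid M \<longleftrightarrow> von i j \<or> 0 < j \<and> von i (j - 1)"
proof
  assume "(S i, T j) \<in> vgrid M"
  then obtain i1 i2 j1 j2 where b: "i1 < i2" "i2 \<le> n" "j1 < j2" "j2 \<le> l"
    "{S i1..S i2} \<times> {T j1..T j2} \<in> cells M" "S i = S i1 \<or> S i = S i2" "j1 \<le> j" "j \<le> j2"
    unfolding vgrid_iff by auto
  have "von i e" if "j1 \<le> e" "e < j2" for e
  proof (rule von_if_mid)
    show "(S i, midT e) \<in> vgrid M" unfolding vgrid_iff using b that
      by (intro exI[of _ i1] exI[of _ i2] exI[of _ j1] exI[of _ j2]) auto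
  qed
  from this[of j] this[of "j - 1"] show "von i j \<or> 0 < j \<and> von i (j - 1)" using b(3,7,8) by (cases "j < j2") auto
next
  assume "von i j \<or> 0 < j \<and> von i (j - 1)"
  then show "(S i, T j) \<in> vgrid M" by (auto simp: von_def)
qed

lemma hgrid_hon_iff:
  assumes "i < n"
  shows "(S i, T j) \<in> hgrid M \<longleftrightarrow> hon i j \<or> 0 < i \<and> hon (i - 1) j"
proof -
  interpret t: mesh_grid "transpose_mesh M" T S l n by (rule transpose_grid)
  show ?thesis using t.vgrid_von_iff[OF assms, of j] by (simp add: hon_eq)
qed

definition indices :: "(nat \<times> nat) set" where "indices = {..<n} \<times> {..<l}"

lemma finite_indices [simp]: "finite indices" by (simp add: indices_def)

text \<open>An edge is identified with its lower end point, a vertex from which a drawn segment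
  ascends.\<close>

lemma card_interior_vedges:
  "card (interior_vedges M) = card {(i, j) \<in> indices. 0 < i \<and> von i j \<and> (S i, T j) \<in> vertices M}" (is "_ = card ?I")
proof -
  have src: "vedge_at i j \<in> interior_vedges M \<and> edge_src (vedge_at i j) = (S i, T j)" if "(i, j) \<in> ?I" for i j
    using vedges_with_src[of i j] that by (auto simp: indices_def)
  have "bij_betw (\<lambda>(i, j). vedge_at i j) ?I (interior_vedges M)"
  proof (rule bij_betw_imageI)
    show "inj_on (\<lambda>(i, j). vedge_at i j) ?I"
    proof (rule inj_onI, clarify)
      fix i j i' j' assume *: "(i, j) \<in> indices" "0 < i" "von i j" "(S i, T j) \<in> vertices M"
        "(i', j') \<in> indices" "0 < i'" "von i' j'" "(S i', T j') \<in> vertices M" "vedge_at i j = vedge_at i' j'"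
      have "(S i, T j) = edge_src (vedge_at i j)" using src[of i j] *(1-4) by simp
      also have "\<dots> = edge_src (vedge_at i' j')" unfolding *(9) ..
      also have "\<dots> = (S i', T j')" using src[of i' j'] *(5-8) by simp
      finally show "i = i' \<and> j = j'" by simp
    qed
    show "(\<lambda>(i, j). vedge_at i j) ` ?I = interior_vedges M"
    proof (intro equalityI subsetI)
      fix \<tau> assume "\<tau> \<in> (\<lambda>(i, j). vedge_at i j) ` ?I"
      then show "\<tau> \<in> interior_vedges M" using src by auto
    next
      fix \<tau> assume "\<tau> \<in> interior_vedges M"
      then obtain i j1 j2 where e: "vedge \<tau> (Suc i) j1 j2" "Suc i < n" by (rule interior_vedgeE)
      then have "(Suc i, j1) \<in> ?I" "vedge_at (Suc i) j1 = \<tau>"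
        using vedge_at_eq[OF e(1), of j1] vedge_vertices[OF e(1)] by (auto simp: indices_def vedge_def)
      then show "\<tau> \<in> (\<lambda>(i, j). vedge_at i j) ` ?I" by (intro image_eqI[where x = "(Suc i, j1)"]) auto
    qed
  qed
  then show ?thesis by (simp add: bij_betw_same_card)
qed

lemma card_interior_hedges:
  "card (interior_hedges M) = card {(i, j) \<in> indices. 0 < j \<and> hon i j \<and> (S i, T j) \<in> vertices M}" (is "_ = card ?I")
proof -
  interpret t: mesh_grid "transpose_mesh M" T S l n by (rule transpose_grid)
  let ?J = "{(j, i) \<in> t.indices. 0 < j \<and> t.von j i \<and> (T j, S i) \<in> vertices (transpose_mesh M)}"
  have "z \<in> ?J \<longleftrightarrow> z \<in> prod.swap ` ?I" for z
    by (cases z) (auto simp: indices_def t.indices_def hon_eq)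
  then have "?J = prod.swap ` ?I" by blast
  then have "card ?J = card ?I" by (simp add: card_image inj_on_subset[OF inj_swap])
  then show ?thesis
    using t.card_interior_vedges unfolding interior_hvedges_transpose
    by (simp add: card_image inj_on_subset[OF inj_flip])
qed

lemma card_interior_vertices:
  "card (interior_vertices M) = card {(i, j) \<in> indices. 0 < i \<and> 0 < j \<and> (S i, T j) \<in> vertices M}" (is "_ = card ?I")
proof -
  have "interior_vertices M = (\<lambda>(i, j). (S i, T j)) ` ?I"
  proof (intro equalityI subsetI)
    fix z assume "z \<in> interior_vertices M"
    then obtain i j where "Suc i < n" "Suc j < l" "z = (S (Suc i), T (Suc j))" "z \<in> vertices M" by (rule interior_vertexE)
    then show "z \<in> (\<lambda>(i, j). (S i, T j)) ` ?I"
      by (intro image_eqI[where x = "(Suc i, Suc j)"]) (auto simp: indices_def)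
  qed (auto simp: indices_def interior_vertex_iff)
  moreover have "inj_on (\<lambda>(i, j). (S i, T j)) ?I" by (auto intro!: inj_onI)
  ultimately show ?thesis by (simp add: card_image)
qed

text \<open>A cell is identified with its lower left square, which is recognised by drawn segments
  on its left and below it.\<close>

lemma card_cells: "card (cells M) = card {(i, j) \<in> indices. von i j \<and> hon i j}" (is "_ = card ?I")
proof -
  have corner: "i1 = i \<and> j1 = j \<longleftrightarrow> von i j \<and> hon i j"
    if ij: "i < n" "j < l" and b: "i1 \<le> i" "i < i2" "j1 \<le> j" "j < j2"
      and c: "\<And>i' j'. i1 \<le> i' \<Longrightarrow> i' < i2 \<Longrightarrow> j1 \<le> j' \<Longrightarrow> j' < j2 \<Longrightarrow> cell_at i' j' = cell_at i j"
      and c': "\<And>i' j'. i' < n \<Longrightarrow> j' < l \<Longrightarrow> cell_at i' j' = cell_at i j \<Longrightarrow> i1 \<le> i' \<and> i' < i2 \<and> j1 \<le> j' \<and> j' < j2"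
    for i j i1 i2 j1 j2
  proof -
    have "i1 = i \<longleftrightarrow> von i j"
    proof (cases i)
      case 0 then show ?thesis using b von_boundary ij by simp
    next
      case (Suc a)
      have "von i j \<longleftrightarrow> cell_at a j \<noteq> cell_at i j" using von_iff[of a j] Suc ij by simp
      also have "\<dots> \<longleftrightarrow> \<not> i1 \<le> a" using c[of a j] c'[of a j] Suc ij b by auto
      finally show ?thesis using b Suc by auto
    qed
    moreover have "j1 = j \<longleftrightarrow> hon i j"
    proof (cases j)
      case 0 then show ?thesis using b hon_boundary ij by simp
    next
      case (Suc a)
      have "hon i j \<longleftrightarrow> cell_at i a \<noteq> cell_at i j" using hon_iff[of i a] Suc ij by simp
      also have "\<dots> \<longleftrightarrow> \<not> j1 \<le> a" using c[of i a] c'[of i a] Suc ij b by auto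
      finally show ?thesis using b Suc by auto
    qed
    ultimately show ?thesis by blast
  qed
  have "bij_betw (\<lambda>(i, j). cell_at i j) ?I (cells M)"
  proof (rule bij_betw_imageI)
    show "inj_on (\<lambda>(i, j). cell_at i j) ?I"
    proof (rule inj_onI, clarify)
      fix i j a e assume *: "(i, j) \<in> indices" "von i j" "hon i j" "(a, e) \<in> indices" "von a e" "hon a e"
        and eq: "cell_at i j = cell_at a e"
      have ij: "i < n" "j < l" and ae: "a < n" "e < l" using * by (auto simp: indices_def)
      obtain i1 i2 j1 j2 where b: "i1 \<le> i" "i < i2" "j1 \<le> j" "j < j2"
        and c: "\<And>i' j'. i1 \<le> i' \<Longrightarrow> i' < i2 \<Longrightarrow> j1 \<le> j' \<Longrightarrow> j' < j2 \<Longrightarrow> cell_at i' j' = cell_at i j"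
        and c': "\<And>i' j'. i' < n \<Longrightarrow> j' < l \<Longrightarrow> cell_at i' j' = cell_at i j \<Longrightarrow> i1 \<le> i' \<and> i' < i2 \<and> j1 \<le> j' \<and> j' < j2"
        by (rule cell_at_box[OF ij]) (rule that)
      have "i1 = i \<and> j1 = j" using corner[OF ij b c c'] * by blast
      moreover have "i1 \<le> a" "a < i2" "j1 \<le> e" "e < j2" using c'[OF ae eq[symmetric]] by auto
      then have "i1 = a \<and> j1 = e" using corner[OF ae, of i1 i2 j1 j2] c c' * unfolding eq by blast
      ultimately show "i = a \<and> j = e" by simp
    qed
    show "(\<lambda>(i, j). cell_at i j) ` ?I = cells M"
    proof (intro equalityI subsetI)
      fix \<sigma> assume "\<sigma> \<in> cells M"
      then obtain i j where ij: "i < n" "j < l" "cell_at i j = \<sigma>" by (rule cells_cell_at)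
      obtain i1 i2 j1 j2 where b: "i1 \<le> i" "i < i2" "i2 \<le> n" "j1 \<le> j" "j < j2" "j2 \<le> l"
        and c: "\<And>i' j'. i1 \<le> i' \<Longrightarrow> i' < i2 \<Longrightarrow> j1 \<le> j' \<Longrightarrow> j' < j2 \<Longrightarrow> cell_at i' j' = cell_at i j"
        and c': "\<And>i' j'. i' < n \<Longrightarrow> j' < l \<Longrightarrow> cell_at i' j' = cell_at i j \<Longrightarrow> i1 \<le> i' \<and> i' < i2 \<and> j1 \<le> j' \<and> j' < j2"
        by (rule cell_at_box[OF ij(1,2)]) (rule that)
      have 1: "i1 < n" "j1 < l" "i1 < i2" "j1 < j2" using b by auto
      have eq: "cell_at i1 j1 = cell_at i j" using b by (intro c) auto
      have "von i1 j1 \<and> hon i1 j1"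
        using corner[OF 1(1,2) order_refl 1(3) order_refl 1(4)] c c' unfolding eq by blast
      then show "\<sigma> \<in> (\<lambda>(i, j). cell_at i j) ` ?I"
        using 1 eq ij(3) by (intro image_eqI[where x = "(i1, j1)"]) (auto simp: indices_def)
    qed (auto simp: indices_def cell_at)
  qed
  then show ?thesis by (simp add: bij_betw_same_card)
qed

text \<open>In terms of the lower left corners of the cells, the lower left end points of the edges and
  the vertices, the contributions at each grid point other than the first cancel.\<close>

lemma euler_characteristic:
  "int (card (cells M)) - int (card (interior_vedges M)) - int (card (interior_hedges M))
    + int (card (interior_vertices M)) = 1"
proof -
  let ?v = "\<lambda>i j. (S i, T j) \<in> vertices M"
  have count: "int (card {(i, j) \<in> indices. P i j}) = (\<Sum>(i, j)\<in>indices. of_bool (P i j))" for P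
  proof -
    have "{(i, j) \<in> indices. P i j} = indices \<inter> {z. P (fst z) (snd z)}" by auto
    then show ?thesis by (simp add: sum_of_bool_eq case_prod_beta)
  qed
  have loc: "of_bool (von i j \<and> hon i j) - of_bool (0 < i \<and> von i j \<and> ?v i j) - of_bool (0 < j \<and> hon i j \<and> ?v i j)
      + of_bool (0 < i \<and> 0 < j \<and> ?v i j) = (of_bool ((i, j) = (0, 0)) :: int)" if ij: "(i, j) \<in> indices" for i j
  proof -
    have ij: "i < n" "j < l" using ij by (auto simp: indices_def)
    have v: "?v i j \<longleftrightarrow> (von i j \<or> 0 < j \<and> von i (j - 1)) \<and> (hon i j \<or> 0 < i \<and> hon (i - 1) j)"
      using vertices_eq[OF mesh] vgrid_von_iff[OF ij(2)] hgrid_hon_iff[OF ij(1)] by blast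
    consider "i = 0" | "j = 0" | a e where "i = Suc a" "j = Suc e" by (metis not0_implies_Suc)
    then show ?thesis
    proof cases
      case 1 then show ?thesis using v von_boundary ij by (auto simp: hon_boundary)
    next
      case 2 then show ?thesis using v hon_boundary ij by (auto simp: von_boundary)
    next
      case 3
      \<comment> \<open>The cancellation could fail only at a vertex from which no segment goes up
        or to the right. There the upper left, upper right and lower right squares belong to one
        cell. Its box then contains the lower left square too, so no segment comes from
        below.\<close>
      have "von i j \<or> hon i j \<or> \<not> von i e"
      proof (rule ccontr)
        assume "\<not> (von i j \<or> hon i j \<or> \<not> von i e)"
        then have nc: "cell_at a j = cell_at i j" "cell_at i e = cell_at i j" "cell_at a e \<noteq> cell_at i e"
          using von_iff[of a j] von_iff[of a e] hon_iff[of i e] 3 ij by auto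
        obtain i1 i2 j1 j2 where b: "i1 \<le> i" "i < i2" "j1 \<le> j" "j < j2"
          and c: "\<And>i' j'. i1 \<le> i' \<Longrightarrow> i' < i2 \<Longrightarrow> j1 \<le> j' \<Longrightarrow> j' < j2 \<Longrightarrow> cell_at i' j' = cell_at i j"
          and c': "\<And>i' j'. i' < n \<Longrightarrow> j' < l \<Longrightarrow> cell_at i' j' = cell_at i j \<Longrightarrow> i1 \<le> i' \<and> i' < i2 \<and> j1 \<le> j' \<and> j' < j2"
          by (rule cell_at_box[OF ij]) (rule that)
        have "i1 \<le> a" "j1 \<le> e" using c'[OF _ _ nc(1)] c'[OF _ _ nc(2)] 3 ij by auto
        then have "cell_at a e = cell_at i j" using b 3 by (intro c) auto
        then show False using nc by simp
      qed
      then show ?thesis using v 3 by auto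
    qed
  qed
  have "int (card (cells M)) - int (card (interior_vedges M)) - int (card (interior_hedges M))
      + int (card (interior_vertices M)) = (\<Sum>(i, j)\<in>indices. of_bool ((i, j) = (0, 0)))"
    unfolding card_cells card_interior_vedges card_interior_hedges card_interior_vertices count
      sum_subtractf[symmetric] sum.distrib[symmetric]
    by (intro sum.cong refl) (use loc in \<open>auto simp only: split_beta prod.collapse\<close>)
  also have "\<dots> = (\<Sum>z\<in>indices. if z = (0, 0) then 1 else 0)" by (intro sum.cong refl) auto
  also have "\<dots> = 1" using pos by (simp add: indices_def)
  finally show ?thesis .
qed

section \<open>Ranks of the jump and boundary maps\<close>

lemma linear_jump: "Vector_Spaces.linear (pointwise poly_scale) (pointwise poly_scale) jump"
proof -
  interpret t: mesh_grid "transpose_mesh M" T S l n by (rule transpose_grid)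
  show ?thesis
    by unfold_locales
      (auto simp: jump_def vjump_def t.vjump_def fun_eq_iff pointwise_def Let_def poly2.scale_right_diff_distrib)
qed

end

context spline_grid begin

lemma edge_ideal_subset: "edge_ideal m m' rh rv \<tau> \<subseteq> bideg_le m m'"
  by (auto simp: edge_ideal_def)

lemma subspace_spline_families: "chains.subspace spline_families"
proof -
  have "chains.subspace (families (cells M) (\<lambda>_. bideg_le m m'))"
    by (intro poly2.subspace_families subspace_bideg_le)
  moreover have "chains.subspace {p. jump p \<in> edge_chains m m' rh rv M}"
    by (rule chain_maps.linear_subspace_linear_preimage[OF linear_jump subspace_edge_chains[OF mesh]])
  ultimately have "chains.subspace (families (cells M) (\<lambda>_. bideg_le m m') \<inter> {p. jump p \<in> edge_chains m m' rh rv M})"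
    by (rule chains.subspace_inter)
  moreover have "spline_families = families (cells M) (\<lambda>_. bideg_le m m') \<inter> {p. jump p \<in> edge_chains m m' rh rv M}"
    by (auto simp: spline_families_def)
  ultimately show ?thesis by simp
qed

lemma finitely_spanned_spline_families: "finitely_spanned (pointwise poly_scale) spline_families"
proof (rule finitely_spanned_subset)
  show "finitely_spanned (pointwise poly_scale) (families (cells M) (\<lambda>_. bideg_le m m'))"
    using is_tmeshD(1)[OF mesh] by (intro poly2.finitely_spanned_families finitely_spanned_bideg_le)
qed (auto simp: spline_families_def)

definition cycles :: "(point set \<Rightarrow> real poly poly) set" where
  "cycles = {x \<in> edge_chains m m' rh rv M. boundary1 M x = 0}"

text \<open>Integrating a cycle gives cell polynomials that are sums and differences of its values,
  so they respect the bidegree bound.\<close>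

lemma jump_image: "jump ` spline_families = cycles"
proof (intro equalityI subsetI)
  fix x assume "x \<in> jump ` spline_families"
  then show "x \<in> cycles" by (auto simp: cycles_def spline_families_def fun_eq_iff boundary1_jump)
next
  fix x assume x: "x \<in> cycles"
  then have x0: "\<And>\<tau>. \<tau> \<notin> interior_edges M \<Longrightarrow> x \<tau> = 0" and cyc: "\<And>z. boundary1 M x z = 0"
    by (auto simp: cycles_def edge_chains_def)
  obtain p where p: "\<forall>\<sigma>. \<sigma> \<notin> cells M \<longrightarrow> p \<sigma> = 0" "jump p = x"
    "p ` cells M \<subseteq> {(\<Sum>i'<i. vvalue x (Suc i') j) - (\<Sum>j'<j. hvalue x 0 (Suc j')) | i j. i < n \<and> j < l}"
    using cycle_is_jump[OF x0 cyc] by blast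
  have b: "x \<tau> \<in> bideg_le m m'" for \<tau>
  proof (cases "\<tau> \<in> interior_edges M")
    case True
    then have "x \<tau> \<in> edge_ideal m m' rh rv \<tau>" using x by (simp add: cycles_def edge_chains_def)
    then show ?thesis using edge_ideal_subset by blast
  next
    case False
    then show ?thesis using x0 poly2.subspace_0[OF subspace_bideg_le] by simp
  qed
  have "vvalue x i j \<in> bideg_le m m'" "hvalue x i j \<in> bideg_le m m'" for i j
    using b poly2.subspace_0[OF subspace_bideg_le] by (auto simp: vvalue_def hvalue_def)
  then have P: "(\<Sum>i'<i. vvalue x (Suc i') j) - (\<Sum>j'<j. hvalue x 0 (Suc j')) \<in> bideg_le m m'" for i j
    by (intro poly2.subspace_diff[OF subspace_bideg_le] poly2.subspace_sum[OF subspace_bideg_le])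
  have "p \<sigma> \<in> bideg_le m m'" if "\<sigma> \<in> cells M" for \<sigma>
    using subsetD[OF p(3) imageI[OF that]] P by (elim CollectE exE conjE) simp
  then have "p \<in> spline_families" using p x by (auto simp: spline_families_def families_def cycles_def)
  then show "x \<in> jump ` spline_families" using p(2) by blast
qed

lemma dim_jump_kernel: "chains.dim {p \<in> spline_families. jump p = 0} = (m + 1) * (m' + 1)"
proof -
  interpret vp: vector_space_pair poly_scale "pointwise poly_scale :: real \<Rightarrow> (point set \<Rightarrow> real poly poly) \<Rightarrow> _" ..
  let ?c = "\<lambda>q. \<lambda>\<sigma>. if \<sigma> \<in> cells M then q else 0 :: real poly poly"
  have lin: "Vector_Spaces.linear poly_scale (pointwise poly_scale) ?c"
    by unfold_locales (auto simp: pointwise_def fun_eq_iff)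
  have c0: "cell_at 0 0 \<in> cells M" using cell_at(1) pos by simp
  have j0: "jump (?c q) = 0" for q
    by (rule chain_eqI) (auto simp: jump_eq_0 vvalue_jump hvalue_jump cell_at vvalue_def[of 0] hvalue_def[of 0])
  have "{p \<in> spline_families. jump p = 0} = ?c ` bideg_le m m'"
  proof (intro equalityI subsetI)
    fix p assume p: "p \<in> {p \<in> spline_families. jump p = 0}"
    then have "jump p = (\<lambda>_. 0)" by (simp add: zero_fun_def)
    then have "p \<sigma> = p (cell_at 0 0)" if "\<sigma> \<in> cells M" for \<sigma> using jump_0_constant that by blast
    then have "p = ?c (p (cell_at 0 0))" using p by (auto simp: spline_families_def families_def fun_eq_iff)
    moreover have "p (cell_at 0 0) \<in> bideg_le m m'" using p c0 by (simp add: spline_families_def families_def)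
    ultimately show "p \<in> ?c ` bideg_le m m'" by blast
  next
    fix p assume "p \<in> ?c ` bideg_le m m'"
    then obtain q where q: "q \<in> bideg_le m m'" "p = ?c q" by blast
    have "0 \<in> edge_chains m m' rh rv M" by (rule chains.subspace_0[OF subspace_edge_chains[OF mesh]])
    then show "p \<in> {p \<in> spline_families. jump p = 0}"
      using q j0 by (auto simp: spline_families_def families_def)
  qed
  also have "chains.dim \<dots> = poly2.dim (bideg_le m m')"
  proof (rule vp.dim_inj_image[OF lin subspace_bideg_le finitely_spanned_bideg_le])
    fix q assume "?c q = 0"
    from fun_cong[OF this, of "cell_at 0 0"] show "q = 0" using c0 by simp
  qed
  finally show ?thesis by (simp add: dim_bideg_le)
qed

lemma dim_spline_families: "chains.dim spline_families = chains.dim cycles + (m + 1) * (m' + 1)"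
  using chain_maps.rank_nullity[OF linear_jump subspace_spline_families finitely_spanned_spline_families]
  by (simp add: jump_image dim_jump_kernel)

text \<open>A family is determined by its spline, because a polynomial vanishing on a rectangle is
  0.\<close>

lemma spline_dim_eq: "spline_dim m m' rh rv M = chains.dim spline_families"
proof -
  interpret sp: vector_space_pair "pointwise poly_scale :: real \<Rightarrow> (point set \<Rightarrow> real poly poly) \<Rightarrow> _" fun_scale ..
  have lin: "Vector_Spaces.linear (pointwise poly_scale) fun_scale spline_of"
    by unfold_locales (auto simp: spline_of_def fun_scale_def pointwise_def fun_eq_iff)
  have "spline_space m m' rh rv M = spline_of ` spline_families"
    using spline_space_imp_family spline_of_in_spline_space by blast
  moreover have "real_fun.dim (spline_of ` spline_families) = chains.dim spline_families"
  proof (rule sp.dim_inj_image[OF lin subspace_spline_families finitely_spanned_spline_families])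
    fix p assume p: "p \<in> spline_families" "spline_of p = 0"
    have "p \<sigma> = 0" if s: "\<sigma> \<in> cells M" for \<sigma>
    proof -
      obtain a b c d where r: "a < b" "c < d" "\<sigma> = {a..b} \<times> {c..d}" by (rule rectangleE[OF is_tmeshD(2)[OF mesh s]])
      show ?thesis
        using spline_of_cell[OF p(1) s] p(2) r(3) by (intro bieval_0_on_rectangle[OF r(1,2)]) auto
    qed
    then show "p = 0" using p(1) by (auto simp: fun_eq_iff spline_families_def families_def)
  qed
  ultimately show ?thesis by (simp add: spline_dim_def)
qed

text \<open>The inclusion that turns the surjectivity hypothesis of
  \<open>spline_dim_formula\<close> into an equality of spaces.\<close>

lemma boundary1_in_vertex_chains:
  assumes x: "x \<in> edge_chains m m' rh rv M"
  shows "boundary1 M x \<in> vertex_chains m m' rh rv M"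
proof -
  have "boundary1 M x \<gamma> \<in> vertex_ideal m m' rh rv M \<gamma>" if g: "\<gamma> \<in> interior_vertices M" for \<gamma>
  proof -
    have v: "\<gamma> \<in> vertices M" using g by (simp add: interior_vertices_def)
    have "x \<tau> \<in> vertex_ideal m m' rh rv M \<gamma>"
      if t: "\<tau> \<in> interior_edges M" "edge_tgt \<tau> = \<gamma> \<or> edge_src \<tau> = \<gamma>" for \<tau>
    proof -
      have xt: "x \<tau> \<in> edge_ideal m m' rh rv \<tau>" using x t(1) by (simp add: edge_chains_def)
      consider "\<tau> \<in> interior_vedges M" | "\<tau> \<in> interior_hedges M"
        using t(1) interior_edges_split(1)[OF mesh] by blast
      then show ?thesis
      proof cases
        case 1
        then obtain i j1 j2 where e: "vedge \<tau> (Suc i) j1 j2" by (rule interior_vedgeE)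
        then have "fst \<gamma> = S (Suc i)" using vedge_ends[OF e] t(2) by auto
        then have "x \<tau> \<in> videal m m' (fst \<gamma>) (rh (fst \<gamma>) + 1)" using xt edge_ideal_vedge(1)[OF e] by simp
        then have "x \<tau> + 0 \<in> vertex_ideal m m' rh rv M \<gamma>"
          unfolding vertex_ideal_eq[OF mesh v] using poly2.subspace_0[OF subspace_hideal] by blast
        then show ?thesis by simp
      next
        case 2
        then obtain j i1 i2 where e: "hedge \<tau> (Suc j) i1 i2" by (rule interior_hedgeE)
        then have "snd \<gamma> = T (Suc j)" using t(2) by (auto simp: hedge_def edge_tgt_horizontal edge_src_horizontal)
        then have "x \<tau> \<in> hideal m m' (snd \<gamma>) (rv (snd \<gamma>) + 1)" using xt edge_ideal_hedge(1)[OF e] by simp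
        then have "0 + x \<tau> \<in> vertex_ideal m m' rh rv M \<gamma>"
          unfolding vertex_ideal_eq[OF mesh v] using poly2.subspace_0[OF subspace_videal] by blast
        then show ?thesis by simp
      qed
    qed
    then show ?thesis unfolding boundary1_def using g subspace_vertex_ideal[OF mesh v]
      by (auto intro!: poly2.subspace_diff poly2.subspace_sum)
  qed
  then show ?thesis by (auto simp: vertex_chains_def boundary1_def)
qed

text \<open>The smoothness bound makes the truncated subtractions in \<open>dim_videal\<close> and
  \<open>dim_hideal\<close> exact, so the formula can be stated over the integers.\<close>

lemma dim_edge_chains:
  "int (chains.dim (edge_chains m m' rh rv M)) =
    (\<Sum>\<tau>\<in>interior_vedges M. (int m + 1) * (int m' + 1) - (int m' + 1) * (int (edge_smoothness rh rv \<tau>) + 1)) +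
    (\<Sum>\<tau>\<in>interior_hedges M. (int m + 1) * (int m' + 1) - (int m + 1) * (int (edge_smoothness rh rv \<tau>) + 1))"
proof -
  have fs: "finitely_spanned poly_scale (edge_ideal m m' rh rv \<tau>)" for \<tau>
    using finitely_spanned_bideg_le edge_ideal_subset by (rule finitely_spanned_subset)
  have "chains.dim (edge_chains m m' rh rv M) = (\<Sum>\<tau>\<in>interior_edges M. poly2.dim (edge_ideal m m' rh rv \<tau>))"
    unfolding edge_chains_eq
    using finite_interior_edges[OF mesh] is_tmeshD(4)[OF mesh] fs
    by (intro poly2.dim_families subspace_edge_ideal) (auto simp: interior_edges_def)
  also have "\<dots> = (\<Sum>\<tau>\<in>interior_vedges M. poly2.dim (edge_ideal m m' rh rv \<tau>)) +
      (\<Sum>\<tau>\<in>interior_hedges M. poly2.dim (edge_ideal m m' rh rv \<tau>))"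
    unfolding interior_edges_split(1)[OF mesh] using finite_interior_edges[OF mesh] interior_edges_split(2)[OF mesh]
    by (intro sum.union_disjoint)
  also have "int \<dots> = (\<Sum>\<tau>\<in>interior_vedges M. int (poly2.dim (edge_ideal m m' rh rv \<tau>))) +
      (\<Sum>\<tau>\<in>interior_hedges M. int (poly2.dim (edge_ideal m m' rh rv \<tau>)))" by simp
  also have "(\<Sum>\<tau>\<in>interior_vedges M. int (poly2.dim (edge_ideal m m' rh rv \<tau>))) =
      (\<Sum>\<tau>\<in>interior_vedges M. (int m + 1) * (int m' + 1) - (int m' + 1) * (int (edge_smoothness rh rv \<tau>) + 1))"
  proof (rule sum.cong[OF refl])
    fix \<tau> assume t: "\<tau> \<in> interior_vedges M"
    then obtain i j1 j2 where e: "vedge \<tau> (Suc i) j1 j2" by (rule interior_vedgeE)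
    have "rh (S (Suc i)) \<le> m" using smooth t edge_ideal_vedge(2)[OF e] by (auto simp: smoothness_le_def)
    then show "int (poly2.dim (edge_ideal m m' rh rv \<tau>)) =
        (int m + 1) * (int m' + 1) - (int m' + 1) * (int (edge_smoothness rh rv \<tau>) + 1)"
      unfolding edge_ideal_vedge[OF e] dim_videal of_nat_mult by (simp add: of_nat_diff algebra_simps)
  qed
  also have "(\<Sum>\<tau>\<in>interior_hedges M. int (poly2.dim (edge_ideal m m' rh rv \<tau>))) =
      (\<Sum>\<tau>\<in>interior_hedges M. (int m + 1) * (int m' + 1) - (int m + 1) * (int (edge_smoothness rh rv \<tau>) + 1))"
  proof (rule sum.cong[OF refl])
    fix \<tau> assume t: "\<tau> \<in> interior_hedges M"
    then obtain j i1 i2 where e: "hedge \<tau> (Suc j) i1 i2" by (rule interior_hedgeE)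
    have "rv (T (Suc j)) \<le> m'" using smooth t edge_ideal_hedge(2)[OF e] by (auto simp: smoothness_le_def)
    then show "int (poly2.dim (edge_ideal m m' rh rv \<tau>)) =
        (int m + 1) * (int m' + 1) - (int m + 1) * (int (edge_smoothness rh rv \<tau>) + 1)"
      unfolding edge_ideal_hedge[OF e] dim_hideal of_nat_mult by (simp add: of_nat_diff algebra_simps)
  qed
  finally show ?thesis .
qed

lemma dim_vertex_chains:
  "int (chains.dim (vertex_chains m m' rh rv M)) =
    (\<Sum>\<gamma>\<in>interior_vertices M. (int m + 1) * (int m' + 1) - (int (rh (fst \<gamma>)) + 1) * (int (rv (snd \<gamma>)) + 1))"
proof -
  have fin: "finite (interior_vertices M)" using finite_vertices[OF mesh] by (auto simp: interior_vertices_def)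
  have v: "\<gamma> \<in> vertices M" if "\<gamma> \<in> interior_vertices M" for \<gamma> using that by (simp add: interior_vertices_def)
  have "vertex_ideal m m' rh rv M \<gamma> \<subseteq> bideg_le m m'" if "\<gamma> \<in> interior_vertices M" for \<gamma>
    unfolding vertex_ideal_eq[OF mesh v[OF that]]
    by (auto simp: videal_def hideal_def intro: poly2.subspace_add[OF subspace_bideg_le])
  then have fs: "finitely_spanned poly_scale (vertex_ideal m m' rh rv M \<gamma>)" if "\<gamma> \<in> interior_vertices M" for \<gamma>
    using finitely_spanned_subset[OF finitely_spanned_bideg_le] that by blast
  have "chains.dim (vertex_chains m m' rh rv M) = (\<Sum>\<gamma>\<in>interior_vertices M. poly2.dim (vertex_ideal m m' rh rv M \<gamma>))"
    unfolding vertex_chains_eq using fin fs v by (intro poly2.dim_families subspace_vertex_ideal[OF mesh]) auto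
  also have "int \<dots> = (\<Sum>\<gamma>\<in>interior_vertices M. int (poly2.dim (vertex_ideal m m' rh rv M \<gamma>)))" by simp
  also have "\<dots> = (\<Sum>\<gamma>\<in>interior_vertices M. (int m + 1) * (int m' + 1) - (int (rh (fst \<gamma>)) + 1) * (int (rv (snd \<gamma>)) + 1))"
  proof (rule sum.cong[OF refl])
    fix \<gamma> assume g: "\<gamma> \<in> interior_vertices M"
    then have "\<gamma> \<in> lines d M" for d using interior_vertex_lines[OF rect] by (simp add: interior_vertices_def)
    then have le: "rh (fst \<gamma>) + 1 \<le> m + 1" "rv (snd \<gamma>) + 1 \<le> m' + 1" using smooth unfolding smoothness_le_iff by auto
    have "poly2.dim (vertex_ideal m m' rh rv M \<gamma>) = (m + 1) * (m' + 1) - (rh (fst \<gamma>) + 1) * (rv (snd \<gamma>) + 1)"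
      unfolding vertex_ideal_eq[OF mesh v[OF g]] by (rule dim_ideal_sum[OF le])
    moreover have "(rh (fst \<gamma>) + 1) * (rv (snd \<gamma>) + 1) \<le> (m + 1) * (m' + 1)" using le by (rule mult_le_mono)
    ultimately show "int (poly2.dim (vertex_ideal m m' rh rv M \<gamma>)) =
        (int m + 1) * (int m' + 1) - (int (rh (fst \<gamma>)) + 1) * (int (rv (snd \<gamma>)) + 1)"
      by (simp only: of_nat_diff of_nat_mult of_nat_add of_nat_1)
  qed
  finally show ?thesis .
qed

lemma spline_dim_formula:
  assumes surj: "vertex_chains m m' rh rv M \<subseteq> im_boundary"
  shows "int (spline_dim m m' rh rv M) =
             (\<Sum>\<sigma>\<in>cells M. (int m + 1) * (int m' + 1))
             - (\<Sum>\<tau>\<in>interior_hedges M. (int m + 1) * (int (edge_smoothness rh rv \<tau>) + 1))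
             - (\<Sum>\<tau>\<in>interior_vedges M. (int m' + 1) * (int (edge_smoothness rh rv \<tau>) + 1))
             + (\<Sum>\<gamma>\<in>interior_vertices M. (int (rh (fst \<gamma>)) + 1) * (int (rv (snd \<gamma>)) + 1))"
proof -
  have im: "im_boundary = vertex_chains m m' rh rv M" using surj boundary1_in_vertex_chains by blast
  have fs: "finitely_spanned (pointwise poly_scale) (edge_chains m m' rh rv M)"
    unfolding edge_chains_eq using finite_interior_edges[OF mesh]
    by (intro poly2.finitely_spanned_families finitely_spanned_subset[OF finitely_spanned_bideg_le edge_ideal_subset])
  have "chains.dim (edge_chains m m' rh rv M) = chains.dim (vertex_chains m m' rh rv M) + chains.dim cycles"
    using chain_maps.rank_nullity[OF linear_boundary1[of M] subspace_edge_chains[OF mesh] fs] by (simp add: im cycles_def)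
  then have "int (spline_dim m m' rh rv M) = int (chains.dim (edge_chains m m' rh rv M))
      - int (chains.dim (vertex_chains m m' rh rv M)) + (int m + 1) * (int m' + 1)"
    unfolding spline_dim_eq dim_spline_families by (simp add: algebra_simps)
  \<comment> \<open>The full dimension of \<open>bideg_le\<close> occurs once for the kernel of
    \<open>jump\<close>, once for each interior edge and, negatively, once for each interior vertex.
    By the Euler characteristic its total multiplicity is the number of cells.\<close>
  also have "\<dots> = (int m + 1) * (int m' + 1) * (1 + int (card (interior_vedges M)) + int (card (interior_hedges M))
        - int (card (interior_vertices M)))
      - (\<Sum>\<tau>\<in>interior_hedges M. (int m + 1) * (int (edge_smoothness rh rv \<tau>) + 1))
      - (\<Sum>\<tau>\<in>interior_vedges M. (int m' + 1) * (int (edge_smoothness rh rv \<tau>) + 1))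
      + (\<Sum>\<gamma>\<in>interior_vertices M. (int (rh (fst \<gamma>)) + 1) * (int (rv (snd \<gamma>)) + 1))"
    unfolding dim_edge_chains dim_vertex_chains sum_subtractf sum_constant by (simp add: algebra_simps)
  also have "1 + int (card (interior_vedges M)) + int (card (interior_hedges M)) - int (card (interior_vertices M)) =
      int (card (cells M))" using euler_characteristic by linarith
  finally show ?thesis by (simp add: mult.commute)
qed

end

section \<open>Conclusion\<close>

lemma finite_set_enumeration:
  fixes G :: "real set"
  assumes "finite G" "G \<noteq> {}"
  shows "\<exists>S n. strict_mono S \<and> S ` {..n::nat} = G"
  using assms
proof (induction rule: finite_linorder_max_induct)
  case (insert b G)
  show ?case
  proof (cases "G = {}")
    case True
    have "strict_mono (\<lambda>i. b + real i)" by (rule strict_monoI) simp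
    then show ?thesis using True by (intro exI[of _ "\<lambda>i. b + real i"] exI[of _ 0]) simp
  next
    case False
    then obtain S n where S: "strict_mono S" "S ` {..n::nat} = G" using insert by blast
    \<comment> \<open>The new maximum gets index \<open>n + 1\<close>. Beyond it the values increase
      by one, only to make the enumeration strictly monotone on all naturals.\<close>
    define S' where "S' i = (if i \<le> n then S i else b + real (i - n - 1))" for i
    have "S' i < S' (Suc i)" for i
    proof -
      have "S n < b" using insert S(2) by auto
      moreover have "S i < S (Suc i)" using S(1) by (simp add: strict_mono_Suc_iff)
      ultimately show ?thesis by (cases "i < n"; cases "i = n") (auto simp: S'_def)
    qed
    then have "strict_mono S'" by (simp add: strict_mono_Suc_iff)
    moreover have "S' ` {..Suc n} = insert b G" using S(2) by (auto simp: S'_def atMost_Suc image_iff)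
    ultimately show ?thesis by blast
  qed
qed simp

lemma mesh_grid_exists:
  assumes M: "mesh_of_rectangle M A B C D"
  shows "\<exists>S T n l. mesh_grid M S T n l"
proof -
  have tm: "is_tmesh M" and dom: "domain M = {A..B} \<times> {C..D}" and lt: "A < B" "C < D"
    using M by (auto simp: mesh_of_rectangle_def)
  have enum: "\<exists>S n. strict_mono S \<and> 0 < n \<and> S 0 = a \<and> S n = b \<and> G \<subseteq> S ` {..n::nat}"
    if G: "finite G" "G \<subseteq> {a..b}" "a < b" for G :: "real set" and a b
  proof -
    obtain S n where S: "strict_mono S" "S ` {..n::nat} = {a, b} \<union> G"
      using finite_set_enumeration[of "{a, b} \<union> G"] G(1) by auto
    have mono: "S i \<le> S j \<longleftrightarrow> i \<le> j" for i j using S(1) by (rule strict_mono_less_eq)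
    have "S ` {..n} \<subseteq> {a..b}" unfolding S(2) using G by auto
    then have b: "a \<le> S 0" "S n \<le> b" by auto
    obtain i j where ij: "i \<le> n" "S i = a" "j \<le> n" "S j = b" using S(2) by (metis (no_types, lifting) Un_insert_left atMost_iff imageE insertI1 insert_commute)
    have 0: "S 0 = a" "S n = b" using mono[of 0 i] mono[of j n] ij b by auto
    then have "0 < n" using G(3) by (cases n) auto
    then show ?thesis using S 0 by blast
  qed
  \<comment> \<open>Applied to a cell, \<open>edge_src\<close> and \<open>edge_tgt\<close> give its
    lower left and upper right corner.\<close>
  define GA where "GA = (\<Union>\<sigma>\<in>cells M. {fst (edge_src \<sigma>), fst (edge_tgt \<sigma>)})"
  define GB where "GB = (\<Union>\<sigma>\<in>cells M. {snd (edge_src \<sigma>), snd (edge_tgt \<sigma>)})"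
  have cell: "\<exists>a b c d. a < b \<and> c < d \<and> \<sigma> = {a..b} \<times> {c..d} \<and> edge_src \<sigma> = (a, c) \<and> edge_tgt \<sigma> = (b, d) \<and>
      A \<le> a \<and> b \<le> B \<and> C \<le> c \<and> d \<le> D" if s: "\<sigma> \<in> cells M" for \<sigma>
  proof -
    obtain a b c d where r: "a < b" "c < d" "\<sigma> = {a..b} \<times> {c..d}" by (rule rectangleE[OF is_tmeshD(2)[OF tm s]])
    moreover have "{a..b} \<times> {c..d} \<subseteq> {A..B} \<times> {C..D}" using s r(3) dom by (auto simp: domain_def)
    then have "A \<le> a \<and> b \<le> B \<and> C \<le> c \<and> d \<le> D" using r(1,2) by (simp add: times_subset_iff)
    ultimately show ?thesis by (intro exI[of _ a] exI[of _ b] exI[of _ c] exI[of _ d]) (simp add: edge_src_def edge_tgt_def)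
  qed
  have GA: "finite GA" "GA \<subseteq> {A..B}"
    using is_tmeshD(1)[OF tm] cell by (auto simp: GA_def dest!: cell)
  have GB: "finite GB" "GB \<subseteq> {C..D}"
    using is_tmeshD(1)[OF tm] cell by (auto simp: GB_def dest!: cell)
  obtain S n where S: "strict_mono S" "0 < n" "S 0 = A" "S n = B" "GA \<subseteq> S ` {..n::nat}"
    using enum[OF GA lt(1)] by blast
  obtain T l where T: "strict_mono T" "0 < l" "T 0 = C" "T l = D" "GB \<subseteq> T ` {..l::nat}"
    using enum[OF GB lt(2)] by blast
  have "mesh_grid M S T n l"
  proof
    fix \<sigma> assume s: "\<sigma> \<in> cells M"
    obtain a b c d where r: "a < b" "c < d" "\<sigma> = {a..b} \<times> {c..d}" "edge_src \<sigma> = (a, c)" "edge_tgt \<sigma> = (b, d)"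
      using cell[OF s] by blast
    have "fst (edge_src \<sigma>) \<in> GA" "fst (edge_tgt \<sigma>) \<in> GA" "snd (edge_src \<sigma>) \<in> GB" "snd (edge_tgt \<sigma>) \<in> GB"
      using s by (auto simp: GA_def GB_def)
    then obtain i1 i2 j1 j2 where ij: "a = S i1" "b = S i2" "i2 \<le> n" "c = T j1" "d = T j2" "j2 \<le> l"
      using S(5) T(5) r(4,5) by fastforce
    then have "i1 < i2" "j1 < j2" using r(1,2) S(1) T(1) by (simp_all add: strict_mono_less)
    then show "\<exists>i1 i2 j1 j2. i1 < i2 \<and> i2 \<le> n \<and> j1 < j2 \<and> j2 \<le> l \<and> \<sigma> = {S i1..S i2} \<times> {T j1..T j2}"
      using ij r(3) by blast
  qed (use tm S T dom in auto)
  then show ?thesis by blast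
qed

lemma obtained_by_rule_dimension:
  assumes ob: "obtained_by_rule m m' k k' rh rv M" and sm: "smoothness_le m m' rh rv M"
    and k: "m + 1 \<le> k" "m' + 1 \<le> k'"
  shows "h_number m m' rh rv M = 0"
    and "int (spline_dim m m' rh rv M) =
             (\<Sum>\<sigma>\<in>cells M. (int m + 1) * (int m' + 1))
             - (\<Sum>\<tau>\<in>interior_hedges M. (int m + 1) * (int (edge_smoothness rh rv \<tau>) + 1))
             - (\<Sum>\<tau>\<in>interior_vedges M. (int m' + 1) * (int (edge_smoothness rh rv \<tau>) + 1))
             + (\<Sum>\<gamma>\<in>interior_vertices M. (int (rh (fst \<gamma>)) + 1) * (int (rv (snd \<gamma>)) + 1))"
    and "is_tmesh M"
proof -
  obtain Ms where Ms: "hier_construction Ms" "last Ms = M" "weighted m m' k k' rh rv Ms"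
    using obtained_by_rule_weighted[OF ob sm] by blast
  obtain A B C D where "\<forall>M\<in>set Ms. mesh_of_rectangle M A B C D"
    using hier_construction_meshes[OF Ms(1)] by (elim exE)
  then have M: "mesh_of_rectangle M A B C D" using Ms(2) hier_construction_nonempty[OF Ms(1)] by auto
  then show "is_tmesh M" by (simp add: mesh_of_rectangle_def)
  obtain S T n l where "mesh_grid M S T n l" using mesh_grid_exists[OF M] by blast
  then interpret spline_grid M S T n l m m' rh rv
    using sm by (simp add: spline_grid_def spline_grid_axioms_def)
  show "h_number m m' rh rv M = 0" by (rule h_number_0[OF Ms k])
  show "int (spline_dim m m' rh rv M) =
             (\<Sum>\<sigma>\<in>cells M. (int m + 1) * (int m' + 1))
             - (\<Sum>\<tau>\<in>interior_hedges M. (int m + 1) * (int (edge_smoothness rh rv \<tau>) + 1))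
             - (\<Sum>\<tau>\<in>interior_vedges M. (int m' + 1) * (int (edge_smoothness rh rv \<tau>) + 1))
             + (\<Sum>\<gamma>\<in>interior_vertices M. (int (rh (fst \<gamma>)) + 1) * (int (rv (snd \<gamma>)) + 1))"
    by (rule spline_dim_formula[OF boundary1_surjective[OF Ms k]])
qed

text \<open>Both sums are grouped by values. With orders of smoothness as values, the contributions
  of edges and vertices are seen to depend on numbers only.\<close>

lemma sum_eq_if_card_fibers_eq:
  fixes g :: "'c \<Rightarrow> int"
  assumes "finite A" "finite B" "\<And>c. card {a \<in> A. f a = c} = card {b \<in> B. f' b = c}"
  shows "(\<Sum>a\<in>A. g (f a)) = (\<Sum>b\<in>B. g (f' b))"
proof -
  let ?C = "f ` A \<union> f' ` B"
  have fin: "finite ?C" using assms by simp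
  have "(\<Sum>a\<in>A. g (f a)) = (\<Sum>c\<in>?C. \<Sum>a | a \<in> A \<and> f a = c. g (f a))"
    by (rule sum.group[symmetric]) (use assms fin in auto)
  also have "\<dots> = (\<Sum>c\<in>?C. int (card {a \<in> A. f a = c}) * g c)"
    by (intro sum.cong refl) simp
  also have "\<dots> = (\<Sum>c\<in>?C. int (card {b \<in> B. f' b = c}) * g c)" using assms(3) by simp
  also have "\<dots> = (\<Sum>c\<in>?C. \<Sum>b | b \<in> B \<and> f' b = c. g (f' b))"
    by (intro sum.cong refl) simp
  also have "\<dots> = (\<Sum>b\<in>B. g (f' b))"
    by (rule sum.group) (use assms fin in auto)
  finally show ?thesis .
qed

text \<open>The contribution of an edge or a vertex varies with its order of smoothness. Dependence
  on numbers alone is therefore expressed by comparing two meshes whose counts agree for each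
  order.\<close>

theorem mainTheorem5:
  fixes m m' k k' :: nat
  shows
    "(\<forall>rh rv \<tau> Ms Ms'.
        hier_construction Ms \<and> rule_application m m' k k' rh rv \<tau> Ms Ms' \<and>
        smoothness_le m m' rh rv (last Ms') \<longrightarrow>
        (let \<rho> = max_segment (last Ms') \<tau> in
           ((\<forall>\<rho>0\<in>max_segments (last Ms). \<not> \<rho>0 \<subseteq> \<rho>) \<and> heavy_segment m m' k k' rh rv Ms' \<rho>) \<or>
           (\<exists>\<rho>0\<in>MIS (last Ms). \<rho> \<in> MIS (last Ms') \<and> \<rho>0 \<subset> \<rho> \<and>
              seg_weight m m' rh rv Ms \<rho>0 \<le> seg_weight m m' rh rv Ms' \<rho>) \<or>
           (\<rho> \<in> max_segments (last Ms') \<and> \<rho> \<inter> frontier (domain (last Ms')) \<noteq> {})) \<and>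
        (weighted m m' k k' rh rv Ms \<longrightarrow> weighted m m' k k' rh rv Ms'))
     \<and>
     (k \<ge> m + 1 \<and> k' \<ge> m' + 1 \<longrightarrow>
        (\<forall>rh rv M. obtained_by_rule m m' k k' rh rv M \<and> smoothness_le m m' rh rv M \<longrightarrow>
           h_number m m' rh rv M = 0 \<and>
           int (spline_dim m m' rh rv M) =
             (\<Sum>\<sigma>\<in>cells M. (int m + 1) * (int m' + 1))
             - (\<Sum>\<tau>\<in>interior_hedges M. (int m + 1) * (int (edge_smoothness rh rv \<tau>) + 1))
             - (\<Sum>\<tau>\<in>interior_vedges M. (int m' + 1) * (int (edge_smoothness rh rv \<tau>) + 1))
             + (\<Sum>\<gamma>\<in>interior_vertices M. (int (rh (fst \<gamma>)) + 1) * (int (rv (snd \<gamma>)) + 1))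
             + int (h_number m m' rh rv M)) \<and>
        (\<forall>rh rv M qh qv N.
           obtained_by_rule m m' k k' rh rv M \<and> smoothness_le m m' rh rv M \<and>
           obtained_by_rule m m' k k' qh qv N \<and> smoothness_le m m' qh qv N \<and>
           card (cells M) = card (cells N) \<and>
           (\<forall>i. card {\<tau>\<in>interior_hedges M. edge_smoothness rh rv \<tau> = i} =
                card {\<tau>\<in>interior_hedges N. edge_smoothness qh qv \<tau> = i}) \<and>
           (\<forall>i. card {\<tau>\<in>interior_vedges M. edge_smoothness rh rv \<tau> = i} =
                card {\<tau>\<in>interior_vedges N. edge_smoothness qh qv \<tau> = i}) \<and>
           (\<forall>i j. card {\<gamma>\<in>interior_vertices M. rh (fst \<gamma>) = i \<and> rv (snd \<gamma>) = j} =
                  card {\<gamma>\<in>interior_vertices N. qh (fst \<gamma>) = i \<and> qv (snd \<gamma>) = j}) \<longrightarrow>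
           spline_dim m m' rh rv M = spline_dim m m' qh qv N))"
proof (intro conjI allI impI)
  fix rh rv \<tau> Ms Ms'
  assume a: "hier_construction Ms \<and> rule_application m m' k k' rh rv \<tau> Ms Ms' \<and>
    smoothness_le m m' rh rv (last Ms')"
  then have h: "hier_construction Ms" "rule_application m m' k k' rh rv \<tau> Ms Ms'"
    "smoothness_le m m' rh rv (last Ms')" by blast+
  note c = rule_application_classification[OF h refl]
  show "let \<rho> = max_segment (last Ms') \<tau> in
           ((\<forall>\<rho>0\<in>max_segments (last Ms). \<not> \<rho>0 \<subseteq> \<rho>) \<and> heavy_segment m m' k k' rh rv Ms' \<rho>) \<or>
           (\<exists>\<rho>0\<in>MIS (last Ms). \<rho> \<in> MIS (last Ms') \<and> \<rho>0 \<subset> \<rho> \<and>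
              seg_weight m m' rh rv Ms \<rho>0 \<le> seg_weight m m' rh rv Ms' \<rho>) \<or>
           (\<rho> \<in> max_segments (last Ms') \<and> \<rho> \<inter> frontier (domain (last Ms')) \<noteq> {})"
    unfolding Let_def by (rule c(1))
  show "weighted m m' k k' rh rv Ms \<Longrightarrow> weighted m m' k k' rh rv Ms'" by (rule c(2))
next
  fix rh rv M
  assume k: "k \<ge> m + 1 \<and> k' \<ge> m' + 1"
    and a: "obtained_by_rule m m' k k' rh rv M \<and> smoothness_le m m' rh rv M"
  note d = obtained_by_rule_dimension[OF conjunct1[OF a] conjunct2[OF a] conjunct1[OF k] conjunct2[OF k]]
  show "h_number m m' rh rv M = 0" by (rule d(1))
  then show "int (spline_dim m m' rh rv M) =
             (\<Sum>\<sigma>\<in>cells M. (int m + 1) * (int m' + 1))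
             - (\<Sum>\<tau>\<in>interior_hedges M. (int m + 1) * (int (edge_smoothness rh rv \<tau>) + 1))
             - (\<Sum>\<tau>\<in>interior_vedges M. (int m' + 1) * (int (edge_smoothness rh rv \<tau>) + 1))
             + (\<Sum>\<gamma>\<in>interior_vertices M. (int (rh (fst \<gamma>)) + 1) * (int (rv (snd \<gamma>)) + 1))
             + int (h_number m m' rh rv M)" unfolding d(2) by simp
next
  fix rh rv M qh qv N
  assume k: "k \<ge> m + 1 \<and> k' \<ge> m' + 1"
    and a: "obtained_by_rule m m' k k' rh rv M \<and> smoothness_le m m' rh rv M \<and>
           obtained_by_rule m m' k k' qh qv N \<and> smoothness_le m m' qh qv N \<and>
           card (cells M) = card (cells N) \<and>
           (\<forall>i. card {\<tau>\<in>interior_hedges M. edge_smoothness rh rv \<tau> = i} =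
                card {\<tau>\<in>interior_hedges N. edge_smoothness qh qv \<tau> = i}) \<and>
           (\<forall>i. card {\<tau>\<in>interior_vedges M. edge_smoothness rh rv \<tau> = i} =
                card {\<tau>\<in>interior_vedges N. edge_smoothness qh qv \<tau> = i}) \<and>
           (\<forall>i j. card {\<gamma>\<in>interior_vertices M. rh (fst \<gamma>) = i \<and> rv (snd \<gamma>) = j} =
                  card {\<gamma>\<in>interior_vertices N. qh (fst \<gamma>) = i \<and> qv (snd \<gamma>) = j})"
  have M: "obtained_by_rule m m' k k' rh rv M" "smoothness_le m m' rh rv M"
    and N: "obtained_by_rule m m' k k' qh qv N" "smoothness_le m m' qh qv N"
    and cells: "card (cells M) = card (cells N)"
    and h: "\<And>i. card {\<tau>\<in>interior_hedges M. edge_smoothness rh rv \<tau> = i} =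
                card {\<tau>\<in>interior_hedges N. edge_smoothness qh qv \<tau> = i}"
    and v: "\<And>i. card {\<tau>\<in>interior_vedges M. edge_smoothness rh rv \<tau> = i} =
                card {\<tau>\<in>interior_vedges N. edge_smoothness qh qv \<tau> = i}"
    and ve: "\<And>i j. card {\<gamma>\<in>interior_vertices M. rh (fst \<gamma>) = i \<and> rv (snd \<gamma>) = j} =
                  card {\<gamma>\<in>interior_vertices N. qh (fst \<gamma>) = i \<and> qv (snd \<gamma>) = j}"
    using a by simp_all
  note dM = obtained_by_rule_dimension[OF M conjunct1[OF k] conjunct2[OF k]]
  note dN = obtained_by_rule_dimension[OF N conjunct1[OF k] conjunct2[OF k]]
  have fin: "finite (interior_vertices M)" "finite (interior_vertices N)"
    using finite_vertices[OF dM(3)] finite_vertices[OF dN(3)] by (auto simp: interior_vertices_def)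
  have "(\<Sum>\<gamma>\<in>interior_vertices M. (int (rh (fst \<gamma>)) + 1) * (int (rv (snd \<gamma>)) + 1)) =
      (\<Sum>\<gamma>\<in>interior_vertices N. (int (qh (fst \<gamma>)) + 1) * (int (qv (snd \<gamma>)) + 1))"
    using sum_eq_if_card_fibers_eq[OF fin, of "\<lambda>\<gamma>. (rh (fst \<gamma>), rv (snd \<gamma>))" "\<lambda>\<gamma>. (qh (fst \<gamma>), qv (snd \<gamma>))"
        "\<lambda>(i, j). (int i + 1) * (int j + 1)"] ve by auto
  moreover have "(\<Sum>\<tau>\<in>interior_hedges M. (int m + 1) * (int (edge_smoothness rh rv \<tau>) + 1)) =
      (\<Sum>\<tau>\<in>interior_hedges N. (int m + 1) * (int (edge_smoothness qh qv \<tau>) + 1))"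
    by (rule sum_eq_if_card_fibers_eq[OF finite_interior_edges(3)[OF dM(3)] finite_interior_edges(3)[OF dN(3)] h])
  moreover have "(\<Sum>\<tau>\<in>interior_vedges M. (int m' + 1) * (int (edge_smoothness rh rv \<tau>) + 1)) =
      (\<Sum>\<tau>\<in>interior_vedges N. (int m' + 1) * (int (edge_smoothness qh qv \<tau>) + 1))"
    by (rule sum_eq_if_card_fibers_eq[OF finite_interior_edges(2)[OF dM(3)] finite_interior_edges(2)[OF dN(3)] v])
  moreover have "(\<Sum>\<sigma>\<in>cells M. (int m + 1) * (int m' + 1)) = (\<Sum>\<sigma>\<in>cells N. (int m + 1) * (int m' + 1))"
    using cells by simp
  ultimately have "int (spline_dim m m' rh rv M) = int (spline_dim m m' qh qv N)"
    unfolding dM(2) dN(2) by presburger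
  then show "spline_dim m m' rh rv M = spline_dim m m' qh qv N" by simp
qed

end
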